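(* Let $k$ be a field, $V$ a $k$-vector space, $A=T(V)/(R)$ a quadratic algebra with $R\subseteq V\otimes V$, and $M$ an $A$-bimodule. Then the Koszul homology of $A$ with coefficients in $M$ is isomorphic to a Hochschild hyperhomology, and the Koszul cohomology of $A$ with coefficients in $M$ is isomorphic to a Hochschild hypercohomology: $$HK_{\bullet}(A,M)\cong \mathbb{HH}_{\bullet}(A,M\otimes_A K(A)),\qquad HK^{\bullet}(A,M)\cong \mathbb{HH}^{\bullet}(A,Hom_A(K(A),M)).$$
   Context: $\otimes=\otimes_k$ and $A^e=A\otimes A^{op}$. Put $W_0=k$, $W_1=V$, $W_p=\bigcap_{i+2+j=p}V^{\otimes i}\otimes R\otimes V^{\otimes j}$ for $p\ge2$. Elements of $W_p$ are written $x_1\ldots x_p$ (a sum of such tensors, $x_i\in V$), with the same notation when $W_p$ is viewed inside $V\otimes W_{p-1}$ or $W_{p-1}\otimes V$. The Koszul bimodule complex $K(A)$ has $K(A)_p=A\otimes W_p\otimes A$ in homological degree $p\ge0$, with differential $d(a\otimes x_1\ldots x_p\otimes a')=ax_1\otimes x_2\ldots x_p\otimes a'+(-1)^pa\otimes x_1\ldots x_{p-1}\otimes x_pa'$. Koszul homology $HK_\bullet(A,M)$ is the homology of the complex $M\otimes_{A^e}K(A)$; Koszul cohomology $HK^\bullet(A,M)$ is the cohomology of the complex $Hom_{A^e}(K(A),M)$ (not requiring that $K(A)$ be a resolution of $A$). $Hom_A(N,M)$ denotes the space of left $A$-module morphisms from $N$ to $M$, for $A$-bimodules $N$ and $M$,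 with its natural $A$-bimodule structure; $M\otimes_A K(A)$ and $Hom_A(K(A),M)$ are complexes of $A$-bimodules. For a bounded-below (homologically) chain complex $C$ of $A$-bimodules, $\mathbb{HH}_p(A,C)=H_p(C\otimes^{L}_{A^e}A)=\mathbb{T}or^{A^e}_p(C,A)$; for a bounded-below cochain complex $C$ of $A$-bimodules, $\mathbb{HH}^p(A,C)=H^p(RHom_{A^e}(A,C))$. *)

theory Defs
  imports "HOL-Algebra.QuotRing" "HOL-Algebra.Module"
begin

section \<open>Modules over a commutative ring\<close>

text \<open>
  Modules and (not necessarily commutative) algebras over \<open>K\<close> are both represented by the
  library record \<^type>\<open>module\<close>; the fields \<open>mult\<close> and \<open>one\<close> are irrelevant for a mere module.
\<close>

definition lin_maps ::
    "'k ring \<Rightarrow> ('k, 'x, 'e) module_scheme \<Rightarrow> ('k, 'y, 'f) module_scheme \<Rightarrow> ('x \<Rightarrow> 'y) set" where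
  "lin_maps K X Y = {h \<in> carrier X \<rightarrow> carrier Y.
     (\<forall>x\<in>carrier X. \<forall>y\<in>carrier X. h (x \<oplus>\<^bsub>X\<^esub> y) = h x \<oplus>\<^bsub>Y\<^esub> h y) \<and>
     (\<forall>c\<in>carrier K. \<forall>x\<in>carrier X. h (c \<odot>\<^bsub>X\<^esub> x) = c \<odot>\<^bsub>Y\<^esub> h x)}"

definition mod_iso ::
    "'k ring \<Rightarrow> ('k, 'x, 'e) module_scheme \<Rightarrow> ('k, 'y, 'f) module_scheme \<Rightarrow> bool" where
  "mod_iso K X Y \<longleftrightarrow> (\<exists>h \<in> lin_maps K X Y. bij_betw h (carrier X) (carrier Y))"

definition span_of :: "'k ring \<Rightarrow> ('k, 'x, 'e) module_scheme \<Rightarrow> 'x set \<Rightarrow> 'x set" where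
  "span_of K X S = \<Inter>{N. submodule N K X \<and> S \<subseteq> N}"

text \<open>Quotient of a module by a submodule, and of an algebra by a two-sided ideal.\<close>

definition quot :: "('k, 'x, 'e) module_scheme \<Rightarrow> 'x set \<Rightarrow> ('k, 'x set) module" where
  "quot X N = \<lparr>carrier = carrier (X Quot N), mult = mult (X Quot N), one = one (X Quot N),
     zero = zero (X Quot N), add = add (X Quot N),
     smult = (\<lambda>c S. \<Union>x\<in>S. N +>\<^bsub>X\<^esub> (c \<odot>\<^bsub>X\<^esub> x))\<rparr>"

definition signed :: "('x, 'e) ring_scheme \<Rightarrow> nat \<Rightarrow> 'x \<Rightarrow> 'x" where
  "signed X n x = (if even n then x else \<ominus>\<^bsub>X\<^esub> x)"

definition free_module :: "'k ring \<Rightarrow> 's set \<Rightarrow> ('k, 's \<Rightarrow> 'k) module" where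
  "free_module K S = \<lparr>carrier = {f. (\<forall>s\<in>S. f s \<in> carrier K) \<and> (\<forall>s. s \<notin> S \<longrightarrow> f s = \<zero>\<^bsub>K\<^esub>) \<and>
       finite {s. f s \<noteq> \<zero>\<^bsub>K\<^esub>}},
     mult = undefined, one = undefined,
     zero = (\<lambda>s. \<zero>\<^bsub>K\<^esub>), add = (\<lambda>f g s. f s \<oplus>\<^bsub>K\<^esub> g s), smult = (\<lambda>c f s. c \<otimes>\<^bsub>K\<^esub> f s)\<rparr>"

definition single :: "'k ring \<Rightarrow> 's \<Rightarrow> 's \<Rightarrow> 'k" where
  "single K s = (\<lambda>t. if t = s then \<one>\<^bsub>K\<^esub> else \<zero>\<^bsub>K\<^esub>)"

definition lin_ext ::
    "'k ring \<Rightarrow> ('k, 'z, 'e) module_scheme \<Rightarrow> ('s \<Rightarrow> 'z) \<Rightarrow> ('s \<Rightarrow> 'k) \<Rightarrow> 'z" where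
  "lin_ext K Z \<phi> f = (\<Oplus>\<^bsub>Z\<^esub>s\<in>{s. f s \<noteq> \<zero>\<^bsub>K\<^esub>}. f s \<odot>\<^bsub>Z\<^esub> \<phi> s)"


section \<open>Bimodules\<close>

record ('k, 'a, 'm) bimodule = "('k, 'm) module" +
  lact :: "'a \<Rightarrow> 'm \<Rightarrow> 'm"
  ract :: "'m \<Rightarrow> 'a \<Rightarrow> 'm"

text \<open>
  Bimodules over a \<open>K\<close>-algebra \<open>A\<close> on which \<open>K\<close> acts centrally, that is,
  modules over the enveloping algebra of \<open>A\<close>.
\<close>

locale bimodule = module K M
  for K :: "'k ring" and A :: "('k, 'a) module" and M :: "('k, 'a, 'm) bimodule" +
  assumes lact_closed: "\<lbrakk>a \<in> carrier A; x \<in> carrier M\<rbrakk> \<Longrightarrow> lact M a x \<in> carrier M"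
    and ract_closed: "\<lbrakk>a \<in> carrier A; x \<in> carrier M\<rbrakk> \<Longrightarrow> ract M x a \<in> carrier M"
    and lact_add: "\<lbrakk>a \<in> carrier A; x \<in> carrier M; y \<in> carrier M\<rbrakk> \<Longrightarrow>
      lact M a (x \<oplus>\<^bsub>M\<^esub> y) = lact M a x \<oplus>\<^bsub>M\<^esub> lact M a y"
    and ract_add: "\<lbrakk>a \<in> carrier A; x \<in> carrier M; y \<in> carrier M\<rbrakk> \<Longrightarrow>
      ract M (x \<oplus>\<^bsub>M\<^esub> y) a = ract M x a \<oplus>\<^bsub>M\<^esub> ract M y a"
    and add_lact: "\<lbrakk>a \<in> carrier A; b \<in> carrier A; x \<in> carrier M\<rbrakk> \<Longrightarrow>
      lact M (a \<oplus>\<^bsub>A\<^esub> b) x = lact M a x \<oplus>\<^bsub>M\<^esub> lact M b x"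
    and add_ract: "\<lbrakk>a \<in> carrier A; b \<in> carrier A; x \<in> carrier M\<rbrakk> \<Longrightarrow>
      ract M x (a \<oplus>\<^bsub>A\<^esub> b) = ract M x a \<oplus>\<^bsub>M\<^esub> ract M x b"
    and lact_assoc: "\<lbrakk>a \<in> carrier A; b \<in> carrier A; x \<in> carrier M\<rbrakk> \<Longrightarrow>
      lact M (a \<otimes>\<^bsub>A\<^esub> b) x = lact M a (lact M b x)"
    and ract_assoc: "\<lbrakk>a \<in> carrier A; b \<in> carrier A; x \<in> carrier M\<rbrakk> \<Longrightarrow>
      ract M x (a \<otimes>\<^bsub>A\<^esub> b) = ract M (ract M x a) b"
    and lact_one: "x \<in> carrier M \<Longrightarrow> lact M \<one>\<^bsub>A\<^esub> x = x"
    and ract_one: "x \<in> carrier M \<Longrightarrow> ract M x \<one>\<^bsub>A\<^esub> = x"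
    and lact_ract: "\<lbrakk>a \<in> carrier A; b \<in> carrier A; x \<in> carrier M\<rbrakk> \<Longrightarrow>
      ract M (lact M a x) b = lact M a (ract M x b)"
    and smult_lact: "\<lbrakk>c \<in> carrier K; a \<in> carrier A; x \<in> carrier M\<rbrakk> \<Longrightarrow>
      lact M (c \<odot>\<^bsub>A\<^esub> a) x = c \<odot>\<^bsub>M\<^esub> lact M a x"
    and smult_ract: "\<lbrakk>c \<in> carrier K; a \<in> carrier A; x \<in> carrier M\<rbrakk> \<Longrightarrow>
      ract M x (c \<odot>\<^bsub>A\<^esub> a) = c \<odot>\<^bsub>M\<^esub> ract M x a"
    and lact_smult: "\<lbrakk>c \<in> carrier K; a \<in> carrier A; x \<in> carrier M\<rbrakk> \<Longrightarrow>
      lact M a (c \<odot>\<^bsub>M\<^esub> x) = c \<odot>\<^bsub>M\<^esub> lact M a x"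
    and ract_smult: "\<lbrakk>c \<in> carrier K; a \<in> carrier A; x \<in> carrier M\<rbrakk> \<Longrightarrow>
      ract M (c \<odot>\<^bsub>M\<^esub> x) a = c \<odot>\<^bsub>M\<^esub> ract M x a"

definition make_bimod ::
    "('k, 'm) module \<Rightarrow> ('a \<Rightarrow> 'm \<Rightarrow> 'm) \<Rightarrow> ('m \<Rightarrow> 'a \<Rightarrow> 'm) \<Rightarrow> ('k, 'a, 'm) bimodule" where
  "make_bimod X l r = \<lparr>carrier = carrier X, mult = mult X, one = one X, zero = zero X,
     add = add X, smult = smult X, lact = l, ract = r\<rparr>"

definition regular_bimod :: "('k, 'a) module \<Rightarrow> ('k, 'a, 'a) bimodule" where
  "regular_bimod A = make_bimod A (mult A) (mult A)"

definition left_homs :: "'k ring \<Rightarrow> ('k, 'a) module \<Rightarrow> ('k, 'a, 'x) bimodule \<Rightarrow>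
    ('k, 'a, 'y) bimodule \<Rightarrow> ('x \<Rightarrow> 'y) set" where
  "left_homs K A X Y = {h \<in> lin_maps K X Y.
     \<forall>a\<in>carrier A. \<forall>x\<in>carrier X. h (lact X a x) = lact Y a (h x)}"

definition bimod_homs :: "'k ring \<Rightarrow> ('k, 'a) module \<Rightarrow> ('k, 'a, 'x) bimodule \<Rightarrow>
    ('k, 'a, 'y) bimodule \<Rightarrow> ('x \<Rightarrow> 'y) set" where
  "bimod_homs K A X Y = {h \<in> left_homs K A X Y.
     \<forall>a\<in>carrier A. \<forall>x\<in>carrier X. h (ract X x a) = ract Y (h x) a}"

definition fun_module :: "'x set \<Rightarrow> ('k, 'y, 'e) module_scheme \<Rightarrow> ('x \<Rightarrow> 'y) set \<Rightarrow>
    ('k, 'x \<Rightarrow> 'y) module" where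
  "fun_module S Y H = \<lparr>carrier = H \<inter> extensional S, mult = undefined, one = undefined,
     zero = (\<lambda>x\<in>S. \<zero>\<^bsub>Y\<^esub>), add = (\<lambda>f g. \<lambda>x\<in>S. f x \<oplus>\<^bsub>Y\<^esub> g x),
     smult = (\<lambda>c f. \<lambda>x\<in>S. c \<odot>\<^bsub>Y\<^esub> f x)\<rparr>"

text \<open>Homomorphisms of bimodules, that is, of modules over the enveloping algebra.\<close>

definition Hom_Ae :: "'k ring \<Rightarrow> ('k, 'a) module \<Rightarrow> ('k, 'a, 'x) bimodule \<Rightarrow>
    ('k, 'a, 'y) bimodule \<Rightarrow> ('k, 'x \<Rightarrow> 'y) module" where
  "Hom_Ae K A X Y = fun_module (carrier X) Y (bimod_homs K A X Y)"

text \<open>Left module homomorphisms, a bimodule via \<open>(a f b) x = f (x a) b\<close>.\<close>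

definition Hom_A :: "'k ring \<Rightarrow> ('k, 'a) module \<Rightarrow> ('k, 'a, 'x) bimodule \<Rightarrow>
    ('k, 'a, 'y) bimodule \<Rightarrow> ('k, 'a, 'x \<Rightarrow> 'y) bimodule" where
  "Hom_A K A X Y = make_bimod (fun_module (carrier X) Y (left_homs K A X Y))
     (\<lambda>a f. \<lambda>x\<in>carrier X. f (ract X x a))
     (\<lambda>f b. \<lambda>x\<in>carrier X. ract Y (f x) b)"


section \<open>Tensor products\<close>

text \<open>
  The tensor product is the free module on pairs modulo bilinearity and the relations
  \<open>(x \<cdot> s, y) = (x, s \<cdot> y)\<close> for \<open>s\<close> in a set \<open>S\<close> of operators acting on the right on \<open>X\<close>
  (by \<open>ra\<close>) and on the left on \<open>Y\<close> (by \<open>la\<close>).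
\<close>

definition tensor_rels :: "'k ring \<Rightarrow> ('k, 'x, 'e) module_scheme \<Rightarrow> ('k, 'y, 'f) module_scheme \<Rightarrow>
    's set \<Rightarrow> ('x \<Rightarrow> 's \<Rightarrow> 'x) \<Rightarrow> ('s \<Rightarrow> 'y \<Rightarrow> 'y) \<Rightarrow> ('x \<times> 'y \<Rightarrow> 'k) set" where
  "tensor_rels K X Y S ra la =
     (let F = free_module K (carrier X \<times> carrier Y); e = (\<lambda>x y. single K (x, y)) in
       {e (x \<oplus>\<^bsub>X\<^esub> x') y \<ominus>\<^bsub>F\<^esub> (e x y \<oplus>\<^bsub>F\<^esub> e x' y) | x x' y.
          x \<in> carrier X \<and> x' \<in> carrier X \<and> y \<in> carrier Y} \<union>
       {e x (y \<oplus>\<^bsub>Y\<^esub> y') \<ominus>\<^bsub>F\<^esub> (e x y \<oplus>\<^bsub>F\<^esub> e x y') | x y y'.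
          x \<in> carrier X \<and> y \<in> carrier Y \<and> y' \<in> carrier Y} \<union>
       {e (c \<odot>\<^bsub>X\<^esub> x) y \<ominus>\<^bsub>F\<^esub> c \<odot>\<^bsub>F\<^esub> e x y | c x y.
          c \<in> carrier K \<and> x \<in> carrier X \<and> y \<in> carrier Y} \<union>
       {e x (c \<odot>\<^bsub>Y\<^esub> y) \<ominus>\<^bsub>F\<^esub> c \<odot>\<^bsub>F\<^esub> e x y | c x y.
          c \<in> carrier K \<and> x \<in> carrier X \<and> y \<in> carrier Y} \<union>
       {e (ra x s) y \<ominus>\<^bsub>F\<^esub> e x (la s y) | x s y.
          x \<in> carrier X \<and> s \<in> S \<and> y \<in> carrier Y})"

definition balanced_tensor :: "'k ring \<Rightarrow> ('k, 'x, 'e) module_scheme \<Rightarrow>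
    ('k, 'y, 'f) module_scheme \<Rightarrow> 's set \<Rightarrow> ('x \<Rightarrow> 's \<Rightarrow> 'x) \<Rightarrow> ('s \<Rightarrow> 'y \<Rightarrow> 'y) \<Rightarrow>
    ('k, ('x \<times> 'y \<Rightarrow> 'k) set) module" where
  "balanced_tensor K X Y S ra la =
     (let F = free_module K (carrier X \<times> carrier Y)
      in quot F (span_of K F (tensor_rels K X Y S ra la)))"

text \<open>The class of the generator \<open>(x, y)\<close> in a tensor product \<open>T\<close>.\<close>

definition pure :: "'k ring \<Rightarrow> ('k, ('x \<times> 'y \<Rightarrow> 'k) set, 'e) module_scheme \<Rightarrow> 'x \<Rightarrow> 'y \<Rightarrow>
    ('x \<times> 'y \<Rightarrow> 'k) set" where
  "pure K T x y = (THE t. t \<in> carrier T \<and> single K (x, y) \<in> t)"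

text \<open>
  The linear map out of a tensor product induced by a bilinear balanced map \<open>\<phi>\<close>;
  for such \<open>\<phi>\<close> the choice of the representative is immaterial.
\<close>

definition tensor_lift :: "'k ring \<Rightarrow> ('k, 'z, 'e) module_scheme \<Rightarrow> ('x \<Rightarrow> 'y \<Rightarrow> 'z) \<Rightarrow>
    ('x \<times> 'y \<Rightarrow> 'k) set \<Rightarrow> 'z" where
  "tensor_lift K Z \<phi> t = lin_ext K Z (\<lambda>(x, y). \<phi> x y) (SOME f. f \<in> t)"

definition tensor_K :: "'k ring \<Rightarrow> ('k, 'x, 'e) module_scheme \<Rightarrow> ('k, 'y, 'f) module_scheme \<Rightarrow>
    ('k, ('x \<times> 'y \<Rightarrow> 'k) set) module" where
  "tensor_K K X Y = balanced_tensor K X Y ({} :: unit set) (\<lambda>x s. x) (\<lambda>s y. y)"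

definition tensor_A :: "'k ring \<Rightarrow> ('k, 'a) module \<Rightarrow> ('k, 'a, 'x) bimodule \<Rightarrow>
    ('k, 'a, 'y) bimodule \<Rightarrow> ('k, 'a, ('x \<times> 'y \<Rightarrow> 'k) set) bimodule" where
  "tensor_A K A X Y =
     (let T = balanced_tensor K X Y (carrier A) (ract X) (lact Y)
      in make_bimod T
        (\<lambda>a. tensor_lift K T (\<lambda>x y. pure K T (lact X a x) y))
        (\<lambda>t b. tensor_lift K T (\<lambda>x y. pure K T x (ract Y y b)) t))"

text \<open>
  Over the enveloping algebra, \<open>X\<close> is a right module via \<open>x (a \<otimes> b) = b x a\<close>
  and \<open>Y\<close> a left module via \<open>(a \<otimes> b) y = a y b\<close>. It suffices to balance over the
  elements \<open>a \<otimes> b\<close>, since they span.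
\<close>

definition tensor_Ae :: "'k ring \<Rightarrow> ('k, 'a) module \<Rightarrow> ('k, 'a, 'x) bimodule \<Rightarrow>
    ('k, 'a, 'y) bimodule \<Rightarrow> ('k, ('x \<times> 'y \<Rightarrow> 'k) set) module" where
  "tensor_Ae K A X Y = balanced_tensor K X Y (carrier A \<times> carrier A)
     (\<lambda>x (a, b). lact X b (ract X x a)) (\<lambda>(a, b) y. lact Y a (ract Y y b))"

text \<open>The triple tensor product \<open>A \<otimes> W \<otimes> A\<close> over \<open>K\<close>, with the outer bimodule structure.\<close>

type_synonym ('k, 'a, 'w) triple = "(('a \<times> 'w \<Rightarrow> 'k) set \<times> 'a \<Rightarrow> 'k) set"

definition triple_mod :: "'k ring \<Rightarrow> ('k, 'a) module \<Rightarrow> ('k, 'w) module \<Rightarrow>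
    ('k, ('k, 'a, 'w) triple) module" where
  "triple_mod K A W = tensor_K K (tensor_K K A W) A"

definition triple :: "'k ring \<Rightarrow> ('k, 'a) module \<Rightarrow> ('k, 'w) module \<Rightarrow> 'a \<Rightarrow> 'w \<Rightarrow> 'a \<Rightarrow>
    ('k, 'a, 'w) triple" where
  "triple K A W a w b = pure K (triple_mod K A W) (pure K (tensor_K K A W) a w) b"

definition triple_lift :: "'k ring \<Rightarrow> ('k, 'z, 'e) module_scheme \<Rightarrow> ('a \<Rightarrow> 'w \<Rightarrow> 'a \<Rightarrow> 'z) \<Rightarrow>
    ('k, 'a, 'w) triple \<Rightarrow> 'z" where
  "triple_lift K Z \<phi> = tensor_lift K Z (\<lambda>u b. tensor_lift K Z (\<lambda>a w. \<phi> a w b) u)"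

definition outer_bimod :: "'k ring \<Rightarrow> ('k, 'a) module \<Rightarrow> ('k, 'w) module \<Rightarrow>
    ('k, 'a, ('k, 'a, 'w) triple) bimodule" where
  "outer_bimod K A W =
     (let X = triple_mod K A W
      in make_bimod X
        (\<lambda>c. triple_lift K X (\<lambda>a w b. triple K A W (c \<otimes>\<^bsub>A\<^esub> a) w b))
        (\<lambda>t c. triple_lift K X (\<lambda>a w b. triple K A W a w (b \<otimes>\<^bsub>A\<^esub> c)) t))"


section \<open>Complexes\<close>

text \<open>
  A chain complex is given by \<open>C p\<close> and \<open>d p : C p \<rightarrow> C (p - 1)\<close>, where only \<open>d p\<close> with
  \<open>p > 0\<close> matters; a cochain complex by \<open>C p\<close> and \<open>d p : C p \<rightarrow> C (p + 1)\<close>.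
\<close>

definition homology :: "(nat \<Rightarrow> ('k, 'x, 'e) module_scheme) \<Rightarrow> (nat \<Rightarrow> 'x \<Rightarrow> 'x) \<Rightarrow> nat \<Rightarrow>
    ('k, 'x set) module" where
  "homology C d p =
     quot (C p\<lparr>carrier := {x \<in> carrier (C p). p = 0 \<or> d p x = \<zero>\<^bsub>C (p - 1)\<^esub>}\<rparr>)
       (d (p + 1) ` carrier (C (p + 1)))"

definition cohomology :: "(nat \<Rightarrow> ('k, 'x, 'e) module_scheme) \<Rightarrow> (nat \<Rightarrow> 'x \<Rightarrow> 'x) \<Rightarrow> nat \<Rightarrow>
    ('k, 'x set) module" where
  "cohomology C d p =
     quot (C p\<lparr>carrier := {x \<in> carrier (C p). d p x = \<zero>\<^bsub>C (p + 1)\<^esub>}\<rparr>)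
       (if p = 0 then {\<zero>\<^bsub>C 0\<^esub>} else d (p - 1) ` carrier (C (p - 1)))"

text \<open>
  Total complex of a first quadrant double complex. An element of degree \<open>n\<close> is a family whose
  \<open>i\<close>-th member lies in \<open>D i (n - i)\<close>.
\<close>

definition tot :: "(nat \<Rightarrow> nat \<Rightarrow> ('k, 'x) module) \<Rightarrow> nat \<Rightarrow> ('k, nat \<Rightarrow> 'x) module" where
  "tot D n = \<lparr>carrier = (\<Pi>\<^sub>E i\<in>{..n}. carrier (D i (n - i))), mult = undefined, one = undefined,
     zero = (\<lambda>i\<in>{..n}. \<zero>\<^bsub>D i (n - i)\<^esub>),
     add = (\<lambda>f g. \<lambda>i\<in>{..n}. f i \<oplus>\<^bsub>D i (n - i)\<^esub> g i),
     smult = (\<lambda>c f. \<lambda>i\<in>{..n}. c \<odot>\<^bsub>D i (n - i)\<^esub> f i)\<rparr>"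

definition tot_d :: "(nat \<Rightarrow> nat \<Rightarrow> ('k, 'x) module) \<Rightarrow> (nat \<Rightarrow> nat \<Rightarrow> 'x \<Rightarrow> 'x) \<Rightarrow>
    (nat \<Rightarrow> nat \<Rightarrow> 'x \<Rightarrow> 'x) \<Rightarrow> nat \<Rightarrow> (nat \<Rightarrow> 'x) \<Rightarrow> nat \<Rightarrow> 'x" where
  "tot_d D dh dv n f = (\<lambda>i\<in>{..n - 1}.
     dh (i + 1) (n - 1 - i) (f (i + 1)) \<oplus>\<^bsub>D i (n - 1 - i)\<^esub>
     signed (D i (n - 1 - i)) i (dv i (n - i) (f i)))"

definition cotot_d :: "(nat \<Rightarrow> nat \<Rightarrow> ('k, 'x) module) \<Rightarrow> (nat \<Rightarrow> nat \<Rightarrow> 'x \<Rightarrow> 'x) \<Rightarrow>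
    (nat \<Rightarrow> nat \<Rightarrow> 'x \<Rightarrow> 'x) \<Rightarrow> nat \<Rightarrow> (nat \<Rightarrow> 'x) \<Rightarrow> nat \<Rightarrow> 'x" where
  "cotot_d D dh dv n f = (\<lambda>i\<in>{..n + 1}. let Y = D i (n + 1 - i) in
     (if i = 0 then \<zero>\<^bsub>Y\<^esub> else dh (i - 1) (n + 1 - i) (f (i - 1))) \<oplus>\<^bsub>Y\<^esub>
     (if i = n + 1 then \<zero>\<^bsub>Y\<^esub> else signed Y (n + 1) (dv i (n - i) (f i))))"

text \<open>The functors \<open>M \<otimes> -\<close> and \<open>Hom(-, M)\<close> on differentials, with \<open>\<delta> f = - (-1)\<^sup>p f \<circ> d\<close>.\<close>

definition tensor_id_d :: "'k ring \<Rightarrow> (nat \<Rightarrow> ('k, ('x \<times> 'y \<Rightarrow> 'k) set, 'e) module_scheme) \<Rightarrow>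
    (nat \<Rightarrow> 'y \<Rightarrow> 'y) \<Rightarrow> nat \<Rightarrow> ('x \<times> 'y \<Rightarrow> 'k) set \<Rightarrow> ('x \<times> 'y \<Rightarrow> 'k) set" where
  "tensor_id_d K T d p = tensor_lift K (T (p - 1)) (\<lambda>x y. pure K (T (p - 1)) x (d p y))"

definition hom_d :: "(nat \<Rightarrow> ('k, 'x, 'e) module_scheme) \<Rightarrow> (nat \<Rightarrow> 'x \<Rightarrow> 'x) \<Rightarrow>
    ('k, 'y, 'f) module_scheme \<Rightarrow> nat \<Rightarrow> ('x \<Rightarrow> 'y) \<Rightarrow> 'x \<Rightarrow> 'y" where
  "hom_d C d Y p f = (\<lambda>x\<in>carrier (C (p + 1)). signed Y (p + 1) (f (d (p + 1) x)))"


section \<open>Hochschild hyperhomology and hypercohomology\<close>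

text \<open>
  Projective means direct summand of a free bimodule \<open>A \<otimes> K\<^sup>(\<^sup>B\<^sup>) \<otimes> A\<close>. Requiring the basis
  \<open>B\<close> to live in the type of elements of \<open>X\<close> is no restriction: if \<open>X\<close> is projective then it
  is a summand of the free bimodule on its own carrier.
\<close>

definition projective_bimod :: "'k ring \<Rightarrow> ('k, 'a) module \<Rightarrow> ('k, 'a, 'x) bimodule \<Rightarrow> bool" where
  "projective_bimod K A X \<longleftrightarrow> bimodule K A X \<and>
     (\<exists>B :: 'x set. let F = outer_bimod K A (free_module K B) in
       \<exists>i \<in> bimod_homs K A X F. \<exists>r \<in> bimod_homs K A F X. \<forall>x\<in>carrier X. r (i x) = x)"

definition projective_resolution :: "'k ring \<Rightarrow> ('k, 'a) module \<Rightarrow>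
    (nat \<Rightarrow> ('k, 'a, 'x) bimodule) \<Rightarrow> (nat \<Rightarrow> 'x \<Rightarrow> 'x) \<Rightarrow> ('x \<Rightarrow> 'a) \<Rightarrow> bool" where
  "projective_resolution K A P d \<epsilon> \<longleftrightarrow>
     (\<forall>q. projective_bimod K A (P q)) \<and>
     (\<forall>q. d (q + 1) \<in> bimod_homs K A (P (q + 1)) (P q)) \<and>
     \<epsilon> \<in> bimod_homs K A (P 0) (regular_bimod A) \<and>
     \<epsilon> ` carrier (P 0) = carrier A \<and>
     {x \<in> carrier (P 0). \<epsilon> x = \<zero>\<^bsub>A\<^esub>} = d 1 ` carrier (P 1) \<and>
     (\<forall>q. {x \<in> carrier (P (q + 1)). d (q + 1) x = \<zero>\<^bsub>P q\<^esub>} = d (q + 2) ` carrier (P (q + 2)))"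

text \<open>
  Hyper-Tor and hyper-Ext of a complex \<open>C\<close> of bimodules and of the bimodule \<open>A\<close>, computed from
  a projective resolution \<open>P\<close> of \<open>A\<close>: the (co)homology of the total complexes of
  \<open>C \<otimes> P\<close> and \<open>Hom(P, C)\<close> over the enveloping algebra.
\<close>

definition hyperhomology :: "'k ring \<Rightarrow> ('k, 'a) module \<Rightarrow>
    (nat \<Rightarrow> ('k, 'a, 'p) bimodule) \<Rightarrow> (nat \<Rightarrow> 'p \<Rightarrow> 'p) \<Rightarrow>
    (nat \<Rightarrow> ('k, 'a, 'c) bimodule) \<Rightarrow> (nat \<Rightarrow> 'c \<Rightarrow> 'c) \<Rightarrow> nat \<Rightarrow>
    ('k, (nat \<Rightarrow> ('c \<times> 'p \<Rightarrow> 'k) set) set) module" where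
  "hyperhomology K A P dP C dC =
     (let D = (\<lambda>i j. tensor_Ae K A (C i) (P j));
          dh = (\<lambda>i j. tensor_lift K (D (i - 1) j) (\<lambda>x y. pure K (D (i - 1) j) (dC i x) y));
          dv = (\<lambda>i. tensor_id_d K (D i) dP)
      in homology (tot D) (tot_d D dh dv))"

definition hypercohomology :: "'k ring \<Rightarrow> ('k, 'a) module \<Rightarrow>
    (nat \<Rightarrow> ('k, 'a, 'p) bimodule) \<Rightarrow> (nat \<Rightarrow> 'p \<Rightarrow> 'p) \<Rightarrow>
    (nat \<Rightarrow> ('k, 'a, 'c) bimodule) \<Rightarrow> (nat \<Rightarrow> 'c \<Rightarrow> 'c) \<Rightarrow> nat \<Rightarrow>
    ('k, (nat \<Rightarrow> 'p \<Rightarrow> 'c) set) module" where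
  "hypercohomology K A P dP C dC =
     (let D = (\<lambda>i j. Hom_Ae K A (P j) (C i));
          dh = (\<lambda>i j f. \<lambda>x\<in>carrier (P j). dC i (f x));
          dv = (\<lambda>i j f. \<lambda>x\<in>carrier (P (j + 1)). f (dP (j + 1) x))
      in cohomology (tot D) (cotot_d D dh dv))"


section \<open>Tensor algebra and quadratic algebras\<close>

definition free_algebra :: "'k ring \<Rightarrow> 's set \<Rightarrow> ('k, 's list \<Rightarrow> 'k) module" where
  "free_algebra K S = (free_module K (lists S))\<lparr>
     mult := (\<lambda>f g w. \<Oplus>\<^bsub>K\<^esub>i\<in>{..length w}. f (take i w) \<otimes>\<^bsub>K\<^esub> g (drop i w)),
     one := single K []\<rparr>"

text \<open>
  \<open>T(V)\<close> is the free algebra on the set of vectors modulo linearity of the generators.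
  The ideal is spanned by the multilinearity relations between words of the same length, so the
  degree \<open>p\<close> part is \<open>V\<^sup>\<otimes>\<^sup>p\<close>; the class of the word \<open>x\<^sub>1 \<dots> x\<^sub>p\<close> is \<open>x\<^sub>1 \<otimes> \<dots> \<otimes> x\<^sub>p\<close>.
\<close>

definition tensor_ideal :: "'k ring \<Rightarrow> ('k, 'v) module \<Rightarrow> ('v list \<Rightarrow> 'k) set" where
  "tensor_ideal K V = (let F = free_algebra K (carrier V) in Idl\<^bsub>F\<^esub>
     ({single K [x \<oplus>\<^bsub>V\<^esub> y] \<ominus>\<^bsub>F\<^esub> (single K [x] \<oplus>\<^bsub>F\<^esub> single K [y]) | x y.
         x \<in> carrier V \<and> y \<in> carrier V} \<union>
      {single K [c \<odot>\<^bsub>V\<^esub> x] \<ominus>\<^bsub>F\<^esub> c \<odot>\<^bsub>F\<^esub> single K [x] | c x.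
         c \<in> carrier K \<and> x \<in> carrier V}))"

definition tensor_algebra :: "'k ring \<Rightarrow> ('k, 'v) module \<Rightarrow> ('k, ('v list \<Rightarrow> 'k) set) module" where
  "tensor_algebra K V = quot (free_algebra K (carrier V)) (tensor_ideal K V)"

definition tensor_power :: "'k ring \<Rightarrow> ('k, 'v) module \<Rightarrow> nat \<Rightarrow> ('v list \<Rightarrow> 'k) set set" where
  "tensor_power K V p = (\<lambda>f. tensor_ideal K V +>\<^bsub>free_algebra K (carrier V)\<^esub> f) `
     {f \<in> carrier (free_algebra K (carrier V)). \<forall>w. f w \<noteq> \<zero>\<^bsub>K\<^esub> \<longrightarrow> length w = p}"

type_synonym ('k, 'v) tens = "('v list \<Rightarrow> 'k) set"

definition rel_ideal :: "'k ring \<Rightarrow> ('k, 'v) module \<Rightarrow> ('k, 'v) tens set \<Rightarrow>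
    ('k, 'v) tens set" where
  "rel_ideal K V R = Idl\<^bsub>tensor_algebra K V\<^esub> R"

definition quadratic_algebra :: "'k ring \<Rightarrow> ('k, 'v) module \<Rightarrow> ('k, 'v) tens set \<Rightarrow>
    ('k, ('k, 'v) tens set) module" where
  "quadratic_algebra K V R = quot (tensor_algebra K V) (rel_ideal K V R)"


section \<open>Koszul complex\<close>

text \<open>
  The subspaces \<open>W\<^sub>p\<close> of \<open>V\<^sup>\<otimes>\<^sup>p\<close>. For \<open>p < 2\<close> the intersection is over the empty family,
  giving \<open>W\<^sub>0 = K\<close> and \<open>W\<^sub>1 = V\<close>.
\<close>

definition koszul_W :: "'k ring \<Rightarrow> ('k, 'v) module \<Rightarrow> ('k, 'v) tens set \<Rightarrow> nat \<Rightarrow>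
    ('k, 'v) tens set" where
  "koszul_W K V R p = (let T = tensor_algebra K V in
     {t \<in> tensor_power K V p. \<forall>i j. i + 2 + j = p \<longrightarrow>
       t \<in> span_of K T {a \<otimes>\<^bsub>T\<^esub> r \<otimes>\<^bsub>T\<^esub> b | a r b.
         a \<in> tensor_power K V i \<and> r \<in> R \<and> b \<in> tensor_power K V j}})"

definition koszul_W_mod :: "'k ring \<Rightarrow> ('k, 'v) module \<Rightarrow> ('k, 'v) tens set \<Rightarrow> nat \<Rightarrow>
    ('k, ('k, 'v) tens) module" where
  "koszul_W_mod K V R p = (tensor_algebra K V)\<lparr>carrier := koszul_W K V R p\<rparr>"

text \<open>
  An element of \<open>W\<^sub>p\<close> viewed inside \<open>V \<otimes> W\<^sub>p\<^sub>-\<^sub>1\<close> and inside \<open>W\<^sub>p\<^sub>-\<^sub>1 \<otimes> V\<close>, both of which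
  embed into \<open>T(V)\<close> by multiplication.
\<close>

definition left_split :: "'k ring \<Rightarrow> ('k, 'v) module \<Rightarrow> ('k, 'v) tens set \<Rightarrow> nat \<Rightarrow>
    ('k, 'v) tens \<Rightarrow> (('k, 'v) tens \<times> ('k, 'v) tens \<Rightarrow> 'k) set" where
  "left_split K V R p = (let T = tensor_algebra K V in
     inv_into (carrier (tensor_K K (koszul_W_mod K V R 1) (koszul_W_mod K V R (p - 1))))
       (tensor_lift K T (\<lambda>x w. x \<otimes>\<^bsub>T\<^esub> w)))"

definition right_split :: "'k ring \<Rightarrow> ('k, 'v) module \<Rightarrow> ('k, 'v) tens set \<Rightarrow> nat \<Rightarrow>
    ('k, 'v) tens \<Rightarrow> (('k, 'v) tens \<times> ('k, 'v) tens \<Rightarrow> 'k) set" where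
  "right_split K V R p = (let T = tensor_algebra K V in
     inv_into (carrier (tensor_K K (koszul_W_mod K V R (p - 1)) (koszul_W_mod K V R 1)))
       (tensor_lift K T (\<lambda>w x. w \<otimes>\<^bsub>T\<^esub> x)))"

type_synonym ('k, 'v) quad = "('k, 'v) tens set"
type_synonym ('k, 'v) kosz = "('k, ('k, 'v) quad, ('k, 'v) tens) triple"

definition koszul :: "'k ring \<Rightarrow> ('k, 'v) module \<Rightarrow> ('k, 'v) tens set \<Rightarrow> nat \<Rightarrow>
    ('k, ('k, 'v) quad, ('k, 'v) kosz) bimodule" where
  "koszul K V R p = outer_bimod K (quadratic_algebra K V R) (koszul_W_mod K V R p)"

definition koszul_d :: "'k ring \<Rightarrow> ('k, 'v) module \<Rightarrow> ('k, 'v) tens set \<Rightarrow> nat \<Rightarrow>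
    ('k, 'v) kosz \<Rightarrow> ('k, 'v) kosz" where
  "koszul_d K V R p =
     (let T = tensor_algebra K V; A = quadratic_algebra K V R; Y = koszul K V R (p - 1);
          cl = (\<lambda>x. rel_ideal K V R +>\<^bsub>T\<^esub> x);
          tri = triple K A (koszul_W_mod K V R (p - 1))
      in triple_lift K Y (\<lambda>a w b.
           tensor_lift K Y (\<lambda>x w'. tri (a \<otimes>\<^bsub>A\<^esub> cl x) w' b) (left_split K V R p w) \<oplus>\<^bsub>Y\<^esub>
           signed Y p (tensor_lift K Y (\<lambda>w' x. tri a w' (cl x \<otimes>\<^bsub>A\<^esub> b)) (right_split K V R p w))))"

definition koszul_homology :: "'k ring \<Rightarrow> ('k, 'v) module \<Rightarrow> ('k, 'v) tens set \<Rightarrow>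
    ('k, ('k, 'v) quad, 'm) bimodule \<Rightarrow> nat \<Rightarrow>
    ('k, ('m \<times> ('k, 'v) kosz \<Rightarrow> 'k) set set) module" where
  "koszul_homology K V R M =
     (let C = (\<lambda>p. tensor_Ae K (quadratic_algebra K V R) M (koszul K V R p))
      in homology C (tensor_id_d K C (koszul_d K V R)))"

definition koszul_cohomology :: "'k ring \<Rightarrow> ('k, 'v) module \<Rightarrow> ('k, 'v) tens set \<Rightarrow>
    ('k, ('k, 'v) quad, 'm) bimodule \<Rightarrow> nat \<Rightarrow> ('k, (('k, 'v) kosz \<Rightarrow> 'm) set) module" where
  "koszul_cohomology K V R M =
     cohomology (\<lambda>p. Hom_Ae K (quadratic_algebra K V R) (koszul K V R p) M)
       (hom_d (koszul K V R) (koszul_d K V R) M)"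

text \<open>The complexes of bimodules \<open>M \<otimes>\<^sub>A K(A)\<close> and \<open>Hom\<^sub>A(K(A), M)\<close>.\<close>

definition koszul_tensor :: "'k ring \<Rightarrow> ('k, 'v) module \<Rightarrow> ('k, 'v) tens set \<Rightarrow>
    ('k, ('k, 'v) quad, 'm) bimodule \<Rightarrow> nat \<Rightarrow>
    ('k, ('k, 'v) quad, ('m \<times> ('k, 'v) kosz \<Rightarrow> 'k) set) bimodule" where
  "koszul_tensor K V R M p = tensor_A K (quadratic_algebra K V R) M (koszul K V R p)"

definition koszul_tensor_d :: "'k ring \<Rightarrow> ('k, 'v) module \<Rightarrow> ('k, 'v) tens set \<Rightarrow>
    ('k, ('k, 'v) quad, 'm) bimodule \<Rightarrow> nat \<Rightarrow>
    ('m \<times> ('k, 'v) kosz \<Rightarrow> 'k) set \<Rightarrow> ('m \<times> ('k, 'v) kosz \<Rightarrow> 'k) set" where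
  "koszul_tensor_d K V R M = tensor_id_d K (koszul_tensor K V R M) (koszul_d K V R)"

definition koszul_Hom :: "'k ring \<Rightarrow> ('k, 'v) module \<Rightarrow> ('k, 'v) tens set \<Rightarrow>
    ('k, ('k, 'v) quad, 'm) bimodule \<Rightarrow> nat \<Rightarrow>
    ('k, ('k, 'v) quad, ('k, 'v) kosz \<Rightarrow> 'm) bimodule" where
  "koszul_Hom K V R M p = Hom_A K (quadratic_algebra K V R) (koszul K V R p) M"

definition koszul_Hom_d :: "'k ring \<Rightarrow> ('k, 'v) module \<Rightarrow> ('k, 'v) tens set \<Rightarrow>
    ('k, ('k, 'v) quad, 'm) bimodule \<Rightarrow> nat \<Rightarrow>
    (('k, 'v) kosz \<Rightarrow> 'm) \<Rightarrow> ('k, 'v) kosz \<Rightarrow> 'm" where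
  "koszul_Hom_d K V R M = hom_d (koszul K V R) (koszul_d K V R) M"

end

theory Submission
  imports Defs
begin

text \<open>
  Write \<open>K\<^sub>i = A \<otimes> W\<^sub>i \<otimes> A\<close>. The double complex with entries \<open>(M \<otimes>\<^sub>A K\<^sub>i) \<otimes> P\<^sub>q\<close> over the
  enveloping algebra, whose total complex computes the hyperhomology, has exact rows in the direction
  of \<open>q\<close>, augmented by \<open>M \<otimes> K\<^sub>i\<close>: the resolution \<open>P \<rightarrow> A\<close> has a contraction that is right \<open>A\<close>-linear
  only, and this contraction acts on the rows because \<open>K\<^sub>i\<close> is free as a right module over its subspace
  \<open>A \<otimes> W\<^sub>i \<otimes> 1\<close>. So the total complex is quasi-isomorphic to the Koszul complex with coefficients in
  \<open>M\<close>, without \<open>K(A)\<close> being a resolution. Cohomology is dual.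

  The Koszul differential splits off outer tensor factors along \<open>W\<^sub>p\<^sub>+\<^sub>1 \<subseteq> V \<otimes> W\<^sub>p\<close> and
  \<open>W\<^sub>p\<^sub>+\<^sub>1 \<subseteq> W\<^sub>p \<otimes> V\<close>. These inclusions follow by contracting the outer factors with functionals on
  \<open>V\<close>, where \<open>V\<close> may be infinite-dimensional.
\<close>

section \<open>Linear maps and quotients\<close>

text \<open>Over the enveloping algebra the left factor \<open>M (x)_A (A (x) W (x) A)\<close> is
  \<open>M (x) W (x) A\<close>, and tensoring with \<open>P\<close> moves the last factor
  \<open>A\<close> onto \<open>P\<close>. What remains is \<open>P (x)_A M\<close> tensored with
  \<open>W\<close>: the left structure of \<open>P\<close> is used up and only its right structure
  is still visible. In general \<open>P -> A\<close> has no contraction by bimodule maps, but as a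
  complex of right modules it splits, because \<open>A\<close> is free on \<open>1\<close> and a
  summand of \<open>A (x) B (x) A\<close> is projective as a right module. Dually, bimodule maps
  from \<open>P\<close> into \<open>Hom_A(A (x) W (x) A, M)\<close> amount to right linear maps from
  \<open>P\<close> into the linear maps from \<open>W\<close> to \<open>M\<close>. These
  contractions are not left linear, so in general they do not commute with the Koszul differential,
  and no homotopy of total complexes is written down; exactness in one direction is fed into an
  abstract statement on double complexes. The field enters through complements: linear sections of
  boundary maps, functionals on \<open>V\<close>, and a complement of \<open>W_p\<close> in the
  tensor algebra. That the Koszul differential is well defined, bilinear over \<open>A\<close> and
  squares to zero has to be shown as well.\<close>

lemma lin_mapsI:
  assumes "\<And>x. x \<in> carrier X \<Longrightarrow> h x \<in> carrier Y"
    and "\<And>x y. \<lbrakk>x \<in> carrier X; y \<in> carrier X\<rbrakk> \<Longrightarrow> h (x \<oplus>\<^bsub>X\<^esub> y) = h x \<oplus>\<^bsub>Y\<^esub> h y"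
    and "\<And>c x. \<lbrakk>c \<in> carrier K; x \<in> carrier X\<rbrakk> \<Longrightarrow> h (c \<odot>\<^bsub>X\<^esub> x) = c \<odot>\<^bsub>Y\<^esub> h x"
  shows "h \<in> lin_maps K X Y"
  using assms unfolding lin_maps_def by auto

lemma lin_closed: "\<lbrakk>h \<in> lin_maps K X Y; x \<in> carrier X\<rbrakk> \<Longrightarrow> h x \<in> carrier Y"
  unfolding lin_maps_def by auto

lemma lin_add: "\<lbrakk>h \<in> lin_maps K X Y; x \<in> carrier X; y \<in> carrier X\<rbrakk> \<Longrightarrow>
    h (x \<oplus>\<^bsub>X\<^esub> y) = h x \<oplus>\<^bsub>Y\<^esub> h y"
  unfolding lin_maps_def by auto

lemma lin_smult: "\<lbrakk>h \<in> lin_maps K X Y; c \<in> carrier K; x \<in> carrier X\<rbrakk> \<Longrightarrow>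
    h (c \<odot>\<^bsub>X\<^esub> x) = c \<odot>\<^bsub>Y\<^esub> h x"
  unfolding lin_maps_def by auto

lemma lin_zero:
  assumes "module K X" "module K Y" "h \<in> lin_maps K X Y"
  shows "h \<zero>\<^bsub>X\<^esub> = \<zero>\<^bsub>Y\<^esub>"
proof -
  interpret X: module K X by fact
  interpret Y: module K Y by fact
  have "h (\<zero>\<^bsub>K\<^esub> \<odot>\<^bsub>X\<^esub> \<zero>\<^bsub>X\<^esub>) = \<zero>\<^bsub>K\<^esub> \<odot>\<^bsub>Y\<^esub> h \<zero>\<^bsub>X\<^esub>"
    by (rule lin_smult[OF assms(3)]) auto
  then show ?thesis using lin_closed[OF assms(3)] by simp
qed

lemma lin_neg:
  assumes "module K X" "module K Y" "h \<in> lin_maps K X Y" "x \<in> carrier X"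
  shows "h (\<ominus>\<^bsub>X\<^esub> x) = \<ominus>\<^bsub>Y\<^esub> h x"
proof -
  interpret X: module K X by fact
  interpret Y: module K Y by fact
  have "h ((\<ominus>\<^bsub>K\<^esub> \<one>\<^bsub>K\<^esub>) \<odot>\<^bsub>X\<^esub> x) = (\<ominus>\<^bsub>K\<^esub> \<one>\<^bsub>K\<^esub>) \<odot>\<^bsub>Y\<^esub> h x"
    by (rule lin_smult[OF assms(3)]) (auto simp: assms)
  then show ?thesis
    using lin_closed[OF assms(3,4)] assms(4) X.smult_l_minus Y.smult_l_minus by simp
qed

lemma lin_diff:
  assumes "module K X" "module K Y" "h \<in> lin_maps K X Y" "x \<in> carrier X" "y \<in> carrier X"
  shows "h (x \<ominus>\<^bsub>X\<^esub> y) = h x \<ominus>\<^bsub>Y\<^esub> h y"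
proof -
  interpret X: module K X by fact
  show ?thesis
    by (simp add: a_minus_def lin_add[OF assms(3)] lin_neg[OF assms(1-3)] assms(4,5))
qed

lemma signed_closed: "\<lbrakk>module K X; x \<in> carrier X\<rbrakk> \<Longrightarrow> signed X n x \<in> carrier X"
  unfolding signed_def module_def by (auto intro: abelian_group.a_inv_closed)

lemma lin_signed:
  assumes "module K X" "module K Y" "h \<in> lin_maps K X Y" "x \<in> carrier X"
  shows "h (signed X n x) = signed Y n (h x)"
  using lin_neg[OF assms] by (simp add: signed_def)

lemma signed_add:
  assumes "module K X" "x \<in> carrier X" "y \<in> carrier X"
  shows "signed X n (x \<oplus>\<^bsub>X\<^esub> y) = signed X n x \<oplus>\<^bsub>X\<^esub> signed X n y"
proof -
  interpret X: module K X by fact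
  show ?thesis using assms(2,3) by (simp add: signed_def X.minus_add)
qed

lemma signed_smult:
  assumes "module K X" "c \<in> carrier K" "x \<in> carrier X"
  shows "signed X n (c \<odot>\<^bsub>X\<^esub> x) = c \<odot>\<^bsub>X\<^esub> signed X n x"
proof -
  interpret X: module K X by fact
  show ?thesis using assms(2,3) by (simp add: signed_def X.smult_r_minus)
qed

lemma lin_comp:
  "\<lbrakk>f \<in> lin_maps K X Y; g \<in> lin_maps K Y Z\<rbrakk> \<Longrightarrow> (\<lambda>x. g (f x)) \<in> lin_maps K X Z"
  by (rule lin_mapsI) (auto simp: lin_closed lin_add lin_smult)

lemma lin_id: "(\<lambda>x. x) \<in> lin_maps K X X"
  by (rule lin_mapsI) auto

lemma lin_const_zero: "module K Y \<Longrightarrow> (\<lambda>x. \<zero>\<^bsub>Y\<^esub>) \<in> lin_maps K X Y"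
proof (rule lin_mapsI)
  assume "module K Y"
  then interpret Y: module K Y .
  show "\<zero>\<^bsub>Y\<^esub> \<in> carrier Y" "\<zero>\<^bsub>Y\<^esub> = \<zero>\<^bsub>Y\<^esub> \<oplus>\<^bsub>Y\<^esub> \<zero>\<^bsub>Y\<^esub>" by auto
  show "c \<in> carrier K \<Longrightarrow> \<zero>\<^bsub>Y\<^esub> = c \<odot>\<^bsub>Y\<^esub> \<zero>\<^bsub>Y\<^esub>" for c by simp
qed

lemma lin_sum:
  assumes "module K Y" "f \<in> lin_maps K X Y" "g \<in> lin_maps K X Y"
  shows "(\<lambda>x. f x \<oplus>\<^bsub>Y\<^esub> g x) \<in> lin_maps K X Y"
proof -
  interpret Y: module K Y by fact
  show ?thesis
  proof (rule lin_mapsI)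
    fix x y assume *: "x \<in> carrier X" "y \<in> carrier X"
    note c = lin_closed[OF assms(2) *(1)] lin_closed[OF assms(2) *(2)]
      lin_closed[OF assms(3) *(1)] lin_closed[OF assms(3) *(2)]
    show "f (x \<oplus>\<^bsub>X\<^esub> y) \<oplus>\<^bsub>Y\<^esub> g (x \<oplus>\<^bsub>X\<^esub> y) = f x \<oplus>\<^bsub>Y\<^esub> g x \<oplus>\<^bsub>Y\<^esub> (f y \<oplus>\<^bsub>Y\<^esub> g y)"
      using c by (simp add: lin_add[OF assms(2)] lin_add[OF assms(3)] * Y.a_ac)
  qed (auto simp: lin_closed[OF assms(2)] lin_closed[OF assms(3)] lin_smult[OF assms(2)]
        lin_smult[OF assms(3)] Y.smult_r_distr)
qed

lemma lin_sgn: "\<lbrakk>module K Y; f \<in> lin_maps K X Y\<rbrakk> \<Longrightarrow> (\<lambda>x. signed Y n (f x)) \<in> lin_maps K X Y"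
  by (rule lin_mapsI) (auto simp: lin_closed lin_add lin_smult signed_closed signed_add signed_smult)

text \<open>Modules, algebras and bimodules share record fields, and many constructions differ only
  in \<open>mult\<close>, \<open>one\<close> or the actions. The module axioms see four fields, so
  they pass between such records.\<close>

lemma module_cong:
  assumes "module K X" "carrier X' = carrier X" "add X' = add X" "zero X' = zero X"
    "smult X' = smult X"
  shows "module K X'"
proof -
  interpret X: module K X by fact
  show ?thesis
  proof (rule moduleI)
    show "cring K" by (rule X.R.is_cring)
    show "abelian_group X'"
    proof (rule abelian_groupI)
      show "\<exists>y\<in>carrier X'. y \<oplus>\<^bsub>X'\<^esub> x = \<zero>\<^bsub>X'\<^esub>" if "x \<in> carrier X'" for x
        using that by (intro bexI[of _ "\<ominus>\<^bsub>X\<^esub> x"]) (simp_all add: assms(2-5) X.l_neg)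
    qed (simp_all add: assms(2-5) X.a_ac)
  qed (auto simp: assms(2-5) X.smult_l_distr X.smult_r_distr X.smult_assoc1)
qed

lemma module_make_bimod: "module K X \<Longrightarrow> module K (make_bimod X l r)"
  by (erule module_cong) (auto simp: make_bimod_def)

lemma make_bimod_simps [simp]:
  "carrier (make_bimod X l r) = carrier X" "add (make_bimod X l r) = add X"
  "zero (make_bimod X l r) = zero X" "smult (make_bimod X l r) = smult X"
  "lact (make_bimod X l r) = l" "ract (make_bimod X l r) = r"
  by (auto simp: make_bimod_def)

lemma module_abelian_group: "module K X \<Longrightarrow> abelian_group X"
  unfolding module_def by auto

lemma module_neg_unique:
  assumes "module K X" "x \<in> carrier X" "y \<in> carrier X" "x \<oplus>\<^bsub>X\<^esub> y = \<zero>\<^bsub>X\<^esub>"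
  shows "y = \<ominus>\<^bsub>X\<^esub> x"
proof -
  interpret X: module K X by fact
  show ?thesis using assms(2-4) by (metis X.a_comm X.minus_equality)
qed

lemma module_diff_eq_zero:
  assumes "module K X" "x \<in> carrier X" "y \<in> carrier X" "x \<ominus>\<^bsub>X\<^esub> y = \<zero>\<^bsub>X\<^esub>"
  shows "x = y"
proof -
  interpret X: module K X by fact
  have "\<ominus>\<^bsub>X\<^esub> (\<ominus>\<^bsub>X\<^esub> y) = x" using assms by (intro X.minus_equality) (simp_all add: a_minus_def)
  then show ?thesis using assms(3) by simp
qed

lemma submodule_zero: "\<lbrakk>module K X; submodule N K X\<rbrakk> \<Longrightarrow> \<zero>\<^bsub>X\<^esub> \<in> N"
  unfolding submodule_def using subgroup.one_closed by fastforce

lemma submodule_abelian_subgroup: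
  assumes "module K X" "submodule N K X"
  shows "abelian_subgroup N X"
proof (rule abelian_subgroupI3)
  show "additive_subgroup N X"
    using assms(2) by (simp add: additive_subgroup_def submodule_def)
  show "abelian_group X" by (rule module_abelian_group[OF assms(1)])
qed

lemma submodule_kernel:
  assumes "module K X" "module K Y" "h \<in> lin_maps K X Y"
  shows "submodule {x \<in> carrier X. h x = \<zero>\<^bsub>Y\<^esub>} K X"
proof -
  interpret X: module K X by fact
  interpret Y: module K Y by fact
  show ?thesis
    by (rule X.submoduleI)
      (auto simp: lin_zero[OF assms] lin_neg[OF assms] lin_add[OF assms(3)] lin_smult[OF assms(3)])
qed

lemma submodule_image:
  assumes "module K X" "module K Y" "h \<in> lin_maps K X Y"
  shows "submodule (h ` carrier X) K Y"
proof -
  interpret X: module K X by fact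
  interpret Y: module K Y by fact
  show ?thesis
  proof (rule Y.submoduleI)
    show "\<zero>\<^bsub>Y\<^esub> \<in> h ` carrier X"
      using lin_zero[OF assms] by (intro image_eqI[of _ _ "\<zero>\<^bsub>X\<^esub>"]) auto
    fix a assume "a \<in> h ` carrier X"
    then obtain x where x: "x \<in> carrier X" "a = h x" by blast
    show "\<ominus>\<^bsub>Y\<^esub> a \<in> h ` carrier X"
      using x lin_neg[OF assms x(1)] by (intro image_eqI[of _ _ "\<ominus>\<^bsub>X\<^esub> x"]) simp_all
    show "c \<odot>\<^bsub>Y\<^esub> a \<in> h ` carrier X" if "c \<in> carrier K" for c
      using x lin_smult[OF assms(3) that x(1)] that
      by (intro image_eqI[of _ _ "c \<odot>\<^bsub>X\<^esub> x"]) simp_all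
    fix b assume "b \<in> h ` carrier X"
    then obtain y where y: "y \<in> carrier X" "b = h y" by blast
    show "a \<oplus>\<^bsub>Y\<^esub> b \<in> h ` carrier X"
      using x y lin_add[OF assms(3) x(1) y(1)]
      by (intro image_eqI[of _ _ "x \<oplus>\<^bsub>X\<^esub> y"]) simp_all
  qed (use lin_closed[OF assms(3)] in auto)
qed

section \<open>Spans and quotients by submodules\<close>

lemma span_of_submodule:
  assumes "module K X" "S \<subseteq> carrier X"
  shows "submodule (span_of K X S) K X"
proof -
  interpret X: module K X by fact
  have c: "submodule (carrier X) K X" by (rule X.carrier_is_submodule)
  show ?thesis unfolding span_of_def
  proof (rule X.submoduleI)
    show "\<Inter> {N. submodule N K X \<and> S \<subseteq> N} \<subseteq> carrier X" using c assms by auto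
  qed (auto dest: X.submoduleE intro: submodule_zero[OF assms(1)])
qed

lemma span_of_base: "s \<in> S \<Longrightarrow> s \<in> span_of K X S"
  unfolding span_of_def by auto

lemma span_of_least: "\<lbrakk>submodule N K X; S \<subseteq> N\<rbrakk> \<Longrightarrow> span_of K X S \<subseteq> N"
  unfolding span_of_def by auto

lemma span_of_zero:
  assumes "module K X" "module K Y" "h \<in> lin_maps K X Y" "S \<subseteq> carrier X"
    "\<And>s. s \<in> S \<Longrightarrow> h s = \<zero>\<^bsub>Y\<^esub>" "x \<in> span_of K X S"
  shows "h x = \<zero>\<^bsub>Y\<^esub>"
  using span_of_least[OF submodule_kernel[OF assms(1-3)], of S] assms(4-6) by auto

lemma quot_simps:
  "carrier (quot X N) = (\<lambda>x. N +>\<^bsub>X\<^esub> x) ` carrier X" "zero (quot X N) = N"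
  "one (quot X N) = N +>\<^bsub>X\<^esub> \<one>\<^bsub>X\<^esub>" "mult (quot X N) = rcoset_mult X N"
  "add (quot X N) = set_add X"
  by (auto simp: quot_def FactRing_def A_RCOSETS_def' )

lemma coset_eq_iff:
  assumes "module K X" "submodule N K X" "x \<in> carrier X" "y \<in> carrier X"
  shows "N +>\<^bsub>X\<^esub> x = N +>\<^bsub>X\<^esub> y \<longleftrightarrow> x \<ominus>\<^bsub>X\<^esub> y \<in> N"
proof -
  interpret N: abelian_subgroup N X by (rule submodule_abelian_subgroup[OF assms(1,2)])
  show ?thesis
    using N.a_rcos_module[OF assms(4,3)] N.a_repr_independence'[OF _ assms(4), of x]
      N.a_repr_independenceD[OF assms(3), of y] unfolding a_minus_def by blast
qed

lemma coset_mem_iff: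
  assumes "module K X" "submodule N K X" "x \<in> carrier X"
  shows "y \<in> N +>\<^bsub>X\<^esub> x \<longleftrightarrow> y \<in> carrier X \<and> N +>\<^bsub>X\<^esub> y = N +>\<^bsub>X\<^esub> x"
proof -
  interpret N: abelian_subgroup N X by (rule submodule_abelian_subgroup[OF assms(1,2)])
  show ?thesis
    using N.a_repr_independence'[OF _ assms(3), of y] N.a_repr_independenceD[of y x]
      N.a_elemrcos_carrier[OF assms(3), of y] by blast
qed

lemma quot_add:
  assumes "module K X" "submodule N K X" "x \<in> carrier X" "y \<in> carrier X"
  shows "(N +>\<^bsub>X\<^esub> x) \<oplus>\<^bsub>quot X N\<^esub> (N +>\<^bsub>X\<^esub> y) = N +>\<^bsub>X\<^esub> (x \<oplus>\<^bsub>X\<^esub> y)"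
proof -
  interpret N: abelian_subgroup N X by (rule submodule_abelian_subgroup[OF assms(1,2)])
  show ?thesis using N.a_rcos_sum assms by (simp add: quot_simps)
qed

text \<open>\<open>quot\<close> defines the scalar action on a coset as a union over its
  representatives. All members of this union are one and the same coset, since \<open>N\<close>
  absorbs multiples of differences.\<close>

lemma quot_smult:
  assumes "module K X" "submodule N K X" "c \<in> carrier K" "x \<in> carrier X"
  shows "c \<odot>\<^bsub>quot X N\<^esub> (N +>\<^bsub>X\<^esub> x) = N +>\<^bsub>X\<^esub> (c \<odot>\<^bsub>X\<^esub> x)"
proof -
  interpret X: module K X by fact
  interpret N: abelian_subgroup N X by (rule submodule_abelian_subgroup[OF assms(1,2)])
  have "N +>\<^bsub>X\<^esub> (c \<odot>\<^bsub>X\<^esub> y) = N +>\<^bsub>X\<^esub> (c \<odot>\<^bsub>X\<^esub> x)" if "y \<in> N +>\<^bsub>X\<^esub> x" for y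
  proof -
    have y: "y \<in> carrier X" "N +>\<^bsub>X\<^esub> y = N +>\<^bsub>X\<^esub> x"
      using that coset_mem_iff[OF assms(1,2,4)] by auto
    then have "y \<ominus>\<^bsub>X\<^esub> x \<in> N" using coset_eq_iff[OF assms(1,2) y(1) assms(4)] by simp
    then have "c \<odot>\<^bsub>X\<^esub> (y \<ominus>\<^bsub>X\<^esub> x) \<in> N" using assms(2,3) X.submoduleE(4) by blast
    then have "c \<odot>\<^bsub>X\<^esub> y \<ominus>\<^bsub>X\<^esub> c \<odot>\<^bsub>X\<^esub> x \<in> N"
      using y assms(3,4) by (simp add: a_minus_def X.smult_r_distr X.smult_r_minus)
    then show ?thesis using coset_eq_iff[OF assms(1,2)] y assms(3,4) by simp
  qed
  moreover have "x \<in> N +>\<^bsub>X\<^esub> x" using N.a_rcos_self assms by auto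
  ultimately have "(\<Union>y\<in>N +>\<^bsub>X\<^esub> x. N +>\<^bsub>X\<^esub> (c \<odot>\<^bsub>X\<^esub> y)) = N +>\<^bsub>X\<^esub> (c \<odot>\<^bsub>X\<^esub> x)"
    by blast
  then show ?thesis by (simp add: quot_def)
qed

lemma quot_module:
  assumes "module K X" "submodule N K X"
  shows "module K (quot X N)"
proof -
  interpret X: module K X by fact
  interpret N: abelian_subgroup N X by (rule submodule_abelian_subgroup[OF assms(1,2)])
  note qa = quot_add[OF assms] and qs = quot_smult[OF assms]
  have N: "N = N +>\<^bsub>X\<^esub> \<zero>\<^bsub>X\<^esub>" using X.a_coset_add_zero N.a_subset by simp
  show ?thesis
  proof (rule moduleI)
    show "cring K" by (rule X.R.is_cring)
    show "abelian_group (quot X N)"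
    proof (rule abelian_groupI)
      fix x assume "x \<in> carrier (quot X N)"
      then obtain y where y: "y \<in> carrier X" "x = N +>\<^bsub>X\<^esub> y" by (auto simp: quot_simps)
      show "\<zero>\<^bsub>quot X N\<^esub> \<oplus>\<^bsub>quot X N\<^esub> x = x"
        using y qa[of "\<zero>\<^bsub>X\<^esub>" y] N by (simp add: quot_simps)
      show "\<exists>y\<in>carrier (quot X N). y \<oplus>\<^bsub>quot X N\<^esub> x = \<zero>\<^bsub>quot X N\<^esub>"
        using y qa[of "\<ominus>\<^bsub>X\<^esub> y" y] N
        by (intro bexI[of _ "N +>\<^bsub>X\<^esub> (\<ominus>\<^bsub>X\<^esub> y)"]) (auto simp: quot_simps X.l_neg)
    next
      fix x y assume "x \<in> carrier (quot X N)" "y \<in> carrier (quot X N)"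
      then obtain a b where ab: "a \<in> carrier X" "x = N +>\<^bsub>X\<^esub> a" "b \<in> carrier X" "y = N +>\<^bsub>X\<^esub> b"
        by (auto simp: quot_simps)
      show "x \<oplus>\<^bsub>quot X N\<^esub> y \<in> carrier (quot X N)" using ab qa by (auto simp: quot_simps)
      show "x \<oplus>\<^bsub>quot X N\<^esub> y = y \<oplus>\<^bsub>quot X N\<^esub> x" using ab qa X.a_comm by auto
      fix z assume "z \<in> carrier (quot X N)"
      then obtain c where c: "c \<in> carrier X" "z = N +>\<^bsub>X\<^esub> c" by (auto simp: quot_simps)
      show "x \<oplus>\<^bsub>quot X N\<^esub> y \<oplus>\<^bsub>quot X N\<^esub> z = x \<oplus>\<^bsub>quot X N\<^esub> (y \<oplus>\<^bsub>quot X N\<^esub> z)"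
        using ab c qa X.a_assoc by simp
    next
      show "\<zero>\<^bsub>quot X N\<^esub> \<in> carrier (quot X N)" using N by (auto simp: quot_simps)
    qed
  qed (auto simp: quot_simps(1) qa qs X.smult_l_distr X.smult_r_distr X.smult_assoc1)
qed

lemma quot_proj: "\<lbrakk>module K X; submodule N K X\<rbrakk> \<Longrightarrow> (\<lambda>x. N +>\<^bsub>X\<^esub> x) \<in> lin_maps K X (quot X N)"
  by (rule lin_mapsI) (auto simp: quot_simps(1) quot_add quot_smult)

lemma coset_zero_iff:
  assumes "module K X" "submodule N K X" "x \<in> carrier X"
  shows "N +>\<^bsub>X\<^esub> x = N \<longleftrightarrow> x \<in> N"
proof -
  interpret X: module K X by fact
  interpret N: abelian_subgroup N X by (rule submodule_abelian_subgroup[OF assms(1,2)])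
  have "N = N +>\<^bsub>X\<^esub> \<zero>\<^bsub>X\<^esub>" using X.a_coset_add_zero N.a_subset by simp
  moreover have "x \<ominus>\<^bsub>X\<^esub> \<zero>\<^bsub>X\<^esub> = x"
    using assms(3) by (simp add: a_minus_def X.add.inv_one[unfolded a_inv_def[symmetric]])
  ultimately show ?thesis using coset_eq_iff[OF assms, of "\<zero>\<^bsub>X\<^esub>"] by simp
qed

text \<open>Induced maps are evaluated at a representative picked by \<open>SOME\<close>; a map that
  kills \<open>N\<close> is constant on cosets, so the pick is harmless.\<close>

lemma quot_lift_coset:
  assumes "module K X" "submodule N K X" "module K Y" "h \<in> lin_maps K X Y"
    "\<And>x. x \<in> N \<Longrightarrow> h x = \<zero>\<^bsub>Y\<^esub>" "x \<in> carrier X"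
  shows "h (SOME y. y \<in> N +>\<^bsub>X\<^esub> x) = h x"
proof -
  interpret X: module K X by fact
  interpret Y: module K Y by fact
  have "x \<in> N +>\<^bsub>X\<^esub> x" using coset_mem_iff[OF assms(1,2,6)] assms(6) by simp
  then have "(SOME y. y \<in> N +>\<^bsub>X\<^esub> x) \<in> N +>\<^bsub>X\<^esub> x" by (rule someI)
  then obtain y where y: "y = (SOME y. y \<in> N +>\<^bsub>X\<^esub> x)" "y \<in> carrier X" "N +>\<^bsub>X\<^esub> y = N +>\<^bsub>X\<^esub> x"
    using coset_mem_iff[OF assms(1,2,6)] by blast
  then have "h (y \<ominus>\<^bsub>X\<^esub> x) = \<zero>\<^bsub>Y\<^esub>" using assms(5) coset_eq_iff[OF assms(1,2) y(2) assms(6)] by simp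
  then have "h y \<ominus>\<^bsub>Y\<^esub> h x = \<zero>\<^bsub>Y\<^esub>" using lin_diff[OF assms(1,3,4) y(2) assms(6)] by simp
  then have "h y = h x"
    using module_diff_eq_zero[OF assms(3)] lin_closed[OF assms(4)] y(2) assms(6) by blast
  then show ?thesis using y by simp
qed

lemma quot_lift:
  assumes "module K X" "submodule N K X" "module K Y" "h \<in> lin_maps K X Y"
    "\<And>x. x \<in> N \<Longrightarrow> h x = \<zero>\<^bsub>Y\<^esub>"
  shows "(\<lambda>S. h (SOME y. y \<in> S)) \<in> lin_maps K (quot X N) Y"
proof -
  interpret X: module K X by fact
  note v = quot_lift_coset[OF assms]
  show ?thesis
    by (rule lin_mapsI)
      (auto simp: quot_simps(1) v lin_closed[OF assms(4)] quot_add[OF assms(1,2)]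
        quot_smult[OF assms(1,2)] lin_add[OF assms(4)] lin_smult[OF assms(4)])
qed

text \<open>An isomorphism theorem cut for homology classes: hitting each class modulo
  \<open>N'\<close> is enough, so \<open>h\<close> itself may fail to be onto.\<close>

lemma mod_iso_quot:
  assumes X: "module K X" "submodule N K X" and Y: "module K Y" "submodule N' K Y"
    and h: "h \<in> lin_maps K X Y" and N: "\<And>x. x \<in> carrier X \<Longrightarrow> h x \<in> N' \<longleftrightarrow> x \<in> N"
    and surj: "\<And>y. y \<in> carrier Y \<Longrightarrow> \<exists>x\<in>carrier X. h x \<ominus>\<^bsub>Y\<^esub> y \<in> N'"
  shows "mod_iso K (quot X N) (quot Y N')"
proof -
  interpret X: module K X by fact
  interpret Y: module K Y by fact
  let ?g = "\<lambda>x. N' +>\<^bsub>Y\<^esub> (h x)"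
  have g: "?g \<in> lin_maps K X (quot Y N')" by (rule lin_comp[OF h quot_proj[OF Y]])
  have NX: "x \<in> carrier X" if "x \<in> N" for x using that X.submoduleE(1)[OF X(2)] by auto
  have g0: "?g x = \<zero>\<^bsub>quot Y N'\<^esub>" if "x \<in> N" for x
    using N that NX coset_zero_iff[OF Y] lin_closed[OF h] by (auto simp: quot_simps)
  note m = quot_module[OF Y]
  let ?f = "\<lambda>S. ?g (SOME y. y \<in> S)"
  have f: "?f \<in> lin_maps K (quot X N) (quot Y N')" by (rule quot_lift[OF X m g g0])
  have v: "?f (N +>\<^bsub>X\<^esub> x) = ?g x" if "x \<in> carrier X" for x
    by (rule quot_lift_coset[OF X m g g0 that])
  have "bij_betw ?f (carrier (quot X N)) (carrier (quot Y N'))"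
  proof (rule bij_betw_imageI)
    show "inj_on ?f (carrier (quot X N))"
    proof (rule inj_onI)
      fix S S' assume "S \<in> carrier (quot X N)" "S' \<in> carrier (quot X N)" and eq: "?f S = ?f S'"
      then obtain x y where xy: "x \<in> carrier X" "S = N +>\<^bsub>X\<^esub> x" "y \<in> carrier X" "S' = N +>\<^bsub>X\<^esub> y"
        by (auto simp: quot_simps)
      have "?g x = ?g y" using eq v xy by metis
      then have "h x \<ominus>\<^bsub>Y\<^esub> h y \<in> N'" using coset_eq_iff[OF Y] lin_closed[OF h] xy by blast
      then have "h (x \<ominus>\<^bsub>X\<^esub> y) \<in> N'" using lin_diff[OF X(1) Y(1) h] xy by simp
      then have "x \<ominus>\<^bsub>X\<^esub> y \<in> N" using N xy by simp
      then show "S = S'" using coset_eq_iff[OF X] xy by blast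
    qed
    show "?f ` carrier (quot X N) = carrier (quot Y N')"
    proof
      show "?f ` carrier (quot X N) \<subseteq> carrier (quot Y N')" using lin_closed[OF f] by auto
      show "carrier (quot Y N') \<subseteq> ?f ` carrier (quot X N)"
      proof
        fix S assume "S \<in> carrier (quot Y N')"
        then obtain y where y: "y \<in> carrier Y" "S = N' +>\<^bsub>Y\<^esub> y" by (auto simp: quot_simps)
        then obtain x where x: "x \<in> carrier X" "h x \<ominus>\<^bsub>Y\<^esub> y \<in> N'" using surj by blast
        then have "?f (N +>\<^bsub>X\<^esub> x) = S" using v y coset_eq_iff[OF Y] lin_closed[OF h] by metis
        then show "S \<in> ?f ` carrier (quot X N)" using x by (auto simp: quot_simps)
      qed
    qed
  qed
  then show ?thesis unfolding mod_iso_def using f by blast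
qed

lemma mod_iso_sym:
  assumes "module K X" "module K Y" "mod_iso K X Y"
  shows "mod_iso K Y X"
proof -
  interpret X: module K X by fact
  obtain h where h: "h \<in> lin_maps K X Y" "bij_betw h (carrier X) (carrier Y)"
    using assms(3) unfolding mod_iso_def by auto
  let ?g = "inv_into (carrier X) h"
  have b: "bij_betw ?g (carrier Y) (carrier X)" by (rule bij_betw_inv_into[OF h(2)])
  have gc: "?g y \<in> carrier X" if "y \<in> carrier Y" for y using b that by (auto simp: bij_betw_def)
  have hg: "h (?g y) = y" if "y \<in> carrier Y" for y using bij_betw_inv_into_right[OF h(2) that] .
  have gh: "?g (h x) = x" if "x \<in> carrier X" for x using bij_betw_inv_into_left[OF h(2) that] .
  have "?g \<in> lin_maps K Y X"
  proof (rule lin_mapsI)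
    fix x y assume xy: "x \<in> carrier Y" "y \<in> carrier Y"
    have "h (?g x \<oplus>\<^bsub>X\<^esub> ?g y) = x \<oplus>\<^bsub>Y\<^esub> y" using lin_add[OF h(1)] gc hg xy by simp
    then show "?g (x \<oplus>\<^bsub>Y\<^esub> y) = ?g x \<oplus>\<^bsub>X\<^esub> ?g y" using gh gc xy by (metis X.a_closed)
  next
    fix c x assume cx: "c \<in> carrier K" "x \<in> carrier Y"
    have "h (c \<odot>\<^bsub>X\<^esub> ?g x) = c \<odot>\<^bsub>Y\<^esub> x" using lin_smult[OF h(1)] gc hg cx by simp
    then show "?g (c \<odot>\<^bsub>Y\<^esub> x) = c \<odot>\<^bsub>X\<^esub> ?g x" using gh gc cx by (metis X.smult_closed)
  qed (use gc in auto)
  then show ?thesis unfolding mod_iso_def using b by blast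
qed

section \<open>Complements over a field\<close>

definition self_mod :: "'k ring \<Rightarrow> ('k, 'k) module" where
  "self_mod K = \<lparr>carrier = carrier K, mult = mult K, one = one K, zero = zero K, add = add K,
     smult = mult K\<rparr>"

lemma self_mod_simps [simp]:
  "carrier (self_mod K) = carrier K" "zero (self_mod K) = zero K" "add (self_mod K) = add K"
  "smult (self_mod K) = mult K"
  by (auto simp: self_mod_def)

lemma self_mod_module:
  assumes "cring K"
  shows "module K (self_mod K)"
proof -
  interpret cring K by fact
  show ?thesis
  proof (rule moduleI)
    show "abelian_group (self_mod K)"
    proof (rule abelian_groupI)
      show "\<exists>y\<in>carrier (self_mod K). y \<oplus>\<^bsub>self_mod K\<^esub> x = \<zero>\<^bsub>self_mod K\<^esub>"
        if "x \<in> carrier (self_mod K)" for x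
        using that by (intro bexI[of _ "\<ominus>\<^bsub>K\<^esub> x"]) (simp_all add: l_neg)
    qed (simp_all add: a_ac)
  qed (simp_all add: l_distr r_distr m_assoc is_cring)
qed

lemma submodule_Union_chain:
  assumes "module K X" "C \<noteq> {}" "subset.chain {N. submodule N K X} C"
  shows "submodule (\<Union>C) K X"
proof -
  interpret X: module K X by fact
  have C: "submodule N K X" if "N \<in> C" for N using assms(3) that by (auto simp: subset.chain_def)
  note E = X.submoduleE[OF C]
  show ?thesis
  proof (rule X.submoduleI)
    show "\<Union>C \<subseteq> carrier X" using E(1) by auto
    show "\<zero>\<^bsub>X\<^esub> \<in> \<Union>C" using assms(2) submodule_zero[OF assms(1) C] by auto
    show "\<ominus>\<^bsub>X\<^esub> a \<in> \<Union>C" if "a \<in> \<Union>C" for a using that E(3) by auto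
    show "c \<odot>\<^bsub>X\<^esub> a \<in> \<Union>C" if "c \<in> carrier K" "a \<in> \<Union>C" for c a using that E(4) by auto
    fix a b assume "a \<in> \<Union>C" "b \<in> \<Union>C"
    then obtain N N' where N: "N \<in> C" "N' \<in> C" "a \<in> N" "b \<in> N'" by auto
    then have "N \<subseteq> N' \<or> N' \<subseteq> N" using assms(3) by (auto simp: subset.chain_def)
    then show "a \<oplus>\<^bsub>X\<^esub> b \<in> \<Union>C" using N E(5) by (meson UnionI subsetD)
  qed
qed

text \<open>Zorn's lemma gives a submodule maximal among those meeting \<open>N\<close> only in
  zero. If some \<open>x\<close> escaped the sum, adjoining it would create a nonzero intersection
  with \<open>N\<close>, and over a field that relation can be solved for \<open>x\<close>.\<close>

lemma exists_complement:
  assumes "field K" "module K X" "submodule N K X"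
  obtains N' where "submodule N' K X" "N \<inter> N' \<subseteq> {\<zero>\<^bsub>X\<^esub>}"
    "\<And>x. x \<in> carrier X \<Longrightarrow> \<exists>a\<in>N. \<exists>b\<in>N'. x = a \<oplus>\<^bsub>X\<^esub> b"
proof -
  interpret K: field K by fact
  interpret X: module K X by fact
  note EN = X.submoduleE[OF assms(3)]
  let ?A = "{N'. submodule N' K X \<and> N \<inter> N' \<subseteq> {\<zero>\<^bsub>X\<^esub>}}"
  have "submodule {\<zero>\<^bsub>X\<^esub>} K X" by (rule X.submoduleI) auto
  then have "?A \<noteq> {}" by blast
  moreover have "\<Union>C \<in> ?A" if "C \<noteq> {}" "subset.chain ?A C" for C
  proof -
    have "subset.chain {N. submodule N K X} C" using that(2) by (auto simp: subset.chain_def)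
    moreover have "N \<inter> \<Union>C \<subseteq> {\<zero>\<^bsub>X\<^esub>}" using that(2) by (auto simp: subset.chain_def)
    ultimately show ?thesis using submodule_Union_chain[OF assms(2) that(1)] by simp
  qed
  ultimately have "\<exists>N'\<in>?A. \<forall>Z\<in>?A. N' \<subseteq> Z \<longrightarrow> Z = N'" by (rule subset_Zorn_nonempty)
  then obtain N' where N': "submodule N' K X" "N \<inter> N' \<subseteq> {\<zero>\<^bsub>X\<^esub>}"
    and max: "\<And>Z. \<lbrakk>submodule Z K X; N \<inter> Z \<subseteq> {\<zero>\<^bsub>X\<^esub>}; N' \<subseteq> Z\<rbrakk> \<Longrightarrow> Z = N'"
    by auto
  note EN' = X.submoduleE[OF N'(1)]
  have c: "a \<in> carrier X" if "a \<in> N \<or> a \<in> N'" for a using EN(1) EN'(1) that by auto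
  have "\<exists>a\<in>N. \<exists>b\<in>N'. x = a \<oplus>\<^bsub>X\<^esub> b" if x: "x \<in> carrier X" for x
  proof (cases "x \<in> N'")
    case True
    then show ?thesis using x submodule_zero[OF assms(2,3)] by (intro bexI[of _ "\<zero>\<^bsub>X\<^esub>"] bexI[of _ x]) auto
  next
    case False
    let ?Z = "{n \<oplus>\<^bsub>X\<^esub> k \<odot>\<^bsub>X\<^esub> x | n k. n \<in> N' \<and> k \<in> carrier K}"
    have "submodule ?Z K X"
    proof (rule X.submoduleI)
      show "?Z \<subseteq> carrier X" using c x by auto
      show "\<zero>\<^bsub>X\<^esub> \<in> ?Z"
        using x submodule_zero[OF assms(2) N'(1)] by (force intro: exI[of _ "\<zero>\<^bsub>X\<^esub>"] exI[of _ "\<zero>\<^bsub>K\<^esub>"])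
    next
      fix a assume "a \<in> ?Z"
      then obtain n k where a: "n \<in> N'" "k \<in> carrier K" "a = n \<oplus>\<^bsub>X\<^esub> k \<odot>\<^bsub>X\<^esub> x" by auto
      have "\<ominus>\<^bsub>X\<^esub> a = \<ominus>\<^bsub>X\<^esub> n \<oplus>\<^bsub>X\<^esub> (\<ominus>\<^bsub>K\<^esub> k) \<odot>\<^bsub>X\<^esub> x" using a c x by (simp add: X.minus_add X.smult_l_minus)
      then show "\<ominus>\<^bsub>X\<^esub> a \<in> ?Z" using a EN'(3) by blast
      show "l \<odot>\<^bsub>X\<^esub> a \<in> ?Z" if l: "l \<in> carrier K" for l
      proof -
        have "l \<odot>\<^bsub>X\<^esub> a = l \<odot>\<^bsub>X\<^esub> n \<oplus>\<^bsub>X\<^esub> (l \<otimes>\<^bsub>K\<^esub> k) \<odot>\<^bsub>X\<^esub> x"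
          using a c x l by (simp add: X.smult_r_distr X.smult_assoc1)
        then show ?thesis using a EN'(4) l by blast
      qed
      fix b assume "b \<in> ?Z"
      then obtain m j where b: "m \<in> N'" "j \<in> carrier K" "b = m \<oplus>\<^bsub>X\<^esub> j \<odot>\<^bsub>X\<^esub> x" by auto
      have "a \<oplus>\<^bsub>X\<^esub> b = (n \<oplus>\<^bsub>X\<^esub> m) \<oplus>\<^bsub>X\<^esub> (k \<oplus>\<^bsub>K\<^esub> j) \<odot>\<^bsub>X\<^esub> x"
        using a b c x by (simp add: X.smult_l_distr X.a_ac)
      then show "a \<oplus>\<^bsub>X\<^esub> b \<in> ?Z" using a b EN'(5) by blast
    qed
    moreover have sub: "N' \<subseteq> ?Z"
    proof
      fix n assume "n \<in> N'"
      then show "n \<in> ?Z" using x c by (auto intro!: exI[of _ n] exI[of _ "\<zero>\<^bsub>K\<^esub>"])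
    qed
    moreover have xZ: "x \<in> ?Z"
      using x submodule_zero[OF assms(2) N'(1)] by (auto intro!: exI[of _ "\<zero>\<^bsub>X\<^esub>"] exI[of _ "\<one>\<^bsub>K\<^esub>"])
    ultimately have "\<not> N \<inter> ?Z \<subseteq> {\<zero>\<^bsub>X\<^esub>}" using max False by blast
    then obtain n k where nk: "n \<in> N'" "k \<in> carrier K" "n \<oplus>\<^bsub>X\<^esub> k \<odot>\<^bsub>X\<^esub> x \<in> N" "n \<oplus>\<^bsub>X\<^esub> k \<odot>\<^bsub>X\<^esub> x \<noteq> \<zero>\<^bsub>X\<^esub>"
      by auto
    \<comment> \<open>Otherwise the nonzero element would be \<open>n\<close> itself, lying in both
      \<open>N\<close> and \<open>N'\<close>.\<close>
    have "k \<noteq> \<zero>\<^bsub>K\<^esub>"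
    proof
      assume "k = \<zero>\<^bsub>K\<^esub>"
      then have "n \<oplus>\<^bsub>X\<^esub> k \<odot>\<^bsub>X\<^esub> x = n" using nk x c by simp
      then show False using nk N'(2) by auto
    qed
    then have ik: "inv\<^bsub>K\<^esub> k \<in> carrier K" "inv\<^bsub>K\<^esub> k \<otimes>\<^bsub>K\<^esub> k = \<one>\<^bsub>K\<^esub>"
      using nk(2) K.field_Units by auto
    let ?a = "inv\<^bsub>K\<^esub> k \<odot>\<^bsub>X\<^esub> (n \<oplus>\<^bsub>X\<^esub> k \<odot>\<^bsub>X\<^esub> x)" and ?b = "\<ominus>\<^bsub>X\<^esub> (inv\<^bsub>K\<^esub> k \<odot>\<^bsub>X\<^esub> n)"
    have "inv\<^bsub>K\<^esub> k \<odot>\<^bsub>X\<^esub> (k \<odot>\<^bsub>X\<^esub> x) = x"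
      using X.smult_assoc1[OF ik(1) nk(2) x] ik(2) x by simp
    then have "?a \<oplus>\<^bsub>X\<^esub> ?b = (inv\<^bsub>K\<^esub> k \<odot>\<^bsub>X\<^esub> n \<oplus>\<^bsub>X\<^esub> x) \<oplus>\<^bsub>X\<^esub> \<ominus>\<^bsub>X\<^esub> (inv\<^bsub>K\<^esub> k \<odot>\<^bsub>X\<^esub> n)"
      using ik nk x c by (simp add: X.smult_r_distr)
    also have "\<dots> = x" using ik nk x c by (simp add: X.a_ac X.r_neg X.r_neg1 X.r_neg2)
    finally have "x = ?a \<oplus>\<^bsub>X\<^esub> ?b" by simp
    moreover have "?a \<in> N" "?b \<in> N'" using EN(4) EN'(3,4) ik nk by auto
    ultimately show ?thesis by blast
  qed
  then show ?thesis using that N' by blast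
qed

text \<open>The component along a complement. Uniqueness of the decomposition is what makes the
  chosen component linear.\<close>

lemma exists_projection:
  assumes "field K" "module K X" "submodule N K X"
  obtains \<pi> where "\<pi> \<in> lin_maps K X X" "\<And>x. x \<in> carrier X \<Longrightarrow> \<pi> x \<in> N" "\<And>x. x \<in> N \<Longrightarrow> \<pi> x = x"
proof -
  interpret X: module K X by fact
  obtain N' where N': "submodule N' K X" "N \<inter> N' \<subseteq> {\<zero>\<^bsub>X\<^esub>}"
    and dec: "\<And>x. x \<in> carrier X \<Longrightarrow> \<exists>a\<in>N. \<exists>b\<in>N'. x = a \<oplus>\<^bsub>X\<^esub> b"
    by (rule exists_complement[OF assms]) blast
  note EN = X.submoduleE[OF assms(3)]
  note EN' = X.submoduleE[OF N'(1)]
  have c: "a \<in> carrier X" if "a \<in> N \<or> a \<in> N'" for a using EN(1) EN'(1) that by auto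
  define \<pi> where "\<pi> x = (SOME a. a \<in> N \<and> (\<exists>b\<in>N'. x = a \<oplus>\<^bsub>X\<^esub> b))" for x
  have \<pi>: "\<pi> x \<in> N \<and> (\<exists>b\<in>N'. x = \<pi> x \<oplus>\<^bsub>X\<^esub> b)" if "x \<in> carrier X" for x
    unfolding \<pi>_def by (rule someI_ex) (use dec that in blast)
  have uniq: "\<pi> x = a" if ab: "a \<in> N" "b \<in> N'" "x = a \<oplus>\<^bsub>X\<^esub> b" for x a b
  proof -
    have x: "x \<in> carrier X" using ab c by simp
    obtain b' where b': "b' \<in> N'" "x = \<pi> x \<oplus>\<^bsub>X\<^esub> b'" using \<pi>[OF x] by blast
    have p: "\<pi> x \<in> N" using \<pi>[OF x] by blast
    have cc: "\<pi> x \<in> carrier X" "a \<in> carrier X" "b \<in> carrier X" "b' \<in> carrier X"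
      using c p ab b' by blast+
    have "\<pi> x \<ominus>\<^bsub>X\<^esub> a = (\<pi> x \<oplus>\<^bsub>X\<^esub> b') \<oplus>\<^bsub>X\<^esub> (\<ominus>\<^bsub>X\<^esub> b' \<ominus>\<^bsub>X\<^esub> a)"
      using cc by (simp add: a_minus_def X.a_assoc X.r_neg2 X.r_neg1)
    also have "\<dots> = (a \<oplus>\<^bsub>X\<^esub> b) \<oplus>\<^bsub>X\<^esub> (\<ominus>\<^bsub>X\<^esub> b' \<ominus>\<^bsub>X\<^esub> a)" using b' ab by metis
    also have "\<dots> = (b \<oplus>\<^bsub>X\<^esub> a) \<oplus>\<^bsub>X\<^esub> (\<ominus>\<^bsub>X\<^esub> a \<ominus>\<^bsub>X\<^esub> b')"
      using cc X.a_comm by (simp add: a_minus_def)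
    also have "\<dots> = b \<ominus>\<^bsub>X\<^esub> b'"
      using cc by (simp add: a_minus_def X.a_assoc X.r_neg2 X.r_neg1)
    finally have "\<pi> x \<ominus>\<^bsub>X\<^esub> a = b \<ominus>\<^bsub>X\<^esub> b'" .
    moreover have "\<pi> x \<ominus>\<^bsub>X\<^esub> a \<in> N" "b \<ominus>\<^bsub>X\<^esub> b' \<in> N'"
      using p ab b' EN(3,5) EN'(3,5) by (auto simp: a_minus_def)
    ultimately have "\<pi> x \<ominus>\<^bsub>X\<^esub> a = \<zero>\<^bsub>X\<^esub>" using N'(2) by auto
    then show ?thesis using module_diff_eq_zero[OF assms(2)] cc by blast
  qed
  have "\<pi> \<in> lin_maps K X X"
  proof (rule lin_mapsI)
    show "\<pi> x \<in> carrier X" if "x \<in> carrier X" for x using \<pi>[OF that] c by blast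
  next
    fix x y assume xy: "x \<in> carrier X" "y \<in> carrier X"
    obtain b b' where b: "b \<in> N'" "x = \<pi> x \<oplus>\<^bsub>X\<^esub> b" "b' \<in> N'" "y = \<pi> y \<oplus>\<^bsub>X\<^esub> b'"
      using \<pi> xy by blast
    have p: "\<pi> x \<in> N" "\<pi> y \<in> N" using \<pi> xy by auto
    have cc: "\<pi> x \<in> carrier X" "\<pi> y \<in> carrier X" "b \<in> carrier X" "b' \<in> carrier X"
      using c p b by blast+
    have "(\<pi> x \<oplus>\<^bsub>X\<^esub> b) \<oplus>\<^bsub>X\<^esub> (\<pi> y \<oplus>\<^bsub>X\<^esub> b') = (\<pi> x \<oplus>\<^bsub>X\<^esub> \<pi> y) \<oplus>\<^bsub>X\<^esub> (b \<oplus>\<^bsub>X\<^esub> b')"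
      using cc by (simp add: X.a_ac)
    then have "x \<oplus>\<^bsub>X\<^esub> y = (\<pi> x \<oplus>\<^bsub>X\<^esub> \<pi> y) \<oplus>\<^bsub>X\<^esub> (b \<oplus>\<^bsub>X\<^esub> b')" using b by metis
    then show "\<pi> (x \<oplus>\<^bsub>X\<^esub> y) = \<pi> x \<oplus>\<^bsub>X\<^esub> \<pi> y"
      using uniq[OF EN(5)[OF p] EN'(5)[OF b(1,3)]] by blast
  next
    fix k x assume kx: "k \<in> carrier K" "x \<in> carrier X"
    obtain b where b: "b \<in> N'" "x = \<pi> x \<oplus>\<^bsub>X\<^esub> b" using \<pi> kx by blast
    have p: "\<pi> x \<in> N" using \<pi> kx by auto
    have "k \<odot>\<^bsub>X\<^esub> (\<pi> x \<oplus>\<^bsub>X\<^esub> b) = k \<odot>\<^bsub>X\<^esub> \<pi> x \<oplus>\<^bsub>X\<^esub> k \<odot>\<^bsub>X\<^esub> b"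
      using X.smult_r_distr[of k "\<pi> x" b] c p b(1) kx(1) by blast
    then have "k \<odot>\<^bsub>X\<^esub> x = k \<odot>\<^bsub>X\<^esub> \<pi> x \<oplus>\<^bsub>X\<^esub> k \<odot>\<^bsub>X\<^esub> b" using b by metis
    then show "\<pi> (k \<odot>\<^bsub>X\<^esub> x) = k \<odot>\<^bsub>X\<^esub> \<pi> x"
      using uniq[OF EN(4)[OF kx(1) p] EN'(4)[OF kx(1) b(1)]] by blast
  qed
  moreover have "\<pi> x = x" if "x \<in> N" for x
    using uniq[OF that submodule_zero[OF assms(2) N'(1)]] c that by simp
  ultimately show ?thesis using that \<pi> by blast
qed

text \<open>Arbitrary preimages need not add up. Subtracting from each preimage its component in the
  kernel removes the ambiguity: the corrected value depends only on the image point, and does so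
  linearly.\<close>

lemma exists_section:
  assumes "field K" "module K X" "module K Y" "d \<in> lin_maps K X Y"
  obtains \<sigma> where "\<sigma> \<in> lin_maps K (Y\<lparr>carrier := d ` carrier X\<rparr>) X"
    "\<And>y. y \<in> d ` carrier X \<Longrightarrow> d (\<sigma> y) = y"
proof -
  interpret X: module K X by fact
  interpret Y: module K Y by fact
  obtain \<pi> where p: "\<pi> \<in> lin_maps K X X" "\<And>x. x \<in> carrier X \<Longrightarrow> d (\<pi> x) = \<zero>\<^bsub>Y\<^esub>"
    "\<And>x. \<lbrakk>x \<in> carrier X; d x = \<zero>\<^bsub>Y\<^esub>\<rbrakk> \<Longrightarrow> \<pi> x = x"
    by (rule exists_projection[OF assms(1,2) submodule_kernel[OF assms(2-4)]]) blast
  note pc = lin_closed[OF p(1)] and dc = lin_closed[OF assms(4)]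
  define g where "g x = x \<oplus>\<^bsub>X\<^esub> \<pi> (\<ominus>\<^bsub>X\<^esub> x)" for x
  have g: "g \<in> lin_maps K X X" unfolding g_def
    by (intro lin_sum[OF assms(2) lin_id] lin_comp[OF _ p(1)] lin_mapsI)
      (auto simp: X.minus_add X.smult_r_minus)
  have dg: "d (g x) = d x" if "x \<in> carrier X" for x
    using that p(2) by (simp add: g_def lin_add[OF assms(4)] pc dc)
  have g0: "g x = \<zero>\<^bsub>X\<^esub>" if "x \<in> carrier X" "d x = \<zero>\<^bsub>Y\<^esub>" for x
    using that p(3) by (simp add: g_def lin_neg[OF assms(2-4)] X.r_neg)
  have geq: "g x = g y" if xy: "x \<in> carrier X" "y \<in> carrier X" "d x = d y" for x y
  proof -
    have "d (x \<ominus>\<^bsub>X\<^esub> y) = \<zero>\<^bsub>Y\<^esub>" using lin_diff[OF assms(2-4) xy(1,2)] xy dc by (simp add: a_minus_def Y.r_neg)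
    then have "g (x \<ominus>\<^bsub>X\<^esub> y) = \<zero>\<^bsub>X\<^esub>" using g0 xy by simp
    then have "g x \<ominus>\<^bsub>X\<^esub> g y = \<zero>\<^bsub>X\<^esub>" using lin_diff[OF assms(2,2) g] xy by simp
    then show ?thesis using module_diff_eq_zero[OF assms(2)] lin_closed[OF g] xy by blast
  qed
  let ?s = "\<lambda>y. g (inv_into (carrier X) d y)"
  have s: "?s (d x) = g x" if "x \<in> carrier X" for x
    by (rule geq) (use that in \<open>auto intro: inv_into_into f_inv_into_f\<close>)
  have "?s \<in> lin_maps K (Y\<lparr>carrier := d ` carrier X\<rparr>) X"
  proof (rule lin_mapsI)
    fix x y assume "x \<in> carrier (Y\<lparr>carrier := d ` carrier X\<rparr>)" "y \<in> carrier (Y\<lparr>carrier := d ` carrier X\<rparr>)"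
    then obtain a b where ab: "a \<in> carrier X" "x = d a" "b \<in> carrier X" "y = d b" by auto
    have "?s (d a \<oplus>\<^bsub>Y\<^esub> d b) = g (a \<oplus>\<^bsub>X\<^esub> b)" using s[of "a \<oplus>\<^bsub>X\<^esub> b"] lin_add[OF assms(4)] ab by simp
    then show "?s (x \<oplus>\<^bsub>Y\<lparr>carrier := d ` carrier X\<rparr>\<^esub> y) = ?s x \<oplus>\<^bsub>X\<^esub> ?s y"
      using s ab lin_add[OF g] by simp
  next
    fix k x assume "x \<in> carrier (Y\<lparr>carrier := d ` carrier X\<rparr>)" and k: "k \<in> carrier K"
    then obtain a where a: "a \<in> carrier X" "x = d a" by auto
    have "?s (k \<odot>\<^bsub>Y\<^esub> d a) = g (k \<odot>\<^bsub>X\<^esub> a)" using s[of "k \<odot>\<^bsub>X\<^esub> a"] lin_smult[OF assms(4)] a k by simp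
    then show "?s (k \<odot>\<^bsub>Y\<lparr>carrier := d ` carrier X\<rparr>\<^esub> x) = k \<odot>\<^bsub>X\<^esub> ?s x"
      using s a k lin_smult[OF g] by simp
  qed (use s lin_closed[OF g] in auto)
  moreover have "d (?s y) = y" if "y \<in> d ` carrier X" for y using that s dg by auto
  ultimately show ?thesis using that by blast
qed

text \<open>Project onto the line through \<open>y\<close>, then read off the coordinate by a linear
  section of the map sending \<open>c\<close> to the multiple of \<open>y\<close> by
  \<open>c\<close>.\<close>

lemma exists_functional:
  assumes "field K" "module K X" "y \<in> carrier X" "y \<noteq> \<zero>\<^bsub>X\<^esub>"
  obtains \<phi> where "\<phi> \<in> lin_maps K X (self_mod K)" "\<phi> y = \<one>\<^bsub>K\<^esub>"
proof -
  interpret K: field K by fact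
  interpret X: module K X by fact
  note m = self_mod_module[OF K.is_cring]
  let ?d = "\<lambda>c. c \<odot>\<^bsub>X\<^esub> y"
  have d: "?d \<in> lin_maps K (self_mod K) X"
    by (rule lin_mapsI) (use assms(3) in \<open>auto simp: X.smult_l_distr X.smult_assoc1\<close>)
  let ?I = "?d ` carrier (self_mod K)"
  obtain \<sigma> where s: "\<sigma> \<in> lin_maps K (X\<lparr>carrier := ?I\<rparr>) (self_mod K)"
    "\<And>y. y \<in> ?I \<Longrightarrow> ?d (\<sigma> y) = y"
    by (rule exists_section[OF assms(1) m assms(2) d]) blast
  obtain \<pi> where p: "\<pi> \<in> lin_maps K X X" "\<And>x. x \<in> carrier X \<Longrightarrow> \<pi> x \<in> ?I" "\<And>x. x \<in> ?I \<Longrightarrow> \<pi> x = x"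
    by (rule exists_projection[OF assms(1,2) submodule_image[OF m assms(2) d]]) blast
  have yI: "y \<in> ?I" using assms(3) by (intro image_eqI[of _ _ "\<one>\<^bsub>K\<^esub>"]) auto
  have "\<pi> \<in> lin_maps K X (X\<lparr>carrier := ?I\<rparr>)"
    by (rule lin_mapsI) (use p(2) in \<open>auto simp: lin_add[OF p(1)] lin_smult[OF p(1)]\<close>)
  then have f: "(\<lambda>x. \<sigma> (\<pi> x)) \<in> lin_maps K X (self_mod K)" by (rule lin_comp[OF _ s(1)])
  let ?c = "\<sigma> (\<pi> y)"
  have c: "?c \<in> carrier K" using lin_closed[OF f assms(3)] by simp
  have cy: "?c \<odot>\<^bsub>X\<^esub> y = y" using s(2)[OF yI] p(3)[OF yI] by simp
  \<comment> \<open>The section only gives that \<open>?c\<close> times \<open>y\<close> is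
    \<open>y\<close>; were \<open>?c\<close> different from one, dividing by the difference would
    force \<open>y\<close> to vanish.\<close>
  have "?c = \<one>\<^bsub>K\<^esub>"
  proof (rule ccontr)
    assume "?c \<noteq> \<one>\<^bsub>K\<^esub>"
    then have n: "?c \<ominus>\<^bsub>K\<^esub> \<one>\<^bsub>K\<^esub> \<noteq> \<zero>\<^bsub>K\<^esub>"
      using c K.minus_equality[of ?c "\<ominus>\<^bsub>K\<^esub> \<one>\<^bsub>K\<^esub>"] by (auto simp: a_minus_def)
    let ?e = "?c \<ominus>\<^bsub>K\<^esub> \<one>\<^bsub>K\<^esub>"
    have e: "?e \<in> carrier K" "inv\<^bsub>K\<^esub> ?e \<in> carrier K" "inv\<^bsub>K\<^esub> ?e \<otimes>\<^bsub>K\<^esub> ?e = \<one>\<^bsub>K\<^esub>"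
      using n c K.field_Units by auto
    have "?e \<odot>\<^bsub>X\<^esub> y = \<zero>\<^bsub>X\<^esub>"
      using c cy assms(3) by (simp add: a_minus_def X.smult_l_distr X.smult_l_minus X.r_neg)
    then have "(inv\<^bsub>K\<^esub> ?e \<otimes>\<^bsub>K\<^esub> ?e) \<odot>\<^bsub>X\<^esub> y = \<zero>\<^bsub>X\<^esub>"
      using X.smult_assoc1[OF e(2,1) assms(3)] e by simp
    then show False using e assms(3,4) by simp
  qed
  then show ?thesis using that f by blast
qed

section \<open>Free modules and tensor products\<close>

lemma free_module_simps:
  "zero (free_module K S) = (\<lambda>s. \<zero>\<^bsub>K\<^esub>)" "add (free_module K S) = (\<lambda>f g s. f s \<oplus>\<^bsub>K\<^esub> g s)"
  "smult (free_module K S) = (\<lambda>c f s. c \<otimes>\<^bsub>K\<^esub> f s)"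
  by (auto simp: free_module_def)

lemma free_carrier_iff: "f \<in> carrier (free_module K S) \<longleftrightarrow> (\<forall>s\<in>S. f s \<in> carrier K) \<and>
    (\<forall>s. s \<notin> S \<longrightarrow> f s = \<zero>\<^bsub>K\<^esub>) \<and> finite {s. f s \<noteq> \<zero>\<^bsub>K\<^esub>}"
  by (auto simp: free_module_def)

lemma free_in_K: "\<lbrakk>cring K; f \<in> carrier (free_module K S)\<rbrakk> \<Longrightarrow> f s \<in> carrier K"
  by (cases "s \<in> S") (auto simp: free_carrier_iff cring_def ring_def abelian_group_def
      intro: abelian_monoid.zero_closed)

lemma free_module_module:
  assumes "cring K"
  shows "module K (free_module K S)"
proof -
  interpret K: cring K by fact
  note fK = free_in_K[OF assms]
  have add: "(\<lambda>s. f s \<oplus>\<^bsub>K\<^esub> g s) \<in> carrier (free_module K S)"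
    if "f \<in> carrier (free_module K S)" "g \<in> carrier (free_module K S)" for f g
  proof -
    have "{s. f s \<oplus>\<^bsub>K\<^esub> g s \<noteq> \<zero>\<^bsub>K\<^esub>} \<subseteq> {s. f s \<noteq> \<zero>\<^bsub>K\<^esub>} \<union> {s. g s \<noteq> \<zero>\<^bsub>K\<^esub>}" by auto
    then show ?thesis using that by (auto simp: free_carrier_iff intro: finite_subset)
  qed
  have sm: "(\<lambda>s. c \<otimes>\<^bsub>K\<^esub> f s) \<in> carrier (free_module K S)"
    if "f \<in> carrier (free_module K S)" "c \<in> carrier K" for f c
  proof -
    have "{s. c \<otimes>\<^bsub>K\<^esub> f s \<noteq> \<zero>\<^bsub>K\<^esub>} \<subseteq> {s. f s \<noteq> \<zero>\<^bsub>K\<^esub>}" using that by auto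
    then show ?thesis using that by (auto simp: free_carrier_iff intro: finite_subset)
  qed
  show ?thesis
  proof (rule moduleI)
    show "abelian_group (free_module K S)"
    proof (rule abelian_groupI)
      show "\<zero>\<^bsub>free_module K S\<^esub> \<in> carrier (free_module K S)"
        by (auto simp: free_carrier_iff free_module_simps)
      show "\<exists>g\<in>carrier (free_module K S). g \<oplus>\<^bsub>free_module K S\<^esub> f = \<zero>\<^bsub>free_module K S\<^esub>"
        if "f \<in> carrier (free_module K S)" for f
      proof (rule bexI)
        show "(\<lambda>s. \<ominus>\<^bsub>K\<^esub> \<one>\<^bsub>K\<^esub> \<otimes>\<^bsub>K\<^esub> f s) \<oplus>\<^bsub>free_module K S\<^esub> f = \<zero>\<^bsub>free_module K S\<^esub>"
          using fK[OF that] by (simp add: free_module_simps K.l_minus K.l_neg)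
      qed (rule sm[OF that K.a_inv_closed[OF K.one_closed]])
      show "f \<oplus>\<^bsub>free_module K S\<^esub> g = g \<oplus>\<^bsub>free_module K S\<^esub> f"
        if "f \<in> carrier (free_module K S)" "g \<in> carrier (free_module K S)" for f g
        using fK[OF that(1)] fK[OF that(2)] K.a_comm by (simp add: free_module_simps)
    qed (simp_all add: free_module_simps add fK K.a_assoc)
  qed (simp_all add: free_module_simps assms sm fK K.l_distr K.r_distr K.m_assoc)
qed

lemma single_closed:
  assumes "cring K" "s \<in> S"
  shows "single K s \<in> carrier (free_module K S)"
proof -
  interpret K: cring K by fact
  have "{t. single K s t \<noteq> \<zero>\<^bsub>K\<^esub>} \<subseteq> {s}" by (auto simp: single_def)
  then show ?thesis using assms(2)
    by (auto simp: free_carrier_iff single_def intro: finite_subset)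
qed

lemma free_module_mono:
  assumes "cring K" "S \<subseteq> S'"
  shows "carrier (free_module K S) \<subseteq> carrier (free_module K S')"
  using free_in_K[OF assms(1)] assms(2) by (fastforce simp: free_carrier_iff)

lemma free_module_induct [consumes 2, case_names zero step]:
  assumes K: "cring K" and f: "f \<in> carrier (free_module K S)"
    and zero: "Q (\<lambda>s. \<zero>\<^bsub>K\<^esub>)"
    and step: "\<And>f c s. \<lbrakk>f \<in> carrier (free_module K S); Q f; c \<in> carrier K; s \<in> S\<rbrakk> \<Longrightarrow>
      Q (c \<odot>\<^bsub>free_module K S\<^esub> single K s \<oplus>\<^bsub>free_module K S\<^esub> f)"
  shows "Q f"
proof -
  interpret K: cring K by fact
  interpret F: module K "free_module K S" by (rule free_module_module[OF K])
  have "finite {s. f s \<noteq> \<zero>\<^bsub>K\<^esub>}" using f by (simp add: free_carrier_iff)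
  then show ?thesis using f
  proof (induction "{s. f s \<noteq> \<zero>\<^bsub>K\<^esub>}" arbitrary: f rule: finite_induct)
    case empty
    then have "f = (\<lambda>s. \<zero>\<^bsub>K\<^esub>)" by auto
    then show ?case using zero by simp
  next
    case (insert s B)
    let ?g = "f(s := \<zero>\<^bsub>K\<^esub>)"
    have s: "f s \<noteq> \<zero>\<^bsub>K\<^esub>" "s \<in> S" using insert by (auto simp: free_carrier_iff)
    have B: "B = {t. ?g t \<noteq> \<zero>\<^bsub>K\<^esub>}" using insert by auto
    have g: "?g \<in> carrier (free_module K S)"
      using insert(1) B insert(5) by (auto simp: free_carrier_iff)
    have "f = f s \<odot>\<^bsub>free_module K S\<^esub> single K s \<oplus>\<^bsub>free_module K S\<^esub> ?g"
      using free_in_K[OF K insert(5)] by (auto simp: single_def free_module_simps)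
    moreover have "Q (f s \<odot>\<^bsub>free_module K S\<^esub> single K s \<oplus>\<^bsub>free_module K S\<^esub> ?g)"
      by (rule step) (use g insert(3)[OF B g] s free_in_K[OF K insert(5)] in auto)
    ultimately show ?case by simp
  qed
qed

text \<open>\<open>lin_ext\<close> sums over the support, which changes under addition and scaling;
  summing over a common larger finite set makes different elements comparable.\<close>

lemma lin_ext_superset:
  assumes "cring K" "module K Z" "\<phi> \<in> S \<rightarrow> carrier Z" "f \<in> carrier (free_module K S)"
    "finite U" "{s. f s \<noteq> \<zero>\<^bsub>K\<^esub>} \<subseteq> U" "U \<subseteq> S"
  shows "lin_ext K Z \<phi> f = (\<Oplus>\<^bsub>Z\<^esub>s\<in>U. f s \<odot>\<^bsub>Z\<^esub> \<phi> s)"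
proof -
  interpret Z: module K Z by fact
  show ?thesis unfolding lin_ext_def
    by (rule Z.add.finprod_mono_neutral_cong_left)
      (use assms free_in_K[OF assms(1,4)] in \<open>auto simp: Pi_iff subset_iff\<close>)
qed

lemma lin_ext_lin:
  assumes "cring K" "module K Z" "\<phi> \<in> S \<rightarrow> carrier Z"
  shows "lin_ext K Z \<phi> \<in> lin_maps K (free_module K S) Z"
proof (rule lin_mapsI)
  interpret K: cring K by fact
  interpret Z: module K Z by fact
  interpret F: module K "free_module K S" by (rule free_module_module[OF assms(1)])
  note ext = lin_ext_superset[OF assms]
  note fK = free_in_K[OF assms(1)]
  fix f assume f: "f \<in> carrier (free_module K S)"
  let ?U = "{s. f s \<noteq> \<zero>\<^bsub>K\<^esub>}"
  have U: "finite ?U" "?U \<subseteq> S" using f by (auto simp: free_carrier_iff)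
  show "lin_ext K Z \<phi> f \<in> carrier Z" unfolding lin_ext_def
    by (rule Z.finsum_closed) (use fK[OF f] assms(3) U in auto)
  show "lin_ext K Z \<phi> (c \<odot>\<^bsub>free_module K S\<^esub> f) = c \<odot>\<^bsub>Z\<^esub> lin_ext K Z \<phi> f" if c: "c \<in> carrier K" for c
  proof -
    have "lin_ext K Z \<phi> (c \<odot>\<^bsub>free_module K S\<^esub> f) = (\<Oplus>\<^bsub>Z\<^esub>s\<in>?U. (c \<otimes>\<^bsub>K\<^esub> f s) \<odot>\<^bsub>Z\<^esub> \<phi> s)"
      using F.smult_closed[OF c f] U c by (subst ext[of _ ?U]) (auto simp: free_module_simps)
    also have "\<dots> = (\<Oplus>\<^bsub>Z\<^esub>s\<in>?U. c \<odot>\<^bsub>Z\<^esub> (f s \<odot>\<^bsub>Z\<^esub> \<phi> s))"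
      by (rule Z.finsum_cong') (use fK[OF f] c assms(3) U(2) in \<open>auto simp: Z.smult_assoc1 Pi_iff subset_iff\<close>)
    also have "\<dots> = c \<odot>\<^bsub>Z\<^esub> (\<Oplus>\<^bsub>Z\<^esub>s\<in>?U. f s \<odot>\<^bsub>Z\<^esub> \<phi> s)"
      by (rule Z.finsum_smult_ldistr[symmetric]) (use fK[OF f] c assms(3) U in auto)
    finally show ?thesis by (simp add: lin_ext_def)
  qed
  fix g assume g: "g \<in> carrier (free_module K S)"
  let ?V = "?U \<union> {s. g s \<noteq> \<zero>\<^bsub>K\<^esub>}"
  have V: "finite ?V" "?V \<subseteq> S" using f g by (auto simp: free_carrier_iff)
  have "lin_ext K Z \<phi> (f \<oplus>\<^bsub>free_module K S\<^esub> g) = (\<Oplus>\<^bsub>Z\<^esub>s\<in>?V. (f s \<oplus>\<^bsub>K\<^esub> g s) \<odot>\<^bsub>Z\<^esub> \<phi> s)"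
    using F.a_closed[OF f g] V by (subst ext[of _ ?V]) (auto simp: free_module_simps)
  also have "\<dots> = (\<Oplus>\<^bsub>Z\<^esub>s\<in>?V. f s \<odot>\<^bsub>Z\<^esub> \<phi> s \<oplus>\<^bsub>Z\<^esub> g s \<odot>\<^bsub>Z\<^esub> \<phi> s)"
    by (rule Z.finsum_cong') (use fK[OF f] fK[OF g] assms(3) V(2) in \<open>auto simp: Z.smult_l_distr Pi_iff subset_iff\<close>)
  also have "\<dots> = (\<Oplus>\<^bsub>Z\<^esub>s\<in>?V. f s \<odot>\<^bsub>Z\<^esub> \<phi> s) \<oplus>\<^bsub>Z\<^esub> (\<Oplus>\<^bsub>Z\<^esub>s\<in>?V. g s \<odot>\<^bsub>Z\<^esub> \<phi> s)"
    by (rule Z.finsum_addf) (use fK[OF f] fK[OF g] assms(3) V(2) in \<open>auto simp: Pi_iff subset_iff\<close>)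
  also have "(\<Oplus>\<^bsub>Z\<^esub>s\<in>?V. f s \<odot>\<^bsub>Z\<^esub> \<phi> s) = lin_ext K Z \<phi> f"
    by (rule ext[OF f V(1) _ V(2), symmetric]) auto
  also have "(\<Oplus>\<^bsub>Z\<^esub>s\<in>?V. g s \<odot>\<^bsub>Z\<^esub> \<phi> s) = lin_ext K Z \<phi> g"
    by (rule ext[OF g V(1) _ V(2), symmetric]) auto
  finally show "lin_ext K Z \<phi> (f \<oplus>\<^bsub>free_module K S\<^esub> g) = lin_ext K Z \<phi> f \<oplus>\<^bsub>Z\<^esub> lin_ext K Z \<phi> g" .
qed

lemma lin_ext_single:
  assumes "cring K" "module K Z" "\<phi> \<in> S \<rightarrow> carrier Z" "s \<in> S"
  shows "lin_ext K Z \<phi> (single K s) = \<phi> s"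
proof -
  interpret Z: module K Z by fact
  have "lin_ext K Z \<phi> (single K s) = (\<Oplus>\<^bsub>Z\<^esub>t\<in>{s}. single K s t \<odot>\<^bsub>Z\<^esub> \<phi> t)"
    by (rule lin_ext_superset[OF assms(1-3) single_closed[OF assms(1,4)]])
      (use assms(4) in \<open>auto simp: single_def\<close>)
  moreover have "\<phi> s \<in> carrier Z" using assms by auto
  ultimately show ?thesis using Z.finsum_singleton[of s "{s}" "\<lambda>t. single K s t \<odot>\<^bsub>Z\<^esub> \<phi> t"]
    by (simp add: single_def)
qed

lemma free_module_eqI:
  assumes "cring K" "module K Z" "g \<in> lin_maps K (free_module K S) Z"
    "h \<in> lin_maps K (free_module K S) Z" "\<And>s. s \<in> S \<Longrightarrow> g (single K s) = h (single K s)"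
    "f \<in> carrier (free_module K S)"
  shows "g f = h f"
  using assms(1,6)
proof (induction rule: free_module_induct)
  case zero
  note F = free_module_module[OF assms(1), of S]
  show ?case using lin_zero[OF F assms(2,3)] lin_zero[OF F assms(2,4)] by (simp add: free_module_simps)
next
  case (step f c s)
  note F = free_module_module[OF assms(1), of S]
  have c: "c \<odot>\<^bsub>free_module K S\<^esub> single K s \<in> carrier (free_module K S)"
    by (rule module.smult_closed[OF F step(2) single_closed[OF assms(1) step(3)]])
  show ?case
    unfolding lin_add[OF assms(3) c step(1)] lin_add[OF assms(4) c step(1)]
      lin_smult[OF assms(3) step(2) single_closed[OF assms(1) step(3)]]
      lin_smult[OF assms(4) step(2) single_closed[OF assms(1) step(3)]]
    using step assms(5) by simp
qed

section \<open>Bilinear maps and balanced tensor products\<close>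

definition bilin :: "'k ring \<Rightarrow> ('k, 'x, 'e) module_scheme \<Rightarrow> ('k, 'y, 'f) module_scheme \<Rightarrow>
    ('k, 'z, 'g) module_scheme \<Rightarrow> ('x \<Rightarrow> 'y \<Rightarrow> 'z) \<Rightarrow> bool" where
  "bilin K X Y Z \<phi> \<longleftrightarrow> (\<forall>x\<in>carrier X. \<phi> x \<in> lin_maps K Y Z) \<and>
     (\<forall>y\<in>carrier Y. (\<lambda>x. \<phi> x y) \<in> lin_maps K X Z)"

lemma bilinI: "\<lbrakk>\<And>x. x \<in> carrier X \<Longrightarrow> (\<lambda>y. \<phi> x y) \<in> lin_maps K Y Z;
    \<And>y. y \<in> carrier Y \<Longrightarrow> (\<lambda>x. \<phi> x y) \<in> lin_maps K X Z\<rbrakk> \<Longrightarrow> bilin K X Y Z \<phi>"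
  by (simp add: bilin_def)

lemma bilin_l: "\<lbrakk>bilin K X Y Z \<phi>; y \<in> carrier Y\<rbrakk> \<Longrightarrow> (\<lambda>x. \<phi> x y) \<in> lin_maps K X Z"
  and bilin_r: "\<lbrakk>bilin K X Y Z \<phi>; x \<in> carrier X\<rbrakk> \<Longrightarrow> (\<lambda>y. \<phi> x y) \<in> lin_maps K Y Z"
  by (auto simp: bilin_def)

lemma bilin_closed: "\<lbrakk>bilin K X Y Z \<phi>; x \<in> carrier X; y \<in> carrier Y\<rbrakk> \<Longrightarrow> \<phi> x y \<in> carrier Z"
  using bilin_r lin_closed by metis

text \<open>Tensor products over \<open>K\<close>, over \<open>A\<close> and over the enveloping
  algebra differ only in the set \<open>S\<close> of balancing operators, so all three are treated
  at once.\<close>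

locale balancing =
  fixes K :: "'k ring" and X :: "('k, 'x, 'e) module_scheme" and Y :: "('k, 'y, 'f) module_scheme"
    and S :: "'s set" and ra :: "'x \<Rightarrow> 's \<Rightarrow> 'x" and la :: "'s \<Rightarrow> 'y \<Rightarrow> 'y"
  assumes X: "module K X" and Y: "module K Y"
    and ra: "\<lbrakk>x \<in> carrier X; s \<in> S\<rbrakk> \<Longrightarrow> ra x s \<in> carrier X"
    and la: "\<lbrakk>y \<in> carrier Y; s \<in> S\<rbrakk> \<Longrightarrow> la s y \<in> carrier Y"
begin

abbreviation "FXY \<equiv> free_module K (carrier X \<times> carrier Y)"
abbreviation "NXY \<equiv> span_of K FXY (tensor_rels K X Y S ra la)"
abbreviation "TXY \<equiv> balanced_tensor K X Y S ra la"

sublocale X: module K X by (rule X)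
sublocale Y: module K Y by (rule Y)

lemma K: "cring K" by (rule X.R.is_cring)

lemma F: "module K FXY" by (rule free_module_module[OF K])

sublocale F: module K FXY by (rule F)

lemma sc: "\<lbrakk>x \<in> carrier X; y \<in> carrier Y\<rbrakk> \<Longrightarrow> single K (x, y) \<in> carrier FXY"
  by (rule single_closed[OF K]) auto

lemma rels_closed: "tensor_rels K X Y S ra la \<subseteq> carrier FXY"
  unfolding tensor_rels_def Let_def
  by (intro Un_least subsetI; clarify) (intro F.minus_closed F.a_closed F.smult_closed sc; simp add: ra la)+

lemma N: "submodule NXY K FXY" by (rule span_of_submodule[OF F rels_closed])

lemma T_def: "TXY = quot FXY NXY" by (simp add: balanced_tensor_def Let_def)

lemma T: "module K TXY" unfolding T_def by (rule quot_module[OF F N])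

sublocale T: module K TXY by (rule T)

text \<open>Cosets partition the free module, so the definite description in \<open>pure\<close>
  picks the coset of the generator. Only the carrier of \<open>T'\<close> matters, which lets the
  bimodule record \<open>tensor_A\<close> reuse the result.\<close>

lemma pure_eq:
  assumes "carrier T' = carrier TXY" "x \<in> carrier X" "y \<in> carrier Y"
  shows "pure K T' x y = NXY +>\<^bsub>FXY\<^esub> single K (x, y)"
  unfolding pure_def
proof (rule the_equality)
  note s = sc[OF assms(2,3)]
  show "NXY +>\<^bsub>FXY\<^esub> single K (x, y) \<in> carrier T' \<and> single K (x, y) \<in> NXY +>\<^bsub>FXY\<^esub> single K (x, y)"
    using s coset_mem_iff[OF F N s] assms(1) by (simp add: T_def quot_simps(1))
  show "t = NXY +>\<^bsub>FXY\<^esub> single K (x, y)" if "t \<in> carrier T' \<and> single K (x, y) \<in> t" for t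
    using that coset_mem_iff[OF F N] assms(1) by (auto simp: T_def quot_simps(1))
qed

lemma rel_eq:
  assumes "a \<ominus>\<^bsub>FXY\<^esub> b \<in> tensor_rels K X Y S ra la" "a \<in> carrier FXY" "b \<in> carrier FXY"
  shows "NXY +>\<^bsub>FXY\<^esub> a = NXY +>\<^bsub>FXY\<^esub> b"
  using coset_eq_iff[OF F N assms(2,3)] span_of_base[OF assms(1)] by simp

lemma proj: "(\<lambda>f. NXY +>\<^bsub>FXY\<^esub> f) \<in> lin_maps K FXY TXY"
  unfolding T_def by (rule quot_proj[OF F N])

lemma tensor_relsI:
  "\<lbrakk>x \<in> carrier X; x' \<in> carrier X; y \<in> carrier Y\<rbrakk> \<Longrightarrow>
    single K (x \<oplus>\<^bsub>X\<^esub> x', y) \<ominus>\<^bsub>FXY\<^esub> (single K (x, y) \<oplus>\<^bsub>FXY\<^esub> single K (x', y)) \<in> tensor_rels K X Y S ra la"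
  "\<lbrakk>x \<in> carrier X; y \<in> carrier Y; y' \<in> carrier Y\<rbrakk> \<Longrightarrow>
    single K (x, y \<oplus>\<^bsub>Y\<^esub> y') \<ominus>\<^bsub>FXY\<^esub> (single K (x, y) \<oplus>\<^bsub>FXY\<^esub> single K (x, y')) \<in> tensor_rels K X Y S ra la"
  "\<lbrakk>c \<in> carrier K; x \<in> carrier X; y \<in> carrier Y\<rbrakk> \<Longrightarrow>
    single K (c \<odot>\<^bsub>X\<^esub> x, y) \<ominus>\<^bsub>FXY\<^esub> c \<odot>\<^bsub>FXY\<^esub> single K (x, y) \<in> tensor_rels K X Y S ra la"
  "\<lbrakk>c \<in> carrier K; x \<in> carrier X; y \<in> carrier Y\<rbrakk> \<Longrightarrow>
    single K (x, c \<odot>\<^bsub>Y\<^esub> y) \<ominus>\<^bsub>FXY\<^esub> c \<odot>\<^bsub>FXY\<^esub> single K (x, y) \<in> tensor_rels K X Y S ra la"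
  "\<lbrakk>x \<in> carrier X; s \<in> S; y \<in> carrier Y\<rbrakk> \<Longrightarrow>
    single K (ra x s, y) \<ominus>\<^bsub>FXY\<^esub> single K (x, la s y) \<in> tensor_rels K X Y S ra la"
  unfolding tensor_rels_def Let_def by blast+

lemma pure_bilin: "bilin K X Y TXY (pure K TXY)"
proof (rule bilinI; rule lin_mapsI)
  note pe = pure_eq[of TXY, OF refl]
  note pa = lin_add[OF proj, symmetric] and ps = lin_smult[OF proj, symmetric]
  fix x y assume xy: "x \<in> carrier X" "y \<in> carrier Y"
  show "pure K TXY x y \<in> carrier TXY" "pure K TXY x y \<in> carrier TXY"
    using lin_closed[OF proj sc[OF xy]] by (simp_all add: pe xy)
  {
    fix y' assume y': "y' \<in> carrier Y"
    have "NXY +>\<^bsub>FXY\<^esub> single K (x, y \<oplus>\<^bsub>Y\<^esub> y') = NXY +>\<^bsub>FXY\<^esub> (single K (x, y) \<oplus>\<^bsub>FXY\<^esub> single K (x, y'))"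
      by (rule rel_eq[OF tensor_relsI(2)]) (intro xy y' F.a_closed sc X.a_closed Y.a_closed F.smult_closed X.smult_closed Y.smult_closed ra la)+
    then show "pure K TXY x (y \<oplus>\<^bsub>Y\<^esub> y') = pure K TXY x y \<oplus>\<^bsub>TXY\<^esub> pure K TXY x y'"
      using xy y' pe pa sc by simp
  next
    fix x' assume x': "x' \<in> carrier X"
    have "NXY +>\<^bsub>FXY\<^esub> single K (x \<oplus>\<^bsub>X\<^esub> x', y) = NXY +>\<^bsub>FXY\<^esub> (single K (x, y) \<oplus>\<^bsub>FXY\<^esub> single K (x', y))"
      by (rule rel_eq[OF tensor_relsI(1)]) (intro xy x' F.a_closed sc X.a_closed Y.a_closed F.smult_closed X.smult_closed Y.smult_closed ra la)+
    then show "pure K TXY (x \<oplus>\<^bsub>X\<^esub> x') y = pure K TXY x y \<oplus>\<^bsub>TXY\<^esub> pure K TXY x' y"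
      using xy x' pe pa sc by simp
  next
    fix c assume c: "c \<in> carrier K"
    have "NXY +>\<^bsub>FXY\<^esub> single K (x, c \<odot>\<^bsub>Y\<^esub> y) = NXY +>\<^bsub>FXY\<^esub> (c \<odot>\<^bsub>FXY\<^esub> single K (x, y))"
      by (rule rel_eq[OF tensor_relsI(4)]) (intro xy c F.a_closed sc X.a_closed Y.a_closed F.smult_closed X.smult_closed Y.smult_closed ra la)+
    then show "pure K TXY x (c \<odot>\<^bsub>Y\<^esub> y) = c \<odot>\<^bsub>TXY\<^esub> pure K TXY x y"
      using xy c pe ps sc by simp
    have "NXY +>\<^bsub>FXY\<^esub> single K (c \<odot>\<^bsub>X\<^esub> x, y) = NXY +>\<^bsub>FXY\<^esub> (c \<odot>\<^bsub>FXY\<^esub> single K (x, y))"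
      by (rule rel_eq[OF tensor_relsI(3)]) (intro xy c F.a_closed sc X.a_closed Y.a_closed F.smult_closed X.smult_closed Y.smult_closed ra la)+
    then show "pure K TXY (c \<odot>\<^bsub>X\<^esub> x) y = c \<odot>\<^bsub>TXY\<^esub> pure K TXY x y"
      using xy c pe ps sc by simp
  }
qed

lemma pure_balanced:
  assumes "x \<in> carrier X" "s \<in> S" "y \<in> carrier Y"
  shows "pure K TXY (ra x s) y = pure K TXY x (la s y)"
proof -
  have "NXY +>\<^bsub>FXY\<^esub> single K (ra x s, y) = NXY +>\<^bsub>FXY\<^esub> single K (x, la s y)"
    by (rule rel_eq[OF tensor_relsI(5)]) (intro assms F.a_closed sc X.a_closed Y.a_closed F.smult_closed X.smult_closed Y.smult_closed ra la)+
  then show ?thesis using assms ra la by (simp add: pure_eq[OF refl])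
qed

lemma pure_cong:
  "\<lbrakk>carrier T' = carrier TXY; x \<in> carrier X; y \<in> carrier Y\<rbrakk> \<Longrightarrow> pure K T' x y = pure K TXY x y"
  by (simp add: pure_eq)

text \<open>Scalars are absorbed into the left factor, so sums of pure tensors already exhaust the
  product.\<close>

lemma tensor_induct [consumes 1, case_names pure add]:
  assumes "t \<in> carrier TXY"
    and pure: "\<And>x y. \<lbrakk>x \<in> carrier X; y \<in> carrier Y\<rbrakk> \<Longrightarrow> Q (pure K TXY x y)"
    and add: "\<And>t u. \<lbrakk>t \<in> carrier TXY; u \<in> carrier TXY; Q t; Q u\<rbrakk> \<Longrightarrow> Q (t \<oplus>\<^bsub>TXY\<^esub> u)"
  shows "Q t"
proof -
  obtain f where f: "f \<in> carrier FXY" "t = NXY +>\<^bsub>FXY\<^esub> f"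
    using assms(1) by (auto simp: T_def quot_simps(1))
  have "Q (NXY +>\<^bsub>FXY\<^esub> f)" using K f(1)
  proof (induction rule: free_module_induct)
    case zero
    have "Q (pure K TXY \<zero>\<^bsub>X\<^esub> \<zero>\<^bsub>Y\<^esub>)" by (rule pure) auto
    moreover have "pure K TXY \<zero>\<^bsub>X\<^esub> \<zero>\<^bsub>Y\<^esub> = \<zero>\<^bsub>TXY\<^esub>"
      using lin_zero[OF Y T bilin_r[OF pure_bilin]] by simp
    moreover have "NXY +>\<^bsub>FXY\<^esub> \<zero>\<^bsub>FXY\<^esub> = \<zero>\<^bsub>TXY\<^esub>" by (rule lin_zero[OF F T proj])
    ultimately show ?case by (simp add: free_module_simps)
  next
    case (step f c s)
    obtain x y where s: "s = (x, y)" "x \<in> carrier X" "y \<in> carrier Y" using step by auto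
    have cs: "c \<odot>\<^bsub>FXY\<^esub> single K s \<in> carrier FXY"
      using F.smult_closed[OF step(2) sc[OF s(2,3)]] s by simp
    have "NXY +>\<^bsub>FXY\<^esub> (c \<odot>\<^bsub>FXY\<^esub> single K s \<oplus>\<^bsub>FXY\<^esub> f) = pure K TXY (c \<odot>\<^bsub>X\<^esub> x) y \<oplus>\<^bsub>TXY\<^esub> (NXY +>\<^bsub>FXY\<^esub> f)"
      using s lin_add[OF proj cs step(1)] lin_smult[OF proj step(2) sc[OF s(2,3)]] step(2)
        lin_smult[OF bilin_l[OF pure_bilin s(3)] step(2) s(2)]
      by (simp add: pure_eq[OF refl])
    moreover have "NXY +>\<^bsub>FXY\<^esub> f \<in> carrier TXY" using lin_closed[OF proj step(1)] .
    moreover have "pure K TXY (c \<odot>\<^bsub>X\<^esub> x) y \<in> carrier TXY"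
      using bilin_closed[OF pure_bilin] s step(2) by simp
    ultimately show ?case using add pure s step by simp
  qed
  then show ?thesis using f by simp
qed

lemma tensor_eqI:
  assumes "t \<in> carrier TXY" "g \<in> lin_maps K TXY Z" "h \<in> lin_maps K TXY Z"
    "\<And>x y. \<lbrakk>x \<in> carrier X; y \<in> carrier Y\<rbrakk> \<Longrightarrow> g (pure K TXY x y) = h (pure K TXY x y)"
  shows "g t = h t"
  using assms(1) by (induction rule: tensor_induct) (auto simp: assms(4) lin_add[OF assms(2)] lin_add[OF assms(3)])

lemma
  assumes Z: "module K Z" and \<phi>: "bilin K X Y Z \<phi>"
    and bal: "\<And>x s y. \<lbrakk>x \<in> carrier X; s \<in> S; y \<in> carrier Y\<rbrakk> \<Longrightarrow> \<phi> (ra x s) y = \<phi> x (la s y)"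
  shows tensor_lift_lin: "tensor_lift K Z \<phi> \<in> lin_maps K TXY Z"
    and tensor_lift_pure: "\<lbrakk>x \<in> carrier X; y \<in> carrier Y\<rbrakk> \<Longrightarrow> tensor_lift K Z \<phi> (pure K TXY x y) = \<phi> x y"
proof -
  interpret Z: module K Z by (rule Z)
  let ?h = "lin_ext K Z (\<lambda>(x, y). \<phi> x y)"
  have p: "(\<lambda>(x, y). \<phi> x y) \<in> carrier X \<times> carrier Y \<rightarrow> carrier Z"
    using bilin_closed[OF \<phi>] by auto
  note h = lin_ext_lin[OF K Z p]
  have hs: "?h (single K (x, y)) = \<phi> x y" if "x \<in> carrier X" "y \<in> carrier Y" for x y
    using lin_ext_single[OF K Z p, of "(x, y)"] that by simp
  have hd: "?h (a \<ominus>\<^bsub>FXY\<^esub> b) = \<zero>\<^bsub>Z\<^esub>" if "a \<in> carrier FXY" "b \<in> carrier FXY" "?h a = ?h b" for a b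
    using lin_diff[OF F Z h that(1,2)] that(3) lin_closed[OF h that(2)] by (simp add: a_minus_def Z.r_neg)
  note ha = lin_add[OF h sc sc] and hc = lin_smult[OF h _ sc]
  \<comment> \<open>The linear extension to the free module has to kill each of the five families of
    relations; bilinearity handles four of them and \<open>bal\<close> the last.\<close>
  have rels: "?h r = \<zero>\<^bsub>Z\<^esub>" if "r \<in> tensor_rels K X Y S ra la" for r
  proof -
    have 1: "?h (single K (x \<oplus>\<^bsub>X\<^esub> x', y) \<ominus>\<^bsub>FXY\<^esub> (single K (x, y) \<oplus>\<^bsub>FXY\<^esub> single K (x', y))) = \<zero>\<^bsub>Z\<^esub>"
      if "x \<in> carrier X" "x' \<in> carrier X" "y \<in> carrier Y" for x x' y
      by (intro hd F.a_closed sc) (use that in \<open>simp_all add: ha hs lin_add[OF bilin_l[OF \<phi>]]\<close>)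
    have 2: "?h (single K (x, y \<oplus>\<^bsub>Y\<^esub> y') \<ominus>\<^bsub>FXY\<^esub> (single K (x, y) \<oplus>\<^bsub>FXY\<^esub> single K (x, y'))) = \<zero>\<^bsub>Z\<^esub>"
      if "x \<in> carrier X" "y \<in> carrier Y" "y' \<in> carrier Y" for x y y'
      by (intro hd F.a_closed sc) (use that in \<open>simp_all add: ha hs lin_add[OF bilin_r[OF \<phi>]]\<close>)
    have 3: "?h (single K (c \<odot>\<^bsub>X\<^esub> x, y) \<ominus>\<^bsub>FXY\<^esub> c \<odot>\<^bsub>FXY\<^esub> single K (x, y)) = \<zero>\<^bsub>Z\<^esub>"
      "?h (single K (x, c \<odot>\<^bsub>Y\<^esub> y) \<ominus>\<^bsub>FXY\<^esub> c \<odot>\<^bsub>FXY\<^esub> single K (x, y)) = \<zero>\<^bsub>Z\<^esub>"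
      if "c \<in> carrier K" "x \<in> carrier X" "y \<in> carrier Y" for c x y
      by (intro hd F.smult_closed sc; use that in \<open>simp add: hc hs lin_smult[OF bilin_l[OF \<phi>]]
        lin_smult[OF bilin_r[OF \<phi>]]\<close>)+
    have 4: "?h (single K (ra x s, y) \<ominus>\<^bsub>FXY\<^esub> single K (x, la s y)) = \<zero>\<^bsub>Z\<^esub>"
      if "x \<in> carrier X" "s \<in> S" "y \<in> carrier Y" for x s y
      by (intro hd sc) (use that ra la bal in \<open>simp_all add: hs\<close>)
    show ?thesis using that unfolding tensor_rels_def Let_def
      by (elim UnE CollectE exE conjE) (simp_all only: 1 2 3 4)
  qed
  have n: "?h f = \<zero>\<^bsub>Z\<^esub>" if "f \<in> NXY" for f
    by (rule span_of_zero[OF F Z h rels_closed rels that])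
  show "tensor_lift K Z \<phi> \<in> lin_maps K TXY Z"
    unfolding tensor_lift_def T_def by (rule quot_lift[OF F N Z h n])
  show "tensor_lift K Z \<phi> (pure K TXY x y) = \<phi> x y" if "x \<in> carrier X" "y \<in> carrier Y"
    using quot_lift_coset[OF F N Z h n sc[OF that]] that hs
    by (simp add: tensor_lift_def pure_eq[OF refl])
qed

end

lemma lin_scale:
  assumes "module K X" "c \<in> carrier K"
  shows "(\<lambda>x. c \<odot>\<^bsub>X\<^esub> x) \<in> lin_maps K X X"
proof -
  interpret X: module K X by fact
  show ?thesis
  proof (rule lin_mapsI)
    show "c \<odot>\<^bsub>X\<^esub> (e \<odot>\<^bsub>X\<^esub> z) = e \<odot>\<^bsub>X\<^esub> (c \<odot>\<^bsub>X\<^esub> z)" if "e \<in> carrier K" "z \<in> carrier X" for e z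
      using that assms(2) X.smult_assoc1 X.R.m_comm by metis
  qed (use assms(2) in \<open>auto simp: X.smult_r_distr\<close>)
qed

lemma lin_maps_eq:
  assumes "f \<in> lin_maps K X Y" "module K X" "\<And>x. x \<in> carrier X \<Longrightarrow> g x = f x"
  shows "g \<in> lin_maps K X Y"
proof -
  interpret X: module K X by fact
  show ?thesis using assms(1,3) by (simp add: lin_maps_def Pi_iff)
qed

text \<open>Nested tensor products are mapped out of one factor at a time. The remaining variable
  then sits in \<open>b\<close> as a parameter, and the next lift needs linear dependence on
  it.\<close>

lemma (in balancing) tensor_lift_param:
  assumes Z: "module K Z"
    and \<phi>: "\<And>b. b \<in> carrier B \<Longrightarrow> bilin K X Y Z (\<phi> b)"
    and bal: "\<And>b x s y. \<lbrakk>b \<in> carrier B; x \<in> carrier X; s \<in> S; y \<in> carrier Y\<rbrakk> \<Longrightarrow>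
      \<phi> b (ra x s) y = \<phi> b x (la s y)"
    and lin: "\<And>x y. \<lbrakk>x \<in> carrier X; y \<in> carrier Y\<rbrakk> \<Longrightarrow> (\<lambda>b. \<phi> b x y) \<in> lin_maps K B Z"
    and B: "module K B" and t: "t \<in> carrier TXY"
  shows "(\<lambda>b. tensor_lift K Z (\<phi> b) t) \<in> lin_maps K B Z"
proof -
  interpret B: module K B by (rule B)
  interpret Z: module K Z by (rule Z)
  note ll = tensor_lift_lin[OF Z \<phi> bal] and lp = tensor_lift_pure[OF Z \<phi> bal]
  note sm = lin_scale[OF Z]
  show ?thesis
  proof (rule lin_mapsI)
    fix b c assume bc: "b \<in> carrier B" "c \<in> carrier B"
    show "tensor_lift K Z (\<phi> (b \<oplus>\<^bsub>B\<^esub> c)) t = tensor_lift K Z (\<phi> b) t \<oplus>\<^bsub>Z\<^esub> tensor_lift K Z (\<phi> c) t"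
      by (rule tensor_eqI[OF t ll lin_sum[OF Z ll ll]]) (simp_all add: bc lp lin_add[OF lin])
  next
    fix b c assume bc: "b \<in> carrier B" "c \<in> carrier K"
    show "tensor_lift K Z (\<phi> (c \<odot>\<^bsub>B\<^esub> b)) t = c \<odot>\<^bsub>Z\<^esub> tensor_lift K Z (\<phi> b) t"
      by (rule tensor_eqI[OF t ll lin_comp[OF ll sm]]) (simp_all add: bc lp lin_smult[OF lin])
  qed (use lin_closed[OF ll t] in auto)
qed

lemma balancing_K:
  "\<lbrakk>module K X; module K Y\<rbrakk> \<Longrightarrow> balancing K X Y ({} :: unit set) (\<lambda>x s. x) (\<lambda>s y. y)"
  by (simp add: balancing_def)

lemmas tensor_K_module = balancing.T[OF balancing_K, folded tensor_K_def]
lemmas tensor_K_bilin = balancing.pure_bilin[OF balancing_K, folded tensor_K_def]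
lemmas tensor_K_eqI = balancing.tensor_eqI[OF balancing_K, folded tensor_K_def]
lemma
  assumes "module K X" "module K Y" "module K Z" "bilin K X Y Z \<phi>"
  shows tensor_K_lift_lin: "tensor_lift K Z \<phi> \<in> lin_maps K (tensor_K K X Y) Z"
    and tensor_K_lift_pure: "\<lbrakk>x \<in> carrier X; y \<in> carrier Y\<rbrakk> \<Longrightarrow>
      tensor_lift K Z \<phi> (pure K (tensor_K K X Y) x y) = \<phi> x y"
  using balancing.tensor_lift_lin[OF balancing_K[OF assms(1,2)] assms(3,4)]
    balancing.tensor_lift_pure[OF balancing_K[OF assms(1,2)] assms(3,4)]
  by (auto simp: tensor_K_def)

lemma tensor_K_lift_param:
  assumes "module K X" "module K Y" "module K Z" "module K B"
    "\<And>b. b \<in> carrier B \<Longrightarrow> bilin K X Y Z (\<phi> b)"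
    "\<And>x y. \<lbrakk>x \<in> carrier X; y \<in> carrier Y\<rbrakk> \<Longrightarrow> (\<lambda>b. \<phi> b x y) \<in> lin_maps K B Z"
    "t \<in> carrier (tensor_K K X Y)"
  shows "(\<lambda>b. tensor_lift K Z (\<phi> b) t) \<in> lin_maps K B Z"
  by (rule balancing.tensor_lift_param[OF balancing_K[OF assms(1,2)] assms(3)])
    (use assms in \<open>auto simp: tensor_K_def\<close>)

section \<open>Trilinear maps out of a triple tensor product\<close>

definition trilin where
  "trilin K A W Z \<phi> \<longleftrightarrow>
     (\<forall>a\<in>carrier A. \<forall>w\<in>carrier W. (\<lambda>b. \<phi> a w b) \<in> lin_maps K A Z) \<and>
     (\<forall>a\<in>carrier A. \<forall>b\<in>carrier A. (\<lambda>w. \<phi> a w b) \<in> lin_maps K W Z) \<and>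
     (\<forall>w\<in>carrier W. \<forall>b\<in>carrier A. (\<lambda>a. \<phi> a w b) \<in> lin_maps K A Z)"

lemma trilinI:
  assumes "\<And>a w. \<lbrakk>a \<in> carrier A; w \<in> carrier W\<rbrakk> \<Longrightarrow> (\<lambda>b. \<phi> a w b) \<in> lin_maps K A Z"
    "\<And>a b. \<lbrakk>a \<in> carrier A; b \<in> carrier A\<rbrakk> \<Longrightarrow> (\<lambda>w. \<phi> a w b) \<in> lin_maps K W Z"
    "\<And>w b. \<lbrakk>w \<in> carrier W; b \<in> carrier A\<rbrakk> \<Longrightarrow> (\<lambda>a. \<phi> a w b) \<in> lin_maps K A Z"
  shows "trilin K A W Z \<phi>"
  using assms by (auto simp: trilin_def)

lemma
  assumes "trilin K A W Z \<phi>"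
  shows trilin_1: "\<lbrakk>w \<in> carrier W; b \<in> carrier A\<rbrakk> \<Longrightarrow> (\<lambda>a. \<phi> a w b) \<in> lin_maps K A Z"
    and trilin_2: "\<lbrakk>a \<in> carrier A; b \<in> carrier A\<rbrakk> \<Longrightarrow> (\<lambda>w. \<phi> a w b) \<in> lin_maps K W Z"
    and trilin_3: "\<lbrakk>a \<in> carrier A; w \<in> carrier W\<rbrakk> \<Longrightarrow> (\<lambda>b. \<phi> a w b) \<in> lin_maps K A Z"
  using assms by (auto simp: trilin_def)

context
  fixes K :: "'k ring" and A :: "('k, 'a) module" and W :: "('k, 'w) module"
  assumes A: "module K A" and W: "module K W"
begin

lemma triple_mod_module: "module K (triple_mod K A W)"
  unfolding triple_mod_def by (intro tensor_K_module A W)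

lemma triple_trilin: "trilin K A W (triple_mod K A W) (triple K A W)"
  unfolding triple_def
proof (rule trilinI)
  note U = tensor_K_module[OF A W]
  note b1 = tensor_K_bilin[OF A W] and b2 = tensor_K_bilin[OF U A, folded triple_mod_def]
  show "(\<lambda>b. pure K (triple_mod K A W) (pure K (tensor_K K A W) a w) b) \<in> lin_maps K A (triple_mod K A W)"
    if "a \<in> carrier A" "w \<in> carrier W" for a w
    by (rule bilin_r[OF b2 bilin_closed[OF b1 that]])
  show "(\<lambda>w. pure K (triple_mod K A W) (pure K (tensor_K K A W) a w) b) \<in> lin_maps K W (triple_mod K A W)"
    if "a \<in> carrier A" "b \<in> carrier A" for a b
    by (rule lin_comp[OF bilin_r[OF b1 that(1)] bilin_l[OF b2 that(2)]])
  show "(\<lambda>a. pure K (triple_mod K A W) (pure K (tensor_K K A W) a w) b) \<in> lin_maps K A (triple_mod K A W)"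
    if "w \<in> carrier W" "b \<in> carrier A" for w b
    by (rule lin_comp[OF bilin_l[OF b1 that(1)] bilin_l[OF b2 that(2)]])
qed

lemma triple_closed:
  "\<lbrakk>a \<in> carrier A; w \<in> carrier W; b \<in> carrier A\<rbrakk> \<Longrightarrow> triple K A W a w b \<in> carrier (triple_mod K A W)"
  using lin_closed[OF trilin_1[OF triple_trilin]] .

lemma triple_eqI:
  assumes "t \<in> carrier (triple_mod K A W)" "g \<in> lin_maps K (triple_mod K A W) Z"
    "h \<in> lin_maps K (triple_mod K A W) Z"
    "\<And>a w b. \<lbrakk>a \<in> carrier A; w \<in> carrier W; b \<in> carrier A\<rbrakk> \<Longrightarrow>
      g (triple K A W a w b) = h (triple K A W a w b)"
  shows "g t = h t"
proof -
  note U = tensor_K_module[OF A W]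
  note b2 = tensor_K_bilin[OF U A, folded triple_mod_def]
  show ?thesis
  proof (rule tensor_K_eqI[OF U A, folded triple_mod_def, OF assms(1-3)])
    fix u b assume u: "u \<in> carrier (tensor_K K A W)" and b: "b \<in> carrier A"
    show "g (pure K (triple_mod K A W) u b) = h (pure K (triple_mod K A W) u b)"
      by (rule tensor_K_eqI[OF A W u lin_comp[OF bilin_l[OF b2 b] assms(2)]
            lin_comp[OF bilin_l[OF b2 b] assms(3)]])
        (use assms(4) b in \<open>simp add: triple_def\<close>)
  qed
qed

lemma
  assumes Z: "module K Z" and \<phi>: "trilin K A W Z \<phi>"
  shows triple_lift_lin: "triple_lift K Z \<phi> \<in> lin_maps K (triple_mod K A W) Z"
    and triple_lift_triple: "\<lbrakk>a \<in> carrier A; w \<in> carrier W; b \<in> carrier A\<rbrakk> \<Longrightarrow>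
      triple_lift K Z \<phi> (triple K A W a w b) = \<phi> a w b"
proof -
  note U = tensor_K_module[OF A W]
  have bb: "bilin K A W Z (\<lambda>a w. \<phi> a w b)" if "b \<in> carrier A" for b
    by (rule bilinI) (use trilin_1[OF \<phi>] trilin_2[OF \<phi>] that in auto)
  have b: "bilin K (tensor_K K A W) A Z (\<lambda>u b. tensor_lift K Z (\<lambda>a w. \<phi> a w b) u)"
  proof (rule bilinI)
    show "(\<lambda>u. tensor_lift K Z (\<lambda>a w. \<phi> a w b) u) \<in> lin_maps K (tensor_K K A W) Z" if "b \<in> carrier A" for b
      by (rule tensor_K_lift_lin[OF A W Z bb[OF that]])
    show "(\<lambda>b. tensor_lift K Z (\<lambda>a w. \<phi> a w b) u) \<in> lin_maps K A Z" if "u \<in> carrier (tensor_K K A W)" for u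
      by (rule tensor_K_lift_param[OF A W Z A bb _ that]) (use trilin_3[OF \<phi>] in auto)
  qed
  show "triple_lift K Z \<phi> \<in> lin_maps K (triple_mod K A W) Z"
    unfolding triple_lift_def triple_mod_def by (rule tensor_K_lift_lin[OF U A Z b])
  show "triple_lift K Z \<phi> (triple K A W a w b) = \<phi> a w b"
    if "a \<in> carrier A" "w \<in> carrier W" "b \<in> carrier A"
    using that tensor_K_lift_pure[OF U A Z b bilin_closed[OF tensor_K_bilin[OF A W]]]
      tensor_K_lift_pure[OF A W Z bb]
    by (simp add: triple_lift_def triple_def triple_mod_def)
qed

end

section \<open>Bimodules over an algebra\<close>

locale kalg =
  fixes K :: "'k ring" and A :: "('k, 'a) module"
  assumes A: "module K A" and ring: "ring A"
    and smult_l: "\<lbrakk>c \<in> carrier K; a \<in> carrier A; b \<in> carrier A\<rbrakk> \<Longrightarrow> (c \<odot>\<^bsub>A\<^esub> a) \<otimes>\<^bsub>A\<^esub> b = c \<odot>\<^bsub>A\<^esub> (a \<otimes>\<^bsub>A\<^esub> b)"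
    and smult_r: "\<lbrakk>c \<in> carrier K; a \<in> carrier A; b \<in> carrier A\<rbrakk> \<Longrightarrow> a \<otimes>\<^bsub>A\<^esub> (c \<odot>\<^bsub>A\<^esub> b) = c \<odot>\<^bsub>A\<^esub> (a \<otimes>\<^bsub>A\<^esub> b)"
begin

sublocale A: module K A by (rule A)
sublocale A: ring A by (rule ring)

lemma K: "cring K" by (rule A.R.is_cring)

lemma mult_lin_r: "a \<in> carrier A \<Longrightarrow> (\<lambda>b. a \<otimes>\<^bsub>A\<^esub> b) \<in> lin_maps K A A"
  by (rule lin_mapsI) (auto simp: A.r_distr smult_r)

lemma mult_lin_l: "b \<in> carrier A \<Longrightarrow> (\<lambda>a. a \<otimes>\<^bsub>A\<^esub> b) \<in> lin_maps K A A"
  by (rule lin_mapsI) (auto simp: A.l_distr smult_l)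

lemma regular_bimodule: "bimodule K A (regular_bimod A)"
  unfolding regular_bimod_def
  by (intro bimodule.intro bimodule_axioms.intro module_make_bimod[OF A])
    (simp_all add: A.l_distr A.r_distr A.m_assoc smult_l smult_r)

text \<open>Two linear actions with no further laws: this is what balancing over the enveloping
  algebra asks for. Working with it spares the verification of all bimodule axioms for
  \<open>tensor_A\<close> and \<open>Hom_A\<close>.\<close>

definition "biact X \<longleftrightarrow> module K X \<and> (\<forall>a\<in>carrier A. lact X a \<in> lin_maps K X X) \<and>
   (\<forall>a\<in>carrier A. (\<lambda>x. ract X x a) \<in> lin_maps K X X)"

lemma biactD: "biact X \<Longrightarrow> module K X" "\<lbrakk>biact X; a \<in> carrier A\<rbrakk> \<Longrightarrow> lact X a \<in> lin_maps K X X"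
  "\<lbrakk>biact X; a \<in> carrier A\<rbrakk> \<Longrightarrow> (\<lambda>x. ract X x a) \<in> lin_maps K X X"
  by (auto simp: biact_def)

lemma bimodule_module: "bimodule K A X \<Longrightarrow> module K X"
  by (simp add: bimodule_def)

lemma bimodule_lact: "\<lbrakk>bimodule K A X; a \<in> carrier A\<rbrakk> \<Longrightarrow> lact X a \<in> lin_maps K X X"
  by (rule lin_mapsI) (auto simp: bimodule.lact_closed bimodule.lact_add bimodule.lact_smult)

lemma bimodule_ract: "\<lbrakk>bimodule K A X; a \<in> carrier A\<rbrakk> \<Longrightarrow> (\<lambda>x. ract X x a) \<in> lin_maps K X X"
  by (rule lin_mapsI) (auto simp: bimodule.ract_closed bimodule.ract_add bimodule.ract_smult)

lemma bimodule_lact': "\<lbrakk>bimodule K A X; x \<in> carrier X\<rbrakk> \<Longrightarrow> (\<lambda>a. lact X a x) \<in> lin_maps K A X"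
  by (rule lin_mapsI) (auto simp: bimodule.lact_closed bimodule.add_lact bimodule.smult_lact)

lemma bimodule_ract': "\<lbrakk>bimodule K A X; x \<in> carrier X\<rbrakk> \<Longrightarrow> (\<lambda>a. ract X x a) \<in> lin_maps K A X"
  by (rule lin_mapsI) (auto simp: bimodule.ract_closed bimodule.add_ract bimodule.smult_ract)

lemma bimodule_biact: "bimodule K A X \<Longrightarrow> biact X"
  by (simp add: biact_def bimodule_module bimodule_lact bimodule_ract)

lemma left_homsD: "h \<in> left_homs K A X Y \<Longrightarrow> h \<in> lin_maps K X Y"
  "\<lbrakk>h \<in> left_homs K A X Y; a \<in> carrier A; x \<in> carrier X\<rbrakk> \<Longrightarrow> h (lact X a x) = lact Y a (h x)"
  by (auto simp: left_homs_def)

lemma bimod_homsD: "h \<in> bimod_homs K A X Y \<Longrightarrow> h \<in> left_homs K A X Y"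
  "h \<in> bimod_homs K A X Y \<Longrightarrow> h \<in> lin_maps K X Y"
  "\<lbrakk>h \<in> bimod_homs K A X Y; a \<in> carrier A; x \<in> carrier X\<rbrakk> \<Longrightarrow> h (lact X a x) = lact Y a (h x)"
  "\<lbrakk>h \<in> bimod_homs K A X Y; a \<in> carrier A; x \<in> carrier X\<rbrakk> \<Longrightarrow> h (ract X x a) = ract Y (h x) a"
  by (auto simp: bimod_homs_def left_homs_def)

text \<open>The class in which the contraction of the resolution lives.\<close>

definition "right_homs X Y = {h \<in> lin_maps K X Y. \<forall>a\<in>carrier A. \<forall>x\<in>carrier X. h (ract X x a) = ract Y (h x) a}"

lemma right_homsD: "h \<in> right_homs X Y \<Longrightarrow> h \<in> lin_maps K X Y"
  "\<lbrakk>h \<in> right_homs X Y; a \<in> carrier A; x \<in> carrier X\<rbrakk> \<Longrightarrow> h (ract X x a) = ract Y (h x) a"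
  by (auto simp: right_homs_def)

lemma bimod_homs_right: "h \<in> bimod_homs K A X Y \<Longrightarrow> h \<in> right_homs X Y"
  by (auto simp: bimod_homs_def left_homs_def right_homs_def)

subsection \<open>The bimodule \<open>A \<otimes> W \<otimes> A\<close>\<close>

abbreviation "AWA W \<equiv> outer_bimod K A W"

lemma lin_maps_cong: "\<lbrakk>carrier X' = carrier X; add X' = add X; smult X' = smult X;
    carrier Y' = carrier Y; add Y' = add Y; smult Y' = smult Y\<rbrakk> \<Longrightarrow> lin_maps K X' Y' = lin_maps K X Y"
  by (simp add: lin_maps_def)

lemma AWA_simps [simp]: "carrier (AWA W) = carrier (triple_mod K A W)" "add (AWA W) = add (triple_mod K A W)"
  "zero (AWA W) = zero (triple_mod K A W)" "smult (AWA W) = smult (triple_mod K A W)"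
  by (simp_all add: outer_bimod_def Let_def)

lemma lin_AWA: "lin_maps K (AWA W) Y = lin_maps K (triple_mod K A W) Y"
  "lin_maps K Y (AWA W) = lin_maps K Y (triple_mod K A W)"
  by (rule lin_maps_cong; simp)+

context
  fixes W :: "('k, 'w) module"
  assumes W: "module K W"
begin

lemma AWA_module: "module K (AWA W)"
  unfolding outer_bimod_def Let_def by (intro module_make_bimod triple_mod_module A W)

lemma triple_tri: "trilin K A W (AWA W) (triple K A W)"
  using triple_trilin[OF A W] by (simp add: trilin_def lin_AWA)

lemma lact_trilin: "c \<in> carrier A \<Longrightarrow> trilin K A W (triple_mod K A W) (\<lambda>a w b. triple K A W (c \<otimes>\<^bsub>A\<^esub> a) w b)"
  by (intro trilinI trilin_2[OF triple_trilin] trilin_3[OF triple_trilin]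
      lin_comp[OF mult_lin_r trilin_1[OF triple_trilin]] A W) auto

lemma ract_trilin: "c \<in> carrier A \<Longrightarrow> trilin K A W (triple_mod K A W) (\<lambda>a w b. triple K A W a w (b \<otimes>\<^bsub>A\<^esub> c))"
  by (intro trilinI trilin_2[OF triple_trilin] trilin_1[OF triple_trilin]
      lin_comp[OF mult_lin_l trilin_3[OF triple_trilin]] A W) auto

lemma AWA_lact_lin: "c \<in> carrier A \<Longrightarrow> lact (AWA W) c \<in> lin_maps K (AWA W) (AWA W)"
  unfolding lin_AWA using triple_lift_lin[OF A W triple_mod_module[OF A W] lact_trilin]
  by (simp add: outer_bimod_def Let_def)

lemma AWA_ract_lin: "c \<in> carrier A \<Longrightarrow> (\<lambda>x. ract (AWA W) x c) \<in> lin_maps K (AWA W) (AWA W)"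
  unfolding lin_AWA using triple_lift_lin[OF A W triple_mod_module[OF A W] ract_trilin]
  by (simp add: outer_bimod_def Let_def)

lemma AWA_lact: "\<lbrakk>c \<in> carrier A; a \<in> carrier A; w \<in> carrier W; b \<in> carrier A\<rbrakk> \<Longrightarrow>
    lact (AWA W) c (triple K A W a w b) = triple K A W (c \<otimes>\<^bsub>A\<^esub> a) w b"
  using triple_lift_triple[OF A W triple_mod_module[OF A W] lact_trilin]
  by (simp add: outer_bimod_def Let_def)

lemma AWA_ract: "\<lbrakk>c \<in> carrier A; a \<in> carrier A; w \<in> carrier W; b \<in> carrier A\<rbrakk> \<Longrightarrow>
    ract (AWA W) (triple K A W a w b) c = triple K A W a w (b \<otimes>\<^bsub>A\<^esub> c)"
  using triple_lift_triple[OF A W triple_mod_module[OF A W] ract_trilin]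
  by (simp add: outer_bimod_def Let_def)

lemmas tri_closed = triple_closed[OF A W]

lemma AWA_eqI:
  assumes "t \<in> carrier (AWA W)" "g \<in> lin_maps K (AWA W) Z" "h \<in> lin_maps K (AWA W) Z"
    "\<And>a w b. \<lbrakk>a \<in> carrier A; w \<in> carrier W; b \<in> carrier A\<rbrakk> \<Longrightarrow>
      g (triple K A W a w b) = h (triple K A W a w b)"
  shows "g t = h t"
  by (rule triple_eqI[OF A W, of t g Z h]) (use assms in \<open>simp_all add: lin_AWA\<close>)

lemma AWA_lift_lin: "\<lbrakk>module K Z; trilin K A W Z \<phi>\<rbrakk> \<Longrightarrow> triple_lift K Z \<phi> \<in> lin_maps K (AWA W) Z"
  using triple_lift_lin[OF A W] by (simp add: lin_AWA)

lemmas AWA_lift_triple = triple_lift_triple[OF A W]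

text \<open>For fixed ring elements each law equates two linear maps of \<open>x\<close>, so it
  reduces to generators, where it becomes a ring law in one of the outer factors.\<close>

lemma AWA_bimodule: "bimodule K A (AWA W)"
proof (intro bimodule.intro bimodule_axioms.intro)
  show "module K (AWA W)" by (rule AWA_module)
  note l = AWA_lact_lin and r = AWA_ract_lin and m = AWA_module
  interpret m: module K "AWA W" by (rule m)
  note sm = lin_scale[OF m]
  note t1 = lin_add[OF trilin_1[OF triple_tri]] and t2 = lin_add[OF trilin_3[OF triple_tri]]
  note s1 = lin_smult[OF trilin_1[OF triple_tri]] and s2 = lin_smult[OF trilin_3[OF triple_tri]]
  fix a b x assume ab: "a \<in> carrier A" "b \<in> carrier A" and x: "x \<in> carrier (AWA W)"
  show "lact (AWA W) (a \<oplus>\<^bsub>A\<^esub> b) x = lact (AWA W) a x \<oplus>\<^bsub>AWA W\<^esub> lact (AWA W) b x"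
    by (rule AWA_eqI[OF x l lin_sum[OF m l l]]) (simp_all only: ab AWA_lact A.l_distr A.m_closed A.a_closed t1)
  show "ract (AWA W) x (a \<oplus>\<^bsub>A\<^esub> b) = ract (AWA W) x a \<oplus>\<^bsub>AWA W\<^esub> ract (AWA W) x b"
    by (rule AWA_eqI[OF x r lin_sum[OF m r r]]) (simp_all only: ab AWA_ract A.r_distr A.m_closed A.a_closed t2)
  show "lact (AWA W) (a \<otimes>\<^bsub>A\<^esub> b) x = lact (AWA W) a (lact (AWA W) b x)"
    by (rule AWA_eqI[OF x l lin_comp[OF l l]]) (simp_all only: ab AWA_lact A.m_assoc A.m_closed)
  show "ract (AWA W) x (a \<otimes>\<^bsub>A\<^esub> b) = ract (AWA W) (ract (AWA W) x a) b"
    by (rule AWA_eqI[OF x r lin_comp[OF r r]]) (simp_all only: ab AWA_ract A.m_assoc A.m_closed)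
  show "ract (AWA W) (lact (AWA W) a x) b = lact (AWA W) a (ract (AWA W) x b)"
    by (rule AWA_eqI[OF x lin_comp[OF l r] lin_comp[OF r l]]) (simp_all only: ab AWA_ract AWA_lact A.m_closed)
next
  note l = AWA_lact_lin and r = AWA_ract_lin and m = AWA_module
  interpret m: module K "AWA W" by (rule m)
  note sm = lin_scale[OF m]
  note s1 = lin_smult[OF trilin_1[OF triple_tri]] and s2 = lin_smult[OF trilin_3[OF triple_tri]]
  fix c a x assume ca: "c \<in> carrier K" "a \<in> carrier A" and x: "x \<in> carrier (AWA W)"
  show "lact (AWA W) (c \<odot>\<^bsub>A\<^esub> a) x = c \<odot>\<^bsub>AWA W\<^esub> lact (AWA W) a x"
    by (rule AWA_eqI[OF x l lin_comp[OF l sm]]) (simp_all only: ca AWA_lact smult_l A.m_closed A.smult_closed s1)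
  show "ract (AWA W) x (c \<odot>\<^bsub>A\<^esub> a) = c \<odot>\<^bsub>AWA W\<^esub> ract (AWA W) x a"
    by (rule AWA_eqI[OF x r lin_comp[OF r sm]]) (simp_all only: ca AWA_ract smult_r A.m_closed A.smult_closed s2)
next
  note l = AWA_lact_lin and r = AWA_ract_lin
  fix x assume x: "x \<in> carrier (AWA W)"
  show "lact (AWA W) \<one>\<^bsub>A\<^esub> x = x"
    by (rule AWA_eqI[OF x l lin_id]) (simp_all only: A.one_closed AWA_lact A.l_one)
  show "ract (AWA W) x \<one>\<^bsub>A\<^esub> = x"
    by (rule AWA_eqI[OF x r lin_id]) (simp_all only: A.one_closed AWA_ract A.r_one)
qed (use lin_closed[OF AWA_lact_lin] lin_closed[OF AWA_ract_lin] lin_add[OF AWA_lact_lin]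
    lin_add[OF AWA_ract_lin] lin_smult[OF AWA_lact_lin] lin_smult[OF AWA_ract_lin] in auto)

end

subsection \<open>Tensor products over \<open>A\<close> and its enveloping algebra\<close>

lemma balancing_A: "\<lbrakk>bimodule K A X; bimodule K A Y\<rbrakk> \<Longrightarrow> balancing K X Y (carrier A) (ract X) (lact Y)"
  by (simp add: balancing_def bimodule_module bimodule.ract_closed bimodule.lact_closed)

lemma tensor_A_simps:
  "carrier (tensor_A K A X Y) = carrier (balanced_tensor K X Y (carrier A) (ract X) (lact Y))"
  "add (tensor_A K A X Y) = add (balanced_tensor K X Y (carrier A) (ract X) (lact Y))"
  "zero (tensor_A K A X Y) = zero (balanced_tensor K X Y (carrier A) (ract X) (lact Y))"
  "smult (tensor_A K A X Y) = smult (balanced_tensor K X Y (carrier A) (ract X) (lact Y))"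
  by (simp_all add: tensor_A_def Let_def)

lemma lin_tensor_A:
  "lin_maps K (tensor_A K A X Y) Z = lin_maps K (balanced_tensor K X Y (carrier A) (ract X) (lact Y)) Z"
  "lin_maps K Z (tensor_A K A X Y) = lin_maps K Z (balanced_tensor K X Y (carrier A) (ract X) (lact Y))"
  by (rule lin_maps_cong; simp add: tensor_A_simps)+

context
  fixes X :: "('k, 'a, 'x) bimodule" and Y :: "('k, 'a, 'y) bimodule"
  assumes X: "bimodule K A X" and Y: "bimodule K A Y"
begin

interpretation T: balancing K X Y "carrier A" "ract X" "lact Y" by (rule balancing_A[OF X Y])

abbreviation (input) "XAY \<equiv> tensor_A K A X Y"

lemma tensor_A_module: "module K XAY"
  using module_cong[OF T.T] tensor_A_simps by metis

lemma tensor_A_pure: "\<lbrakk>x \<in> carrier X; y \<in> carrier Y\<rbrakk> \<Longrightarrow>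
    pure K XAY x y = pure K (balanced_tensor K X Y (carrier A) (ract X) (lact Y)) x y"
  by (rule T.pure_cong) (simp_all add: tensor_A_simps)

lemma tensor_A_bilin: "bilin K X Y XAY (pure K XAY)"
  unfolding bilin_def lin_tensor_A
  by (intro conjI ballI lin_maps_eq[OF bilin_r[OF T.pure_bilin] T.Y] lin_maps_eq[OF bilin_l[OF T.pure_bilin] T.X])
    (simp_all add: tensor_A_pure)

lemma tensor_A_balanced: "\<lbrakk>x \<in> carrier X; a \<in> carrier A; y \<in> carrier Y\<rbrakk> \<Longrightarrow>
    pure K XAY (ract X x a) y = pure K XAY x (lact Y a y)"
  using T.pure_balanced T.ra T.la by (simp add: tensor_A_pure)

lemma tensor_A_eqI:
  assumes "t \<in> carrier XAY" "g \<in> lin_maps K XAY Z" "h \<in> lin_maps K XAY Z"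
    "\<And>x y. \<lbrakk>x \<in> carrier X; y \<in> carrier Y\<rbrakk> \<Longrightarrow> g (pure K XAY x y) = h (pure K XAY x y)"
  shows "g t = h t"
  by (rule T.tensor_eqI) (use assms in \<open>simp_all add: lin_tensor_A tensor_A_simps tensor_A_pure\<close>)

lemma
  assumes "module K Z" "bilin K X Y Z \<phi>"
    "\<And>x a y. \<lbrakk>x \<in> carrier X; a \<in> carrier A; y \<in> carrier Y\<rbrakk> \<Longrightarrow> \<phi> (ract X x a) y = \<phi> x (lact Y a y)"
  shows tensor_A_lift_lin: "tensor_lift K Z \<phi> \<in> lin_maps K XAY Z"
    and tensor_A_lift_pure: "\<lbrakk>x \<in> carrier X; y \<in> carrier Y\<rbrakk> \<Longrightarrow> tensor_lift K Z \<phi> (pure K XAY x y) = \<phi> x y"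
  using T.tensor_lift_lin[OF assms] T.tensor_lift_pure[OF assms] by (auto simp: lin_tensor_A tensor_A_pure)

lemma tensor_A_lift_param:
  assumes "module K Z" "\<And>b. b \<in> carrier B \<Longrightarrow> bilin K X Y Z (\<phi> b)"
    "\<And>b x a y. \<lbrakk>b \<in> carrier B; x \<in> carrier X; a \<in> carrier A; y \<in> carrier Y\<rbrakk> \<Longrightarrow>
      \<phi> b (ract X x a) y = \<phi> b x (lact Y a y)"
    "\<And>x y. \<lbrakk>x \<in> carrier X; y \<in> carrier Y\<rbrakk> \<Longrightarrow> (\<lambda>b. \<phi> b x y) \<in> lin_maps K B Z"
    "module K B" "t \<in> carrier XAY"
  shows "(\<lambda>b. tensor_lift K Z (\<phi> b) t) \<in> lin_maps K B Z"
  by (rule T.tensor_lift_param) (use assms in \<open>auto simp: tensor_A_simps\<close>)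

text \<open>The outer actions respect balancing because on each of the two factors left and right
  multiplication commute.\<close>

lemma
  assumes a: "a \<in> carrier A"
  shows tensor_A_lact_lin: "lact XAY a \<in> lin_maps K XAY XAY"
    and tensor_A_lact: "\<lbrakk>x \<in> carrier X; y \<in> carrier Y\<rbrakk> \<Longrightarrow> lact XAY a (pure K XAY x y) = pure K XAY (lact X a x) y"
    and tensor_A_ract_lin: "(\<lambda>t. ract XAY t a) \<in> lin_maps K XAY XAY"
    and tensor_A_ract: "\<lbrakk>x \<in> carrier X; y \<in> carrier Y\<rbrakk> \<Longrightarrow> ract XAY (pure K XAY x y) a = pure K XAY x (ract Y y a)"
proof -
  interpret X: bimodule K A X by (rule X)
  interpret Y: bimodule K A Y by (rule Y)
  have 1: "bilin K X Y T.TXY (\<lambda>x y. pure K T.TXY (lact X a x) y)"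
    by (rule bilinI) (use a in \<open>auto intro: bilin_r[OF T.pure_bilin] lin_comp[OF bimodule_lact[OF X a] bilin_l[OF T.pure_bilin]]
      X.lact_closed\<close>)
  have 2: "bilin K X Y T.TXY (\<lambda>x y. pure K T.TXY x (ract Y y a))"
    by (rule bilinI) (use a in \<open>auto intro: bilin_l[OF T.pure_bilin] lin_comp[OF bimodule_ract[OF Y a] bilin_r[OF T.pure_bilin]]
      Y.ract_closed\<close>)
  have 3: "pure K T.TXY (lact X a (ract X x s)) y = pure K T.TXY (lact X a x) (lact Y s y)"
    if "x \<in> carrier X" "s \<in> carrier A" "y \<in> carrier Y" for x s y
    using T.pure_balanced[OF X.lact_closed[OF a that(1)] that(2,3)] X.lact_ract[OF a that(2,1)] by simp
  have 4: "pure K T.TXY (ract X x s) (ract Y y a) = pure K T.TXY x (ract Y (lact Y s y) a)"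
    if "x \<in> carrier X" "s \<in> carrier A" "y \<in> carrier Y" for x s y
    using T.pure_balanced[OF that(1,2) Y.ract_closed[OF a that(3)]] Y.lact_ract[OF that(2) a that(3)] by simp
  have L: "lact XAY a = tensor_lift K T.TXY (\<lambda>x y. pure K T.TXY (lact X a x) y)"
    "(\<lambda>t. ract XAY t a) = tensor_lift K T.TXY (\<lambda>x y. pure K T.TXY x (ract Y y a))"
    by (simp_all add: tensor_A_def Let_def)
  show "lact XAY a \<in> lin_maps K XAY XAY" "(\<lambda>t. ract XAY t a) \<in> lin_maps K XAY XAY"
    unfolding L lin_tensor_A using T.tensor_lift_lin[OF T.T 1 3] T.tensor_lift_lin[OF T.T 2 4] by auto
  assume xy: "x \<in> carrier X" "y \<in> carrier Y"
  show "lact XAY a (pure K XAY x y) = pure K XAY (lact X a x) y"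
    using T.tensor_lift_pure[OF T.T 1 3 xy] xy X.lact_closed[OF a] by (simp add: L tensor_A_pure)
  show "ract XAY (pure K XAY x y) a = pure K XAY x (ract Y y a)"
    using T.tensor_lift_pure[OF T.T 2 4 xy] xy Y.ract_closed[OF a] fun_cong[OF L(2)] by (simp add: tensor_A_pure)
qed

lemma tensor_A_biact: "biact XAY"
  by (simp add: biact_def tensor_A_module tensor_A_lact_lin tensor_A_ract_lin)

end

lemma balancing_Ae:
  assumes "biact X" "biact Y"
  shows "balancing K X Y (carrier A \<times> carrier A)
     (\<lambda>x (a, b). lact X b (ract X x a)) (\<lambda>(a, b) y. lact Y a (ract Y y b))"
  using biactD[OF assms(1)] biactD[OF assms(2)] by (auto simp: balancing_def lin_maps_def Pi_iff)

lemma
  assumes "biact X" "biact Y"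
  shows tensor_Ae_module: "module K (tensor_Ae K A X Y)"
    and tensor_Ae_bilin: "bilin K X Y (tensor_Ae K A X Y) (pure K (tensor_Ae K A X Y))"
    and tensor_Ae_eqI: "\<lbrakk>t \<in> carrier (tensor_Ae K A X Y); g \<in> lin_maps K (tensor_Ae K A X Y) Z;
      h \<in> lin_maps K (tensor_Ae K A X Y) Z;
      \<And>x y. \<lbrakk>x \<in> carrier X; y \<in> carrier Y\<rbrakk> \<Longrightarrow>
        g (pure K (tensor_Ae K A X Y) x y) = h (pure K (tensor_Ae K A X Y) x y)\<rbrakk> \<Longrightarrow> g t = h t"
    and tensor_Ae_balanced: "\<lbrakk>x \<in> carrier X; a \<in> carrier A; b \<in> carrier A; y \<in> carrier Y\<rbrakk> \<Longrightarrow>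
      pure K (tensor_Ae K A X Y) (lact X b (ract X x a)) y = pure K (tensor_Ae K A X Y) x (lact Y a (ract Y y b))"
proof -
  interpret T: balancing K X Y "carrier A \<times> carrier A" "\<lambda>x (a, b). lact X b (ract X x a)"
    "\<lambda>(a, b) y. lact Y a (ract Y y b)" by (rule balancing_Ae[OF assms])
  show "module K (tensor_Ae K A X Y)" unfolding tensor_Ae_def by (rule T.T)
  show "bilin K X Y (tensor_Ae K A X Y) (pure K (tensor_Ae K A X Y))"
    unfolding tensor_Ae_def by (rule T.pure_bilin)
  show "g t = h t" if "t \<in> carrier (tensor_Ae K A X Y)" "g \<in> lin_maps K (tensor_Ae K A X Y) Z"
    "h \<in> lin_maps K (tensor_Ae K A X Y) Z"
    "\<And>x y. \<lbrakk>x \<in> carrier X; y \<in> carrier Y\<rbrakk> \<Longrightarrow>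
        g (pure K (tensor_Ae K A X Y) x y) = h (pure K (tensor_Ae K A X Y) x y)"
    using that unfolding tensor_Ae_def by (rule T.tensor_eqI)
  show "pure K (tensor_Ae K A X Y) (lact X b (ract X x a)) y = pure K (tensor_Ae K A X Y) x (lact Y a (ract Y y b))"
    if "x \<in> carrier X" "a \<in> carrier A" "b \<in> carrier A" "y \<in> carrier Y"
    using T.pure_balanced[of x "(a, b)" y] that unfolding tensor_Ae_def by simp
qed

lemma
  assumes "biact X" "biact Y" "module K Z" "bilin K X Y Z \<phi>"
    "\<And>x a b y. \<lbrakk>x \<in> carrier X; a \<in> carrier A; b \<in> carrier A; y \<in> carrier Y\<rbrakk> \<Longrightarrow>
      \<phi> (lact X b (ract X x a)) y = \<phi> x (lact Y a (ract Y y b))"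
  shows tensor_Ae_lift_lin: "tensor_lift K Z \<phi> \<in> lin_maps K (tensor_Ae K A X Y) Z"
    and tensor_Ae_lift_pure: "\<lbrakk>x \<in> carrier X; y \<in> carrier Y\<rbrakk> \<Longrightarrow>
      tensor_lift K Z \<phi> (pure K (tensor_Ae K A X Y) x y) = \<phi> x y"
  using balancing.tensor_lift_lin[OF balancing_Ae[OF assms(1,2)] assms(3,4), folded tensor_Ae_def]
    balancing.tensor_lift_pure[OF balancing_Ae[OF assms(1,2)] assms(3,4), folded tensor_Ae_def] assms(5)
  by auto

end

section \<open>Homology of complexes and total complexes\<close>

lemma signed_signed: "\<lbrakk>module K X; x \<in> carrier X\<rbrakk> \<Longrightarrow> signed X n (signed X n x) = x"
  by (simp add: signed_def abelian_group.minus_minus[OF module_abelian_group])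

lemma signed_Suc: "\<lbrakk>module K X; x \<in> carrier X\<rbrakk> \<Longrightarrow> signed X (Suc n) x = \<ominus>\<^bsub>X\<^esub> signed X n x"
  by (simp add: signed_def abelian_group.minus_minus[OF module_abelian_group])

lemma signed_zero: "module K X \<Longrightarrow> signed X n \<zero>\<^bsub>X\<^esub> = \<zero>\<^bsub>X\<^esub>"
proof -
  assume "module K X"
  then interpret X: module K X .
  have "\<ominus>\<^bsub>X\<^esub> \<zero>\<^bsub>X\<^esub> = \<zero>\<^bsub>X\<^esub>" by (rule X.minus_equality) auto
  then show ?thesis by (simp add: signed_def)
qed

lemma module_sub_add: "\<lbrakk>module K X; x \<in> carrier X; y \<in> carrier X\<rbrakk> \<Longrightarrow> y \<oplus>\<^bsub>X\<^esub> (x \<ominus>\<^bsub>X\<^esub> y) = x"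
proof -
  assume a: "module K X" "x \<in> carrier X" "y \<in> carrier X"
  interpret X: module K X by (rule a(1))
  show ?thesis using a(2,3) by (simp add: a_minus_def X.a_comm[of x] X.r_neg2)
qed

lemma module_add_sub: "\<lbrakk>module K X; x \<in> carrier X; y \<in> carrier X\<rbrakk> \<Longrightarrow> (x \<oplus>\<^bsub>X\<^esub> y) \<ominus>\<^bsub>X\<^esub> x = y"
proof -
  assume a: "module K X" "x \<in> carrier X" "y \<in> carrier X"
  interpret X: module K X by (rule a(1))
  show ?thesis using a(2,3) by (simp add: a_minus_def X.a_comm[of "x \<oplus>\<^bsub>X\<^esub> y"] X.r_neg1)
qed

lemma module_diff_closed: "\<lbrakk>module K X; x \<in> carrier X; y \<in> carrier X\<rbrakk> \<Longrightarrow> x \<ominus>\<^bsub>X\<^esub> y \<in> carrier X"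
  by (simp add: abelian_group.minus_closed[OF module_abelian_group])

lemma module_diff_self: "\<lbrakk>module K X; x \<in> carrier X\<rbrakk> \<Longrightarrow> x \<ominus>\<^bsub>X\<^esub> x = \<zero>\<^bsub>X\<^esub>"
  by (simp add: a_minus_def abelian_group.r_neg[OF module_abelian_group])

lemma module_zero_closed: "module K X \<Longrightarrow> \<zero>\<^bsub>X\<^esub> \<in> carrier X"
  by (meson module_abelian_group abelian_group.axioms(1) abelian_monoid.zero_closed)

text \<open>Negation in a record is defined through its carrier, so shrinking the carrier to the
  cycles might change it; uniqueness of inverses shows that it does not.\<close>

lemma a_inv_restrict:
  assumes "module K X" "submodule Z K X" "x \<in> Z"
  shows "\<ominus>\<^bsub>X\<lparr>carrier := Z\<rparr>\<^esub> x = \<ominus>\<^bsub>X\<^esub> x"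
proof -
  interpret X: module K X by fact
  interpret Z: module K "X\<lparr>carrier := Z\<rparr>" by (rule submodule.submodule_is_module[OF assms(2,1)])
  have "x \<in> carrier X" "\<ominus>\<^bsub>X\<^esub> x \<in> Z" using X.submoduleE[OF assms(2)] assms(3) by auto
  then show ?thesis using Z.minus_equality[of "\<ominus>\<^bsub>X\<^esub> x" x] assms(3) X.l_neg by simp
qed

lemma submodule_restrict:
  assumes "module K X" "submodule Z K X" "submodule B K X" "B \<subseteq> Z"
  shows "submodule B K (X\<lparr>carrier := Z\<rparr>)"
proof -
  interpret X: module K X by fact
  interpret Z: module K "X\<lparr>carrier := Z\<rparr>" by (rule submodule.submodule_is_module[OF assms(2,1)])
  note E = X.submoduleE[OF assms(3)]
  show ?thesis
  proof (rule Z.submoduleI)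
    show "\<ominus>\<^bsub>X\<lparr>carrier := Z\<rparr>\<^esub> a \<in> B" if "a \<in> B" for a
      using that assms(4) a_inv_restrict[OF assms(1,2), of a] E(3) by auto
  qed (use E assms(4) submodule_zero[OF assms(1,3)] in auto)
qed

section \<open>Subquotients and comparison criteria for homology and cohomology\<close>

lemma subquotient_iso:
  assumes X: "module K X" "submodule Z K X" "submodule B K X" "B \<subseteq> Z"
    and Y: "module K Y" "submodule Z' K Y" "submodule B' K Y" "B' \<subseteq> Z'"
    and h: "h \<in> lin_maps K X Y" "\<And>x. x \<in> Z \<Longrightarrow> h x \<in> Z'" "\<And>x. x \<in> Z \<Longrightarrow> h x \<in> B' \<longleftrightarrow> x \<in> B"
    and surj: "\<And>y. y \<in> Z' \<Longrightarrow> \<exists>x\<in>Z. h x \<ominus>\<^bsub>Y\<^esub> y \<in> B'"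
  shows "mod_iso K (quot (X\<lparr>carrier := Z\<rparr>) B) (quot (Y\<lparr>carrier := Z'\<rparr>) B')"
proof (rule mod_iso_quot)
  note m = submodule.submodule_is_module
  interpret X: module K X by fact
  interpret Y: module K Y by fact
  note EZ = X.submoduleE[OF X(2)]
  show "module K (X\<lparr>carrier := Z\<rparr>)" "module K (Y\<lparr>carrier := Z'\<rparr>)" using m X Y by blast+
  show "submodule B K (X\<lparr>carrier := Z\<rparr>)" "submodule B' K (Y\<lparr>carrier := Z'\<rparr>)"
    using submodule_restrict X Y by blast+
  show "h \<in> lin_maps K (X\<lparr>carrier := Z\<rparr>) (Y\<lparr>carrier := Z'\<rparr>)"
    by (rule lin_mapsI) (use h(2) subsetD[OF EZ(1)] lin_add[OF h(1)] lin_smult[OF h(1)] in auto)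
  fix y assume y: "y \<in> carrier (Y\<lparr>carrier := Z'\<rparr>)"
  then show "\<exists>x\<in>carrier (X\<lparr>carrier := Z\<rparr>). h x \<ominus>\<^bsub>Y\<lparr>carrier := Z'\<rparr>\<^esub> y \<in> B'"
    using surj[of y] a_inv_restrict[OF Y(1,2), of y] by (simp add: a_minus_def)
qed (use h(3) in simp)

text \<open>No condition falls on \<open>d 0\<close>: as in \<open>homology\<close>, every element
  of degree 0 counts as a cycle.\<close>

definition "chain_complex K C d \<longleftrightarrow> (\<forall>p. module K (C p)) \<and> (\<forall>p. d (Suc p) \<in> lin_maps K (C (Suc p)) (C p)) \<and>
  (\<forall>p. \<forall>x\<in>carrier (C (Suc (Suc p))). d (Suc p) (d (Suc (Suc p)) x) = \<zero>\<^bsub>C p\<^esub>)"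

definition "cochain_complex K C d \<longleftrightarrow> (\<forall>p. module K (C p)) \<and> (\<forall>p. d p \<in> lin_maps K (C p) (C (Suc p))) \<and>
  (\<forall>p. \<forall>x\<in>carrier (C p). d (Suc p) (d p x) = \<zero>\<^bsub>C (Suc (Suc p))\<^esub>)"

lemma chain_subs:
  assumes "chain_complex K C d"
  shows "submodule {x \<in> carrier (C p). p = 0 \<or> d p x = \<zero>\<^bsub>C (p - 1)\<^esub>} K (C p)"
    and "submodule (d (p + 1) ` carrier (C (p + 1))) K (C p)"
    and "d (p + 1) ` carrier (C (p + 1)) \<subseteq> {x \<in> carrier (C p). p = 0 \<or> d p x = \<zero>\<^bsub>C (p - 1)\<^esub>}"
proof -
  have m: "module K (C q)" and d: "d (Suc q) \<in> lin_maps K (C (Suc q)) (C q)" for q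
    using assms by (auto simp: chain_complex_def)
  have dd: "d (Suc q) (d (Suc (Suc q)) x) = \<zero>\<^bsub>C q\<^esub>" if "x \<in> carrier (C (Suc (Suc q)))" for q x
    using assms that by (auto simp: chain_complex_def)
  show "submodule {x \<in> carrier (C p). p = 0 \<or> d p x = \<zero>\<^bsub>C (p - 1)\<^esub>} K (C p)"
  proof (cases p)
    case 0
    then show ?thesis using module.carrier_is_submodule[OF m[of 0]] by simp
  next
    case (Suc q)
    then show ?thesis using submodule_kernel[OF m m d[of q]] by simp
  qed
  show "submodule (d (p + 1) ` carrier (C (p + 1))) K (C p)"
    using submodule_image[OF m m d[of p]] by simp
  show "d (p + 1) ` carrier (C (p + 1)) \<subseteq> {x \<in> carrier (C p). p = 0 \<or> d p x = \<zero>\<^bsub>C (p - 1)\<^esub>}"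
    by (cases p) (use lin_closed[OF d] dd in auto)
qed

lemma homology_module:
  assumes "chain_complex K C d"
  shows "module K (homology C d p)"
proof -
  have "module K (C p)" using assms by (simp add: chain_complex_def)
  then show ?thesis unfolding homology_def
    by (intro quot_module submodule_restrict submodule.submodule_is_module chain_subs[OF assms])
qed

text \<open>Tailored to a surjective chain map with acyclic kernel: cycles then lift to cycles on
  the nose, not merely up to boundaries, and a cycle lying over a boundary is a boundary.\<close>

lemma homology_iso:
  assumes C: "chain_complex K C d" and E: "chain_complex K E dE"
    and h: "\<And>p. h p \<in> lin_maps K (C p) (E p)"
    and hd: "\<And>p x. x \<in> carrier (C (Suc p)) \<Longrightarrow> h p (d (Suc p) x) = dE (Suc p) (h (Suc p) x)"
    and surj: "\<And>p y. \<lbrakk>y \<in> carrier (E p); p = 0 \<or> dE p y = \<zero>\<^bsub>E (p - 1)\<^esub>\<rbrakk> \<Longrightarrow>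
      \<exists>x\<in>carrier (C p). (p = 0 \<or> d p x = \<zero>\<^bsub>C (p - 1)\<^esub>) \<and> h p x = y"
    and inj: "\<And>p x y. \<lbrakk>x \<in> carrier (C p); p = 0 \<or> d p x = \<zero>\<^bsub>C (p - 1)\<^esub>; y \<in> carrier (E (Suc p));
      h p x = dE (Suc p) y\<rbrakk> \<Longrightarrow> x \<in> d (Suc p) ` carrier (C (Suc p))"
  shows "mod_iso K (homology C d p) (homology E dE p)"
proof -
  have m: "module K (C q)" "module K (E q)" for q
    using C E by (auto simp: chain_complex_def)
  show ?thesis unfolding homology_def
  proof (rule subquotient_iso[OF m(1) chain_subs[OF C] m(2) chain_subs[OF E] h])
    fix x assume x: "x \<in> {x \<in> carrier (C p). p = 0 \<or> d p x = \<zero>\<^bsub>C (p - 1)\<^esub>}"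
    show "h p x \<in> {x \<in> carrier (E p). p = 0 \<or> dE p x = \<zero>\<^bsub>E (p - 1)\<^esub>}"
      by (cases p) (use x lin_closed[OF h] hd lin_zero[OF m(1) m(2) h] in force)+
    show "(h p x \<in> dE (p + 1) ` carrier (E (p + 1))) = (x \<in> d (p + 1) ` carrier (C (p + 1)))"
    proof
      assume "h p x \<in> dE (p + 1) ` carrier (E (p + 1))"
      then show "x \<in> d (p + 1) ` carrier (C (p + 1))" using inj[of x p] x by auto
    next
      assume "x \<in> d (p + 1) ` carrier (C (p + 1))"
      then show "h p x \<in> dE (p + 1) ` carrier (E (p + 1))" using hd lin_closed[OF h] by fastforce
    qed
  next
    fix y assume y: "y \<in> {x \<in> carrier (E p). p = 0 \<or> dE p x = \<zero>\<^bsub>E (p - 1)\<^esub>}"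
    then obtain x where "x \<in> carrier (C p)" "p = 0 \<or> d p x = \<zero>\<^bsub>C (p - 1)\<^esub>" "h p x = y"
      using surj[of y p] by blast
    then show "\<exists>x\<in>{x \<in> carrier (C p). p = 0 \<or> d p x = \<zero>\<^bsub>C (p - 1)\<^esub>}. h p x \<ominus>\<^bsub>E p\<^esub> y \<in> dE (p + 1) ` carrier (E (p + 1))"
      using y module_diff_self[OF m(2)] submodule_zero[OF m(2) chain_subs(2)[OF E]] by auto
  qed
qed

lemma cochain_subs:
  assumes "cochain_complex K C d"
  shows "submodule {x \<in> carrier (C p). d p x = \<zero>\<^bsub>C (p + 1)\<^esub>} K (C p)"
    and "submodule (if p = 0 then {\<zero>\<^bsub>C 0\<^esub>} else d (p - 1) ` carrier (C (p - 1))) K (C p)"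
    and "(if p = 0 then {\<zero>\<^bsub>C 0\<^esub>} else d (p - 1) ` carrier (C (p - 1))) \<subseteq> {x \<in> carrier (C p). d p x = \<zero>\<^bsub>C (p + 1)\<^esub>}"
proof -
  have m: "module K (C q)" and d: "d q \<in> lin_maps K (C q) (C (Suc q))" for q
    using assms by (auto simp: cochain_complex_def)
  have dd: "d (Suc q) (d q x) = \<zero>\<^bsub>C (Suc (Suc q))\<^esub>" if "x \<in> carrier (C q)" for q x
    using assms that by (auto simp: cochain_complex_def)
  show "submodule {x \<in> carrier (C p). d p x = \<zero>\<^bsub>C (p + 1)\<^esub>} K (C p)"
    using submodule_kernel[OF m m d[of p]] by simp
  interpret C0: module K "C 0" by (rule m)
  have "submodule {\<zero>\<^bsub>C 0\<^esub>} K (C 0)" by (rule C0.submoduleI) auto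
  then show "submodule (if p = 0 then {\<zero>\<^bsub>C 0\<^esub>} else d (p - 1) ` carrier (C (p - 1))) K (C p)"
    using submodule_image[OF m m d[of "p - 1"]] by (cases p) auto
  show "(if p = 0 then {\<zero>\<^bsub>C 0\<^esub>} else d (p - 1) ` carrier (C (p - 1))) \<subseteq> {x \<in> carrier (C p). d p x = \<zero>\<^bsub>C (p + 1)\<^esub>}"
    by (cases p) (use lin_closed[OF d] dd lin_zero[OF m m d] in auto)
qed

text \<open>Here the comparison map is injective and goes from the small complex \<open>E\<close>
  into the large one; every cocycle of \<open>C\<close> can be pushed into the image of
  \<open>h\<close> by a coboundary. Degree 0 has no coboundaries, hence the case
  distinctions.\<close>

lemma cohomology_iso:
  assumes C: "cochain_complex K C d" and E: "cochain_complex K E dE"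
    and h: "\<And>p. h p \<in> lin_maps K (E p) (C p)"
    and hd: "\<And>p x. x \<in> carrier (E p) \<Longrightarrow> h (Suc p) (dE p x) = d p (h p x)"
    and inj: "\<And>p x y. \<lbrakk>x \<in> carrier (E p); h p x = \<zero>\<^bsub>C p\<^esub>\<rbrakk> \<Longrightarrow> x = \<zero>\<^bsub>E p\<^esub>"
    and surj: "\<And>p f. \<lbrakk>f \<in> carrier (C p); d p f = \<zero>\<^bsub>C (Suc p)\<^esub>\<rbrakk> \<Longrightarrow>
      \<exists>x\<in>carrier (E p). dE p x = \<zero>\<^bsub>E (Suc p)\<^esub> \<and>
        (if p = 0 then f = h p x else \<exists>g\<in>carrier (C (p - 1)). f = d (p - 1) g \<oplus>\<^bsub>C p\<^esub> h p x)"
    and ker: "\<And>p x g. \<lbrakk>x \<in> carrier (E (Suc p)); g \<in> carrier (C p); h (Suc p) x = d p g\<rbrakk> \<Longrightarrow>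
      x \<in> dE p ` carrier (E p)"
  shows "mod_iso K (cohomology E dE p) (cohomology C d p)"
proof -
  have m: "module K (C q)" "module K (E q)" for q
    using C E by (auto simp: cochain_complex_def)
  have dl: "d q \<in> lin_maps K (C q) (C (Suc q))" for q using C by (auto simp: cochain_complex_def)
  let ?BC = "if p = 0 then {\<zero>\<^bsub>C 0\<^esub>} else d (p - 1) ` carrier (C (p - 1))"
  let ?BE = "if p = 0 then {\<zero>\<^bsub>E 0\<^esub>} else dE (p - 1) ` carrier (E (p - 1))"
  show ?thesis unfolding cohomology_def
  proof (rule subquotient_iso[OF m(2) cochain_subs[OF E] m(1) cochain_subs[OF C] h])
    fix x assume x: "x \<in> {x \<in> carrier (E p). dE p x = \<zero>\<^bsub>E (p + 1)\<^esub>}"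
    have "d p (h p x) = h (Suc p) (dE p x)" using hd[of x p] x by auto
    then show "h p x \<in> {x \<in> carrier (C p). d p x = \<zero>\<^bsub>C (p + 1)\<^esub>}"
      using x lin_closed[OF h] lin_zero[OF m(2) m(1) h] by auto
    show "(h p x \<in> ?BC) = (x \<in> ?BE)"
    proof (cases p)
      case 0
      then show ?thesis using inj[of x 0] x lin_zero[OF m(2) m(1) h] by auto
    next
      case (Suc q)
      have "x \<in> dE q ` carrier (E q)" if "h p x \<in> d q ` carrier (C q)"
        using that ker[of x q] x Suc by auto
      moreover have "h p x \<in> d q ` carrier (C q)" if "x \<in> dE q ` carrier (E q)"
        using that hd Suc lin_closed[OF h] by auto
      ultimately show ?thesis using Suc by auto
    qed
  next
    fix f assume f: "f \<in> {x \<in> carrier (C p). d p x = \<zero>\<^bsub>C (p + 1)\<^esub>}"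
    then obtain x where x: "x \<in> carrier (E p)" "dE p x = \<zero>\<^bsub>E (Suc p)\<^esub>"
      "if p = 0 then f = h p x else \<exists>g\<in>carrier (C (p - 1)). f = d (p - 1) g \<oplus>\<^bsub>C p\<^esub> h p x"
      using surj[of f p] by auto
    note hx = lin_closed[OF h x(1)]
    have "h p x \<ominus>\<^bsub>C p\<^esub> f \<in> ?BC"
    proof (cases p)
      case 0
      then show ?thesis using x(3) hx module_diff_self[OF m(1)] by auto
    next
      case (Suc q)
      then obtain g where g: "g \<in> carrier (C q)" "f = d q g \<oplus>\<^bsub>C p\<^esub> h p x" using x(3) by auto
      interpret Cp: module K "C p" by (rule m)
      note dg = lin_closed[OF dl g(1), folded Suc]
      have "h p x \<ominus>\<^bsub>C p\<^esub> f = \<ominus>\<^bsub>C p\<^esub> d q g"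
        using hx dg by (simp add: g(2) a_minus_def Cp.minus_add Cp.a_comm[of "\<ominus>\<^bsub>C p\<^esub> d q g"] Cp.r_neg2)
      also have "\<dots> = d q (\<ominus>\<^bsub>C q\<^esub> g)" using lin_neg[OF m(1) m(1) dl g(1)] Suc by simp
      finally show ?thesis
        using Suc g(1) abelian_group.a_inv_closed[OF module_abelian_group[OF m(1)]] by auto
    qed
    then show "\<exists>x\<in>{x \<in> carrier (E p). dE p x = \<zero>\<^bsub>E (p + 1)\<^esub>}. h p x \<ominus>\<^bsub>C p\<^esub> f \<in> ?BC"
      using x by auto
  qed
qed

section \<open>Total complexes of double complexes\<close>

lemma tot_simps:
  "carrier (tot D n) = (\<Pi>\<^sub>E i\<in>{..n}. carrier (D i (n - i)))"
  "zero (tot D n) = (\<lambda>i\<in>{..n}. \<zero>\<^bsub>D i (n - i)\<^esub>)"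
  "add (tot D n) = (\<lambda>f g. \<lambda>i\<in>{..n}. f i \<oplus>\<^bsub>D i (n - i)\<^esub> g i)"
  "smult (tot D n) = (\<lambda>c f. \<lambda>i\<in>{..n}. c \<odot>\<^bsub>D i (n - i)\<^esub> f i)"
  by (simp_all add: tot_def)

lemma tot_module:
  assumes m: "\<And>i j. module K (D i j)"
  shows "module K (tot D n)"
proof -
  have g: "abelian_group (D i j)" for i j by (rule module_abelian_group[OF m])
  note z = abelian_monoid.zero_closed[OF abelian_group.axioms(1)[OF g]]
    and c = abelian_monoid.a_closed[OF abelian_group.axioms(1)[OF g]]
    and ac = abelian_monoid.a_assoc[OF abelian_group.axioms(1)[OF g]]
    abelian_monoid.a_comm[OF abelian_group.axioms(1)[OF g]]
    abelian_monoid.l_zero[OF abelian_group.axioms(1)[OF g]]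
    abelian_group.l_neg[OF g]
  have e: "f i \<in> carrier (D i (n - i))" if "f \<in> carrier (tot D n)" "i \<le> n" for f i
    using that by (auto simp: tot_simps)
  have ext: "f = g" if "f \<in> extensional {..n}" "g \<in> extensional {..n}" "\<And>i. i \<le> n \<Longrightarrow> f i = g i" for f g :: "nat \<Rightarrow> 'c"
    using that by (intro extensionalityI[of _ "{..n}"]) auto
  have x: "f \<in> extensional {..n}" if "f \<in> carrier (tot D n)" for f
    using that by (auto simp: tot_simps PiE_def)
  show ?thesis
  proof (rule moduleI)
    show "cring K" using m[of 0 0] by (simp add: module_def)
    show "abelian_group (tot D n)"
    proof (rule abelian_groupI)
      fix f assume f: "f \<in> carrier (tot D n)"
      show "\<zero>\<^bsub>tot D n\<^esub> \<oplus>\<^bsub>tot D n\<^esub> f = f"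
        by (rule ext) (use x[OF f] e[OF f] ac in \<open>simp_all add: tot_simps\<close>)
      show "\<exists>g\<in>carrier (tot D n). g \<oplus>\<^bsub>tot D n\<^esub> f = \<zero>\<^bsub>tot D n\<^esub>"
      proof (rule bexI)
        show "(\<lambda>i\<in>{..n}. \<ominus>\<^bsub>D i (n - i)\<^esub> f i) \<oplus>\<^bsub>tot D n\<^esub> f = \<zero>\<^bsub>tot D n\<^esub>"
          by (rule ext) (use e[OF f] ac in \<open>simp_all add: tot_simps\<close>)
      qed (use e[OF f] abelian_group.a_inv_closed[OF g] in \<open>auto simp: tot_simps\<close>)
      fix g assume g: "g \<in> carrier (tot D n)"
      show "f \<oplus>\<^bsub>tot D n\<^esub> g \<in> carrier (tot D n)"
        using e[OF f] e[OF g] c by (auto simp: tot_simps)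
      show "f \<oplus>\<^bsub>tot D n\<^esub> g = g \<oplus>\<^bsub>tot D n\<^esub> f"
        by (rule ext) (use e[OF f] e[OF g] ac(2) in \<open>simp_all add: tot_simps\<close>)
      fix h assume h: "h \<in> carrier (tot D n)"
      show "f \<oplus>\<^bsub>tot D n\<^esub> g \<oplus>\<^bsub>tot D n\<^esub> h = f \<oplus>\<^bsub>tot D n\<^esub> (g \<oplus>\<^bsub>tot D n\<^esub> h)"
        by (rule ext) (use e[OF f] e[OF g] e[OF h] ac(1) in \<open>simp_all add: tot_simps\<close>)
    qed (use z in \<open>auto simp: tot_simps\<close>)
  next
    fix f k assume f: "f \<in> carrier (tot D n)" and k: "k \<in> carrier K"
    show "k \<odot>\<^bsub>tot D n\<^esub> f \<in> carrier (tot D n)"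
      using e[OF f] k module.smult_closed[OF m] by (auto simp: tot_simps)
    fix g assume g: "g \<in> carrier (tot D n)"
    show "k \<odot>\<^bsub>tot D n\<^esub> (f \<oplus>\<^bsub>tot D n\<^esub> g) = k \<odot>\<^bsub>tot D n\<^esub> f \<oplus>\<^bsub>tot D n\<^esub> k \<odot>\<^bsub>tot D n\<^esub> g"
      by (rule ext) (use e[OF f] e[OF g] k module.smult_r_distr[OF m] in \<open>simp_all add: tot_simps\<close>)
  next
    fix f k l assume f: "f \<in> carrier (tot D n)" and k: "k \<in> carrier K" "l \<in> carrier K"
    show "(k \<oplus>\<^bsub>K\<^esub> l) \<odot>\<^bsub>tot D n\<^esub> f = k \<odot>\<^bsub>tot D n\<^esub> f \<oplus>\<^bsub>tot D n\<^esub> l \<odot>\<^bsub>tot D n\<^esub> f"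
      by (rule ext) (use e[OF f] k module.smult_l_distr[OF m] in \<open>simp_all add: tot_simps\<close>)
    show "(k \<otimes>\<^bsub>K\<^esub> l) \<odot>\<^bsub>tot D n\<^esub> f = k \<odot>\<^bsub>tot D n\<^esub> (l \<odot>\<^bsub>tot D n\<^esub> f)"
      by (rule ext) (use e[OF f] k module.smult_assoc1[OF m] in \<open>simp_all add: tot_simps\<close>)
  next
    fix f assume f: "f \<in> carrier (tot D n)"
    show "\<one>\<^bsub>K\<^esub> \<odot>\<^bsub>tot D n\<^esub> f = f"
      by (rule ext) (use x[OF f] e[OF f] module.smult_one[OF m] in \<open>simp_all add: tot_simps\<close>)
  qed
qed

lemma tot_eqI: "\<lbrakk>f \<in> carrier (tot D n); g \<in> carrier (tot D n); \<And>i. i \<le> n \<Longrightarrow> f i = g i\<rbrakk> \<Longrightarrow> f = g"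
  by (rule extensionalityI[of _ "{..n}"]) (auto simp: tot_simps PiE_def)

lemma tot_in: "\<lbrakk>f \<in> carrier (tot D n); i \<le> n\<rbrakk> \<Longrightarrow> f i \<in> carrier (D i (n - i))"
  by (auto simp: tot_simps)

text \<open>For each \<open>i\<close> the complex \<open>D i\<close> with differential
  \<open>dv\<close> resolves \<open>E i\<close> through \<open>e i\<close>. The two differentials
  commute; the sign that makes the total differential square to zero is supplied by
  \<open>tot_d\<close>. In the application the exact direction is that of the projective
  resolution.\<close>

locale augmented_double_complex =
  fixes K :: "'k ring" and D :: "nat \<Rightarrow> nat \<Rightarrow> ('k, 'x) module" and dh dv :: "nat \<Rightarrow> nat \<Rightarrow> 'x \<Rightarrow> 'x"
    and E :: "nat \<Rightarrow> ('k, 'y) module" and dE :: "nat \<Rightarrow> 'y \<Rightarrow> 'y" and e :: "nat \<Rightarrow> 'x \<Rightarrow> 'y"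
  assumes D: "module K (D i j)"
    and dh: "dh (Suc i) j \<in> lin_maps K (D (Suc i) j) (D i j)"
    and dv: "dv i (Suc j) \<in> lin_maps K (D i (Suc j)) (D i j)"
    and dhdh: "x \<in> carrier (D (Suc (Suc i)) j) \<Longrightarrow> dh (Suc i) j (dh (Suc (Suc i)) j x) = \<zero>\<^bsub>D i j\<^esub>"
    and dvdv: "x \<in> carrier (D i (Suc (Suc j))) \<Longrightarrow> dv i (Suc j) (dv i (Suc (Suc j)) x) = \<zero>\<^bsub>D i j\<^esub>"
    and dhdv: "x \<in> carrier (D (Suc i) (Suc j)) \<Longrightarrow>
      dh (Suc i) j (dv (Suc i) (Suc j) x) = dv i (Suc j) (dh (Suc i) (Suc j) x)"
    and E: "chain_complex K E dE"
    and e: "e i \<in> lin_maps K (D i 0) (E i)"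
    and e_surj: "y \<in> carrier (E i) \<Longrightarrow> \<exists>x\<in>carrier (D i 0). e i x = y"
    and e_dv: "x \<in> carrier (D i (Suc 0)) \<Longrightarrow> e i (dv i (Suc 0) x) = \<zero>\<^bsub>E i\<^esub>"
    and e_dh: "x \<in> carrier (D (Suc i) 0) \<Longrightarrow> e i (dh (Suc i) 0 x) = dE (Suc i) (e (Suc i) x)"
    and exact0: "\<lbrakk>x \<in> carrier (D i 0); e i x = \<zero>\<^bsub>E i\<^esub>\<rbrakk> \<Longrightarrow> \<exists>y\<in>carrier (D i (Suc 0)). dv i (Suc 0) y = x"
    and exact: "\<lbrakk>x \<in> carrier (D i (Suc j)); dv i (Suc j) x = \<zero>\<^bsub>D i j\<^esub>\<rbrakk> \<Longrightarrow>
      \<exists>y\<in>carrier (D i (Suc (Suc j))). dv i (Suc (Suc j)) y = x"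
begin

abbreviation "T \<equiv> tot D"
abbreviation "dT \<equiv> tot_d D dh dv"

lemma Em: "module K (E i)" and dE: "dE (Suc i) \<in> lin_maps K (E (Suc i)) (E i)"
  using E by (auto simp: chain_complex_def)

lemma T: "module K (T n)" by (rule tot_module[OF D])

lemma dT_eq: "i \<le> n \<Longrightarrow> dT (Suc n) f i = dh (Suc i) (n - i) (f (Suc i)) \<oplus>\<^bsub>D i (n - i)\<^esub>
    signed (D i (n - i)) i (dv i (Suc (n - i)) (f i))"
  by (simp add: tot_d_def Suc_diff_le)

lemma T_mem: "\<lbrakk>f \<in> carrier (T (Suc n)); i \<le> n\<rbrakk> \<Longrightarrow> f (Suc i) \<in> carrier (D (Suc i) (n - i))"
  "\<lbrakk>f \<in> carrier (T (Suc n)); i \<le> n\<rbrakk> \<Longrightarrow> f i \<in> carrier (D i (Suc (n - i)))"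
  using tot_in[of f D "Suc n" "Suc i"] tot_in[of f D "Suc n" i] by (auto simp: Suc_diff_le)

lemma dT_term_lin:
  assumes "i \<le> n"
  shows "(\<lambda>f. dT (Suc n) f i) \<in> lin_maps K (T (Suc n)) (D i (n - i))"
proof -
  have 1: "(\<lambda>f. f (Suc i)) \<in> lin_maps K (T (Suc n)) (D (Suc i) (n - i))"
    by (rule lin_mapsI) (use assms T_mem in \<open>auto simp: tot_simps(3,4)\<close>)
  have 2: "(\<lambda>f. f i) \<in> lin_maps K (T (Suc n)) (D i (Suc (n - i)))"
    by (rule lin_mapsI) (use assms T_mem in \<open>auto simp: tot_simps(3,4) Suc_diff_le\<close>)
  show ?thesis unfolding dT_eq[OF assms]
    by (intro lin_sum[OF D] lin_sgn[OF D] lin_comp[OF 1 dh] lin_comp[OF 2 dv])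
qed

lemma dT_lin: "dT (Suc n) \<in> lin_maps K (T (Suc n)) (T n)"
proof (rule lin_mapsI)
  note c = lin_closed[OF dT_term_lin]
  have d: "dT (Suc n) f \<in> carrier (T n)" if "f \<in> carrier (T (Suc n))" for f
  proof -
    have "dT (Suc n) f \<in> extensional {..n}" by (simp add: tot_d_def)
    then show ?thesis using c[OF _ that] by (auto simp: tot_simps(1) PiE_def)
  qed
  show "dT (Suc n) f \<in> carrier (T n)" if "f \<in> carrier (T (Suc n))" for f by (rule d[OF that])
  interpret S: module K "T (Suc n)" by (rule T)
  interpret N: module K "T n" by (rule T)
  fix f assume f: "f \<in> carrier (T (Suc n))"
  show "dT (Suc n) (f \<oplus>\<^bsub>T (Suc n)\<^esub> g) = dT (Suc n) f \<oplus>\<^bsub>T n\<^esub> dT (Suc n) g" if g: "g \<in> carrier (T (Suc n))" for g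
  proof (rule tot_eqI)
    show "dT (Suc n) (f \<oplus>\<^bsub>T (Suc n)\<^esub> g) \<in> carrier (T n)" "dT (Suc n) f \<oplus>\<^bsub>T n\<^esub> dT (Suc n) g \<in> carrier (T n)"
      using d f g by blast+
    show "dT (Suc n) (f \<oplus>\<^bsub>T (Suc n)\<^esub> g) i = (dT (Suc n) f \<oplus>\<^bsub>T n\<^esub> dT (Suc n) g) i" if "i \<le> n" for i
      using lin_add[OF dT_term_lin[OF that] f g] that by (simp add: tot_simps(3)[of D n])
  qed
  show "dT (Suc n) (k \<odot>\<^bsub>T (Suc n)\<^esub> f) = k \<odot>\<^bsub>T n\<^esub> dT (Suc n) f" if k: "k \<in> carrier K" for k
  proof (rule tot_eqI)
    show "dT (Suc n) (k \<odot>\<^bsub>T (Suc n)\<^esub> f) \<in> carrier (T n)" "k \<odot>\<^bsub>T n\<^esub> dT (Suc n) f \<in> carrier (T n)"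
      using d f k by blast+
    show "dT (Suc n) (k \<odot>\<^bsub>T (Suc n)\<^esub> f) i = (k \<odot>\<^bsub>T n\<^esub> dT (Suc n) f) i" if "i \<le> n" for i
      using lin_smult[OF dT_term_lin[OF that] k f] that by (simp add: tot_simps(4)[of D n])
  qed
qed

text \<open>The sign in \<open>tot_d\<close> depends on the first index, which differs by one
  between the two mixed terms, so they cancel.\<close>

lemma dTdT:
  assumes f: "f \<in> carrier (T (Suc (Suc n)))"
  shows "dT (Suc n) (dT (Suc (Suc n)) f) = \<zero>\<^bsub>T n\<^esub>"
proof (rule tot_eqI)
  let ?g = "dT (Suc (Suc n)) f"
  note g = lin_closed[OF dT_lin f]
  show "dT (Suc n) ?g \<in> carrier (T n)" by (rule lin_closed[OF dT_lin g])
  show "\<zero>\<^bsub>T n\<^esub> \<in> carrier (T n)" by (rule module_zero_closed[OF T])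
  fix i assume i: "i \<le> n"
  interpret X: module K "D i (n - i)" by (rule D)
  have "f (Suc (Suc i)) \<in> carrier (D (Suc (Suc i)) (n - i))" "f (Suc i) \<in> carrier (D (Suc i) (Suc (n - i)))"
    "f i \<in> carrier (D i (Suc (Suc (n - i))))"
    using tot_in[OF f, of "Suc (Suc i)"] tot_in[OF f, of "Suc i"] tot_in[OF f, of i] i
    by (auto simp: Suc_diff_le)
  note F = this
  let ?b = "dv i (Suc (n - i)) (dh (Suc i) (Suc (n - i)) (f (Suc i)))"
  have b: "?b \<in> carrier (D i (n - i))" by (rule lin_closed[OF dv lin_closed[OF dh F(2)]])
  have g1: "?g (Suc i) = dh (Suc (Suc i)) (n - i) (f (Suc (Suc i))) \<oplus>\<^bsub>D (Suc i) (n - i)\<^esub>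
      signed (D (Suc i) (n - i)) (Suc i) (dv (Suc i) (Suc (n - i)) (f (Suc i)))"
    using dT_eq[of "Suc i" "Suc n" f] i by simp
  have g2: "?g i = dh (Suc i) (Suc (n - i)) (f (Suc i)) \<oplus>\<^bsub>D i (Suc (n - i))\<^esub>
      signed (D i (Suc (n - i))) i (dv i (Suc (Suc (n - i))) (f i))"
    using dT_eq[of i "Suc n" f] i by (simp add: Suc_diff_le)
  have "dh (Suc i) (n - i) (?g (Suc i)) = signed (D i (n - i)) (Suc i) ?b"
    using b by (simp add: g1 lin_add[OF dh] lin_closed[OF dh F(1)] lin_closed[OF dv F(2)] signed_closed[OF D]
      dhdh[OF F(1)] lin_signed[OF D D dh] dhdv[OF F(2)])
  moreover have "dv i (Suc (n - i)) (?g i) = ?b"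
    using b by (simp add: g2 lin_add[OF dv] lin_closed[OF dh F(2)] lin_closed[OF dv F(3)] signed_closed[OF D]
      dvdv[OF F(3)] lin_signed[OF D D dv] signed_zero[OF D])
  ultimately show "dT (Suc n) ?g i = \<zero>\<^bsub>T n\<^esub> i"
    using i b signed_closed[OF D b] by (simp add: dT_eq tot_simps(2) signed_Suc[OF D] X.l_neg)
qed

lemma T_complex: "chain_complex K T dT"
  using T dT_lin dTdT by (simp add: chain_complex_def)

lemma aug_lin: "(\<lambda>f. e n (f n)) \<in> lin_maps K (T n) (E n)"
proof -
  have "(\<lambda>f. f n) \<in> lin_maps K (T n) (D n 0)"
    by (rule lin_mapsI) (use tot_in[of _ D n n] in \<open>auto simp: tot_simps(3,4)\<close>)
  then show ?thesis by (rule lin_comp[OF _ e])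
qed

text \<open>Only the component with second index 0 is seen by the augmentation, and its vertical
  contribution dies under \<open>e\<close>.\<close>

lemma aug_chain:
  assumes f: "f \<in> carrier (T (Suc n))"
  shows "e n (dT (Suc n) f n) = dE (Suc n) (e (Suc n) (f (Suc n)))"
proof -
  interpret E: module K "E n" by (rule Em)
  have F: "f (Suc n) \<in> carrier (D (Suc n) 0)" "f n \<in> carrier (D n (Suc 0))"
    using T_mem[OF f, of n] by auto
  show ?thesis using dT_eq[of n n f] lin_closed[OF dE lin_closed[OF e F(1)]]
    by (simp add: lin_add[OF e] lin_closed[OF dh F(1)] lin_closed[OF dv F(2)] signed_closed[OF D]
      lin_signed[OF D Em e] e_dv[OF F(2)] e_dh[OF F(1)] signed_zero[OF Em])
qed

text \<open>The components of the primitive are found in the order of descending first index.\<close>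

lemma kernel_acyclic:
  assumes c: "c \<in> carrier (T n)" "n = 0 \<or> dT n c = \<zero>\<^bsub>T (n - 1)\<^esub>" "e n (c n) = \<zero>\<^bsub>E n\<^esub>"
  shows "\<exists>f\<in>carrier (T (Suc n)). f (Suc n) = \<zero>\<^bsub>D (Suc n) 0\<^esub> \<and> dT (Suc n) f = c"
proof -
  have C: "c i \<in> carrier (D i (n - i))" if "i \<le> n" for i using tot_in[OF c(1) that] .
  \<comment> \<open>After \<open>k\<close> rounds the components of index above \<open>n - k\<close>
    are final. The top component is chosen as zero, so that the primitive can be subtracted without
    changing an augmentation.\<close>
  have "\<exists>f. f (Suc n) = \<zero>\<^bsub>D (Suc n) 0\<^esub> \<and> (\<forall>i\<le>Suc n. n < i + k \<longrightarrow> f i \<in> carrier (D i (Suc n - i))) \<and>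
      (\<forall>i\<le>n. n < i + k \<longrightarrow> dT (Suc n) f i = c i)" if "k \<le> Suc n" for k
    using that
  proof (induction k)
    case 0
    \<comment> \<open>Only the value at \<open>Suc n\<close> is constrained at this stage, so a
      constant function will do.\<close>
    then show ?case by (intro exI[of _ "\<lambda>_. \<zero>\<^bsub>D (Suc n) 0\<^esub>"]) (auto simp: module_zero_closed[OF D] le_Suc_eq)
  next
    case (Suc k)
    then obtain f where f: "f (Suc n) = \<zero>\<^bsub>D (Suc n) 0\<^esub>" "\<And>i. \<lbrakk>i \<le> Suc n; n < i + k\<rbrakk> \<Longrightarrow> f i \<in> carrier (D i (Suc n - i))"
      "\<And>i. \<lbrakk>i \<le> n; n < i + k\<rbrakk> \<Longrightarrow> dT (Suc n) f i = c i" by auto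
    define i where "i = n - k"
    have i: "i \<le> n" "n = i + k" using Suc by (auto simp: i_def)
    have nk: "n - i = k" using i by simp
    interpret X: module K "D i k" by (rule D)
    have fSi: "f (Suc i) \<in> carrier (D (Suc i) k)"
    proof (cases k)
      case 0
      then show ?thesis using f(1) i module_zero_closed[OF D] by simp
    next
      case (Suc l)
      then show ?thesis using f(2)[of "Suc i"] i by simp
    qed
    let ?h = "dh (Suc i) k (f (Suc i))"
    have h: "?h \<in> carrier (D i k)" by (rule lin_closed[OF dh fSi])
    have ci: "c i \<in> carrier (D i k)" using C i by (metis nk)
    \<comment> \<open>Up to sign, what \<open>dv\<close> of the component at \<open>i\<close> still
      has to produce once the horizontal contribution of its neighbour is taken off.\<close>
    let ?y = "c i \<ominus>\<^bsub>D i k\<^esub> ?h"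
    have y: "?y \<in> carrier (D i k)" by (rule module_diff_closed[OF D ci h])
    \<comment> \<open>The residue lies in the image of \<open>dv\<close>. For \<open>k = 0\<close>
      the augmentation kills it; otherwise it is a vertical cycle, because \<open>c\<close> is a
      cycle and the equation at index \<open>i + 1\<close> already holds.\<close>
    have "\<exists>z\<in>carrier (D i (Suc k)). dv i (Suc k) z = ?y"
    proof (cases k)
      case 0
      have "?h = \<zero>\<^bsub>D i k\<^esub>" using f(1) i 0 lin_zero[OF D D dh] by simp
      then have "?y = c i" using module_add_sub[OF D X.zero_closed ci] ci by simp
      then have "e i ?y = \<zero>\<^bsub>E i\<^esub>" using c(3) i 0 by simp
      then show ?thesis using exact0[of ?y i] y 0 by simp
    next
      case (Suc l)
      obtain m where m: "n = Suc m" using i Suc by (cases n) auto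
      have ml: "m - i = l" "i \<le> m" using m i Suc by auto
      interpret Y: module K "D i l" by (rule D)
      have cSi: "c (Suc i) \<in> carrier (D (Suc i) l)" using C[of "Suc i"] m ml by simp
      let ?u = "f (Suc (Suc i))" let ?v = "dh (Suc i) l (dv (Suc i) (Suc l) (f (Suc i)))"
      have u: "?u \<in> carrier (D (Suc (Suc i)) l)"
      proof (cases l)
        case 0
        then show ?thesis using f(1) i Suc module_zero_closed[OF D] by simp
      next
        case (Suc l')
        then show ?thesis using f(2)[of "Suc (Suc i)"] i \<open>k = Suc l\<close> by simp
      qed
      have fSi': "f (Suc i) \<in> carrier (D (Suc i) (Suc l))" using fSi Suc by simp
      have vv: "?v \<in> carrier (D i l)" by (rule lin_closed[OF dh lin_closed[OF dv fSi']])
      have dc: "dh (Suc i) l (c (Suc i)) \<oplus>\<^bsub>D i l\<^esub> signed (D i l) i (dv i (Suc l) (c i)) = \<zero>\<^bsub>D i l\<^esub>"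
      proof -
        have "dT n c i = \<zero>\<^bsub>D i l\<^esub>" using c(2) m ml by (simp add: tot_simps(2))
        then show ?thesis using dT_eq[of i m c] ml m by simp
      qed
      have "dT (Suc n) f (Suc i) = c (Suc i)" using f(3)[of "Suc i"] i Suc by simp
      then have "dh (Suc (Suc i)) l ?u \<oplus>\<^bsub>D (Suc i) l\<^esub> signed (D (Suc i) l) (Suc i) (dv (Suc i) (Suc l) (f (Suc i))) = c (Suc i)"
        using dT_eq[of "Suc i" n f] ml m by simp
      then have "dh (Suc i) l (c (Suc i)) = dh (Suc i) l (dh (Suc (Suc i)) l ?u \<oplus>\<^bsub>D (Suc i) l\<^esub>
          signed (D (Suc i) l) (Suc i) (dv (Suc i) (Suc l) (f (Suc i))))" by simp
      also have "\<dots> = signed (D i l) (Suc i) ?v"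
        using lin_add[OF dh lin_closed[OF dh u] signed_closed[OF D lin_closed[OF dv fSi']]]
          dhdh[OF u] lin_signed[OF D D dh lin_closed[OF dv fSi']] signed_closed[OF D vv] by simp
      finally have "dh (Suc i) l (c (Suc i)) = signed (D i l) (Suc i) ?v" .
      then have "\<ominus>\<^bsub>D i l\<^esub> signed (D i l) i ?v \<oplus>\<^bsub>D i l\<^esub> signed (D i l) i (dv i (Suc l) (c i)) = \<zero>\<^bsub>D i l\<^esub>"
        using dc signed_Suc[OF D vv] by simp
      moreover have dci: "dv i (Suc l) (c i) \<in> carrier (D i l)" using lin_closed[OF dv] ci Suc by simp
      ultimately have "signed (D i l) i (dv i (Suc l) (c i)) = \<ominus>\<^bsub>D i l\<^esub> (\<ominus>\<^bsub>D i l\<^esub> signed (D i l) i ?v)"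
        by (intro module_neg_unique[OF D] signed_closed[OF D] Y.a_inv_closed vv)
      then have "signed (D i l) i (dv i (Suc l) (c i)) = signed (D i l) i ?v"
        using signed_closed[OF D vv] by simp
      then have "dv i (Suc l) (c i) = ?v" using signed_signed[OF D] dci vv by metis
      then have "dv i (Suc l) ?y = \<zero>\<^bsub>D i l\<^esub>"
        using lin_diff[OF D D dv, of "c i" i l ?h] ci h dhdv[OF fSi'] module_diff_self[OF D vv] Suc by simp
      then show ?thesis using exact[of ?y i l] y Suc by simp
    qed
    then obtain z where z: "z \<in> carrier (D i (Suc k))" "dv i (Suc k) z = ?y" by blast
    \<comment> \<open>\<open>tot_d\<close> multiplies by the sign of \<open>i\<close>; putting the
      same sign into the component cancels it.\<close>
    let ?z = "signed (D i (Suc k)) i z"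
    let ?f = "f(i := ?z)"
    have "signed (D i k) i (dv i (Suc k) ?z) = ?y"
      using z y by (simp add: lin_signed[OF D D dv] signed_signed[OF D])
    then have "dT (Suc n) ?f i = c i"
      using dT_eq[OF i(1), of ?f] nk module_sub_add[OF D ci h] by simp
    moreover have "dT (Suc n) ?f j = dT (Suc n) f j" if "j \<le> n" "i < j" for j
      using dT_eq[OF that(1)] that by simp
    ultimately have "dT (Suc n) ?f j = c j" if "j \<le> n" "n < j + Suc k" for j
      using f(3)[of j] that i by (cases "j = i") auto
    moreover have "?f j \<in> carrier (D j (Suc n - j))" if "j \<le> Suc n" "n < j + Suc k" for j
    proof (cases "j = i")
      case True
      then show ?thesis using signed_closed[OF D z(1)] i by (simp add: Suc_diff_le)
    qed (use f(2)[of j] that i in auto)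
    moreover have "?f (Suc n) = \<zero>\<^bsub>D (Suc n) 0\<^esub>" using f(1) i by simp
    ultimately show ?case by (intro exI[of _ ?f]) blast
  qed
  from this[of "Suc n"] obtain f where f: "f (Suc n) = \<zero>\<^bsub>D (Suc n) 0\<^esub>"
    "\<And>i. i \<le> Suc n \<Longrightarrow> f i \<in> carrier (D i (Suc n - i))" "\<And>i. i \<le> n \<Longrightarrow> dT (Suc n) f i = c i" by auto
  let ?f = "restrict f {..Suc n}"
  have m: "?f \<in> carrier (T (Suc n))" using f(2) by (auto simp: tot_simps)
  have "dT (Suc n) ?f i = dT (Suc n) f i" if "i \<le> n" for i using dT_eq[OF that] that by simp
  then have "dT (Suc n) ?f = c" using f(3)
    by (intro tot_eqI[OF lin_closed[OF dT_lin m] c(1)]) simp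
  then show ?thesis using m f(1) by (intro bexI[of _ ?f]) auto
qed

lemma aug_surj:
  assumes "y \<in> carrier (E n)"
  shows "\<exists>f\<in>carrier (T n). e n (f n) = y"
proof -
  obtain x where "x \<in> carrier (D n 0)" "e n x = y" using e_surj[OF assms] by blast
  then show ?thesis
    by (intro bexI[of _ "\<lambda>i\<in>{..n}. if i = n then x else \<zero>\<^bsub>D i (n - i)\<^esub>"])
      (auto simp: tot_simps module_zero_closed[OF D])
qed

text \<open>The projection to the top component goes from the total complex to \<open>E\<close> and
  is onto with acyclic kernel; the resulting isomorphism is inverted at the end.\<close>

lemma homology_tot_iso: "mod_iso K (homology E dE n) (homology T dT n)"
proof -
  have "mod_iso K (homology T dT n) (homology E dE n)"
  proof (rule homology_iso[where h = "\<lambda>n f. e n (f n)", OF T_complex E])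
    show "(\<lambda>f. e p (f p)) \<in> lin_maps K (T p) (E p)" for p by (rule aug_lin)
    show "e p (dT (Suc p) f p) = dE (Suc p) (e (Suc p) (f (Suc p)))" if "f \<in> carrier (T (Suc p))" for p f
      by (rule aug_chain[OF that])
  next
    fix n y assume y: "y \<in> carrier (E n)" "n = 0 \<or> dE n y = \<zero>\<^bsub>E (n - 1)\<^esub>"
    obtain f where f: "f \<in> carrier (T n)" "e n (f n) = y" using aug_surj[OF y(1)] by blast
    show "\<exists>x\<in>carrier (T n). (n = 0 \<or> dT n x = \<zero>\<^bsub>T (n - 1)\<^esub>) \<and> e n (x n) = y"
    proof (cases n)
      case 0
      then show ?thesis using f by auto
    next
      case (Suc m)
      have f': "f \<in> carrier (T (Suc m))" using f Suc by simp
      note df = lin_closed[OF dT_lin f']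
      have "e m (dT (Suc m) f m) = \<zero>\<^bsub>E m\<^esub>" using aug_chain[OF f'] f(2) y(2) Suc by simp
      moreover have "m = 0 \<or> dT m (dT (Suc m) f) = \<zero>\<^bsub>T (m - 1)\<^esub>" using dTdT f' by (cases m) auto
      \<comment> \<open>\<open>f\<close> lifts \<open>y\<close> but need not be a cycle. Its
        boundary has a primitive with vanishing augmentation, and subtracting that one turns
        \<open>f\<close> into a cycle still lying over \<open>y\<close>.\<close>
      ultimately obtain g where g: "g \<in> carrier (T (Suc m))" "g (Suc m) = \<zero>\<^bsub>D (Suc m) 0\<^esub>"
        "dT (Suc m) g = dT (Suc m) f"
        using kernel_acyclic[OF df] by blast
      let ?x = "f \<ominus>\<^bsub>T (Suc m)\<^esub> g"
      have "dT (Suc m) ?x = \<zero>\<^bsub>T m\<^esub>"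
        using lin_diff[OF T T dT_lin f' g(1)] g(3) module_diff_self[OF T df] by simp
      moreover have "e (Suc m) (?x (Suc m)) = y"
      proof -
        have "e (Suc m) (?x (Suc m)) = y \<ominus>\<^bsub>E (Suc m)\<^esub> e (Suc m) (g (Suc m))"
          using lin_diff[OF T Em aug_lin f' g(1)] f(2) Suc by simp
        also have "e (Suc m) (g (Suc m)) = \<zero>\<^bsub>E (Suc m)\<^esub>" using g(2) lin_zero[OF D Em e] by simp
        finally show ?thesis
          using module_add_sub[OF Em, of "\<zero>\<^bsub>E (Suc m)\<^esub>" "Suc m" y] module_zero_closed[OF Em] y(1) Suc
            abelian_monoid.l_zero[OF abelian_group.axioms(1)[OF module_abelian_group[OF Em]]] by simp
      qed
      ultimately show ?thesis using Suc module_diff_closed[OF T f' g(1)] by (intro bexI[of _ ?x]) auto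
    qed
  next
    fix n f y assume f: "f \<in> carrier (T n)" "n = 0 \<or> dT n f = \<zero>\<^bsub>T (n - 1)\<^esub>"
      and y: "y \<in> carrier (E (Suc n))" "e n (f n) = dE (Suc n) y"
    obtain g where g: "g \<in> carrier (T (Suc n))" "e (Suc n) (g (Suc n)) = y" using aug_surj[OF y(1)] by blast
    note dg = lin_closed[OF dT_lin g(1)]
    \<comment> \<open>Removing the boundary of a lift of \<open>y\<close> moves \<open>f\<close>
      into the kernel of the augmentation.\<close>
    let ?c = "f \<ominus>\<^bsub>T n\<^esub> dT (Suc n) g"
    have c: "?c \<in> carrier (T n)" by (rule module_diff_closed[OF T f(1) dg])
    have "e n (?c n) = \<zero>\<^bsub>E n\<^esub>"
      using lin_diff[OF T Em aug_lin f(1) dg] y g aug_chain[OF g(1)] module_diff_self[OF Em lin_closed[OF dE y(1)]]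
      by simp
    moreover have "n = 0 \<or> dT n ?c = \<zero>\<^bsub>T (n - 1)\<^esub>"
    proof (cases n)
      case (Suc m)
      have f': "f \<in> carrier (T (Suc m))" and dg': "dT (Suc n) g \<in> carrier (T (Suc m))"
        and g': "g \<in> carrier (T (Suc (Suc m)))" using f(1) dg g(1) Suc by auto
      show ?thesis using lin_diff[OF T T dT_lin f' dg'] f(2) dTdT[OF g'] Suc
        module_diff_self[OF T module_zero_closed[OF T]] by simp
    qed simp
    ultimately obtain h where h: "h \<in> carrier (T (Suc n))" "dT (Suc n) h = ?c"
      using kernel_acyclic[OF c] by blast
    have "dT (Suc n) (g \<oplus>\<^bsub>T (Suc n)\<^esub> h) = f"
      using lin_add[OF dT_lin g(1) h(1)] h(2) module_sub_add[OF T f(1) dg] by simp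
    moreover have "g \<oplus>\<^bsub>T (Suc n)\<^esub> h \<in> carrier (T (Suc n))"
      using g(1) h(1) abelian_monoid.a_closed[OF abelian_group.axioms(1)[OF module_abelian_group[OF T]]] by blast
    ultimately show "f \<in> dT (Suc n) ` carrier (T (Suc n))" by force
  qed
  then show ?thesis by (rule mod_iso_sym[OF homology_module[OF T_complex] homology_module[OF E]])
qed

end

text \<open>Dual to \<open>augmented_double_complex\<close>: each \<open>D i\<close> is a
  coresolution of \<open>E i\<close>, which embeds through \<open>e i\<close> as the vertical
  cocycles of second index 0.\<close>

locale coaugmented_double_complex =
  fixes K :: "'k ring" and D :: "nat \<Rightarrow> nat \<Rightarrow> ('k, 'x) module" and dh dv :: "nat \<Rightarrow> nat \<Rightarrow> 'x \<Rightarrow> 'x"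
    and E :: "nat \<Rightarrow> ('k, 'y) module" and dE :: "nat \<Rightarrow> 'y \<Rightarrow> 'y" and e :: "nat \<Rightarrow> 'y \<Rightarrow> 'x"
  assumes D: "module K (D i j)"
    and dh: "dh i j \<in> lin_maps K (D i j) (D (Suc i) j)"
    and dv: "dv i j \<in> lin_maps K (D i j) (D i (Suc j))"
    and dhdh: "x \<in> carrier (D i j) \<Longrightarrow> dh (Suc i) j (dh i j x) = \<zero>\<^bsub>D (Suc (Suc i)) j\<^esub>"
    and dvdv: "x \<in> carrier (D i j) \<Longrightarrow> dv i (Suc j) (dv i j x) = \<zero>\<^bsub>D i (Suc (Suc j))\<^esub>"
    and dhdv: "x \<in> carrier (D i j) \<Longrightarrow> dh i (Suc j) (dv i j x) = dv (Suc i) j (dh i j x)"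
    and E: "cochain_complex K E dE"
    and e: "e i \<in> lin_maps K (E i) (D i 0)"
    and e_inj: "\<lbrakk>y \<in> carrier (E i); e i y = \<zero>\<^bsub>D i 0\<^esub>\<rbrakk> \<Longrightarrow> y = \<zero>\<^bsub>E i\<^esub>"
    and e_dv: "y \<in> carrier (E i) \<Longrightarrow> dv i 0 (e i y) = \<zero>\<^bsub>D i (Suc 0)\<^esub>"
    and e_dh: "y \<in> carrier (E i) \<Longrightarrow> dh i 0 (e i y) = e (Suc i) (dE i y)"
    and exact0: "\<lbrakk>x \<in> carrier (D i 0); dv i 0 x = \<zero>\<^bsub>D i (Suc 0)\<^esub>\<rbrakk> \<Longrightarrow> \<exists>y\<in>carrier (E i). e i y = x"
    and exact: "\<lbrakk>x \<in> carrier (D i (Suc j)); dv i (Suc j) x = \<zero>\<^bsub>D i (Suc (Suc j))\<^esub>\<rbrakk> \<Longrightarrow>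
      \<exists>y\<in>carrier (D i j). dv i j y = x"
begin

abbreviation "T \<equiv> tot D"
abbreviation "dT \<equiv> cotot_d D dh dv"

lemma Em: "module K (E i)" and dE: "dE i \<in> lin_maps K (E i) (E (Suc i))"
  using E by (auto simp: cochain_complex_def)

lemma T: "module K (T n)" by (rule tot_module[OF D])

text \<open>\<open>hor\<close> and \<open>ver\<close> are the two summands of
  \<open>cotot_d\<close>. A component at either end of the index range misses one of them, and the
  zero fills the gap.\<close>

definition "hor n f i = (if i = 0 then \<zero>\<^bsub>D i (Suc n - i)\<^esub> else dh (i - 1) (Suc n - i) (f (i - 1)))"

definition "ver n f i = (if i = Suc n then \<zero>\<^bsub>D i (Suc n - i)\<^esub>
  else signed (D i (Suc n - i)) (Suc n) (dv i (n - i) (f i)))"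

lemma dT_eq: "i \<le> Suc n \<Longrightarrow> dT n f i = hor n f i \<oplus>\<^bsub>D i (Suc n - i)\<^esub> ver n f i"
  by (simp add: cotot_d_def Let_def hor_def ver_def)

lemma hor_lin: "i \<le> Suc n \<Longrightarrow> (\<lambda>f. hor n f i) \<in> lin_maps K (T n) (D i (Suc n - i))"
proof (cases i)
  case 0
  then show ?thesis using lin_const_zero[OF D] by (simp add: hor_def)
next
  case (Suc j)
  assume "i \<le> Suc n"
  then have "(\<lambda>f. f j) \<in> lin_maps K (T n) (D j (n - j))"
    using Suc by (intro lin_mapsI) (auto simp: tot_simps(3,4) tot_in)
  then show ?thesis using lin_comp[OF _ dh] Suc by (simp add: hor_def)
qed

lemma ver_lin: "i \<le> Suc n \<Longrightarrow> (\<lambda>f. ver n f i) \<in> lin_maps K (T n) (D i (Suc n - i))"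
proof (cases "i = Suc n")
  case True
  then show ?thesis using lin_const_zero[OF D] by (simp add: ver_def)
next
  case False
  assume "i \<le> Suc n"
  then have i: "i \<le> n" using False by simp
  have "(\<lambda>f. f i) \<in> lin_maps K (T n) (D i (n - i))"
    using i by (intro lin_mapsI) (auto simp: tot_simps(3,4) tot_in)
  then have "(\<lambda>f. dv i (n - i) (f i)) \<in> lin_maps K (T n) (D i (Suc (n - i)))" by (rule lin_comp[OF _ dv])
  then show ?thesis using lin_sgn[OF D] False i by (simp add: ver_def Suc_diff_le)
qed

lemma dT_term_lin: "i \<le> Suc n \<Longrightarrow> (\<lambda>f. dT n f i) \<in> lin_maps K (T n) (D i (Suc n - i))"
  unfolding dT_eq by (intro lin_sum[OF D] hor_lin ver_lin)

lemma dT_lin: "dT n \<in> lin_maps K (T n) (T (Suc n))"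
proof (rule lin_mapsI)
  note c = lin_closed[OF dT_term_lin]
  have d: "dT n f \<in> carrier (T (Suc n))" if "f \<in> carrier (T n)" for f
  proof -
    have "dT n f \<in> extensional {..Suc n}" by (simp add: cotot_d_def)
    then show ?thesis using c[OF _ that] by (auto simp: tot_simps(1) PiE_def)
  qed
  show "dT n f \<in> carrier (T (Suc n))" if "f \<in> carrier (T n)" for f by (rule d[OF that])
  interpret S: module K "T (Suc n)" by (rule T)
  interpret N: module K "T n" by (rule T)
  fix f assume f: "f \<in> carrier (T n)"
  show "dT n (f \<oplus>\<^bsub>T n\<^esub> g) = dT n f \<oplus>\<^bsub>T (Suc n)\<^esub> dT n g" if g: "g \<in> carrier (T n)" for g
  proof (rule tot_eqI)
    show "dT n (f \<oplus>\<^bsub>T n\<^esub> g) \<in> carrier (T (Suc n))" "dT n f \<oplus>\<^bsub>T (Suc n)\<^esub> dT n g \<in> carrier (T (Suc n))"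
      using d f g by blast+
    show "dT n (f \<oplus>\<^bsub>T n\<^esub> g) i = (dT n f \<oplus>\<^bsub>T (Suc n)\<^esub> dT n g) i" if "i \<le> Suc n" for i
      using lin_add[OF dT_term_lin[OF that] f g] that by (simp add: tot_simps(3)[of D "Suc n"])
  qed
  show "dT n (k \<odot>\<^bsub>T n\<^esub> f) = k \<odot>\<^bsub>T (Suc n)\<^esub> dT n f" if k: "k \<in> carrier K" for k
  proof (rule tot_eqI)
    show "dT n (k \<odot>\<^bsub>T n\<^esub> f) \<in> carrier (T (Suc n))" "k \<odot>\<^bsub>T (Suc n)\<^esub> dT n f \<in> carrier (T (Suc n))"
      using d f k by blast+
    show "dT n (k \<odot>\<^bsub>T n\<^esub> f) i = (k \<odot>\<^bsub>T (Suc n)\<^esub> dT n f) i" if "i \<le> Suc n" for i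
      using lin_smult[OF dT_term_lin[OF that] k f] that by (simp add: tot_simps(4)[of D "Suc n"])
  qed
qed

lemma hor_0: "hor n f 0 = \<zero>\<^bsub>D 0 (Suc n)\<^esub>"
  and hor_Suc: "hor n f (Suc i) = dh i (n - i) (f i)"
  and ver_le: "i \<le> n \<Longrightarrow> ver n f i = signed (D i (Suc (n - i))) (Suc n) (dv i (n - i) (f i))"
  and ver_Suc: "ver n f (Suc n) = \<zero>\<^bsub>D (Suc n) 0\<^esub>"
  by (simp_all add: hor_def ver_def Suc_diff_le)

text \<open>The horizontal summand disappears by \<open>dhdh\<close>, so only the mixed term
  survives; at \<open>i = Suc n\<close> not even that one exists.\<close>

lemma dh_step:
  assumes f: "f \<in> carrier (T n)" and i: "i \<le> Suc n"
  shows "dh i (Suc n - i) (dT n f i) =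
    (if i = Suc n then \<zero>\<^bsub>D (Suc i) 0\<^esub> else signed (D (Suc i) (Suc (n - i))) (Suc n) (dv (Suc i) (n - i) (dh i (n - i) (f i))))"
proof -
  note h = lin_closed[OF hor_lin[OF i] f] and v = lin_closed[OF ver_lin[OF i] f]
  have 1: "dh i (Suc n - i) (hor n f i) = \<zero>\<^bsub>D (Suc i) (Suc n - i)\<^esub>"
  proof (cases i)
    case 0
    then show ?thesis using lin_zero[OF D D dh] by (simp add: hor_0)
  next
    case (Suc j)
    then show ?thesis using dhdh[OF tot_in[OF f, of j]] i by (simp add: hor_Suc)
  qed
  have 2: "dh i (Suc n - i) (ver n f i) = (if i = Suc n then \<zero>\<^bsub>D (Suc i) 0\<^esub>
    else signed (D (Suc i) (Suc (n - i))) (Suc n) (dv (Suc i) (n - i) (dh i (n - i) (f i))))"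
  proof (cases "i = Suc n")
    case True
    then show ?thesis using lin_zero[OF D D dh] by (simp add: ver_Suc)
  next
    case False
    then have "i \<le> n" using i by simp
    then show ?thesis using lin_signed[OF D D dh lin_closed[OF dv tot_in[OF f]], of i] dhdv[OF tot_in[OF f], of i]
      by (simp add: ver_le Suc_diff_le)
  qed
  have "dh i (Suc n - i) (ver n f i) \<in> carrier (D (Suc i) (Suc n - i))" by (rule lin_closed[OF dh v])
  then show ?thesis unfolding dT_eq[OF i] lin_add[OF dh h v] 1
    using 2 abelian_monoid.l_zero[OF abelian_group.axioms(1)[OF module_abelian_group[OF D]]] by metis
qed

text \<open>The sign of \<open>ver\<close> depends on the total degree and not on the index; the
  mixed terms cancel because it flips from one degree to the next.\<close>

lemma dTdT:
  assumes f: "f \<in> carrier (T n)"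
  shows "dT (Suc n) (dT n f) = \<zero>\<^bsub>T (Suc (Suc n))\<^esub>"
proof (rule tot_eqI)
  let ?g = "dT n f"
  note g = lin_closed[OF dT_lin f]
  show "dT (Suc n) ?g \<in> carrier (T (Suc (Suc n)))" by (rule lin_closed[OF dT_lin g])
  show "\<zero>\<^bsub>T (Suc (Suc n))\<^esub> \<in> carrier (T (Suc (Suc n)))" by (rule module_zero_closed[OF T])
  fix i assume i: "i \<le> Suc (Suc n)"
  interpret X: module K "D i (Suc (Suc n) - i)" by (rule D)
  have "hor (Suc n) ?g i \<oplus>\<^bsub>D i (Suc (Suc n) - i)\<^esub> ver (Suc n) ?g i = \<zero>\<^bsub>D i (Suc (Suc n) - i)\<^esub>"
  proof (cases "i = Suc (Suc n)")
    case True
    then show ?thesis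
      using dh_step[OF f, of "Suc n"]
        abelian_monoid.l_zero[OF abelian_group.axioms(1)[OF module_abelian_group[OF D]] module_zero_closed[OF D]]
      by (simp add: ver_Suc hor_Suc)
  next
    case False
    then have i': "i \<le> Suc n" using i by simp
    have sd: "Suc (Suc n) - i = Suc (Suc n - i)" using i' by simp
    note h = lin_closed[OF hor_lin[OF i'] f] and v = lin_closed[OF ver_lin[OF i'] f]
    have vv: "dv i (Suc n - i) (ver n f i) = \<zero>\<^bsub>D i (Suc (Suc n - i))\<^esub>"
    proof (cases "i = Suc n")
      case True
      then show ?thesis using lin_zero[OF D D dv] by (simp add: ver_Suc)
    next
      case False
      then have "i \<le> n" using i' by simp
      then show ?thesis using lin_signed[OF D D dv lin_closed[OF dv tot_in[OF f]], of i] dvdv[OF tot_in[OF f], of i]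
        by (simp add: ver_le Suc_diff_le signed_zero[OF D])
    qed
    let ?w = "dv i (Suc n - i) (hor n f i)"
    have w: "?w \<in> carrier (D i (Suc (Suc n - i)))" by (rule lin_closed[OF dv h])
    interpret Y: module K "D i (Suc (Suc n - i))" by (rule D)
    have "dv i (Suc n - i) (?g i) = ?w"
      unfolding dT_eq[OF i'] lin_add[OF dv h v] vv using w by simp
    then have 1: "ver (Suc n) ?g i = signed (D i (Suc (Suc n - i))) (Suc (Suc n)) ?w" using ver_le[OF i'] by simp
    have 2: "hor (Suc n) ?g i = signed (D i (Suc (Suc n - i))) (Suc n) ?w"
    proof (cases i)
      case 0
      then show ?thesis using lin_zero[OF D D dv] by (simp add: hor_0 signed_zero[OF D])
    next
      case (Suc j)
      then show ?thesis using dh_step[OF f, of j] i' by (simp add: hor_Suc Suc_diff_le)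
    qed
    show ?thesis unfolding sd 1 2 signed_Suc[OF D w, of "Suc n"] using signed_closed[OF D w] by (simp add: Y.r_neg)
  qed
  then show "dT (Suc n) ?g i = \<zero>\<^bsub>T (Suc (Suc n))\<^esub> i" using i by (simp add: dT_eq tot_simps(2))
qed

lemma T_complex: "cochain_complex K T dT"
  using T dT_lin dTdT by (simp add: cochain_complex_def)

definition "coaug n y = (\<lambda>i\<in>{..n}. if i = n then e n y else \<zero>\<^bsub>D i (n - i)\<^esub>)"

lemma coaug_closed: "y \<in> carrier (E n) \<Longrightarrow> coaug n y \<in> carrier (T n)"
  using lin_closed[OF e] module_zero_closed[OF D] by (auto simp: coaug_def tot_simps)

lemma coaug_lin: "coaug n \<in> lin_maps K (E n) (T n)"
proof -
  interpret E: module K "E n" by (rule Em)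
  interpret T: module K "T n" by (rule T)
  have z: "\<zero>\<^bsub>D i j\<^esub> = \<zero>\<^bsub>D i j\<^esub> \<oplus>\<^bsub>D i j\<^esub> \<zero>\<^bsub>D i j\<^esub>" "c \<in> carrier K \<Longrightarrow> c \<odot>\<^bsub>D i j\<^esub> \<zero>\<^bsub>D i j\<^esub> = \<zero>\<^bsub>D i j\<^esub>" for i j c
  proof -
    interpret D: module K "D i j" by (rule D)
    show "\<zero>\<^bsub>D i j\<^esub> = \<zero>\<^bsub>D i j\<^esub> \<oplus>\<^bsub>D i j\<^esub> \<zero>\<^bsub>D i j\<^esub>" "c \<in> carrier K \<Longrightarrow> c \<odot>\<^bsub>D i j\<^esub> \<zero>\<^bsub>D i j\<^esub> = \<zero>\<^bsub>D i j\<^esub>" by simp_all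
  qed
  show ?thesis
  proof (rule lin_mapsI)
    fix x y assume xy: "x \<in> carrier (E n)" "y \<in> carrier (E n)"
    show "coaug n (x \<oplus>\<^bsub>E n\<^esub> y) = coaug n x \<oplus>\<^bsub>T n\<^esub> coaug n y"
      by (rule tot_eqI[OF coaug_closed T.a_closed[OF coaug_closed coaug_closed]])
        (use xy z(1) in \<open>simp_all add: tot_simps(3) coaug_def lin_add[OF e]\<close>)
  next
    fix c y assume cy: "c \<in> carrier K" "y \<in> carrier (E n)"
    show "coaug n (c \<odot>\<^bsub>E n\<^esub> y) = c \<odot>\<^bsub>T n\<^esub> coaug n y"
      by (rule tot_eqI[OF coaug_closed T.smult_closed[OF _ coaug_closed]])
        (use cy z(2) in \<open>simp_all add: tot_simps(4) coaug_def lin_smult[OF e]\<close>)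
  qed (rule coaug_closed)
qed

lemma coaug_chain:
  assumes y: "y \<in> carrier (E n)"
  shows "coaug (Suc n) (dE n y) = dT n (coaug n y)"
proof (rule tot_eqI[OF coaug_closed[OF lin_closed[OF dE y]] lin_closed[OF dT_lin coaug_closed[OF y]]])
  fix i assume i: "i \<le> Suc n"
  interpret X: module K "D i (Suc n - i)" by (rule D)
  have h: "hor n (coaug n y) i = (if i = Suc n then e (Suc n) (dE n y) else \<zero>\<^bsub>D i (Suc n - i)\<^esub>)"
  proof (cases i)
    case 0
    then show ?thesis by (simp add: hor_0)
  next
    case (Suc j)
    then show ?thesis using e_dh[OF y] lin_zero[OF D D dh] i by (simp add: hor_Suc coaug_def)
  qed
  have "ver n (coaug n y) i = \<zero>\<^bsub>D i (Suc n - i)\<^esub>"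
  proof (cases "i = Suc n")
    case True
    then show ?thesis by (simp add: ver_Suc)
  next
    case False
    then have "i \<le> n" using i by simp
    then show ?thesis using e_dv[OF y] lin_zero[OF D D dv]
      by (cases "i = n") (simp_all add: ver_le coaug_def signed_zero[OF D] Suc_diff_le)
  qed
  then show "coaug (Suc n) (dE n y) i = dT n (coaug n y) i"
    using h i X.zero_closed lin_closed[OF e lin_closed[OF dE y]]
      abelian_monoid.r_zero[OF abelian_group.axioms(1)[OF module_abelian_group[OF D]]]
    by (auto simp: dT_eq coaug_def)
qed

text \<open>In the ascending construction \<open>t\<close> is the contribution of the components
  already found. The cocycle condition at index \<open>i\<close> then leaves the difference of
  \<open>f i\<close> and \<open>t\<close> as a vertical cocycle, to which exactness applies.\<close>

lemma dv_residue:
  assumes f: "f \<in> carrier (T n)" and df: "dT n f i = \<zero>\<^bsub>D i (Suc n - i)\<^esub>" and i: "i \<le> n"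
    and t: "t \<in> carrier (D i (n - i))"
    and dt: "dh i (n - i) t = \<zero>\<^bsub>D (Suc i) (n - i)\<^esub>"
    and vt: "hor n f i = signed (D i (Suc n - i)) n (dv i (n - i) t)"
  shows "dv i (n - i) (f i \<ominus>\<^bsub>D i (n - i)\<^esub> t) = \<zero>\<^bsub>D i (Suc (n - i))\<^esub>"
proof -
  let ?D = "D i (Suc (n - i))"
  interpret Y: module K ?D by (rule D)
  have sd: "Suc n - i = Suc (n - i)" using i by simp
  have c: "dv i (n - i) t \<in> carrier ?D" "dv i (n - i) (f i) \<in> carrier ?D"
    using lin_closed[OF dv] t tot_in[OF f i] by auto
  have "signed ?D n (dv i (n - i) t) \<oplus>\<^bsub>?D\<^esub> signed ?D (Suc n) (dv i (n - i) (f i)) = \<zero>\<^bsub>?D\<^esub>"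
    using df dT_eq[of i n f] i vt ver_le[OF i] sd by simp
  then have "signed ?D (Suc n) (dv i (n - i) (f i)) = \<ominus>\<^bsub>?D\<^esub> signed ?D n (dv i (n - i) t)"
    by (intro module_neg_unique[OF D] signed_closed[OF D] c)
  then have "signed ?D (Suc n) (dv i (n - i) (f i)) = signed ?D (Suc n) (dv i (n - i) t)"
    using signed_Suc[OF D c(1)] by simp
  then have "dv i (n - i) (f i) = dv i (n - i) t" using signed_signed[OF D] c by metis
  then show ?thesis using lin_diff[OF D D dv tot_in[OF f i] t] module_diff_self[OF D c(1)] by simp
qed

text \<open>The components of the primitive are found in the order of ascending first index.\<close>

lemma cokernel_acyclic:
  assumes f: "f \<in> carrier (T n)" and df: "\<And>i. i \<le> n \<Longrightarrow> dT n f i = \<zero>\<^bsub>D i (Suc n - i)\<^esub>"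
  shows "\<exists>y\<in>carrier (E n). if n = 0 then f = coaug n y
    else \<exists>g\<in>carrier (T (n - 1)). f = dT (n - 1) g \<oplus>\<^bsub>T n\<^esub> coaug n y"
proof (cases n)
  case 0
  have f0: "f 0 \<in> carrier (D 0 0)" using tot_in[OF f, of 0] 0 by simp
  have "dv 0 0 (f 0 \<ominus>\<^bsub>D 0 0\<^esub> \<zero>\<^bsub>D 0 0\<^esub>) = \<zero>\<^bsub>D 0 (Suc 0)\<^esub>"
    using dv_residue[OF f df, of 0 "\<zero>\<^bsub>D 0 0\<^esub>"] 0 module_zero_closed[OF D] lin_zero[OF D D dh] lin_zero[OF D D dv]
    by (simp add: hor_0 signed_zero[OF D])
  moreover have "f 0 \<ominus>\<^bsub>D 0 0\<^esub> \<zero>\<^bsub>D 0 0\<^esub> = f 0"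
    using module_sub_add[OF D f0 module_zero_closed[OF D]] module_diff_closed[OF D f0 module_zero_closed[OF D]]
      abelian_monoid.l_zero[OF abelian_group.axioms(1)[OF module_abelian_group[OF D]]] by simp
  ultimately obtain y where y: "y \<in> carrier (E 0)" "e 0 y = f 0" using exact0[of "f 0" 0] f0 by auto
  then have "f = coaug 0 y"
    using tot_eqI[of f D 0 "coaug 0 y"] f 0 coaug_closed[of y 0] by (simp add: coaug_def)
  then show ?thesis using y 0 by auto
next
  case (Suc m)
  note F = tot_in[OF f]
  \<comment> \<open>Whatever the next component of the primitive will be, index \<open>i\<close>
    receives \<open>hor m g i\<close> from the previous one; the claim isolates what vertical
    exactness must still account for.\<close>
  have step: "\<exists>t. t \<in> carrier (D i (n - i)) \<and> t = hor m g i \<and> dv i (n - i) (f i \<ominus>\<^bsub>D i (n - i)\<^esub> t) = \<zero>\<^bsub>D i (Suc (n - i))\<^esub>"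
    if i: "i \<le> n" and g: "\<And>j. j < i \<Longrightarrow> g j \<in> carrier (D j (m - j)) \<and> dT m g j = f j" for i g
  proof (cases i)
    case 0
    show ?thesis
      using dv_residue[OF f df[OF i] i, of "\<zero>\<^bsub>D i (n - i)\<^esub>"] 0 Suc module_zero_closed[OF D] lin_zero[OF D D dh] lin_zero[OF D D dv]
      by (simp add: hor_0 signed_zero[OF D])
  next
    case (Suc j)
    have j: "j \<le> m" "m - j = n - i" "Suc m - j = Suc (n - i)" using i Suc \<open>n = Suc m\<close> by auto
    have gj: "g j \<in> carrier (D j (n - i))" and fj: "dT m g j = f j" using g[of j] Suc j by auto
    let ?t = "dh j (n - i) (g j)" let ?D = "D i (Suc (n - i))"
    have t: "?t \<in> carrier (D i (n - i))" using lin_closed[OF dh gj] Suc by simp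
    have dvg: "dv j (n - i) (g j) \<in> carrier (D j (Suc (n - i)))" by (rule lin_closed[OF dv gj])
    have hm: "hor m g j \<in> carrier (D j (Suc (n - i))) \<and> dh j (Suc (n - i)) (hor m g j) = \<zero>\<^bsub>?D\<^esub>"
    proof (cases j)
      case 0
      then show ?thesis using lin_zero[OF D D dh] module_zero_closed[OF D] j Suc by (simp add: hor_def)
    next
      case (Suc l)
      then have "g l \<in> carrier (D l (m - l))" "m - l = Suc (n - i)" using g[of l] \<open>i = Suc j\<close> j by auto
      then show ?thesis using lin_closed[OF dh] dhdh Suc \<open>i = Suc j\<close> by (simp add: hor_Suc)
    qed
    \<comment> \<open>Applying the horizontal differential to the equation already solved at
      \<open>j\<close> kills its horizontal part and yields the hypothesis of
      \<open>dv_residue\<close> at \<open>i\<close>.\<close>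
    have "f j = hor m g j \<oplus>\<^bsub>D j (Suc (n - i))\<^esub> signed (D j (Suc (n - i))) n (dv j (n - i) (g j))"
      using dT_eq[of j m g] ver_le[OF j(1), of g] fj j \<open>n = Suc m\<close> by simp
    then have "dh j (Suc (n - i)) (f j) = \<zero>\<^bsub>?D\<^esub> \<oplus>\<^bsub>?D\<^esub> signed ?D n (dh j (Suc (n - i)) (dv j (n - i) (g j)))"
      using lin_add[OF dh _ signed_closed[OF D dvg]] lin_signed[OF D D dh dvg] hm Suc by simp
    also have "\<dots> = signed ?D n (dv i (n - i) ?t)"
      using dhdv[OF gj] Suc signed_closed[OF D lin_closed[OF dv t]]
        abelian_monoid.l_zero[OF abelian_group.axioms(1)[OF module_abelian_group[OF D]]] by simp
    finally have "hor n f i = signed (D i (Suc n - i)) n (dv i (n - i) ?t)"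
      using Suc i Suc_diff_Suc[of j n] by (simp add: hor_Suc)
    moreover have "dh i (n - i) ?t = \<zero>\<^bsub>D (Suc i) (n - i)\<^esub>" using dhdh[OF gj] Suc by simp
    ultimately show ?thesis using dv_residue[OF f df[OF i] i t] t Suc j by (simp add: hor_Suc)
  qed
  have "\<exists>g. \<forall>i<k. g i \<in> carrier (D i (m - i)) \<and> dT m g i = f i" if "k \<le> Suc m" for k
    using that
  proof (induction k)
    case 0
    show ?case by simp
  next
    case (Suc k)
    then obtain g where g: "\<And>i. i < k \<Longrightarrow> g i \<in> carrier (D i (m - i)) \<and> dT m g i = f i" by auto
    have k: "k \<le> m" "k \<le> n" "n - k = Suc (m - k)" using Suc \<open>n = Suc m\<close> by auto
    obtain t where t: "t \<in> carrier (D k (n - k))" "t = hor m g k"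
      "dv k (n - k) (f k \<ominus>\<^bsub>D k (n - k)\<^esub> t) = \<zero>\<^bsub>D k (Suc (n - k))\<^esub>" using step[OF k(2) g] by blast
    have y: "f k \<ominus>\<^bsub>D k (n - k)\<^esub> t \<in> carrier (D k (n - k))" by (rule module_diff_closed[OF D F[OF k(2)] t(1)])
    obtain z where z: "z \<in> carrier (D k (m - k))" "dv k (m - k) z = f k \<ominus>\<^bsub>D k (n - k)\<^esub> t"
      using exact[of "f k \<ominus>\<^bsub>D k (n - k)\<^esub> t" k "m - k"] y t(3) k by auto
    let ?z = "signed (D k (m - k)) n z" let ?g = "g(k := ?z)"
    have "signed (D k (n - k)) n (dv k (m - k) ?z) = f k \<ominus>\<^bsub>D k (n - k)\<^esub> t"
      using lin_signed[OF D D dv z(1)] z(2) signed_signed[OF D y] k by simp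
    moreover have "hor m ?g k = t" unfolding t(2) by (cases k) (simp_all add: hor_def)
    ultimately have gk: "dT m ?g k = f k"
      using dT_eq[of k m ?g] ver_le[OF k(1), of ?g] k \<open>n = Suc m\<close> module_sub_add[OF D F[OF k(2)] t(1)] by simp
    have "?g i \<in> carrier (D i (m - i)) \<and> dT m ?g i = f i" if "i < Suc k" for i
    proof (cases "i = k")
      case True
      then show ?thesis using gk signed_closed[OF D z(1)] by (simp only: fun_upd_same simp_thms)
    next
      case False
      then have ik: "i < k" "i \<noteq> k" "i - Suc 0 \<noteq> k" using that by auto
      then have "dT m ?g i = dT m g i" using dT_eq[of i m] k by (simp add: hor_def ver_def)
      then show ?thesis using ik g[OF ik(1)] by (simp only: fun_upd_other) simp
    qed
    then show ?case by blast
  qed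
  from this[of n] obtain g' where g': "\<And>i. i < n \<Longrightarrow> g' i \<in> carrier (D i (m - i)) \<and> dT m g' i = f i"
    using Suc by auto
  let ?g = "restrict g' {..m}"
  have gT: "?g \<in> carrier (T m)" using g' Suc by (auto simp: tot_simps)
  have eq: "dT m ?g i = dT m g' i" if "i \<le> n" for i
    using dT_eq[of i m] that Suc by (auto simp: hor_def ver_def)
  have g: "?g i \<in> carrier (D i (m - i)) \<and> dT m ?g i = f i" if "i < n" for i
    using g'[OF that] eq[of i] that Suc by simp
  \<comment> \<open>At index \<open>n\<close> the second index is 0 and no further component of the
    primitive is available; what remains comes from \<open>E n\<close> by
    \<open>exact0\<close>.\<close>
  obtain t where t: "t \<in> carrier (D n 0)" "t = hor m ?g n" "dv n 0 (f n \<ominus>\<^bsub>D n 0\<^esub> t) = \<zero>\<^bsub>D n (Suc 0)\<^esub>"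
    using step[of n ?g] g by auto
  have fn: "f n \<in> carrier (D n 0)" using F[of n] by simp
  obtain y where y: "y \<in> carrier (E n)" "e n y = f n \<ominus>\<^bsub>D n 0\<^esub> t"
    using exact0[OF module_diff_closed[OF D fn t(1)] t(3)] by blast
  have "f = dT m ?g \<oplus>\<^bsub>T n\<^esub> coaug n y"
  proof (rule tot_eqI[OF f])
    show "dT m ?g \<oplus>\<^bsub>T n\<^esub> coaug n y \<in> carrier (T n)"
      using lin_closed[OF dT_lin gT] coaug_closed[OF y(1)] Suc
        abelian_monoid.a_closed[OF abelian_group.axioms(1)[OF module_abelian_group[OF T]]] by simp
    fix i assume i: "i \<le> n"
    have r: "x \<oplus>\<^bsub>D i j\<^esub> \<zero>\<^bsub>D i j\<^esub> = x" if "x \<in> carrier (D i j)" for i j x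
      using abelian_monoid.r_zero[OF abelian_group.axioms(1)[OF module_abelian_group[OF D]] that] .
    show "f i = (dT m ?g \<oplus>\<^bsub>T n\<^esub> coaug n y) i"
    proof (cases "i = n")
      case True
      have "dT m ?g n = t" using dT_eq[of n m ?g] Suc ver_Suc[of m ?g] t(1,2) r by simp
      then show ?thesis using True y(2) module_sub_add[OF D fn t(1)] by (simp add: tot_simps(3) coaug_def)
    next
      case False
      then show ?thesis using g[of i] i r F[OF i] by (simp add: tot_simps(3) coaug_def)
    qed
  qed
  then show ?thesis using y(1) gT Suc by auto
qed

lemma coaug_inj: "\<lbrakk>y \<in> carrier (E n); coaug n y = \<zero>\<^bsub>T n\<^esub>\<rbrakk> \<Longrightarrow> y = \<zero>\<^bsub>E n\<^esub>"
proof -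
  assume y: "y \<in> carrier (E n)" and eq: "coaug n y = \<zero>\<^bsub>T n\<^esub>"
  have "e n y = \<zero>\<^bsub>D n 0\<^esub>" using fun_cong[OF eq, of n] by (simp add: coaug_def tot_simps(2))
  then show ?thesis by (rule e_inj[OF y])
qed

lemma coaug_inj': "\<lbrakk>x \<in> carrier (E n); y \<in> carrier (E n); coaug n x = coaug n y\<rbrakk> \<Longrightarrow> x = y"
  using coaug_inj[of "x \<ominus>\<^bsub>E n\<^esub> y" n] lin_diff[OF Em T coaug_lin, of x n y] module_diff_self[OF T coaug_closed, of y n]
    module_diff_eq_zero[OF Em, of x n y] module_diff_closed[OF Em, of x n y] by simp

lemma cohomology_tot_iso: "mod_iso K (cohomology E dE n) (cohomology T dT n)"
proof (rule cohomology_iso[where h = coaug, OF T_complex E coaug_lin coaug_chain coaug_inj])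
  fix n f assume f: "f \<in> carrier (T n)" "dT n f = \<zero>\<^bsub>T (Suc n)\<^esub>"
  have z: "dT n f i = \<zero>\<^bsub>D i (Suc n - i)\<^esub>" if "i \<le> n" for i using f(2) that by (simp add: tot_simps(2))
  obtain y where y: "y \<in> carrier (E n)" "if n = 0 then f = coaug n y
    else \<exists>g\<in>carrier (T (n - 1)). f = dT (n - 1) g \<oplus>\<^bsub>T n\<^esub> coaug n y"
    using cokernel_acyclic[OF f(1) z] by blast
  \<comment> \<open>\<open>f\<close> and the coboundary are both cocycles, hence so is the
    coaugmented part; injectivity then passes this on to \<open>y\<close>.\<close>
  have "dT n (coaug n y) = \<zero>\<^bsub>T (Suc n)\<^esub>"
  proof (cases n)
    case 0
    then show ?thesis using f(2) y(2) by simp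
  next
    case (Suc m)
    then obtain g where g: "g \<in> carrier (T m)" "f = dT m g \<oplus>\<^bsub>T n\<^esub> coaug n y" using y(2) by auto
    have dg: "dT m g \<in> carrier (T n)" using lin_closed[OF dT_lin g(1)] Suc by simp
    have "dT n f = \<zero>\<^bsub>T (Suc n)\<^esub> \<oplus>\<^bsub>T (Suc n)\<^esub> dT n (coaug n y)"
      using lin_add[OF dT_lin dg coaug_closed[OF y(1)]] dTdT[OF g(1)] g(2) Suc by simp
    then show ?thesis using f(2) lin_closed[OF dT_lin coaug_closed[OF y(1)]]
        abelian_monoid.l_zero[OF abelian_group.axioms(1)[OF module_abelian_group[OF T]]] by simp
  qed
  then have "coaug (Suc n) (dE n y) = \<zero>\<^bsub>T (Suc n)\<^esub>" using coaug_chain[OF y(1)] by simp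
  then have "dE n y = \<zero>\<^bsub>E (Suc n)\<^esub>" by (rule coaug_inj[OF lin_closed[OF dE y(1)]])
  then show "\<exists>x\<in>carrier (E n). dE n x = \<zero>\<^bsub>E (Suc n)\<^esub> \<and> (if n = 0 then f = coaug n x
    else \<exists>g\<in>carrier (T (n - 1)). f = dT (n - 1) g \<oplus>\<^bsub>T n\<^esub> coaug n x)" using y by blast
next
  fix n x g assume x: "x \<in> carrier (E (Suc n))" and g: "g \<in> carrier (T n)" "coaug (Suc n) x = dT n g"
  \<comment> \<open>Only the components up to \<open>n\<close> are known to vanish here, the last
    one being \<open>e (Suc n) x\<close>. This is why \<open>cokernel_acyclic\<close> is stated for
    those components alone.\<close>
  have z: "dT n g i = \<zero>\<^bsub>D i (Suc n - i)\<^esub>" if "i \<le> n" for i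
    using fun_cong[OF g(2), of i] that by (simp add: coaug_def)
  obtain y where y: "y \<in> carrier (E n)" "if n = 0 then g = coaug n y
    else \<exists>g'\<in>carrier (T (n - 1)). g = dT (n - 1) g' \<oplus>\<^bsub>T n\<^esub> coaug n y"
    using cokernel_acyclic[OF g(1) z] by blast
  have "dT n g = dT n (coaug n y)"
  proof (cases n)
    case (Suc m)
    then obtain g' where g': "g' \<in> carrier (T m)" "g = dT m g' \<oplus>\<^bsub>T n\<^esub> coaug n y" using y(2) by auto
    have dg: "dT m g' \<in> carrier (T n)" using lin_closed[OF dT_lin g'(1)] Suc by simp
    show ?thesis
      using lin_add[OF dT_lin dg coaug_closed[OF y(1)]] dTdT[OF g'(1)] g'(2) Suc
        lin_closed[OF dT_lin coaug_closed[OF y(1)]]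
        abelian_monoid.l_zero[OF abelian_group.axioms(1)[OF module_abelian_group[OF T]]] by simp
  qed (use y(2) in simp)
  then have "coaug (Suc n) x = coaug (Suc n) (dE n y)" using g(2) coaug_chain[OF y(1)] by simp
  then have "x = dE n y" by (rule coaug_inj'[OF x lin_closed[OF dE y(1)]])
  then show "x \<in> dE n ` carrier (E n)" using y(1) by simp
qed

end

section \<open>Right-linear contractions of projective resolutions\<close>

lemma triple_lift_param:
  assumes A: "module K A" and W: "module K W" and Z: "module K Z"
    and \<phi>: "\<And>b. b \<in> carrier B \<Longrightarrow> trilin K A W Z (\<phi> b)"
    and lin: "\<And>a w c. \<lbrakk>a \<in> carrier A; w \<in> carrier W; c \<in> carrier A\<rbrakk> \<Longrightarrow> (\<lambda>b. \<phi> b a w c) \<in> lin_maps K B Z"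
    and B: "module K B" and t: "t \<in> carrier (triple_mod K A W)"
  shows "(\<lambda>b. triple_lift K Z (\<phi> b) t) \<in> lin_maps K B Z"
proof -
  interpret B: module K B by (rule B)
  note ll = triple_lift_lin[OF A W Z \<phi>] and lp = triple_lift_triple[OF A W Z \<phi>]
  show ?thesis
  proof (rule lin_mapsI)
    fix b c assume bc: "b \<in> carrier B" "c \<in> carrier B"
    show "triple_lift K Z (\<phi> (b \<oplus>\<^bsub>B\<^esub> c)) t = triple_lift K Z (\<phi> b) t \<oplus>\<^bsub>Z\<^esub> triple_lift K Z (\<phi> c) t"
      by (rule triple_eqI[OF A W t ll lin_sum[OF Z ll ll]]) (simp_all add: bc lp lin_add[OF lin])
  next
    fix b c assume bc: "b \<in> carrier B" "c \<in> carrier K"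
    show "triple_lift K Z (\<phi> (c \<odot>\<^bsub>B\<^esub> b)) t = c \<odot>\<^bsub>Z\<^esub> triple_lift K Z (\<phi> b) t"
      by (rule triple_eqI[OF A W t ll lin_comp[OF ll lin_scale[OF Z bc(2)]]]) (simp_all add: bc lp lin_smult[OF lin])
  qed (use lin_closed[OF ll t] in auto)
qed

context kalg
begin

lemma right_homsI:
  "\<lbrakk>h \<in> lin_maps K X Y; \<And>a x. \<lbrakk>a \<in> carrier A; x \<in> carrier X\<rbrakk> \<Longrightarrow> h (ract X x a) = ract Y (h x) a\<rbrakk> \<Longrightarrow>
    h \<in> right_homs X Y"
  by (simp add: right_homs_def)

lemma left_homsI:
  "\<lbrakk>h \<in> lin_maps K X Y; \<And>a x. \<lbrakk>a \<in> carrier A; x \<in> carrier X\<rbrakk> \<Longrightarrow> h (lact X a x) = lact Y a (h x)\<rbrakk> \<Longrightarrow>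
    h \<in> left_homs K A X Y"
  by (simp add: left_homs_def)

lemma bimod_homsI:
  "\<lbrakk>h \<in> lin_maps K X Y; \<And>a x. \<lbrakk>a \<in> carrier A; x \<in> carrier X\<rbrakk> \<Longrightarrow> h (lact X a x) = lact Y a (h x);
    \<And>a x. \<lbrakk>a \<in> carrier A; x \<in> carrier X\<rbrakk> \<Longrightarrow> h (ract X x a) = ract Y (h x) a\<rbrakk> \<Longrightarrow>
    h \<in> bimod_homs K A X Y"
  by (simp add: bimod_homs_def left_homs_def)

lemma lin_difference:
  assumes "module K X" "module K Y" "f \<in> lin_maps K X Y" "g \<in> lin_maps K X Y"
  shows "(\<lambda>x. f x \<ominus>\<^bsub>Y\<^esub> g x) \<in> lin_maps K X Y"
proof -
  have "(\<lambda>x. \<ominus>\<^bsub>Y\<^esub> g x) \<in> lin_maps K X Y" using lin_sgn[OF assms(2,4), of 1] by (simp add: signed_def)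
  then show ?thesis unfolding a_minus_def by (rule lin_sum[OF assms(2,3)])
qed

text \<open>\<open>A (x) W (x) A\<close> is free as a right module over its subspace
  \<open>A (x) W (x) 1\<close>. A right linear map may be prescribed there by any linear map, for
  instance by \<open>g\<close> followed by a linear section of \<open>d\<close>, and a summand
  inherits the lifting property through \<open>i\<close> and \<open>r\<close>.\<close>

lemma right_lift:
  fixes P :: "('k, 'a, 'p) bimodule"
  assumes K: "field K" and P: "projective_bimod K A P" and X: "bimodule K A X" and Y: "bimodule K A Y"
    and d: "d \<in> right_homs X Y" and g: "g \<in> right_homs P Y" and im: "g ` carrier P \<subseteq> d ` carrier X"
  obtains s where "s \<in> right_homs P X" "\<And>x. x \<in> carrier P \<Longrightarrow> d (s x) = g x"
proof -
  obtain B :: "'p set" and i r where ir: "i \<in> bimod_homs K A P (AWA (free_module K B))" "r \<in> bimod_homs K A (AWA (free_module K B)) P"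
    "\<And>x. x \<in> carrier P \<Longrightarrow> r (i x) = x" and Pb: "bimodule K A P"
    using P unfolding projective_bimod_def Let_def by blast
  define W where "W = free_module K B"
  note ir = ir[folded W_def]
  have W: "module K W" unfolding W_def by (rule free_module_module[OF kalg.K[OF kalg_axioms]])
  note Xm = bimodule_module[OF X] and Ym = bimodule_module[OF Y]
  interpret X: bimodule K A X by (rule X)
  interpret Y: bimodule K A Y by (rule Y)
  obtain \<sigma> where s: "\<sigma> \<in> lin_maps K (Y\<lparr>carrier := d ` carrier X\<rparr>) X" "\<And>y. y \<in> d ` carrier X \<Longrightarrow> d (\<sigma> y) = y"
    by (rule exists_section[OF K Xm Ym right_homsD(1)[OF d]]) blast
  note il = bimod_homsD(2)[OF ir(1)] and rl = bimod_homsD(2)[OF ir(2)] and gl = right_homsD(1)[OF g]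
  have "g \<in> lin_maps K P (Y\<lparr>carrier := d ` carrier X\<rparr>)"
    by (rule lin_mapsI) (use im in \<open>auto simp: lin_add[OF gl] lin_smult[OF gl]\<close>)
  then have q: "(\<lambda>t. \<sigma> (g (r t))) \<in> lin_maps K (AWA W) X"
    by (rule lin_comp[OF lin_comp[OF rl] s(1)])
  have dq: "d (\<sigma> (g (r t))) = g (r t)" if "t \<in> carrier (AWA W)" for t
    using s(2) im lin_closed[OF rl that] by auto
  \<comment> \<open>The value at \<open>a (x) w (x) 1\<close>, multiplied by \<open>b\<close> from
    the right. The section \<open>\<sigma>\<close> is merely linear, so it is used on the subspace
    only and extended by right multiplication.\<close>
  let ?\<phi> = "\<lambda>a w b. ract X (\<sigma> (g (r (triple K A W a w \<one>\<^bsub>A\<^esub>)))) b"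
  have qt: "\<sigma> (g (r (triple K A W a w \<one>\<^bsub>A\<^esub>))) \<in> carrier X" if "a \<in> carrier A" "w \<in> carrier W" for a w
    using lin_closed[OF q] tri_closed[OF W that] by simp
  have tri: "trilin K A W X ?\<phi>"
  proof (rule trilinI)
    show "?\<phi> a w \<in> lin_maps K A X" if "a \<in> carrier A" "w \<in> carrier W" for a w
      by (rule bimodule_ract'[OF X qt[OF that]])
    show "(\<lambda>w. ?\<phi> a w b) \<in> lin_maps K W X" if "a \<in> carrier A" "b \<in> carrier A" for a b
      by (rule lin_comp[OF lin_comp[OF trilin_2[OF triple_tri[OF W] that(1) A.one_closed] q] bimodule_ract[OF X that(2)]])
    show "(\<lambda>a. ?\<phi> a w b) \<in> lin_maps K A X" if "w \<in> carrier W" "b \<in> carrier A" for w b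
      by (rule lin_comp[OF lin_comp[OF trilin_1[OF triple_tri[OF W] that(1) A.one_closed] q] bimodule_ract[OF X that(2)]])
  qed
  define s' where "s' = triple_lift K X ?\<phi>"
  have s'l: "s' \<in> lin_maps K (AWA W) X" unfolding s'_def by (rule AWA_lift_lin[OF W Xm tri])
  have s't: "s' (triple K A W a w b) = ?\<phi> a w b" if "a \<in> carrier A" "w \<in> carrier W" "b \<in> carrier A" for a w b
    unfolding s'_def by (rule AWA_lift_triple[OF W Xm tri that])
  have s'r: "s' (ract (AWA W) t c) = ract X (s' t) c" if c: "c \<in> carrier A" and t: "t \<in> carrier (AWA W)" for t c
    by (rule AWA_eqI[OF W t lin_comp[OF AWA_ract_lin[OF W c] s'l] lin_comp[OF s'l bimodule_ract[OF X c]]])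
      (simp add: s't AWA_ract W c X.ract_assoc qt)
  have ds': "d (s' t) = g (r t)" if t: "t \<in> carrier (AWA W)" for t
  proof (rule AWA_eqI[OF W t lin_comp[OF s'l right_homsD(1)[OF d]] lin_comp[OF rl gl]])
    fix a w b assume abw: "a \<in> carrier A" "w \<in> carrier W" "b \<in> carrier A"
    let ?t = "triple K A W a w \<one>\<^bsub>A\<^esub>"
    have t: "?t \<in> carrier (AWA W)" using tri_closed[OF W] abw by simp
    have "d (s' (triple K A W a w b)) = ract Y (g (r ?t)) b"
      using abw t by (simp add: s't right_homsD(2)[OF d] qt dq)
    also have "\<dots> = g (r (ract (AWA W) ?t b))"
      using abw(3) t by (simp only: right_homsD(2)[OF g] bimod_homsD(4)[OF ir(2)] lin_closed[OF rl])
    also have "ract (AWA W) ?t b = triple K A W a w b" using AWA_ract[OF W abw(3) abw(1,2) A.one_closed] abw by simp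
    finally show "d (s' (triple K A W a w b)) = g (r (triple K A W a w b))" .
  qed
  have "(\<lambda>x. s' (i x)) \<in> right_homs P X"
    by (rule right_homsI[OF lin_comp[OF il s'l]]) (simp add: bimod_homsD(4)[OF ir(1)] s'r[OF _ lin_closed[OF il]])
  moreover have "d (s' (i x)) = g x" if "x \<in> carrier P" for x
    using ds'[OF lin_closed[OF il that]] ir(3)[OF that] by simp
  ultimately show ?thesis using that by blast
qed

lemma right_homs_residue:
  assumes "bimodule K A X" "bimodule K A Y" "f \<in> right_homs X Y" "g \<in> right_homs Y X"
  shows "(\<lambda>x. x \<ominus>\<^bsub>X\<^esub> g (f x)) \<in> right_homs X X"
proof (rule right_homsI)
  note m = bimodule_module[OF assms(1)]
  note fg = lin_comp[OF right_homsD(1)[OF assms(3)] right_homsD(1)[OF assms(4)]]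
  show "(\<lambda>x. x \<ominus>\<^bsub>X\<^esub> g (f x)) \<in> lin_maps K X X" by (rule lin_difference[OF m m lin_id fg])
  show "ract X x a \<ominus>\<^bsub>X\<^esub> g (f (ract X x a)) = ract X (x \<ominus>\<^bsub>X\<^esub> g (f x)) a" if "a \<in> carrier A" "x \<in> carrier X" for a x
    using lin_diff[OF m m bimodule_ract[OF assms(1) that(1)] that(2) lin_closed[OF fg that(2)]]
    by (simp add: right_homsD(2)[OF assms(3)] right_homsD(2)[OF assms(4)] lin_closed[OF right_homsD(1)[OF assms(3)]] that)
qed

context
  fixes P :: "nat \<Rightarrow> ('k, 'a, 'p) bimodule" and dP :: "nat \<Rightarrow> 'p \<Rightarrow> 'p" and \<epsilon> :: "'p \<Rightarrow> 'a"
  assumes field: "field K" and res: "projective_resolution K A P dP \<epsilon>"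
begin

lemma res_bimodule: "bimodule K A (P q)"
  and res_projective: "projective_bimod K A (P q)"
  and res_d: "dP (Suc q) \<in> bimod_homs K A (P (Suc q)) (P q)"
  and res_eps: "\<epsilon> \<in> bimod_homs K A (P 0) (regular_bimod A)"
  and res_eps_surj: "\<epsilon> ` carrier (P 0) = carrier A"
  and res_exact0: "{x \<in> carrier (P 0). \<epsilon> x = \<zero>\<^bsub>A\<^esub>} = dP (Suc 0) ` carrier (P (Suc 0))"
  and res_exact: "{x \<in> carrier (P (Suc q)). dP (Suc q) x = \<zero>\<^bsub>P q\<^esub>} = dP (Suc (Suc q)) ` carrier (P (Suc (Suc q)))"
  using res by (simp_all add: projective_resolution_def projective_bimod_def)

lemmas res_module = bimodule_module[OF res_bimodule]
lemmas res_d_lin = bimod_homsD(2)[OF res_d]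

lemma eps_lin: "\<epsilon> \<in> lin_maps K (P 0) A"
  using bimod_homsD(2)[OF res_eps] by (simp add: lin_maps_def regular_bimod_def)

lemma eps_act: "\<lbrakk>a \<in> carrier A; x \<in> carrier (P 0)\<rbrakk> \<Longrightarrow> \<epsilon> (lact (P 0) a x) = a \<otimes>\<^bsub>A\<^esub> \<epsilon> x"
  "\<lbrakk>a \<in> carrier A; x \<in> carrier (P 0)\<rbrakk> \<Longrightarrow> \<epsilon> (ract (P 0) x a) = \<epsilon> x \<otimes>\<^bsub>A\<^esub> a"
  using bimod_homsD(3,4)[OF res_eps] by (simp_all add: regular_bimod_def)

lemma eps_d: "x \<in> carrier (P (Suc 0)) \<Longrightarrow> \<epsilon> (dP (Suc 0) x) = \<zero>\<^bsub>A\<^esub>"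
  using res_exact0 by auto

lemma res_dd: "x \<in> carrier (P (Suc (Suc q))) \<Longrightarrow> dP (Suc q) (dP (Suc (Suc q)) x) = \<zero>\<^bsub>P q\<^esub>"
  using res_exact by auto

text \<open>\<open>A\<close> is free on \<open>1\<close> as a right module, so sending
  \<open>a\<close> to \<open>p a\<close> with \<open>p\<close> lying over \<open>1\<close> splits
  \<open>\<epsilon>\<close>. This splitting is not left linear in general, and nothing better can be
  expected: a two-sided one would make \<open>A\<close> a projective bimodule.\<close>

lemma contraction_0:
  obtains s u where "s \<in> right_homs (regular_bimod A) (P 0)" "u \<in> right_homs (P 0) (P (Suc 0))"
    "\<And>x. x \<in> carrier (P 0) \<Longrightarrow> s (\<epsilon> x) \<oplus>\<^bsub>P 0\<^esub> dP (Suc 0) (u x) = x"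
proof -
  note m = res_module
  interpret P0: bimodule K A "P 0" by (rule res_bimodule)
  obtain p where p: "p \<in> carrier (P 0)" "\<epsilon> p = \<one>\<^bsub>A\<^esub>" using res_eps_surj A.one_closed by (metis imageE)
  let ?s = "\<lambda>a. ract (P 0) p a"
  have s: "?s \<in> right_homs (regular_bimod A) (P 0)"
  proof (rule right_homsI)
    show "?s \<in> lin_maps K (regular_bimod A) (P 0)"
      using bimodule_ract'[OF res_bimodule p(1)] by (simp add: regular_bimod_def lin_maps_def)
  qed (simp add: regular_bimod_def P0.ract_assoc p)
  have eps: "\<epsilon> \<in> right_homs (P 0) (regular_bimod A)" by (rule bimod_homs_right[OF res_eps])
  let ?g = "\<lambda>x. x \<ominus>\<^bsub>P 0\<^esub> ?s (\<epsilon> x)"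
  have g: "?g \<in> right_homs (P 0) (P 0)"
    by (rule right_homs_residue[OF res_bimodule regular_bimodule eps s])
  have sc: "?s (\<epsilon> x) \<in> carrier (P 0)" if "x \<in> carrier (P 0)" for x
    using P0.ract_closed[OF lin_closed[OF eps_lin that] p(1)] .
  have "?g ` carrier (P 0) \<subseteq> dP (Suc 0) ` carrier (P (Suc 0))"
  proof (unfold res_exact0[symmetric], clarify, intro conjI)
    fix x assume x: "x \<in> carrier (P 0)"
    show "?g x \<in> carrier (P 0)" by (rule lin_closed[OF right_homsD(1)[OF g] x])
    show "\<epsilon> (?g x) = \<zero>\<^bsub>A\<^esub>"
      using lin_diff[OF m A eps_lin x sc[OF x]] lin_closed[OF eps_lin x] p eps_act(2)
        module_diff_self[OF A lin_closed[OF eps_lin x]] by simp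
  qed
  then obtain u where u: "u \<in> right_homs (P 0) (P (Suc 0))" "\<And>x. x \<in> carrier (P 0) \<Longrightarrow> dP (Suc 0) (u x) = ?g x"
    using right_lift[OF field res_projective res_bimodule res_bimodule bimod_homs_right[OF res_d] g] by blast
  show ?thesis
    by (rule that[OF s u(1)]) (simp add: u(2) module_sub_add[OF m] sc)
qed

text \<open>The hypothesis says just enough for the difference of \<open>x\<close> and
  \<open>s (dP (Suc q) x)\<close> to be a cycle, and \<open>right_lift\<close> then expresses it as
  a boundary in a right linear way.\<close>

lemma contraction_step:
  assumes s: "s \<in> right_homs (P q) (P (Suc q))"
    and ds: "\<And>x. x \<in> carrier (P (Suc q)) \<Longrightarrow> dP (Suc q) (s (dP (Suc q) x)) = dP (Suc q) x"
  obtains u where "u \<in> right_homs (P (Suc q)) (P (Suc (Suc q)))"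
    "\<And>x. x \<in> carrier (P (Suc q)) \<Longrightarrow> s (dP (Suc q) x) \<oplus>\<^bsub>P (Suc q)\<^esub> dP (Suc (Suc q)) (u x) = x"
proof -
  note m = res_module
  let ?g = "\<lambda>x. x \<ominus>\<^bsub>P (Suc q)\<^esub> s (dP (Suc q) x)"
  have g: "?g \<in> right_homs (P (Suc q)) (P (Suc q))"
    by (rule right_homs_residue[OF res_bimodule res_bimodule bimod_homs_right[OF res_d] s])
  have sc: "s (dP (Suc q) x) \<in> carrier (P (Suc q))" if "x \<in> carrier (P (Suc q))" for x
    using lin_closed[OF right_homsD(1)[OF s] lin_closed[OF res_d_lin that]] .
  have "?g ` carrier (P (Suc q)) \<subseteq> dP (Suc (Suc q)) ` carrier (P (Suc (Suc q)))"
  proof (unfold res_exact[symmetric], clarify, intro conjI)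
    fix x assume x: "x \<in> carrier (P (Suc q))"
    show "?g x \<in> carrier (P (Suc q))" by (rule lin_closed[OF right_homsD(1)[OF g] x])
    show "dP (Suc q) (?g x) = \<zero>\<^bsub>P q\<^esub>"
      using lin_diff[OF m m res_d_lin x sc[OF x]] ds[OF x] module_diff_self[OF m lin_closed[OF res_d_lin x]] by simp
  qed
  then obtain u where u: "u \<in> right_homs (P (Suc q)) (P (Suc (Suc q)))"
    "\<And>x. x \<in> carrier (P (Suc q)) \<Longrightarrow> dP (Suc (Suc q)) (u x) = ?g x"
    using right_lift[OF field res_projective res_bimodule res_bimodule bimod_homs_right[OF res_d] g] by blast
  show ?thesis by (rule that[OF u(1)]) (simp add: u(2) module_sub_add[OF m] sc)
qed

text \<open>The homotopy relation evaluated on boundaries gives \<open>d u d = d\<close>, which is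
  the hypothesis needed one degree higher; the induction therefore carries only this
  identity.\<close>

lemma contraction_exists:
  "\<exists>s\<in>right_homs (P q) (P (Suc q)). \<forall>x\<in>carrier (P (Suc q)). dP (Suc q) (s (dP (Suc q) x)) = dP (Suc q) x"
proof (induction q)
  case 0
  obtain s u where su: "s \<in> right_homs (regular_bimod A) (P 0)" "u \<in> right_homs (P 0) (P (Suc 0))"
    "\<And>x. x \<in> carrier (P 0) \<Longrightarrow> s (\<epsilon> x) \<oplus>\<^bsub>P 0\<^esub> dP (Suc 0) (u x) = x" by (rule contraction_0) blast
  have sl: "s \<in> lin_maps K A (P 0)" using right_homsD(1)[OF su(1)] by (simp add: lin_maps_def regular_bimod_def)
  interpret P0: module K "P 0" by (rule res_module)
  have "dP (Suc 0) (u (dP (Suc 0) x)) = dP (Suc 0) x" if x: "x \<in> carrier (P (Suc 0))" for x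
  proof -
    note d = lin_closed[OF res_d_lin x]
    have "\<zero>\<^bsub>P 0\<^esub> \<oplus>\<^bsub>P 0\<^esub> dP (Suc 0) (u (dP (Suc 0) x)) = dP (Suc 0) x"
      using su(3)[OF d] lin_zero[OF A res_module sl] eps_d[OF x] by simp
    then show ?thesis using lin_closed[OF res_d_lin lin_closed[OF right_homsD(1)[OF su(2)] d]] by simp
  qed
  then show ?case using su(2) by blast
next
  case (Suc q)
  then obtain s where s: "s \<in> right_homs (P q) (P (Suc q))"
    "\<And>x. x \<in> carrier (P (Suc q)) \<Longrightarrow> dP (Suc q) (s (dP (Suc q) x)) = dP (Suc q) x" by blast
  obtain u where u: "u \<in> right_homs (P (Suc q)) (P (Suc (Suc q)))"
    "\<And>x. x \<in> carrier (P (Suc q)) \<Longrightarrow> s (dP (Suc q) x) \<oplus>\<^bsub>P (Suc q)\<^esub> dP (Suc (Suc q)) (u x) = x"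
    by (rule contraction_step[OF s]) (assumption, blast)
  interpret P1: module K "P (Suc q)" by (rule res_module)
  have "dP (Suc (Suc q)) (u (dP (Suc (Suc q)) x)) = dP (Suc (Suc q)) x" if x: "x \<in> carrier (P (Suc (Suc q)))" for x
  proof -
    note d = lin_closed[OF res_d_lin x]
    have "\<zero>\<^bsub>P (Suc q)\<^esub> \<oplus>\<^bsub>P (Suc q)\<^esub> dP (Suc (Suc q)) (u (dP (Suc (Suc q)) x)) = dP (Suc (Suc q)) x"
      using u(2)[OF d] lin_zero[OF res_module res_module right_homsD(1)[OF s(1)]] res_dd[OF x] by simp
    then show ?thesis using lin_closed[OF res_d_lin lin_closed[OF right_homsD(1)[OF u(1)] d]] by simp
  qed
  then show ?case using u(1) by blast
qed

lemma contraction_Suc: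
  obtains s u where "s \<in> right_homs (P q) (P (Suc q))" "u \<in> right_homs (P (Suc q)) (P (Suc (Suc q)))"
    "\<And>x. x \<in> carrier (P (Suc q)) \<Longrightarrow> s (dP (Suc q) x) \<oplus>\<^bsub>P (Suc q)\<^esub> dP (Suc (Suc q)) (u x) = x"
proof -
  obtain s where s: "s \<in> right_homs (P q) (P (Suc q))"
    "\<And>x. x \<in> carrier (P (Suc q)) \<Longrightarrow> dP (Suc q) (s (dP (Suc q) x)) = dP (Suc q) x"
    using contraction_exists by blast
  show ?thesis by (rule contraction_step[OF s]) (use that s(1) in blast)+
qed

end

end

section \<open>The homological comparison\<close>

context kalg
begin

lemma tensor_Ae_induct [consumes 3, case_names pure add]:
  assumes "biact X" "biact Y" "t \<in> carrier (tensor_Ae K A X Y)"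
    and "\<And>x y. \<lbrakk>x \<in> carrier X; y \<in> carrier Y\<rbrakk> \<Longrightarrow> Q (pure K (tensor_Ae K A X Y) x y)"
    and "\<And>t u. \<lbrakk>t \<in> carrier (tensor_Ae K A X Y); u \<in> carrier (tensor_Ae K A X Y); Q t; Q u\<rbrakk> \<Longrightarrow>
      Q (t \<oplus>\<^bsub>tensor_Ae K A X Y\<^esub> u)"
  shows "Q t"
  using assms(3-5) unfolding tensor_Ae_def by (rule balancing.tensor_induct[OF balancing_Ae[OF assms(1,2)]])

lemma
  assumes X: "biact X" and Q: "biact Q" and Q': "biact Q'" and d: "d \<in> bimod_homs K A Q Q'"
  defines "f \<equiv> tensor_lift K (tensor_Ae K A X Q') (\<lambda>x y. pure K (tensor_Ae K A X Q') x (d y))"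
  shows tensor_Ae_map_lin: "f \<in> lin_maps K (tensor_Ae K A X Q) (tensor_Ae K A X Q')"
    and tensor_Ae_map_pure: "\<lbrakk>x \<in> carrier X; y \<in> carrier Q\<rbrakk> \<Longrightarrow>
      f (pure K (tensor_Ae K A X Q) x y) = pure K (tensor_Ae K A X Q') x (d y)"
proof -
  note dl = bimod_homsD(2)[OF d]
  note T = tensor_Ae_module[OF X Q'] and b = tensor_Ae_bilin[OF X Q']
  have bi: "bilin K X Q (tensor_Ae K A X Q') (\<lambda>x y. pure K (tensor_Ae K A X Q') x (d y))"
    by (rule bilinI) (auto intro: lin_comp[OF dl bilin_r[OF b]] bilin_l[OF b] lin_closed[OF dl])
  have bal: "pure K (tensor_Ae K A X Q') (lact X b (ract X x a)) (d y) = pure K (tensor_Ae K A X Q') x (d (lact Q a (ract Q y b)))"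
    if "x \<in> carrier X" "a \<in> carrier A" "b \<in> carrier A" "y \<in> carrier Q" for x a b y
    using tensor_Ae_balanced[OF X Q' that(1-3) lin_closed[OF dl that(4)]] that
      lin_closed[OF biactD(3)[OF Q that(3)] that(4)]
    by (simp add: bimod_homsD(3,4)[OF d])
  show "f \<in> lin_maps K (tensor_Ae K A X Q) (tensor_Ae K A X Q')"
    unfolding f_def by (rule tensor_Ae_lift_lin[OF X Q T bi bal])
  show "f (pure K (tensor_Ae K A X Q) x y) = pure K (tensor_Ae K A X Q') x (d y)" if "x \<in> carrier X" "y \<in> carrier Q"
    unfolding f_def by (rule tensor_Ae_lift_pure[OF X Q T bi bal that])
qed

lemma
  assumes X: "biact X" and X': "biact X'" and Q: "biact Q" and d: "d \<in> bimod_homs K A X X'"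
  defines "f \<equiv> tensor_lift K (tensor_Ae K A X' Q) (\<lambda>x y. pure K (tensor_Ae K A X' Q) (d x) y)"
  shows tensor_Ae_lmap_lin: "f \<in> lin_maps K (tensor_Ae K A X Q) (tensor_Ae K A X' Q)"
    and tensor_Ae_lmap_pure: "\<lbrakk>x \<in> carrier X; y \<in> carrier Q\<rbrakk> \<Longrightarrow>
      f (pure K (tensor_Ae K A X Q) x y) = pure K (tensor_Ae K A X' Q) (d x) y"
proof -
  note dl = bimod_homsD(2)[OF d]
  note T = tensor_Ae_module[OF X' Q] and b = tensor_Ae_bilin[OF X' Q]
  have bi: "bilin K X Q (tensor_Ae K A X' Q) (\<lambda>x y. pure K (tensor_Ae K A X' Q) (d x) y)"
    by (rule bilinI) (auto intro: lin_comp[OF dl bilin_l[OF b]] bilin_r[OF b] lin_closed[OF dl])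
  have bal: "pure K (tensor_Ae K A X' Q) (d (lact X b (ract X x a))) y = pure K (tensor_Ae K A X' Q) (d x) (lact Q a (ract Q y b))"
    if "x \<in> carrier X" "a \<in> carrier A" "b \<in> carrier A" "y \<in> carrier Q" for x a b y
    using tensor_Ae_balanced[OF X' Q lin_closed[OF dl that(1)] that(2-4)] that
      lin_closed[OF biactD(3)[OF X that(2)] that(1)]
    by (simp add: bimod_homsD(3,4)[OF d])
  show "f \<in> lin_maps K (tensor_Ae K A X Q) (tensor_Ae K A X' Q)"
    unfolding f_def by (rule tensor_Ae_lift_lin[OF X Q T bi bal])
  show "f (pure K (tensor_Ae K A X Q) x y) = pure K (tensor_Ae K A X' Q) (d x) y" if "x \<in> carrier X" "y \<in> carrier Q"
    unfolding f_def by (rule tensor_Ae_lift_pure[OF X Q T bi bal that])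
qed

context
  fixes M :: "('k, 'a, 'm) bimodule"
  assumes M: "bimodule K A M"
begin

lemma
  assumes X: "bimodule K A X" and X': "bimodule K A X'" and d: "d \<in> bimod_homs K A X X'"
  defines "f \<equiv> tensor_lift K (tensor_A K A M X') (\<lambda>m x. pure K (tensor_A K A M X') m (d x))"
  shows tensor_A_map_pure: "\<lbrakk>m \<in> carrier M; x \<in> carrier X\<rbrakk> \<Longrightarrow>
      f (pure K (tensor_A K A M X) m x) = pure K (tensor_A K A M X') m (d x)"
    and tensor_A_map_hom: "f \<in> bimod_homs K A (tensor_A K A M X) (tensor_A K A M X')"
proof -
  interpret M: bimodule K A M by (rule M)
  interpret X: bimodule K A X by (rule X)
  let ?T = "tensor_A K A M X" and ?T' = "tensor_A K A M X'"
  note dl = bimod_homsD(2)[OF d]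
  note T = tensor_A_module[OF M X'] and b = tensor_A_bilin[OF M X']
  have bi: "bilin K M X ?T' (\<lambda>x y. pure K ?T' x (d y))"
    by (rule bilinI) (auto intro: lin_comp[OF dl bilin_r[OF b]] bilin_l[OF b] lin_closed[OF dl])
  have bal: "pure K ?T' (ract M m a) (d x) = pure K ?T' m (d (lact X a x))"
    if "m \<in> carrier M" "a \<in> carrier A" "x \<in> carrier X" for m a x
    using tensor_A_balanced[OF M X' that(1,2) lin_closed[OF dl that(3)]] that
    by (simp add: bimod_homsD(3)[OF d])
  have l: "f \<in> lin_maps K ?T ?T'" unfolding f_def by (rule tensor_A_lift_lin[OF M X T bi bal])
  have p: "f (pure K ?T m x) = pure K ?T' m (d x)" if "m \<in> carrier M" "x \<in> carrier X" for m x
    unfolding f_def by (rule tensor_A_lift_pure[OF M X T bi bal that])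
  show "f (pure K ?T m x) = pure K ?T' m (d x)" if "m \<in> carrier M" "x \<in> carrier X" by (rule p[OF that])
  show "f \<in> bimod_homs K A ?T ?T'"
  proof (rule bimod_homsI[OF l])
    fix a t assume a: "a \<in> carrier A" and t: "t \<in> carrier ?T"
    show "f (lact ?T a t) = lact ?T' a (f t)"
      by (rule tensor_A_eqI[OF M X t lin_comp[OF tensor_A_lact_lin[OF M X a] l] lin_comp[OF l tensor_A_lact_lin[OF M X' a]]])
        (simp add: tensor_A_lact[OF M X a] tensor_A_lact[OF M X' a] p lin_closed[OF dl] M.lact_closed a)
    show "f (ract ?T t a) = ract ?T' (f t) a"
      by (rule tensor_A_eqI[OF M X t lin_comp[OF tensor_A_ract_lin[OF M X a] l] lin_comp[OF l tensor_A_ract_lin[OF M X' a]]])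
        (simp add: tensor_A_ract[OF M X a] tensor_A_ract[OF M X' a] p lin_closed[OF dl] X.ract_closed a bimod_homsD(4)[OF d])
  qed
qed

context
  fixes W :: "('k, 'w) module"
  assumes W: "module K W"
begin

abbreviation "MW \<equiv> tensor_A K A M (AWA W)"
abbreviation "DW Q \<equiv> tensor_Ae K A MW Q"

lemmas C = AWA_bimodule[OF W]
lemmas MW_biact = tensor_A_biact[OF M C]

text \<open>The normal form of a generator: the right factor of \<open>A (x) W (x) A\<close> has
  been moved onto \<open>p\<close>. These elements span, and the action on \<open>p\<close> that is
  still tied up is the right one, which trades against the left action on \<open>m\<close>.\<close>

definition "gen Q m a w p = pure K (DW Q) (pure K MW m (triple K A W a w \<one>\<^bsub>A\<^esub>)) p"

lemma tri1: "\<lbrakk>a \<in> carrier A; w \<in> carrier W\<rbrakk> \<Longrightarrow> triple K A W a w \<one>\<^bsub>A\<^esub> \<in> carrier (AWA W)"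
  using tri_closed[OF W] by simp

lemma pure_MW: "\<lbrakk>m \<in> carrier M; t \<in> carrier (AWA W)\<rbrakk> \<Longrightarrow> pure K MW m t \<in> carrier MW"
  using bilin_closed[OF tensor_A_bilin[OF M C]] .

context
  fixes Q :: "('k, 'a, 'q) bimodule"
  assumes Q: "bimodule K A Q"
begin

interpretation M: bimodule K A M by (rule M)
interpretation Q: bimodule K A Q by (rule Q)

lemmas DW_bilin = tensor_Ae_bilin[OF MW_biact bimodule_biact[OF Q]]
lemmas DW_balanced = tensor_Ae_balanced[OF MW_biact bimodule_biact[OF Q]]

text \<open>Balancing with the unit on the other side. Since \<open>MW\<close> is only known as a
  \<open>biact\<close>, that the unit acts trivially on it is checked on pure tensors.\<close>

lemma DW_absorb_r: "\<lbrakk>y \<in> carrier MW; a \<in> carrier A; p \<in> carrier Q\<rbrakk> \<Longrightarrow>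
    pure K (DW Q) (ract MW y a) p = pure K (DW Q) y (lact Q a p)"
  using DW_balanced[of y a "\<one>\<^bsub>A\<^esub>" p] tensor_A_eqI[OF M C, of "ract MW y a" "lact MW \<one>\<^bsub>A\<^esub>" MW "\<lambda>x. x"]
    tensor_A_lact_lin[OF M C A.one_closed] lin_id[of K MW] lin_closed[OF tensor_A_ract_lin[OF M C]]
  by (simp add: tensor_A_lact[OF M C A.one_closed] M.lact_one Q.ract_one)

lemma DW_absorb_l: "\<lbrakk>y \<in> carrier MW; a \<in> carrier A; p \<in> carrier Q\<rbrakk> \<Longrightarrow>
    pure K (DW Q) (lact MW a y) p = pure K (DW Q) y (ract Q p a)"
  using DW_balanced[of y "\<one>\<^bsub>A\<^esub>" a p] tensor_A_eqI[OF M C, of y "\<lambda>y. ract MW y \<one>\<^bsub>A\<^esub>" MW "\<lambda>x. x"]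
    tensor_A_ract_lin[OF M C A.one_closed] lin_id[of K MW]
  by (simp add: tensor_A_ract[OF M C A.one_closed] bimodule.ract_one[OF C] Q.lact_one Q.ract_closed)

lemma pure_gen:
  assumes "m \<in> carrier M" "a \<in> carrier A" "w \<in> carrier W" "b \<in> carrier A" "p \<in> carrier Q"
  shows "pure K (DW Q) (pure K MW m (triple K A W a w b)) p = gen Q m a w (lact Q b p)"
proof -
  have "pure K MW m (triple K A W a w b) = ract MW (pure K MW m (triple K A W a w \<one>\<^bsub>A\<^esub>)) b"
    using assms by (simp add: tensor_A_ract[OF M C] tri1 AWA_ract[OF W] del: AWA_simps)
  then show ?thesis unfolding gen_def using DW_absorb_r[OF pure_MW[OF assms(1) tri1[OF assms(2,3)]] assms(4,5)] by simp
qed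

lemma gen_lin: "\<lbrakk>m \<in> carrier M; a \<in> carrier A; w \<in> carrier W\<rbrakk> \<Longrightarrow> (\<lambda>p. gen Q m a w p) \<in> lin_maps K Q (DW Q)"
  unfolding gen_def by (rule bilin_r[OF DW_bilin pure_MW[OF _ tri1]])

lemma DW_eqI:
  assumes t: "t \<in> carrier (DW Q)" and f: "f \<in> lin_maps K (DW Q) Z" and g: "g \<in> lin_maps K (DW Q) Z"
    and eq: "\<And>m a w p. \<lbrakk>m \<in> carrier M; a \<in> carrier A; w \<in> carrier W; p \<in> carrier Q\<rbrakk> \<Longrightarrow> f (gen Q m a w p) = g (gen Q m a w p)"
  shows "f t = g t"
proof (rule tensor_Ae_eqI[OF MW_biact bimodule_biact[OF Q] t f g])
  fix y p assume y: "y \<in> carrier MW" and p: "p \<in> carrier Q"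
  note l = lin_comp[OF bilin_l[OF DW_bilin p] f] lin_comp[OF bilin_l[OF DW_bilin p] g]
  show "f (pure K (DW Q) y p) = g (pure K (DW Q) y p)"
  proof (rule tensor_A_eqI[OF M C y l])
    fix m x assume m: "m \<in> carrier M" and x: "x \<in> carrier (AWA W)"
    note r = bilin_r[OF tensor_A_bilin[OF M C] m]
    show "f (pure K (DW Q) (pure K MW m x) p) = g (pure K (DW Q) (pure K MW m x) p)"
      by (rule AWA_eqI[OF W x lin_comp[OF r l(1)] lin_comp[OF r l(2)]])
        (simp add: pure_gen m p eq Q.lact_closed)
  qed
qed

text \<open>A map that is merely right linear still acts, because \<open>AWA W\<close> is free as a right module
  on the left submodule of the elements \<open>a \<otimes> w \<otimes> 1\<close>.\<close>

lemma DW_right_map: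
  fixes Q' :: "('k, 'a, 'r) bimodule"
  assumes Q': "bimodule K A Q'" and s: "s \<in> right_homs Q Q'"
  obtains G where "G \<in> lin_maps K (DW Q) (DW Q')"
    "\<And>m a w p. \<lbrakk>m \<in> carrier M; a \<in> carrier A; w \<in> carrier W; p \<in> carrier Q\<rbrakk> \<Longrightarrow> G (gen Q m a w p) = gen Q' m a w (s p)"
proof -
  interpret Q': bimodule K A Q' by (rule Q')
  note sl = right_homsD(1)[OF s]
  note D' = tensor_Ae_module[OF MW_biact bimodule_biact[OF Q']]
  note b' = tensor_Ae_bilin[OF MW_biact bimodule_biact[OF Q']]
  note bA = tensor_A_bilin[OF M C]
  let ?n = "\<lambda>m a w p. pure K (DW Q') (pure K MW m (triple K A W a w \<one>\<^bsub>A\<^esub>)) p"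
  have nl1: "(\<lambda>m. ?n m a w p) \<in> lin_maps K M (DW Q')" if "a \<in> carrier A" "w \<in> carrier W" "p \<in> carrier Q'" for a w p
    by (rule lin_comp[OF bilin_l[OF bA tri1[OF that(1,2)]] bilin_l[OF b' that(3)]])
  have nl2: "(\<lambda>a. ?n m a w p) \<in> lin_maps K A (DW Q')" if "m \<in> carrier M" "w \<in> carrier W" "p \<in> carrier Q'" for m w p
    by (rule lin_comp[OF lin_comp[OF trilin_1[OF triple_tri[OF W] that(2) A.one_closed] bilin_r[OF bA that(1)]] bilin_l[OF b' that(3)]])
  have nl3: "(\<lambda>w. ?n m a w p) \<in> lin_maps K W (DW Q')" if "m \<in> carrier M" "a \<in> carrier A" "p \<in> carrier Q'" for m a p
    by (rule lin_comp[OF lin_comp[OF trilin_2[OF triple_tri[OF W] that(2) A.one_closed] bilin_r[OF bA that(1)]] bilin_l[OF b' that(3)]])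
  have nl4: "(\<lambda>p. ?n m a w p) \<in> lin_maps K Q' (DW Q')" if "m \<in> carrier M" "a \<in> carrier A" "w \<in> carrier W" for m a w
    by (rule bilin_r[OF b' pure_MW[OF that(1) tri1[OF that(2,3)]]])
  \<comment> \<open>The right factor \<open>b\<close> is applied to \<open>p\<close> before
    \<open>s\<close>, as in the normal form; so \<open>s\<close> never has to commute with left
    multiplication.\<close>
  let ?\<phi> = "\<lambda>p m a w b. ?n m a w (s (lact Q b p))"
  have sc: "s (lact Q b p) \<in> carrier Q'" if "b \<in> carrier A" "p \<in> carrier Q" for b p
    using lin_closed[OF sl Q.lact_closed[OF that]] .
  have tri: "trilin K A W (DW Q') (?\<phi> p m)" if "m \<in> carrier M" "p \<in> carrier Q" for m p
    by (rule trilinI) (use that in \<open>auto intro!: nl2 nl3 sc lin_comp[OF lin_comp[OF bimodule_lact'[OF Q] sl] nl4]\<close>)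
  \<comment> \<open>Three lifts are stacked: out of \<open>A (x) W (x) A\<close>, then out of
    \<open>MW\<close>, then out of the product with \<open>Q\<close>. Each layer needs linearity in
    the variables still to come.\<close>
  define \<gamma> where "\<gamma> p m = triple_lift K (DW Q') (?\<phi> p m)" for p m
  have \<gamma>l: "\<gamma> p m \<in> lin_maps K (AWA W) (DW Q')" if "m \<in> carrier M" "p \<in> carrier Q" for m p
    unfolding \<gamma>_def by (rule AWA_lift_lin[OF W D' tri[OF that]])
  have \<gamma>t: "\<gamma> p m (triple K A W a w b) = ?\<phi> p m a w b"
    if "m \<in> carrier M" "p \<in> carrier Q" "a \<in> carrier A" "w \<in> carrier W" "b \<in> carrier A" for m p a w b
    unfolding \<gamma>_def by (rule AWA_lift_triple[OF W D' tri[OF that(1,2)] that(3-5)])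
  have \<gamma>m: "(\<lambda>m. \<gamma> p m x) \<in> lin_maps K M (DW Q')" if "p \<in> carrier Q" "x \<in> carrier (AWA W)" for p x
    unfolding \<gamma>_def
    by (rule triple_lift_param[OF A W D' tri[OF _ that(1)] _ bimodule_module[OF M]])
      (use that in \<open>auto intro!: nl1 sc\<close>)
  have \<gamma>p: "(\<lambda>p. \<gamma> p m x) \<in> lin_maps K Q (DW Q')" if "m \<in> carrier M" "x \<in> carrier (AWA W)" for m x
    unfolding \<gamma>_def
    by (rule triple_lift_param[OF A W D' tri[OF that(1)] _ bimodule_module[OF Q]])
      (use that in \<open>auto intro!: lin_comp[OF lin_comp[OF bimodule_lact[OF Q] sl] nl4]\<close>)
  have \<gamma>bi: "bilin K M (AWA W) (DW Q') (\<gamma> p)" if "p \<in> carrier Q" for p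
    by (rule bilinI[OF \<gamma>l[OF _ that] \<gamma>m[OF that]])
  have \<gamma>bal: "\<gamma> p (ract M m c) x = \<gamma> p m (lact (AWA W) c x)"
    if mpc: "p \<in> carrier Q" "m \<in> carrier M" "c \<in> carrier A" and x: "x \<in> carrier (AWA W)" for p m c x
  proof (rule AWA_eqI[OF W x \<gamma>l lin_comp[OF AWA_lact_lin[OF W] \<gamma>l]])
    fix a w b assume abw: "a \<in> carrier A" "w \<in> carrier W" "b \<in> carrier A"
    have "pure K MW (ract M m c) (triple K A W a w \<one>\<^bsub>A\<^esub>) = pure K MW m (triple K A W (c \<otimes>\<^bsub>A\<^esub> a) w \<one>\<^bsub>A\<^esub>)"
      using tensor_A_balanced[OF M C mpc(2,3) tri1[OF abw(1,2)]] AWA_lact[OF W mpc(3) abw(1,2) A.one_closed] by simp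
    then show "\<gamma> p (ract M m c) (triple K A W a w b) = \<gamma> p m (lact (AWA W) c (triple K A W a w b))"
      using mpc abw by (simp add: AWA_lact[OF W] \<gamma>t M.ract_closed)
  qed (use mpc M.ract_closed in auto)
  define gm where "gm p = tensor_lift K (DW Q') (\<gamma> p)" for p
  have gml: "gm p \<in> lin_maps K MW (DW Q')" if "p \<in> carrier Q" for p
    unfolding gm_def by (rule tensor_A_lift_lin[OF M C D' \<gamma>bi[OF that] \<gamma>bal[OF that]])
  have gmp: "gm p (pure K MW m x) = \<gamma> p m x" if "p \<in> carrier Q" "m \<in> carrier M" "x \<in> carrier (AWA W)" for p m x
    unfolding gm_def by (rule tensor_A_lift_pure[OF M C D' \<gamma>bi[OF that(1)] \<gamma>bal[OF that(1)] that(2,3)])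
  have gmq: "(\<lambda>p. gm p y) \<in> lin_maps K Q (DW Q')" if "y \<in> carrier MW" for y
    unfolding gm_def by (rule tensor_A_lift_param[OF M C D' \<gamma>bi \<gamma>bal \<gamma>p bimodule_module[OF Q] that])
  have bi: "bilin K MW Q (DW Q') (\<lambda>y p. gm p y)" by (rule bilinI[OF gmq gml])
  \<comment> \<open>The left action on \<open>p\<close> is collected together with \<open>d\<close>
    inside \<open>s\<close>; the right action has to cross \<open>s\<close>, and this is the one
    place where right linearity is used.\<close>
  have bal: "gm p (lact MW b (ract MW y a)) = gm (lact Q a (ract Q p b)) y"
    if y: "y \<in> carrier MW" and ab: "a \<in> carrier A" "b \<in> carrier A" and p: "p \<in> carrier Q" for y a b p
  proof -
    have pq: "lact Q a (ract Q p b) \<in> carrier Q" using ab p Q.lact_closed Q.ract_closed by simp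
    note l1 = lin_comp[OF lin_comp[OF tensor_A_ract_lin[OF M C ab(1)] tensor_A_lact_lin[OF M C ab(2)]] gml[OF p]]
    note l2 = gml[OF pq]
    show ?thesis
    proof (rule tensor_A_eqI[OF M C y l1 l2])
      fix m x assume m: "m \<in> carrier M" and x: "x \<in> carrier (AWA W)"
      note r = bilin_r[OF bA m]
      show "gm p (lact MW b (ract MW (pure K MW m x) a)) = gm (lact Q a (ract Q p b)) (pure K MW m x)"
      proof (rule AWA_eqI[OF W x lin_comp[OF r l1] lin_comp[OF r l2]])
        fix c w d assume cwd: "c \<in> carrier A" "w \<in> carrier W" "d \<in> carrier A"
        have t: "triple K A W c w d \<in> carrier (AWA W)" "triple K A W c w (d \<otimes>\<^bsub>A\<^esub> a) \<in> carrier (AWA W)"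
          using tri_closed[OF W] cwd ab by auto
        let ?q = "lact Q (d \<otimes>\<^bsub>A\<^esub> a) p" let ?y = "pure K MW m (triple K A W c w \<one>\<^bsub>A\<^esub>)"
        have q: "?q \<in> carrier Q" using Q.lact_closed cwd ab p by simp
        have y1: "?y \<in> carrier MW" by (rule pure_MW[OF m tri1[OF cwd(1,2)]])
        have "gm p (lact MW b (ract MW (pure K MW m (triple K A W c w d)) a)) = ?n (lact M b m) c w (s ?q)"
          using m cwd ab t p by (simp add: tensor_A_ract[OF M C] tensor_A_lact[OF M C] AWA_ract[OF W] gmp \<gamma>t M.lact_closed del: AWA_simps)
        also have "\<dots> = pure K (DW Q') (lact MW b ?y) (s ?q)"
          using tensor_A_lact[OF M C ab(2) m tri1[OF cwd(1,2)]] by simp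
        also have "\<dots> = pure K (DW Q') ?y (ract Q' (s ?q) b)"
        proof -
          have "pure K (DW Q') (lact MW b (ract MW ?y \<one>\<^bsub>A\<^esub>)) (s ?q) = pure K (DW Q') ?y (lact Q' \<one>\<^bsub>A\<^esub> (ract Q' (s ?q) b))"
            by (rule tensor_Ae_balanced[OF MW_biact bimodule_biact[OF Q'] y1 A.one_closed ab(2) lin_closed[OF sl q]])
          moreover have "ract MW ?y \<one>\<^bsub>A\<^esub> = ?y"
            using tensor_A_ract[OF M C A.one_closed m tri1[OF cwd(1,2)]] bimodule.ract_one[OF C tri1[OF cwd(1,2)]] by simp
          ultimately show ?thesis using Q'.lact_one[OF Q'.ract_closed[OF ab(2) lin_closed[OF sl q]]] by simp
        qed
        also have "\<dots> = pure K (DW Q') ?y (s (lact Q d (lact Q a (ract Q p b))))"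
          using right_homsD(2)[OF s ab(2) q] cwd ab p
          by (simp add: Q.lact_assoc Q.lact_ract Q.lact_closed)
        also have "\<dots> = gm (lact Q a (ract Q p b)) (pure K MW m (triple K A W c w d))"
          using m cwd t pq by (simp add: gmp \<gamma>t del: AWA_simps)
        finally show "gm p (lact MW b (ract MW (pure K MW m (triple K A W c w d)) a)) =
          gm (lact Q a (ract Q p b)) (pure K MW m (triple K A W c w d))" .
      qed
    qed
  qed
  let ?G = "tensor_lift K (DW Q') (\<lambda>y p. gm p y)"
  have "?G \<in> lin_maps K (DW Q) (DW Q')"
    by (rule tensor_Ae_lift_lin[OF MW_biact bimodule_biact[OF Q] D' bi bal])
  moreover have "?G (gen Q m a w p) = gen Q' m a w (s p)"
    if "m \<in> carrier M" "a \<in> carrier A" "w \<in> carrier W" "p \<in> carrier Q" for m a w p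
    unfolding gen_def
    using tensor_Ae_lift_pure[OF MW_biact bimodule_biact[OF Q] D' bi bal pure_MW[OF that(1) tri1[OF that(2,3)]] that(4)]
      that tri1[OF that(2,3)] by (simp add: gmp \<gamma>t Q.lact_one)
  ultimately show ?thesis using that by blast
qed

end

end

end

end

section \<open>The augmentation of a row of the homological double complex\<close>

context kalg
begin

context
  fixes M :: "('k, 'a, 'm) bimodule" and W :: "('k, 'w) module" and Q :: "('k, 'a, 'q) bimodule" and \<epsilon> :: "'q \<Rightarrow> 'a"
  assumes M: "bimodule K A M" and W: "module K W" and Q: "bimodule K A Q"
    and eps: "\<epsilon> \<in> bimod_homs K A Q (regular_bimod A)"
begin

interpretation M: bimodule K A M by (rule M)
interpretation Q: bimodule K A Q by (rule Q)
interpretation C: bimodule K A "AWA W" by (rule AWA_bimodule[OF W])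

abbreviation (input) "MC \<equiv> tensor_A K A M (AWA W)"
abbreviation (input) "EC \<equiv> tensor_Ae K A M (AWA W)"

lemmas CC = AWA_bimodule[OF W]
lemmas EC_module = tensor_Ae_module[OF bimodule_biact[OF M] bimodule_biact[OF CC]]
lemmas EC_bilin = tensor_Ae_bilin[OF bimodule_biact[OF M] bimodule_biact[OF CC]]
lemmas EC_bal = tensor_Ae_balanced[OF bimodule_biact[OF M] bimodule_biact[OF CC]]

lemma eps_l: "\<epsilon> \<in> lin_maps K Q A"
  using bimod_homsD(2)[OF eps] by (simp add: lin_maps_def regular_bimod_def)

lemma eps_a: "\<lbrakk>a \<in> carrier A; x \<in> carrier Q\<rbrakk> \<Longrightarrow> \<epsilon> (lact Q a x) = a \<otimes>\<^bsub>A\<^esub> \<epsilon> x"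
  "\<lbrakk>a \<in> carrier A; x \<in> carrier Q\<rbrakk> \<Longrightarrow> \<epsilon> (ract Q x a) = \<epsilon> x \<otimes>\<^bsub>A\<^esub> a"
  using bimod_homsD(3,4)[OF eps] by (simp_all add: regular_bimod_def)

lemma EC_bal_l: "\<lbrakk>m \<in> carrier M; a \<in> carrier A; x \<in> carrier (AWA W)\<rbrakk> \<Longrightarrow> pure K EC (ract M m a) x = pure K EC m (lact (AWA W) a x)"
  using EC_bal[of m a "\<one>\<^bsub>A\<^esub>" x] M.lact_one[OF M.ract_closed] C.ract_one by (simp del: AWA_simps)

lemma EC_bal_r: "\<lbrakk>m \<in> carrier M; a \<in> carrier A; x \<in> carrier (AWA W)\<rbrakk> \<Longrightarrow> pure K EC (lact M a m) x = pure K EC m (ract (AWA W) x a)"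
  using EC_bal[of m "\<one>\<^bsub>A\<^esub>" a x] M.ract_one C.lact_one[OF C.ract_closed] by (simp del: AWA_simps)

text \<open>With \<open>X = A (x) W (x) A\<close> this is \<open>id (x) \<epsilon>\<close> followed
  by the identification, over the enveloping algebra, of the product of \<open>M (x)_A X\<close> and
  \<open>A\<close> with the product of \<open>M\<close> and \<open>X\<close>.\<close>

definition "aug = tensor_lift K EC (\<lambda>y p. tensor_lift K EC (\<lambda>m x. pure K EC m (ract (AWA W) x (\<epsilon> p))) y)"

lemma
  shows aug_lin: "aug \<in> lin_maps K (tensor_Ae K A MC Q) EC"
    and aug_pure: "\<lbrakk>m \<in> carrier M; x \<in> carrier (AWA W); p \<in> carrier Q\<rbrakk> \<Longrightarrow>
      aug (pure K (tensor_Ae K A MC Q) (pure K MC m x) p) = pure K EC m (ract (AWA W) x (\<epsilon> p))"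
proof -
  note ec = lin_closed[OF eps_l]
  let ?\<phi> = "\<lambda>p m x. pure K EC m (ract (AWA W) x (\<epsilon> p))"
  define \<beta> where "\<beta> p = tensor_lift K EC (?\<phi> p)" for p
  have bi: "bilin K M (AWA W) EC (?\<phi> p)" if "p \<in> carrier Q" for p
    by (rule bilinI) (auto intro: lin_comp[OF bimodule_ract[OF CC ec[OF that]] bilin_r[OF EC_bilin]]
      bilin_l[OF EC_bilin] C.ract_closed[OF ec[OF that]] simp del: AWA_simps)
  have bal: "?\<phi> p (ract M m a) x = ?\<phi> p m (lact (AWA W) a x)"
    if "p \<in> carrier Q" "m \<in> carrier M" "a \<in> carrier A" "x \<in> carrier (AWA W)" for p m a x
    using that EC_bal_l[OF that(2,3) C.ract_closed[OF ec that(4)]] C.lact_ract ec by (simp del: AWA_simps)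
  have \<beta>l: "\<beta> p \<in> lin_maps K MC EC" if "p \<in> carrier Q" for p
    unfolding \<beta>_def by (rule tensor_A_lift_lin[OF M CC EC_module bi[OF that] bal[OF that]])
  have \<beta>p: "\<beta> p (pure K MC m x) = ?\<phi> p m x" if "p \<in> carrier Q" "m \<in> carrier M" "x \<in> carrier (AWA W)" for p m x
    unfolding \<beta>_def by (rule tensor_A_lift_pure[OF M CC EC_module bi[OF that(1)] bal[OF that(1)] that(2,3)])
  have \<phi>p: "(\<lambda>p. ?\<phi> p m x) \<in> lin_maps K Q EC" if "m \<in> carrier M" "x \<in> carrier (AWA W)" for m x
    by (rule lin_comp[OF lin_comp[OF eps_l bimodule_ract'[OF CC that(2)]] bilin_r[OF EC_bilin that(1)]])
  have \<beta>q: "(\<lambda>p. \<beta> p y) \<in> lin_maps K Q EC" if "y \<in> carrier MC" for y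
    unfolding \<beta>_def by (rule tensor_A_lift_param[OF M CC EC_module bi bal \<phi>p bimodule_module[OF Q] that])
  have bi2: "bilin K MC Q EC (\<lambda>y p. \<beta> p y)" by (rule bilinI[OF \<beta>q \<beta>l])
  have bal2: "\<beta> p (lact MC b (ract MC y a)) = \<beta> (lact Q a (ract Q p b)) y"
    if y: "y \<in> carrier MC" and ab: "a \<in> carrier A" "b \<in> carrier A" and p: "p \<in> carrier Q" for y a b p
  proof -
    have pq: "lact Q a (ract Q p b) \<in> carrier Q" using ab p Q.lact_closed Q.ract_closed by simp
    show ?thesis
    proof (rule tensor_A_eqI[OF M CC y lin_comp[OF lin_comp[OF tensor_A_ract_lin[OF M CC ab(1)] tensor_A_lact_lin[OF M CC ab(2)]] \<beta>l[OF p]] \<beta>l[OF pq]])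
      fix m x assume mx: "m \<in> carrier M" "x \<in> carrier (AWA W)"
      note e = ec[OF p]
      have "\<beta> p (lact MC b (ract MC (pure K MC m x) a)) = pure K EC (lact M b m) (ract (AWA W) (ract (AWA W) x a) (\<epsilon> p))"
        using mx ab p by (simp add: tensor_A_ract[OF M CC] tensor_A_lact[OF M CC] C.ract_closed M.lact_closed \<beta>p del: AWA_simps)
      also have "\<dots> = pure K EC m (ract (AWA W) x (a \<otimes>\<^bsub>A\<^esub> (\<epsilon> p \<otimes>\<^bsub>A\<^esub> b)))"
        using mx ab e by (simp add: EC_bal_r C.ract_closed C.ract_assoc[symmetric] A.m_assoc del: AWA_simps)
      also have "\<dots> = \<beta> (lact Q a (ract Q p b)) (pure K MC m x)"
        using mx ab p pq by (simp add: \<beta>p eps_a Q.ract_closed del: AWA_simps)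
      finally show "\<beta> p (lact MC b (ract MC (pure K MC m x) a)) = \<beta> (lact Q a (ract Q p b)) (pure K MC m x)" .
    qed
  qed
  note t = tensor_A_biact[OF M CC] bimodule_biact[OF Q] EC_module
  show "aug \<in> lin_maps K (tensor_Ae K A MC Q) EC"
    using tensor_Ae_lift_lin[OF t bi2 bal2] by (simp add: aug_def \<beta>_def)
  show "aug (pure K (tensor_Ae K A MC Q) (pure K MC m x) p) = pure K EC m (ract (AWA W) x (\<epsilon> p))"
    if "m \<in> carrier M" "x \<in> carrier (AWA W)" "p \<in> carrier Q"
    using tensor_Ae_lift_pure[OF t bi2 bal2 bilin_closed[OF tensor_A_bilin[OF M CC] that(1,2)] that(3)] that
    by (simp add: aug_def \<beta>_def[symmetric] \<beta>p del: AWA_simps)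
qed

lemma aug_surj:
  assumes 1: "\<epsilon> ` carrier Q = carrier A" and t: "t \<in> carrier EC"
  shows "\<exists>z\<in>carrier (tensor_Ae K A MC Q). aug z = t"
proof -
  obtain p where p: "p \<in> carrier Q" "\<epsilon> p = \<one>\<^bsub>A\<^esub>" using 1 A.one_closed by (metis imageE)
  note b = tensor_A_biact[OF M CC] bimodule_biact[OF Q]
  interpret D: module K "tensor_Ae K A MC Q" by (rule tensor_Ae_module[OF b])
  show ?thesis using bimodule_biact[OF M] bimodule_biact[OF CC] t
  proof (induction rule: tensor_Ae_induct)
    case (pure m x)
    then show ?case using p aug_pure[OF pure p(1)] C.ract_one
      bilin_closed[OF tensor_Ae_bilin[OF b] bilin_closed[OF tensor_A_bilin[OF M CC] pure] p(1)]
      by (metis)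
  next
    case (add t u)
    then show ?case using lin_add[OF aug_lin] D.a_closed by metis
  qed
qed

text \<open>The map sending \<open>m (x) x\<close> to \<open>(m (x) x) (x) 1\<close> recovers
  \<open>id (x) \<epsilon>\<close> from \<open>aug\<close>, so whatever \<open>aug\<close> kills is
  killed by \<open>id (x) \<epsilon>\<close>. The contraction is formulated with the latter,
  exactness with the former.\<close>

lemma aug_kernel:
  assumes z: "z \<in> carrier (tensor_Ae K A MC Q)" "aug z = \<zero>\<^bsub>EC\<^esub>"
    and f: "f \<in> lin_maps K (tensor_Ae K A MC Q) (tensor_Ae K A MC (regular_bimod A))"
      "\<And>y p. \<lbrakk>y \<in> carrier MC; p \<in> carrier Q\<rbrakk> \<Longrightarrow>
        f (pure K (tensor_Ae K A MC Q) y p) = pure K (tensor_Ae K A MC (regular_bimod A)) y (\<epsilon> p)"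
  shows "f z = \<zero>\<^bsub>tensor_Ae K A MC (regular_bimod A)\<^esub>"
proof -
  let ?D = "tensor_Ae K A MC (regular_bimod A)"
  have rA: "carrier (regular_bimod A) = carrier A" "lact (regular_bimod A) = mult A" "ract (regular_bimod A) = mult A"
    by (simp_all add: regular_bimod_def)
  note b = tensor_A_biact[OF M CC] bimodule_biact[OF regular_bimodule]
  note Dm = tensor_Ae_module[OF b] and Db = tensor_Ae_bilin[OF b]
  note abr = DW_absorb_r[OF M W regular_bimodule, unfolded rA] and abl = DW_absorb_l[OF M W regular_bimodule, unfolded rA]
  note bA = tensor_A_bilin[OF M CC]
  let ?\<theta> = "\<lambda>m x. pure K ?D (pure K MC m x) \<one>\<^bsub>A\<^esub>"
  have one: "\<one>\<^bsub>A\<^esub> \<in> carrier (regular_bimod A)" by (simp add: rA)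
  have bi: "bilin K M (AWA W) ?D ?\<theta>"
    by (rule bilinI) (auto intro: lin_comp[OF bilin_r[OF bA] bilin_l[OF Db one]] lin_comp[OF bilin_l[OF bA] bilin_l[OF Db one]])
  have bal: "?\<theta> (lact M b (ract M m a)) x = ?\<theta> m (lact (AWA W) a (ract (AWA W) x b))"
    if "m \<in> carrier M" "a \<in> carrier A" "b \<in> carrier A" "x \<in> carrier (AWA W)" for m a b x
  proof -
    have y: "pure K MC m (lact (AWA W) a x) \<in> carrier MC"
      using bilin_closed[OF bA that(1) C.lact_closed[OF that(2,4)]] .
    have "pure K MC (lact M b (ract M m a)) x = lact MC b (pure K MC m (lact (AWA W) a x))"
      using that by (simp add: tensor_A_lact[OF M CC] tensor_A_balanced[OF M CC, symmetric] C.lact_closed M.ract_closed del: AWA_simps)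
    moreover have "pure K MC m (lact (AWA W) a (ract (AWA W) x b)) = ract MC (pure K MC m (lact (AWA W) a x)) b"
      using that by (simp add: tensor_A_ract[OF M CC] C.lact_closed C.lact_ract del: AWA_simps)
    ultimately show ?thesis using abl[OF y that(3) A.one_closed] abr[OF y that(3) A.one_closed] that(3) by simp
  qed
  note t = bimodule_biact[OF M] bimodule_biact[OF CC] Dm bi bal
  note \<theta>l = tensor_Ae_lift_lin[OF t] and \<theta>p = tensor_Ae_lift_pure[OF t]
  let ?T = "tensor_lift K ?D ?\<theta>"
  have "?T (aug z) = f z"
  proof (rule tensor_Ae_eqI[OF tensor_A_biact[OF M CC] bimodule_biact[OF Q] z(1) lin_comp[OF aug_lin \<theta>l] f(1)])
    fix y p assume y: "y \<in> carrier MC" and p: "p \<in> carrier Q"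
    note b' = bilin_l[OF tensor_Ae_bilin[OF tensor_A_biact[OF M CC] bimodule_biact[OF Q]] p]
    show "?T (aug (pure K (tensor_Ae K A MC Q) y p)) = f (pure K (tensor_Ae K A MC Q) y p)"
    proof (rule tensor_A_eqI[OF M CC y lin_comp[OF lin_comp[OF b' aug_lin] \<theta>l] lin_comp[OF b' f(1)]])
      fix m x assume mx: "m \<in> carrier M" "x \<in> carrier (AWA W)"
      note e = lin_closed[OF eps_l p] and y = bilin_closed[OF bA mx]
      show "?T (aug (pure K (tensor_Ae K A MC Q) (pure K MC m x) p)) = f (pure K (tensor_Ae K A MC Q) (pure K MC m x) p)"
        using mx p y e abr[OF y e A.one_closed]
        by (simp add: aug_pure f(2) \<theta>p C.ract_closed tensor_A_ract[OF M CC] del: AWA_simps)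
    qed
  qed
  then show ?thesis using z(2) lin_zero[OF EC_module Dm \<theta>l] by simp
qed

end

section \<open>The homological double complex\<close>

context
  fixes M :: "('k, 'a, 'm) bimodule" and W :: "nat \<Rightarrow> ('k, 'w) module" and P :: "nat \<Rightarrow> ('k, 'a, 'p) bimodule"
    and dP :: "nat \<Rightarrow> 'p \<Rightarrow> 'p" and \<epsilon> :: "'p \<Rightarrow> 'a" and d :: "nat \<Rightarrow> ('k, 'a, 'w) triple \<Rightarrow> ('k, 'a, 'w) triple"
  assumes M: "bimodule K A M" and W: "\<And>i. module K (W i)"
    and field: "field K" and res: "projective_resolution K A P dP \<epsilon>"
    and d: "\<And>i. d (Suc i) \<in> bimod_homs K A (AWA (W (Suc i))) (AWA (W i))"
    and dd: "\<And>i x. x \<in> carrier (AWA (W (Suc (Suc i)))) \<Longrightarrow> d (Suc i) (d (Suc (Suc i)) x) = \<zero>\<^bsub>AWA (W i)\<^esub>"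
begin

abbreviation (input) "MX i \<equiv> tensor_A K A M (AWA (W i))"
abbreviation (input) "dMX \<equiv> tensor_id_d K MX d"
abbreviation (input) "DD i j \<equiv> tensor_Ae K A (MX i) (P j)"
abbreviation (input) "EE i \<equiv> tensor_Ae K A M (AWA (W i))"

lemmas CW = AWA_bimodule[OF W]
lemmas Pb = res_bimodule[OF field res]
lemmas Xb = tensor_A_biact[OF M CW]
lemmas Mb = bimodule_biact[OF M]

lemma dX_hom: "dMX (Suc i) \<in> bimod_homs K A (MX (Suc i)) (MX i)"
  and dX_pure: "\<lbrakk>m \<in> carrier M; x \<in> carrier (AWA (W (Suc i)))\<rbrakk> \<Longrightarrow>
    dMX (Suc i) (pure K (MX (Suc i)) m x) = pure K (MX i) m (d (Suc i) x)"
  using tensor_A_map_hom[OF M CW CW d] tensor_A_map_pure[OF M CW CW d] by (simp_all add: tensor_id_d_def)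

lemma dX_dX: "y \<in> carrier (MX (Suc (Suc i))) \<Longrightarrow> dMX (Suc i) (dMX (Suc (Suc i)) y) = \<zero>\<^bsub>MX i\<^esub>"
proof -
  note l = bimod_homsD(2)[OF dX_hom] and m = tensor_A_module[OF M CW]
  assume y: "y \<in> carrier (MX (Suc (Suc i)))"
  show ?thesis
    by (rule tensor_A_eqI[OF M CW y lin_comp[OF l l] lin_const_zero[OF m]])
      (simp add: dX_pure dd lin_closed[OF bimod_homsD(2)[OF d]] lin_zero[OF bimodule_module[OF CW] m bilin_r[OF tensor_A_bilin[OF M CW]]] del: AWA_simps)
qed

text \<open>Valid for any complex of bimodules \<open>A (x) W_i (x) A\<close>; the input specific to
  quadratic algebras is packed into the assumptions on \<open>d\<close>.\<close>

lemma homology_hyperhomology_iso: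
  "mod_iso K (homology EE (tensor_id_d K EE d) n) (hyperhomology K A P dP MX dMX n)"
proof -
  define dh where "dh i j = tensor_lift K (DD (i - 1) j) (\<lambda>x y. pure K (DD (i - 1) j) (dMX i x) y)" for i j
  define dv where "dv i = tensor_id_d K (DD i) dP" for i
  define e where "e i = aug M (W i) \<epsilon>" for i
  note Pbi = bimodule_biact[OF Pb]
  note dl = bimod_homsD(2)[OF d]
  have dh: "dh (Suc i) j \<in> lin_maps K (DD (Suc i) j) (DD i j)" for i j
    unfolding dh_def using tensor_Ae_lmap_lin[OF Xb Xb Pbi dX_hom] by simp
  have dhp: "dh (Suc i) j (pure K (DD (Suc i) j) y p) = pure K (DD i j) (dMX (Suc i) y) p"
    if "y \<in> carrier (MX (Suc i))" "p \<in> carrier (P j)" for i j y p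
    unfolding dh_def using tensor_Ae_lmap_pure[OF Xb Xb Pbi dX_hom that] by simp
  have dv: "dv i (Suc j) \<in> lin_maps K (DD i (Suc j)) (DD i j)" for i j
    unfolding dv_def tensor_id_d_def using tensor_Ae_map_lin[OF Xb Pbi Pbi res_d[OF field res]] by simp
  have dvp: "dv i (Suc j) (pure K (DD i (Suc j)) y p) = pure K (DD i j) y (dP (Suc j) p)"
    if "y \<in> carrier (MX i)" "p \<in> carrier (P (Suc j))" for i j y p
    unfolding dv_def tensor_id_d_def using tensor_Ae_map_pure[OF Xb Pbi Pbi res_d[OF field res] that] by simp
  have dE: "tensor_id_d K EE d (Suc i) \<in> lin_maps K (EE (Suc i)) (EE i)" for i
    unfolding tensor_id_d_def using tensor_Ae_map_lin[OF Mb bimodule_biact[OF CW] bimodule_biact[OF CW] d] by simp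
  have dEp: "tensor_id_d K EE d (Suc i) (pure K (EE (Suc i)) m x) = pure K (EE i) m (d (Suc i) x)"
    if "m \<in> carrier M" "x \<in> carrier (AWA (W (Suc i)))" for i m x
    unfolding tensor_id_d_def using tensor_Ae_map_pure[OF Mb bimodule_biact[OF CW] bimodule_biact[OF CW] d that] by simp
  note Dm = tensor_Ae_module[OF Xb Pbi] and Db = tensor_Ae_bilin[OF Xb Pbi]
  note Em = tensor_Ae_module[OF Mb bimodule_biact[OF CW]] and Eb = tensor_Ae_bilin[OF Mb bimodule_biact[OF CW]]
  note dXc = lin_closed[OF bimod_homsD(2)[OF dX_hom]]
  note Pd = res_d_lin[OF field res] and Pm = res_module[OF field res]
  note el = aug_lin[OF M W Pb res_eps[OF field res], folded e_def]
  note ep = aug_pure[OF M W Pb res_eps[OF field res], folded e_def]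
  note zr = lin_zero[OF Pm Dm bilin_r[OF Db]] and zl = lin_zero[OF tensor_A_module[OF M CW] Dm bilin_l[OF Db]]
  have De: "f t = g t" if "t \<in> carrier (DD i j)" "f \<in> lin_maps K (DD i j) Z" "g \<in> lin_maps K (DD i j) Z"
    "\<And>m x p. \<lbrakk>m \<in> carrier M; x \<in> carrier (AWA (W i)); p \<in> carrier (P j)\<rbrakk> \<Longrightarrow>
      f (pure K (DD i j) (pure K (MX i) m x) p) = g (pure K (DD i j) (pure K (MX i) m x) p)"
    for t f g i j and Z :: "('k, 'z) module"
  proof (rule tensor_Ae_eqI[OF Xb Pbi that(1-3)])
    fix y p assume y: "y \<in> carrier (MX i)" and p: "p \<in> carrier (P j)"
    note b' = bilin_l[OF Db p]
    show "f (pure K (DD i j) y p) = g (pure K (DD i j) y p)"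
      by (rule tensor_A_eqI[OF M CW y lin_comp[OF b' that(2)] lin_comp[OF b' that(3)]]) (rule that(4)[OF _ _ p])
  qed
  have "augmented_double_complex K DD dh dv EE (tensor_id_d K EE d) e"
  proof (rule augmented_double_complex.intro)
    show "module K (DD i j)" for i j by (rule Dm)
    show "dh (Suc i) j \<in> lin_maps K (DD (Suc i) j) (DD i j)" for i j by (rule dh)
    show "dv i (Suc j) \<in> lin_maps K (DD i (Suc j)) (DD i j)" for i j by (rule dv)
    show "dh (Suc i) j (dh (Suc (Suc i)) j t) = \<zero>\<^bsub>DD i j\<^esub>" if "t \<in> carrier (DD (Suc (Suc i)) j)" for i j t
      by (rule tensor_Ae_eqI[OF Xb Pbi that lin_comp[OF dh dh] lin_const_zero[OF Dm]])
        (simp add: dhp dXc dX_dX zl)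
    show "dv i (Suc j) (dv i (Suc (Suc j)) t) = \<zero>\<^bsub>DD i j\<^esub>" if "t \<in> carrier (DD i (Suc (Suc j)))" for i j t
      by (rule tensor_Ae_eqI[OF Xb Pbi that lin_comp[OF dv dv] lin_const_zero[OF Dm]])
        (simp add: dvp lin_closed[OF Pd] res_dd[OF field res] zr)
    show "dh (Suc i) j (dv (Suc i) (Suc j) t) = dv i (Suc j) (dh (Suc i) (Suc j) t)"
      if "t \<in> carrier (DD (Suc i) (Suc j))" for i j t
      by (rule tensor_Ae_eqI[OF Xb Pbi that lin_comp[OF dv dh] lin_comp[OF dh dv]])
        (simp add: dvp dhp lin_closed[OF Pd] dXc)
    have "tensor_id_d K EE d (Suc p) (tensor_id_d K EE d (Suc (Suc p)) t) = \<zero>\<^bsub>EE p\<^esub>"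
      if "t \<in> carrier (EE (Suc (Suc p)))" for p t
      by (rule tensor_Ae_eqI[OF Mb bimodule_biact[OF CW] that lin_comp[OF dE dE] lin_const_zero[OF Em]])
        (simp add: dEp lin_closed[OF dl] dd lin_zero[OF bimodule_module[OF CW] Em bilin_r[OF Eb]] del: AWA_simps)
    then show "chain_complex K EE (tensor_id_d K EE d)" using Em dE by (simp add: chain_complex_def)
    show "e i \<in> lin_maps K (DD i 0) (EE i)" for i by (rule el)
    show "\<exists>x\<in>carrier (DD i 0). e i x = y" if "y \<in> carrier (EE i)" for i y
      using aug_surj[OF M W Pb res_eps[OF field res] res_eps_surj[OF field res] that] by (simp add: e_def)
    show "e i (dv i (Suc 0) t) = \<zero>\<^bsub>EE i\<^esub>" if "t \<in> carrier (DD i (Suc 0))" for i t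
      by (rule De[OF that lin_comp[OF dv el] lin_const_zero[OF Em]])
        (simp add: dvp ep bilin_closed[OF tensor_A_bilin[OF M CW]] lin_closed[OF Pd] eps_d[OF field res]
          lin_zero[OF A bimodule_module[OF CW] bimodule_ract'[OF CW]] lin_zero[OF bimodule_module[OF CW] Em bilin_r[OF Eb]] del: AWA_simps)
    show "e i (dh (Suc i) 0 t) = tensor_id_d K EE d (Suc i) (e (Suc i) t)" if "t \<in> carrier (DD (Suc i) 0)" for i t
      by (rule De[OF that lin_comp[OF dh el] lin_comp[OF el dE]])
        (simp add: dhp ep dEp bilin_closed[OF tensor_A_bilin[OF M CW]] dX_pure lin_closed[OF dl]
          lin_closed[OF eps_lin[OF field res]] bimodule.ract_closed[OF CW] bimod_homsD(4)[OF d] del: AWA_simps)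
  next
    fix t i assume t: "t \<in> carrier (DD i 0)" "e i t = \<zero>\<^bsub>EE i\<^esub>"
    obtain s u where su: "s \<in> right_homs (regular_bimod A) (P 0)" "u \<in> right_homs (P 0) (P (Suc 0))"
      "\<And>x. x \<in> carrier (P 0) \<Longrightarrow> s (\<epsilon> x) \<oplus>\<^bsub>P 0\<^esub> dP (Suc 0) (u x) = x"
      by (rule contraction_0[OF field res]) blast
    obtain S where S: "S \<in> lin_maps K (tensor_Ae K A (MX i) (regular_bimod A)) (DD i 0)"
      "\<And>m a w p. \<lbrakk>m \<in> carrier M; a \<in> carrier A; w \<in> carrier (W i); p \<in> carrier (regular_bimod A)\<rbrakk> \<Longrightarrow>
        S (gen M (W i) (regular_bimod A) m a w p) = gen M (W i) (P 0) m a w (s p)"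
      by (rule DW_right_map[OF M W regular_bimodule Pb su(1)]) blast
    obtain U where U: "U \<in> lin_maps K (DD i 0) (DD i (Suc 0))"
      "\<And>m a w p. \<lbrakk>m \<in> carrier M; a \<in> carrier A; w \<in> carrier (W i); p \<in> carrier (P 0)\<rbrakk> \<Longrightarrow>
        U (gen M (W i) (P 0) m a w p) = gen M (W i) (P (Suc 0)) m a w (u p)"
      by (rule DW_right_map[OF M W Pb Pb su(2)]) blast
    let ?f = "tensor_lift K (tensor_Ae K A (MX i) (regular_bimod A)) (\<lambda>x y. pure K (tensor_Ae K A (MX i) (regular_bimod A)) x (\<epsilon> y))"
    note fl = tensor_Ae_map_lin[OF Xb[of i] Pbi bimodule_biact[OF regular_bimodule] res_eps[OF field res]]
    note fp = tensor_Ae_map_pure[OF Xb[of i] Pbi bimodule_biact[OF regular_bimodule] res_eps[OF field res]]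
    have f0: "?f t = \<zero>\<^bsub>tensor_Ae K A (MX i) (regular_bimod A)\<^esub>"
      using aug_kernel[OF M W Pb res_eps[OF field res], of t i ?f] t fl fp by (simp add: e_def)
    have ec: "\<epsilon> p \<in> carrier (regular_bimod A)" if "p \<in> carrier (P 0)" for p
      using lin_closed[OF bimod_homsD(2)[OF res_eps[OF field res]] that] .
    interpret D: module K "DD i 0" by (rule Dm)
    \<comment> \<open>The contraction of the resolution, transported to the row: on a generator this
      is the relation for \<open>s\<close> and \<open>u\<close> applied to \<open>p\<close>. As
      \<open>?f t\<close> vanishes, \<open>t\<close> is a vertical boundary.\<close>
    have "S (?f t) \<oplus>\<^bsub>DD i 0\<^esub> dv i (Suc 0) (U t) = t"
    proof (rule DW_eqI[OF M W Pb t(1) lin_sum[OF Dm lin_comp[OF fl S(1)] lin_comp[OF U(1) dv]] lin_id])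
      fix m a w p assume *: "m \<in> carrier M" "a \<in> carrier A" "w \<in> carrier (W i)" "p \<in> carrier (P 0)"
      note g = gen_lin[OF M W Pb *(1-3)] and y = pure_MW[OF M W *(1) tri1[OF M W *(2,3)]]
      have up: "u p \<in> carrier (P (Suc 0))" using lin_closed[OF right_homsD(1)[OF su(2)] *(4)] .
      have sp: "s (\<epsilon> p) \<in> carrier (P 0)" using lin_closed[OF right_homsD(1)[OF su(1)] ec[OF *(4)]] .
      have "?f (gen M (W i) (P 0) m a w p) = gen M (W i) (regular_bimod A) m a w (\<epsilon> p)"
        using fp[OF y *(4)] by (simp add: gen_def[OF M W])
      then have 1: "S (?f (gen M (W i) (P 0) m a w p)) = gen M (W i) (P 0) m a w (s (\<epsilon> p))"
        using S(2)[OF *(1-3) ec[OF *(4)]] by simp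
      have 2: "dv i (Suc 0) (U (gen M (W i) (P 0) m a w p)) = gen M (W i) (P 0) m a w (dP (Suc 0) (u p))"
        using U(2)[OF *] dvp[OF y up] by (simp add: gen_def[OF M W])
      show "S (?f (gen M (W i) (P 0) m a w p)) \<oplus>\<^bsub>DD i 0\<^esub> dv i (Suc 0) (U (gen M (W i) (P 0) m a w p)) = gen M (W i) (P 0) m a w p"
        unfolding 1 2 using lin_add[OF g sp lin_closed[OF Pd up]] su(3)[OF *(4)] by simp
    qed
    then have "dv i (Suc 0) (U t) = t"
      using f0 lin_zero[OF tensor_Ae_module[OF Xb bimodule_biact[OF regular_bimodule]] Dm S(1)]
        lin_closed[OF dv lin_closed[OF U(1) t(1)]] by simp
    then show "\<exists>y\<in>carrier (DD i (Suc 0)). dv i (Suc 0) y = t" using lin_closed[OF U(1) t(1)] by blast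
  next
    fix t i j assume t: "t \<in> carrier (DD i (Suc j))" "dv i (Suc j) t = \<zero>\<^bsub>DD i j\<^esub>"
    obtain s u where su: "s \<in> right_homs (P j) (P (Suc j))" "u \<in> right_homs (P (Suc j)) (P (Suc (Suc j)))"
      "\<And>x. x \<in> carrier (P (Suc j)) \<Longrightarrow> s (dP (Suc j) x) \<oplus>\<^bsub>P (Suc j)\<^esub> dP (Suc (Suc j)) (u x) = x"
      by (rule contraction_Suc[OF field res]) blast
    obtain S where S: "S \<in> lin_maps K (DD i j) (DD i (Suc j))"
      "\<And>m a w p. \<lbrakk>m \<in> carrier M; a \<in> carrier A; w \<in> carrier (W i); p \<in> carrier (P j)\<rbrakk> \<Longrightarrow>
        S (gen M (W i) (P j) m a w p) = gen M (W i) (P (Suc j)) m a w (s p)"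
      by (rule DW_right_map[OF M W Pb Pb su(1)]) blast
    obtain U where U: "U \<in> lin_maps K (DD i (Suc j)) (DD i (Suc (Suc j)))"
      "\<And>m a w p. \<lbrakk>m \<in> carrier M; a \<in> carrier A; w \<in> carrier (W i); p \<in> carrier (P (Suc j))\<rbrakk> \<Longrightarrow>
        U (gen M (W i) (P (Suc j)) m a w p) = gen M (W i) (P (Suc (Suc j))) m a w (u p)"
      by (rule DW_right_map[OF M W Pb Pb su(2)]) blast
    interpret D: module K "DD i (Suc j)" by (rule Dm)
    \<comment> \<open>The same transported relation in positive degree; for a vertical cycle the
      first summand drops out.\<close>
    have "S (dv i (Suc j) t) \<oplus>\<^bsub>DD i (Suc j)\<^esub> dv i (Suc (Suc j)) (U t) = t"
    proof (rule DW_eqI[OF M W Pb t(1) lin_sum[OF Dm lin_comp[OF dv S(1)] lin_comp[OF U(1) dv]] lin_id])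
      fix m a w p assume *: "m \<in> carrier M" "a \<in> carrier A" "w \<in> carrier (W i)" "p \<in> carrier (P (Suc j))"
      note g = gen_lin[OF M W Pb *(1-3)] and y = pure_MW[OF M W *(1) tri1[OF M W *(2,3)]]
      have up: "u p \<in> carrier (P (Suc (Suc j)))" using lin_closed[OF right_homsD(1)[OF su(2)] *(4)] .
      note dp = lin_closed[OF Pd *(4)]
      have sp: "s (dP (Suc j) p) \<in> carrier (P (Suc j))" using lin_closed[OF right_homsD(1)[OF su(1)] dp] .
      have 1: "S (dv i (Suc j) (gen M (W i) (P (Suc j)) m a w p)) = gen M (W i) (P (Suc j)) m a w (s (dP (Suc j) p))"
        using S(2)[OF *(1-3) dp] dvp[OF y *(4)] by (simp add: gen_def[OF M W])
      have 2: "dv i (Suc (Suc j)) (U (gen M (W i) (P (Suc j)) m a w p)) = gen M (W i) (P (Suc j)) m a w (dP (Suc (Suc j)) (u p))"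
        using U(2)[OF *] dvp[OF y up] by (simp add: gen_def[OF M W])
      show "S (dv i (Suc j) (gen M (W i) (P (Suc j)) m a w p)) \<oplus>\<^bsub>DD i (Suc j)\<^esub> dv i (Suc (Suc j)) (U (gen M (W i) (P (Suc j)) m a w p))
          = gen M (W i) (P (Suc j)) m a w p"
        unfolding 1 2 using lin_add[OF g sp lin_closed[OF Pd up]] su(3)[OF *(4)] by simp
    qed
    then have "dv i (Suc (Suc j)) (U t) = t"
      using t(2) lin_zero[OF Dm Dm S(1)] lin_closed[OF dv lin_closed[OF U(1) t(1)]] by simp
    then show "\<exists>y\<in>carrier (DD i (Suc (Suc j))). dv i (Suc (Suc j)) y = t" using lin_closed[OF U(1) t(1)] by blast
  qed
  then have "mod_iso K (homology EE (tensor_id_d K EE d) n) (homology (tot DD) (tot_d DD dh dv) n)"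
    by (rule augmented_double_complex.homology_tot_iso)
  then show ?thesis unfolding hyperhomology_def Let_def dh_def[abs_def] dv_def[abs_def] .
qed

end

end

section \<open>The cohomological comparison\<close>

lemma fun_module_simps:
  "carrier (fun_module S Y H) = H \<inter> extensional S" "zero (fun_module S Y H) = (\<lambda>x\<in>S. \<zero>\<^bsub>Y\<^esub>)"
  "add (fun_module S Y H) = (\<lambda>f g. \<lambda>x\<in>S. f x \<oplus>\<^bsub>Y\<^esub> g x)"
  "smult (fun_module S Y H) = (\<lambda>c f. \<lambda>x\<in>S. c \<odot>\<^bsub>Y\<^esub> f x)"
  by (simp_all add: fun_module_def)

text \<open>Elements are extensional functions on \<open>S\<close>, so that functions agreeing on
  \<open>S\<close> are equal and the module axioms hold literally.\<close>

lemma fun_module_module: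
  assumes Y: "module K Y" and H: "\<And>f x. \<lbrakk>f \<in> H; x \<in> S\<rbrakk> \<Longrightarrow> f x \<in> carrier Y" and zero: "(\<lambda>x\<in>S. \<zero>\<^bsub>Y\<^esub>) \<in> H"
    and add: "\<And>f g. \<lbrakk>f \<in> H; g \<in> H\<rbrakk> \<Longrightarrow> (\<lambda>x\<in>S. f x \<oplus>\<^bsub>Y\<^esub> g x) \<in> H"
    and smult: "\<And>c f. \<lbrakk>c \<in> carrier K; f \<in> H\<rbrakk> \<Longrightarrow> (\<lambda>x\<in>S. c \<odot>\<^bsub>Y\<^esub> f x) \<in> H"
  shows "module K (fun_module S Y H)"
proof -
  interpret Y: module K Y by (rule Y)
  have ext: "f = g" if "f \<in> extensional S" "g \<in> extensional S" "\<And>x. x \<in> S \<Longrightarrow> f x = g x" for f g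
    by (rule extensionalityI[OF that])
  show ?thesis
  proof (rule moduleI)
    show "cring K" by (rule Y.R.is_cring)
    show "abelian_group (fun_module S Y H)"
    proof (rule abelian_groupI)
      fix f assume f: "f \<in> carrier (fun_module S Y H)"
      show "\<exists>g\<in>carrier (fun_module S Y H). g \<oplus>\<^bsub>fun_module S Y H\<^esub> f = \<zero>\<^bsub>fun_module S Y H\<^esub>"
      proof (rule bexI)
        show "(\<lambda>x\<in>S. (\<ominus>\<^bsub>K\<^esub> \<one>\<^bsub>K\<^esub>) \<odot>\<^bsub>Y\<^esub> f x) \<oplus>\<^bsub>fun_module S Y H\<^esub> f = \<zero>\<^bsub>fun_module S Y H\<^esub>"
          by (rule ext) (use f H in \<open>auto simp: fun_module_simps Y.smult_l_minus Y.l_neg\<close>)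
      qed (use f smult in \<open>auto simp: fun_module_simps\<close>)
      show "\<zero>\<^bsub>fun_module S Y H\<^esub> \<oplus>\<^bsub>fun_module S Y H\<^esub> f = f"
        by (rule ext) (use f H in \<open>auto simp: fun_module_simps\<close>)
      fix g assume g: "g \<in> carrier (fun_module S Y H)"
      show "f \<oplus>\<^bsub>fun_module S Y H\<^esub> g = g \<oplus>\<^bsub>fun_module S Y H\<^esub> f"
        by (rule ext) (use f g H Y.a_comm in \<open>auto simp: fun_module_simps\<close>)
      fix h assume h: "h \<in> carrier (fun_module S Y H)"
      show "f \<oplus>\<^bsub>fun_module S Y H\<^esub> g \<oplus>\<^bsub>fun_module S Y H\<^esub> h = f \<oplus>\<^bsub>fun_module S Y H\<^esub> (g \<oplus>\<^bsub>fun_module S Y H\<^esub> h)"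
        by (rule ext) (use f g h H Y.a_assoc in \<open>auto simp: fun_module_simps\<close>)
    qed (use zero add in \<open>auto simp: fun_module_simps\<close>)
  next
    fix f c assume f: "f \<in> carrier (fun_module S Y H)" and c: "c \<in> carrier K"
    show "c \<odot>\<^bsub>fun_module S Y H\<^esub> f \<in> carrier (fun_module S Y H)" using f c smult by (auto simp: fun_module_simps)
    fix g assume g: "g \<in> carrier (fun_module S Y H)"
    show "c \<odot>\<^bsub>fun_module S Y H\<^esub> (f \<oplus>\<^bsub>fun_module S Y H\<^esub> g) = c \<odot>\<^bsub>fun_module S Y H\<^esub> f \<oplus>\<^bsub>fun_module S Y H\<^esub> c \<odot>\<^bsub>fun_module S Y H\<^esub> g"
      by (rule ext) (use f g c H Y.smult_r_distr in \<open>auto simp: fun_module_simps\<close>)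
  next
    fix f a b assume f: "f \<in> carrier (fun_module S Y H)" and ab: "a \<in> carrier K" "b \<in> carrier K"
    show "(a \<oplus>\<^bsub>K\<^esub> b) \<odot>\<^bsub>fun_module S Y H\<^esub> f = a \<odot>\<^bsub>fun_module S Y H\<^esub> f \<oplus>\<^bsub>fun_module S Y H\<^esub> b \<odot>\<^bsub>fun_module S Y H\<^esub> f"
      by (rule ext) (use f ab H Y.smult_l_distr in \<open>auto simp: fun_module_simps\<close>)
    show "(a \<otimes>\<^bsub>K\<^esub> b) \<odot>\<^bsub>fun_module S Y H\<^esub> f = a \<odot>\<^bsub>fun_module S Y H\<^esub> (b \<odot>\<^bsub>fun_module S Y H\<^esub> f)"
      by (rule ext) (use f ab H Y.smult_assoc1 in \<open>auto simp: fun_module_simps\<close>)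
  next
    fix f assume f: "f \<in> carrier (fun_module S Y H)"
    show "\<one>\<^bsub>K\<^esub> \<odot>\<^bsub>fun_module S Y H\<^esub> f = f"
      by (rule ext) (use f H in \<open>auto simp: fun_module_simps\<close>)
  qed
qed

lemma eval_lin: "x \<in> S \<Longrightarrow> H \<subseteq> S \<rightarrow> carrier Y \<Longrightarrow> (\<lambda>f. f x) \<in> lin_maps K (fun_module S Y H) Y"
  by (rule lin_mapsI) (auto simp: fun_module_simps)

lemma lin_into_fun_module:
  assumes "\<And>p. p \<in> carrier Q \<Longrightarrow> f p \<in> H \<inter> extensional S" "\<And>x. x \<in> S \<Longrightarrow> (\<lambda>p. f p x) \<in> lin_maps K Q Y"
    and Q: "module K Q"
  shows "f \<in> lin_maps K Q (fun_module S Y H)"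
proof (rule lin_mapsI)
  interpret Q: module K Q by (rule Q)
  have e: "f p \<in> extensional S" if "p \<in> carrier Q" for p using assms(1)[OF that] by simp
  show "f p \<in> carrier (fun_module S Y H)" if "p \<in> carrier Q" for p using assms(1)[OF that] by (simp add: fun_module_simps)
  show "f (x \<oplus>\<^bsub>Q\<^esub> y) = f x \<oplus>\<^bsub>fun_module S Y H\<^esub> f y" if "x \<in> carrier Q" "y \<in> carrier Q" for x y
    by (rule extensionalityI[of _ S]) (use that e lin_add[OF assms(2)] in \<open>auto simp: fun_module_simps\<close>)
  show "f (c \<odot>\<^bsub>Q\<^esub> x) = c \<odot>\<^bsub>fun_module S Y H\<^esub> f x" if "c \<in> carrier K" "x \<in> carrier Q" for c x
    by (rule extensionalityI[of _ S]) (use that e lin_smult[OF assms(2)] in \<open>auto simp: fun_module_simps\<close>)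
qed

section \<open>Hom modules over \<open>A\<close> and over its enveloping algebra\<close>

context kalg
begin

lemma biact_closed: "\<lbrakk>biact X; a \<in> carrier A; x \<in> carrier X\<rbrakk> \<Longrightarrow> lact X a x \<in> carrier X"
  "\<lbrakk>biact X; a \<in> carrier A; x \<in> carrier X\<rbrakk> \<Longrightarrow> ract X x a \<in> carrier X"
  by (rule lin_closed[OF biactD(2)]; assumption) (rule lin_closed[OF biactD(3)]; assumption)

lemma bimod_homs_iff: "f \<in> bimod_homs K A X Y \<longleftrightarrow> f \<in> left_homs K A X Y \<and> f \<in> right_homs X Y"
  by (auto simp: bimod_homs_def left_homs_def right_homs_def)

context
  fixes X :: "('k, 'a, 'x) bimodule" and Y :: "('k, 'a, 'y) bimodule"
  assumes X: "biact X" and Y: "biact Y"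
begin

text \<open>Members of the Hom modules are restrictions to the carrier, so being a homomorphism has
  to be insensitive to values elsewhere.\<close>

lemma left_homs_cong: "\<lbrakk>f \<in> left_homs K A X Y; \<And>x. x \<in> carrier X \<Longrightarrow> g x = f x\<rbrakk> \<Longrightarrow> g \<in> left_homs K A X Y"
  by (rule left_homsI[OF lin_maps_eq[OF left_homsD(1) biactD(1)[OF X]]])
    (auto simp: left_homsD(2) biact_closed[OF X])

lemma right_homs_cong: "\<lbrakk>f \<in> right_homs X Y; \<And>x. x \<in> carrier X \<Longrightarrow> g x = f x\<rbrakk> \<Longrightarrow> g \<in> right_homs X Y"
  by (rule right_homsI[OF lin_maps_eq[OF right_homsD(1) biactD(1)[OF X]]])
    (auto simp: right_homsD(2) biact_closed[OF X])

lemma left_homs_ops: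
  shows "(\<lambda>x\<in>carrier X. \<zero>\<^bsub>Y\<^esub>) \<in> left_homs K A X Y"
    and "\<lbrakk>f \<in> left_homs K A X Y; g \<in> left_homs K A X Y\<rbrakk> \<Longrightarrow> (\<lambda>x\<in>carrier X. f x \<oplus>\<^bsub>Y\<^esub> g x) \<in> left_homs K A X Y"
    and "\<lbrakk>c \<in> carrier K; f \<in> left_homs K A X Y\<rbrakk> \<Longrightarrow> (\<lambda>x\<in>carrier X. c \<odot>\<^bsub>Y\<^esub> f x) \<in> left_homs K A X Y"
proof -
  note m = biactD(1)[OF Y]
  show "(\<lambda>x\<in>carrier X. \<zero>\<^bsub>Y\<^esub>) \<in> left_homs K A X Y"
    by (rule left_homs_cong[OF left_homsI[OF lin_const_zero[OF m]]])
      (auto simp: lin_zero[OF m m biactD(2)[OF Y]])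
  show "(\<lambda>x\<in>carrier X. f x \<oplus>\<^bsub>Y\<^esub> g x) \<in> left_homs K A X Y" if "f \<in> left_homs K A X Y" "g \<in> left_homs K A X Y"
    by (rule left_homs_cong[OF left_homsI[OF lin_sum[OF m that[THEN left_homsD(1)]]]])
      (auto simp: that[THEN left_homsD(2)] lin_add[OF biactD(2)[OF Y]] lin_closed[OF left_homsD(1)[OF that(1)]]
        lin_closed[OF left_homsD(1)[OF that(2)]])
  show "(\<lambda>x\<in>carrier X. c \<odot>\<^bsub>Y\<^esub> f x) \<in> left_homs K A X Y" if "c \<in> carrier K" "f \<in> left_homs K A X Y"
    by (rule left_homs_cong[OF left_homsI[OF lin_comp[OF left_homsD(1)[OF that(2)] lin_scale[OF m that(1)]]]])
      (auto simp: left_homsD(2)[OF that(2)] lin_smult[OF biactD(2)[OF Y]] that(1) lin_closed[OF left_homsD(1)[OF that(2)]])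
qed

lemma right_homs_ops:
  shows "(\<lambda>x\<in>carrier X. \<zero>\<^bsub>Y\<^esub>) \<in> right_homs X Y"
    and "\<lbrakk>f \<in> right_homs X Y; g \<in> right_homs X Y\<rbrakk> \<Longrightarrow> (\<lambda>x\<in>carrier X. f x \<oplus>\<^bsub>Y\<^esub> g x) \<in> right_homs X Y"
    and "\<lbrakk>c \<in> carrier K; f \<in> right_homs X Y\<rbrakk> \<Longrightarrow> (\<lambda>x\<in>carrier X. c \<odot>\<^bsub>Y\<^esub> f x) \<in> right_homs X Y"
proof -
  note m = biactD(1)[OF Y]
  show "(\<lambda>x\<in>carrier X. \<zero>\<^bsub>Y\<^esub>) \<in> right_homs X Y"
    by (rule right_homs_cong[OF right_homsI[OF lin_const_zero[OF m]]])
      (auto simp: lin_zero[OF m m biactD(3)[OF Y]])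
  show "(\<lambda>x\<in>carrier X. f x \<oplus>\<^bsub>Y\<^esub> g x) \<in> right_homs X Y" if "f \<in> right_homs X Y" "g \<in> right_homs X Y"
    by (rule right_homs_cong[OF right_homsI[OF lin_sum[OF m that[THEN right_homsD(1)]]]])
      (auto simp: that[THEN right_homsD(2)] lin_add[OF biactD(3)[OF Y]] lin_closed[OF right_homsD(1)[OF that(1)]]
        lin_closed[OF right_homsD(1)[OF that(2)]])
  show "(\<lambda>x\<in>carrier X. c \<odot>\<^bsub>Y\<^esub> f x) \<in> right_homs X Y" if "c \<in> carrier K" "f \<in> right_homs X Y"
    by (rule right_homs_cong[OF right_homsI[OF lin_comp[OF right_homsD(1)[OF that(2)] lin_scale[OF m that(1)]]]])
      (auto simp: right_homsD(2)[OF that(2)] lin_smult[OF biactD(3)[OF Y]] that(1) lin_closed[OF right_homsD(1)[OF that(2)]])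
qed

lemma Hom_Ae_module: "module K (Hom_Ae K A X Y)"
  unfolding Hom_Ae_def
  by (rule fun_module_module[OF biactD(1)[OF Y]])
    (auto simp: bimod_homs_iff left_homs_ops right_homs_ops intro: lin_closed[OF left_homsD(1)])

end

lemma Hom_Ae_carrier: "f \<in> carrier (Hom_Ae K A X Y) \<longleftrightarrow> f \<in> bimod_homs K A X Y \<and> f \<in> extensional (carrier X)"
  by (simp add: Hom_Ae_def fun_module_simps)

lemma Hom_Ae_eqI: "\<lbrakk>f \<in> carrier (Hom_Ae K A X Y); g \<in> carrier (Hom_Ae K A X Y); \<And>x. x \<in> carrier X \<Longrightarrow> f x = g x\<rbrakk> \<Longrightarrow> f = g"
  unfolding Hom_Ae_carrier by (auto intro: extensionalityI)

lemma Hom_Ae_restrict: "\<lbrakk>biact X; biact Y; f \<in> bimod_homs K A X Y\<rbrakk> \<Longrightarrow> (\<lambda>x\<in>carrier X. f x) \<in> carrier (Hom_Ae K A X Y)"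
  unfolding Hom_Ae_carrier bimod_homs_iff
  using left_homs_cong[of X Y f] right_homs_cong[of X Y f] by simp

lemma lin_into_Hom_Ae:
  assumes "module K Q" "\<And>p. p \<in> carrier Q \<Longrightarrow> f p \<in> carrier (Hom_Ae K A X Y)"
    "\<And>x. x \<in> carrier X \<Longrightarrow> (\<lambda>p. f p x) \<in> lin_maps K Q Y"
  shows "f \<in> lin_maps K Q (Hom_Ae K A X Y)"
  unfolding Hom_Ae_def by (rule lin_into_fun_module) (use assms in \<open>auto simp: Hom_Ae_carrier\<close>)

lemma Hom_Ae_eval: "x \<in> carrier X \<Longrightarrow> (\<lambda>f. f x) \<in> lin_maps K (Hom_Ae K A X Y) Y"
  unfolding Hom_Ae_def by (rule eval_lin) (auto intro: lin_closed[OF bimod_homsD(2)])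

lemma Hom_A_carrier: "f \<in> carrier (Hom_A K A X Y) \<longleftrightarrow> f \<in> left_homs K A X Y \<and> f \<in> extensional (carrier X)"
  by (simp add: Hom_A_def fun_module_simps)

lemma Hom_A_zero: "\<zero>\<^bsub>Hom_A K A X Y\<^esub> = (\<lambda>x\<in>carrier X. \<zero>\<^bsub>Y\<^esub>)"
  by (simp add: Hom_A_def fun_module_simps)

lemma Hom_A_act:
  "lact (Hom_A K A X Y) a f = (\<lambda>x\<in>carrier X. f (ract X x a))" "ract (Hom_A K A X Y) f a = (\<lambda>x\<in>carrier X. ract Y (f x) a)"
  by (simp_all add: Hom_A_def)

lemma Hom_A_eqI: "\<lbrakk>f \<in> carrier (Hom_A K A X Y); g \<in> carrier (Hom_A K A X Y); \<And>x. x \<in> carrier X \<Longrightarrow> f x = g x\<rbrakk> \<Longrightarrow> f = g"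
  unfolding Hom_A_carrier by (auto intro: extensionalityI)

lemma Hom_A_eval: "x \<in> carrier X \<Longrightarrow> (\<lambda>f. f x) \<in> lin_maps K (Hom_A K A X Y) Y"
proof -
  assume "x \<in> carrier X"
  then have "(\<lambda>f. f x) \<in> lin_maps K (fun_module (carrier X) Y (left_homs K A X Y)) Y"
    by (rule eval_lin) (auto intro: lin_closed[OF left_homsD(1)])
  then show ?thesis by (simp add: lin_maps_def Hom_A_def)
qed

lemma lin_into_Hom_A:
  assumes "module K Q" "\<And>p. p \<in> carrier Q \<Longrightarrow> f p \<in> carrier (Hom_A K A X Y)"
    "\<And>x. x \<in> carrier X \<Longrightarrow> (\<lambda>p. f p x) \<in> lin_maps K Q Y"
  shows "f \<in> lin_maps K Q (Hom_A K A X Y)"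
proof -
  have "f \<in> lin_maps K Q (fun_module (carrier X) Y (left_homs K A X Y))"
    by (rule lin_into_fun_module) (use assms in \<open>auto simp: Hom_A_carrier\<close>)
  then show ?thesis by (simp add: lin_maps_def Hom_A_def)
qed

lemma Hom_A_module: "\<lbrakk>biact X; biact Y\<rbrakk> \<Longrightarrow> module K (Hom_A K A X Y)"
  unfolding Hom_A_def
  by (rule module_make_bimod, rule fun_module_module[OF biactD(1)])
    (auto simp: left_homs_ops intro: lin_closed[OF left_homsD(1)])

text \<open>Both actions preserve left linearity because left and right multiplication commute, on
  \<open>X\<close> for the one action and on \<open>Y\<close> for the other.\<close>

lemma Hom_A_biact:
  assumes X: "bimodule K A X" and Y: "bimodule K A Y"
  shows "biact (Hom_A K A X Y)"
proof -
  interpret X: bimodule K A X by (rule X)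
  interpret Y: bimodule K A Y by (rule Y)
  note Xb = bimodule_biact[OF X] and Yb = bimodule_biact[OF Y]
  note m = Hom_A_module[OF Xb Yb]
  have l: "lact (Hom_A K A X Y) a f \<in> carrier (Hom_A K A X Y)" if a: "a \<in> carrier A" and f: "f \<in> carrier (Hom_A K A X Y)" for a f
  proof -
    have f: "f \<in> left_homs K A X Y" using f by (simp add: Hom_A_carrier)
    have "(\<lambda>x. f (ract X x a)) \<in> left_homs K A X Y"
      by (rule left_homsI[OF lin_comp[OF bimodule_ract[OF X a] left_homsD(1)[OF f]]])
        (simp add: X.lact_ract a left_homsD(2)[OF f] X.ract_closed)
    then show ?thesis unfolding Hom_A_carrier Hom_A_act by (auto intro: left_homs_cong[OF Xb Yb])
  qed
  have r: "ract (Hom_A K A X Y) f a \<in> carrier (Hom_A K A X Y)" if a: "a \<in> carrier A" and f: "f \<in> carrier (Hom_A K A X Y)" for a f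
  proof -
    have f: "f \<in> left_homs K A X Y" using f by (simp add: Hom_A_carrier)
    have "(\<lambda>x. ract Y (f x) a) \<in> left_homs K A X Y"
      by (rule left_homsI[OF lin_comp[OF left_homsD(1)[OF f] bimodule_ract[OF Y a]]])
        (simp add: Y.lact_ract a left_homsD(2)[OF f] lin_closed[OF left_homsD(1)[OF f]])
    then show ?thesis unfolding Hom_A_carrier Hom_A_act by (auto intro: left_homs_cong[OF Xb Yb])
  qed
  show ?thesis unfolding biact_def
  proof (intro conjI ballI m)
    fix a assume a: "a \<in> carrier A"
    show "lact (Hom_A K A X Y) a \<in> lin_maps K (Hom_A K A X Y) (Hom_A K A X Y)"
      by (rule lin_into_Hom_A[OF m l[OF a]]) (simp_all add: Hom_A_act Hom_A_eval X.ract_closed a)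
    show "(\<lambda>f. ract (Hom_A K A X Y) f a) \<in> lin_maps K (Hom_A K A X Y) (Hom_A K A X Y)"
      by (rule lin_into_Hom_A[OF m r[OF a]])
        (simp_all add: Hom_A_act lin_comp[OF Hom_A_eval bimodule_ract[OF Y a]])
  qed
qed

context
  fixes M :: "('k, 'a, 'm) bimodule" and W :: "('k, 'w) module"
    and Q :: "('k, 'a, 'q) bimodule" and Q' :: "('k, 'a, 'r) bimodule" and s :: "'q \<Rightarrow> 'r"
  assumes M: "bimodule K A M" and W: "module K W" and Q: "bimodule K A Q" and Q': "bimodule K A Q'"
    and s: "s \<in> right_homs Q Q'"
begin

interpretation M: bimodule K A M by (rule M)
interpretation Q: bimodule K A Q by (rule Q)
interpretation Q': bimodule K A Q' by (rule Q')

abbreviation (input) "HW \<equiv> Hom_A K A (AWA W) M"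

lemmas HW_biact = Hom_A_biact[OF AWA_bimodule[OF W] M]

text \<open>A bimodule map \<open>f\<close> into \<open>HW\<close> is determined by its values at
  \<open>1 (x) w (x) 1\<close>: left linearity extracts \<open>a\<close>, and \<open>b\<close> turns
  into left multiplication on the argument of \<open>f\<close>. The formula composes only these
  values with \<open>s\<close>, since \<open>f\<close> after \<open>s\<close> itself need not
  respect left multiplication.\<close>

lemma Hom_right_map:
  assumes f: "f \<in> carrier (Hom_Ae K A Q' HW)"
  obtains g where "g \<in> carrier (Hom_Ae K A Q HW)"
    "\<And>p a w b. \<lbrakk>p \<in> carrier Q; a \<in> carrier A; w \<in> carrier W; b \<in> carrier A\<rbrakk> \<Longrightarrow>
      g p (triple K A W a w b) = lact M a (f (s (lact Q b p)) (triple K A W \<one>\<^bsub>A\<^esub> w \<one>\<^bsub>A\<^esub>))"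
proof -
  note sl = right_homsD(1)[OF s] and C = AWA_bimodule[OF W]
  interpret C: bimodule K A "AWA W" by (rule C)
  have fb: "f \<in> bimod_homs K A Q' HW" using f by (simp add: Hom_Ae_carrier)
  note fl = bimod_homsD(2)[OF fb]
  let ?t = "\<lambda>w. triple K A W \<one>\<^bsub>A\<^esub> w \<one>\<^bsub>A\<^esub>"
  have tc: "?t w \<in> carrier (AWA W)" if "w \<in> carrier W" for w using tri_closed[OF W] that by simp
  have fin: "f q \<in> left_homs K A (AWA W) M" if "q \<in> carrier Q'" for q
    using lin_closed[OF fl that] by (simp add: Hom_A_carrier)
  have sc: "s (lact Q b p) \<in> carrier Q'" if "b \<in> carrier A" "p \<in> carrier Q" for b p
    using lin_closed[OF sl Q.lact_closed[OF that]] .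
  let ?\<phi> = "\<lambda>p a w b. lact M a (f (s (lact Q b p)) (?t w))"
  have fc: "f (s (lact Q b p)) (?t w) \<in> carrier M" if "b \<in> carrier A" "p \<in> carrier Q" "w \<in> carrier W" for p w b
    using lin_closed[OF left_homsD(1)[OF fin[OF sc[OF that(1,2)]]] tc[OF that(3)]] .
  have tri: "trilin K A W M (?\<phi> p)" if p: "p \<in> carrier Q" for p
  proof (rule trilinI)
    show "(\<lambda>b. ?\<phi> p a w b) \<in> lin_maps K A M" if "a \<in> carrier A" "w \<in> carrier W" for a w
      by (rule lin_comp[OF lin_comp[OF lin_comp[OF lin_comp[OF bimodule_lact'[OF Q p] sl] fl] Hom_A_eval[OF tc[OF that(2)]]] bimodule_lact[OF M that(1)]])
    show "(\<lambda>w. ?\<phi> p a w b) \<in> lin_maps K W M" if "a \<in> carrier A" "b \<in> carrier A" for a b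
      by (rule lin_comp[OF lin_comp[OF trilin_2[OF triple_tri[OF W] A.one_closed A.one_closed] left_homsD(1)[OF fin[OF sc[OF that(2) p]]]] bimodule_lact[OF M that(1)]])
    show "(\<lambda>a. ?\<phi> p a w b) \<in> lin_maps K A M" if "w \<in> carrier W" "b \<in> carrier A" for w b
      by (rule bimodule_lact'[OF M fc[OF that(2) p that(1)]])
  qed
  note Mm = bimodule_module[OF M]
  define \<gamma> where "\<gamma> p = triple_lift K M (?\<phi> p)" for p
  have \<gamma>l: "\<gamma> p \<in> lin_maps K (AWA W) M" if "p \<in> carrier Q" for p
    unfolding \<gamma>_def by (rule AWA_lift_lin[OF W Mm tri[OF that]])
  have \<gamma>t: "\<gamma> p (triple K A W a w b) = ?\<phi> p a w b"
    if "p \<in> carrier Q" "a \<in> carrier A" "w \<in> carrier W" "b \<in> carrier A" for p a w b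
    unfolding \<gamma>_def by (rule AWA_lift_triple[OF W Mm tri[OF that(1)] that(2-4)])
  have \<gamma>q: "(\<lambda>p. \<gamma> p x) \<in> lin_maps K Q M" if "x \<in> carrier (AWA W)" for x
    unfolding \<gamma>_def
    by (rule triple_lift_param[OF A W Mm tri _ bimodule_module[OF Q]])
      (use that in \<open>auto intro!: lin_comp[OF lin_comp[OF lin_comp[OF lin_comp[OF bimodule_lact[OF Q] sl] fl] Hom_A_eval[OF tc]] bimodule_lact[OF M]]\<close>)
  define g where "g p = (\<lambda>x\<in>carrier (AWA W). \<gamma> p x)" for p
  have gH: "g p \<in> carrier HW" if p: "p \<in> carrier Q" for p
  proof -
    have "\<gamma> p \<in> left_homs K A (AWA W) M"
    proof (rule left_homsI[OF \<gamma>l[OF p]])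
      fix c x assume c: "c \<in> carrier A" and x: "x \<in> carrier (AWA W)"
      show "\<gamma> p (lact (AWA W) c x) = lact M c (\<gamma> p x)"
        by (rule AWA_eqI[OF W x lin_comp[OF AWA_lact_lin[OF W c] \<gamma>l[OF p]] lin_comp[OF \<gamma>l[OF p] bimodule_lact[OF M c]]])
          (simp add: AWA_lact[OF W] c \<gamma>t p M.lact_assoc fc)
    qed
    then show ?thesis unfolding Hom_A_carrier g_def
      using left_homs_cong[OF bimodule_biact[OF C] bimodule_biact[OF M]] by auto
  qed
  have gl: "g \<in> lin_maps K Q HW"
    by (rule lin_into_Hom_A[OF bimodule_module[OF Q] gH]) (simp_all add: g_def \<gamma>q del: AWA_simps)
  have "g \<in> bimod_homs K A Q HW"
  proof (rule bimod_homsI[OF gl])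
    fix c p assume c: "c \<in> carrier A" and p: "p \<in> carrier Q"
    note cp = Q.lact_closed[OF c p] and pc = Q.ract_closed[OF c p]
    show "g (lact Q c p) = lact HW c (g p)"
    proof (rule Hom_A_eqI[OF gH[OF cp] biact_closed(1)[OF HW_biact c gH[OF p]]])
      fix x assume x: "x \<in> carrier (AWA W)"
      have "\<gamma> (lact Q c p) x = \<gamma> p (ract (AWA W) x c)"
        by (rule AWA_eqI[OF W x \<gamma>l[OF cp] lin_comp[OF AWA_ract_lin[OF W c] \<gamma>l[OF p]]])
          (simp add: AWA_ract[OF W] c \<gamma>t p cp Q.lact_assoc)
      then show "g (lact Q c p) x = lact HW c (g p) x"
        using x c C.ract_closed by (simp add: g_def Hom_A_act del: AWA_simps)
    qed
    show "g (ract Q p c) = ract HW (g p) c"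
    proof (rule Hom_A_eqI[OF gH[OF pc] biact_closed(2)[OF HW_biact c gH[OF p]]])
      fix x assume x: "x \<in> carrier (AWA W)"
      have "\<gamma> (ract Q p c) x = ract M (\<gamma> p x) c"
      proof (rule AWA_eqI[OF W x \<gamma>l[OF pc] lin_comp[OF \<gamma>l[OF p] bimodule_ract[OF M c]]])
        fix a w b assume abw: "a \<in> carrier A" "w \<in> carrier W" "b \<in> carrier A"
        \<comment> \<open>Right linearity of \<open>s\<close> enters here; compatibility with the
          left action came from the formula itself.\<close>
        have "f (s (lact Q b (ract Q p c))) = ract HW (f (s (lact Q b p))) c"
          using abw c p by (simp add: Q.lact_ract[symmetric] right_homsD(2)[OF s] Q.lact_closed bimod_homsD(4)[OF fb] sc)
        then show "\<gamma> (ract Q p c) (triple K A W a w b) = ract M (\<gamma> p (triple K A W a w b)) c"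
          using abw c p pc tc fc by (simp add: \<gamma>t Hom_A_act M.lact_ract del: AWA_simps)
      qed
      then show "g (ract Q p c) x = ract HW (g p) c x" using x by (simp add: g_def Hom_A_act del: AWA_simps)
    qed
  qed
  then have "(\<lambda>p\<in>carrier Q. g p) \<in> carrier (Hom_Ae K A Q HW)"
    by (rule Hom_Ae_restrict[OF bimodule_biact[OF Q] HW_biact])
  then show ?thesis
    by (rule that) (use tri_closed[OF W] in \<open>simp add: g_def \<gamma>t\<close>)
qed

end

section \<open>The cohomological double complex\<close>

context
  fixes M :: "('k, 'a, 'm) bimodule" and W :: "nat \<Rightarrow> ('k, 'w) module" and P :: "nat \<Rightarrow> ('k, 'a, 'p) bimodule"
    and dP :: "nat \<Rightarrow> 'p \<Rightarrow> 'p" and \<epsilon> :: "'p \<Rightarrow> 'a" and d :: "nat \<Rightarrow> ('k, 'a, 'w) triple \<Rightarrow> ('k, 'a, 'w) triple"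
  assumes M: "bimodule K A M" and W: "\<And>i. module K (W i)"
    and field: "field K" and res: "projective_resolution K A P dP \<epsilon>"
    and d: "\<And>i. d (Suc i) \<in> bimod_homs K A (AWA (W (Suc i))) (AWA (W i))"
    and dd: "\<And>i x. x \<in> carrier (AWA (W (Suc (Suc i)))) \<Longrightarrow> d (Suc i) (d (Suc (Suc i)) x) = \<zero>\<^bsub>AWA (W i)\<^esub>"
begin

interpretation M: bimodule K A M by (rule M)

abbreviation (input) "HH i \<equiv> Hom_A K A (AWA (W i)) M"
abbreviation (input) "dH \<equiv> hom_d (\<lambda>i. AWA (W i)) d M"
abbreviation (input) "HD i j \<equiv> Hom_Ae K A (P j) (HH i)"
abbreviation (input) "HE i \<equiv> Hom_Ae K A (AWA (W i)) M"

lemmas dl = bimod_homsD(2)[OF d]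
lemmas Hb = Hom_A_biact[OF AWA_bimodule[OF W] M]

lemma dH_eq: "x \<in> carrier (AWA (W (Suc i))) \<Longrightarrow> dH i f x = signed M (Suc i) (f (d (Suc i) x))"
  by (simp add: hom_d_def)

lemma signed_lact: "\<lbrakk>a \<in> carrier A; x \<in> carrier M\<rbrakk> \<Longrightarrow> signed M n (lact M a x) = lact M a (signed M n x)"
  using lin_signed[OF bimodule_module[OF M] bimodule_module[OF M] bimodule_lact[OF M]] by simp

lemma signed_ract: "\<lbrakk>a \<in> carrier A; x \<in> carrier M\<rbrakk> \<Longrightarrow> signed M n (ract M x a) = ract M (signed M n x) a"
  using lin_signed[OF bimodule_module[OF M] bimodule_module[OF M] bimodule_ract[OF M]] by simp

lemma dH_left: "f \<in> left_homs K A (AWA (W i)) M \<Longrightarrow> dH i f \<in> left_homs K A (AWA (W (Suc i))) M"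
proof -
  assume f: "f \<in> left_homs K A (AWA (W i)) M"
  have "(\<lambda>x. signed M (Suc i) (f (d (Suc i) x))) \<in> left_homs K A (AWA (W (Suc i))) M"
    by (rule left_homsI[OF lin_sgn[OF bimodule_module[OF M] lin_comp[OF dl left_homsD(1)[OF f]]]])
      (simp add: bimod_homsD(3)[OF d] left_homsD(2)[OF f] lin_closed[OF dl] signed_lact
        lin_closed[OF left_homsD(1)[OF f]] del: AWA_simps)
  then show ?thesis
    by (rule left_homs_cong[OF bimodule_biact[OF AWA_bimodule[OF W]] bimodule_biact[OF M]]) (rule dH_eq)
qed

lemma dH_right: "f \<in> right_homs (AWA (W i)) M \<Longrightarrow> dH i f \<in> right_homs (AWA (W (Suc i))) M"
proof -
  assume f: "f \<in> right_homs (AWA (W i)) M"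
  have "(\<lambda>x. signed M (Suc i) (f (d (Suc i) x))) \<in> right_homs (AWA (W (Suc i))) M"
    by (rule right_homsI[OF lin_sgn[OF bimodule_module[OF M] lin_comp[OF dl right_homsD(1)[OF f]]]])
      (simp add: bimod_homsD(4)[OF d] right_homsD(2)[OF f] lin_closed[OF dl] signed_ract
        lin_closed[OF right_homsD(1)[OF f]] del: AWA_simps)
  then show ?thesis
    by (rule right_homs_cong[OF bimodule_biact[OF AWA_bimodule[OF W]] bimodule_biact[OF M]]) (rule dH_eq)
qed

lemma dH_ext: "dH i f \<in> extensional (carrier (AWA (W (Suc i))))"
  by (simp add: hom_d_def)

lemma dH_hom: "dH i \<in> bimod_homs K A (HH i) (HH (Suc i))"
proof (rule bimod_homsI)
  have c: "dH i f \<in> carrier (HH (Suc i))" if "f \<in> carrier (HH i)" for f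
    using that dH_left dH_ext by (simp add: Hom_A_carrier del: AWA_simps)
  show "dH i \<in> lin_maps K (HH i) (HH (Suc i))"
    by (rule lin_into_Hom_A[OF biactD(1)[OF Hb] c])
      (simp_all add: dH_eq lin_sgn[OF bimodule_module[OF M] Hom_A_eval] lin_closed[OF dl] del: AWA_simps)
  note bc = biact_closed[OF Hb] and Cr = bimodule.ract_closed[OF AWA_bimodule[OF W]]
  fix a f assume a: "a \<in> carrier A" and f: "f \<in> carrier (HH i)"
  have fl: "f \<in> lin_maps K (AWA (W i)) M" using f by (auto intro: left_homsD(1) simp: Hom_A_carrier simp del: AWA_simps)
  show "dH i (lact (HH i) a f) = lact (HH (Suc i)) a (dH i f)"
    by (rule Hom_A_eqI[OF c[OF bc(1)[OF a f]] bc(1)[OF a c[OF f]]])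
      (simp add: dH_eq Hom_A_act lin_closed[OF dl] Cr a bimod_homsD(4)[OF d] del: AWA_simps)
  show "dH i (ract (HH i) f a) = ract (HH (Suc i)) (dH i f) a"
    by (rule Hom_A_eqI[OF c[OF bc(2)[OF a f]] bc(2)[OF a c[OF f]]])
      (simp add: dH_eq Hom_A_act lin_closed[OF dl] a signed_ract lin_closed[OF fl] del: AWA_simps)
qed

lemma dH_dH: "\<lbrakk>f \<in> lin_maps K (AWA (W i)) M; x \<in> carrier (AWA (W (Suc (Suc i))))\<rbrakk> \<Longrightarrow> dH (Suc i) (dH i f) x = \<zero>\<^bsub>M\<^esub>"
proof -
  assume f: "f \<in> lin_maps K (AWA (W i)) M" and x: "x \<in> carrier (AWA (W (Suc (Suc i))))"
  have "f \<zero>\<^bsub>AWA (W i)\<^esub> = \<zero>\<^bsub>M\<^esub>"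
    by (rule lin_zero[OF bimodule_module[OF AWA_bimodule[OF W]] bimodule_module[OF M] f])
  then show ?thesis using x
    by (simp add: dH_eq lin_closed[OF dl] dd signed_zero[OF bimodule_module[OF M]] del: AWA_simps)
qed

lemma cohomology_hypercohomology_iso:
  "mod_iso K (cohomology HE dH n) (hypercohomology K A P dP HH dH n)"
proof -
  define dh where "dh i j f = (\<lambda>x\<in>carrier (P j). dH i (f x))" for i :: nat and j and f :: "'p \<Rightarrow> ('k, 'a, 'w) triple \<Rightarrow> 'm"
  define dv where "dv i j f = (\<lambda>x\<in>carrier (P (j + 1)). f (dP (j + 1) x))" for i :: nat and j and f :: "'p \<Rightarrow> ('k, 'a, 'w) triple \<Rightarrow> 'm"
  \<comment> \<open>A bimodule map \<open>g\<close> corresponds to the bimodule map from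
    \<open>A\<close> into \<open>Hom_A\<close> that takes \<open>1\<close> to \<open>g\<close>;
    composing that one with \<open>\<epsilon>\<close> gives \<open>e i g\<close>.\<close>
  define e where "e i g = (\<lambda>p\<in>carrier (P 0). \<lambda>x\<in>carrier (AWA (W i)). g (ract (AWA (W i)) x (\<epsilon> p)))" for i and g :: "('k, 'a, 'w) triple \<Rightarrow> 'm"
  note Pb = res_bimodule[OF field res] and Pd = res_d[OF field res]
  note Pl = bimod_homsD(2)[OF Pd] and Pbi = bimodule_biact[OF Pb] and Pm = res_module[OF field res]
  note Cb = AWA_bimodule[OF W] note Cm = bimodule_module[OF Cb] and Cbi = bimodule_biact[OF Cb]
  note Mm = bimodule_module[OF M] and Mbi = bimodule_biact[OF M]
  note Hm = biactD(1)[OF Hb]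
  note el = eps_lin[OF field res] and ea = eps_act[OF field res]
  have fH: "f p \<in> left_homs K A (AWA (W i)) M" "f p \<in> carrier (HH i)" if "f \<in> carrier (HD i j)" "p \<in> carrier (P j)" for f i j p
    using lin_closed[OF bimod_homsD(2), of f "P j" "HH i" p] that by (auto simp: Hom_Ae_carrier Hom_A_carrier)
  have fB: "f \<in> bimod_homs K A (P j) (HH i)" "f \<in> lin_maps K (P j) (HH i)" if "f \<in> carrier (HD i j)" for f i j
    using that by (auto simp: Hom_Ae_carrier intro: bimod_homsD(2))
  have comp: "(\<lambda>x. g (f x)) \<in> bimod_homs K A X Z" if "f \<in> bimod_homs K A X Y" "g \<in> bimod_homs K A Y Z"
    for f g and X :: "('k, 'a, 'x) bimodule" and Y :: "('k, 'a, 'y) bimodule" and Z :: "('k, 'a, 'z) bimodule"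
    by (rule bimod_homsI[OF lin_comp[OF bimod_homsD(2)[OF that(1)] bimod_homsD(2)[OF that(2)]]])
      (simp_all add: bimod_homsD(3,4)[OF that(1)] bimod_homsD(3,4)[OF that(2)] lin_closed[OF bimod_homsD(2)[OF that(1)]])
  have dhc: "dh i j f \<in> carrier (HD (Suc i) j)" if "f \<in> carrier (HD i j)" for i j f
    unfolding dh_def by (rule Hom_Ae_restrict[OF Pbi Hb comp[OF fB(1)[OF that] dH_hom]])
  have dvc: "dv i j f \<in> carrier (HD i (Suc j))" if "f \<in> carrier (HD i j)" for i j f
    unfolding dv_def using Hom_Ae_restrict[OF Pbi Hb comp[OF Pd fB(1)[OF that]]] by simp
  have ec: "e i g \<in> carrier (HD i 0)" if g: "g \<in> carrier (HE i)" for i g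
  proof -
    interpret C: bimodule K A "AWA (W i)" by (rule Cb)
    have gB: "g \<in> bimod_homs K A (AWA (W i)) M" using g by (simp add: Hom_Ae_carrier)
    note gl = bimod_homsD(2)[OF gB]
    let ?h = "\<lambda>p. \<lambda>x\<in>carrier (AWA (W i)). g (ract (AWA (W i)) x (\<epsilon> p))"
    have h: "?h p \<in> carrier (HH i)" if p: "p \<in> carrier (P 0)" for p
    proof -
      note ep = lin_closed[OF el p]
      have "(\<lambda>x. g (ract (AWA (W i)) x (\<epsilon> p))) \<in> left_homs K A (AWA (W i)) M"
        by (rule left_homsI[OF lin_comp[OF bimodule_ract[OF Cb ep] gl]])
          (simp add: C.lact_ract ep bimod_homsD(3)[OF gB] C.ract_closed del: AWA_simps)
      then show ?thesis unfolding Hom_A_carrier using left_homs_cong[OF Cbi Mbi] by auto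
    qed
    have "?h \<in> bimod_homs K A (P 0) (HH i)"
    proof (rule bimod_homsI)
      show "?h \<in> lin_maps K (P 0) (HH i)"
        by (rule lin_into_Hom_A[OF Pm h]) (simp_all add: lin_comp[OF lin_comp[OF el bimodule_ract'[OF Cb]] gl] del: AWA_simps)
      fix a p assume ap: "a \<in> carrier A" "p \<in> carrier (P 0)"
      note ep = lin_closed[OF el ap(2)]
      show "?h (lact (P 0) a p) = lact (HH i) a (?h p)"
        by (rule Hom_A_eqI[OF h biact_closed(1)[OF Hb ap(1) h[OF ap(2)]]])
          (simp_all add: ap bimodule.lact_closed[OF Pb] Hom_A_act C.ract_closed ea C.ract_assoc ep del: AWA_simps)
      show "?h (ract (P 0) p a) = ract (HH i) (?h p) a"
        by (rule Hom_A_eqI[OF h biact_closed(2)[OF Hb ap(1) h[OF ap(2)]]])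
          (simp_all add: ap bimodule.ract_closed[OF Pb] Hom_A_act C.ract_closed ea C.ract_assoc ep bimod_homsD(4)[OF gB] del: AWA_simps)
    qed
    then show ?thesis unfolding e_def by (rule Hom_Ae_restrict[OF Pbi Hb])
  qed
  have HDeq: "f = g" if "f \<in> carrier (HD i j)" "g \<in> carrier (HD i j)"
    "\<And>p x. \<lbrakk>p \<in> carrier (P j); x \<in> carrier (AWA (W i))\<rbrakk> \<Longrightarrow> f p x = g p x" for f g i j
    by (rule Hom_Ae_eqI[OF that(1,2)], rule Hom_A_eqI[OF fH(2)[OF that(1)] fH(2)[OF that(2)]])
      (assumption | erule (1) that(3))+
  have HDz: "\<zero>\<^bsub>HD i j\<^esub> p x = \<zero>\<^bsub>M\<^esub>" if "p \<in> carrier (P j)" "x \<in> carrier (AWA (W i))" for i j p x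
    using that by (simp add: Hom_Ae_def fun_module_simps Hom_A_zero)
  have Dm: "module K (HD i j)" for i j by (rule Hom_Ae_module[OF Pbi Hb])
  note zc = module_zero_closed[OF Dm]
  have "coaugmented_double_complex K HD dh dv HE dH e"
  proof (rule coaugmented_double_complex.intro)
    show "module K (HD i j)" for i j by (rule Dm)
    show "dh i j \<in> lin_maps K (HD i j) (HD (Suc i) j)" for i j
      by (rule lin_into_Hom_Ae[OF Dm dhc]) (simp_all add: dh_def lin_comp[OF Hom_Ae_eval bimod_homsD(2)[OF dH_hom]])
    show "dv i j \<in> lin_maps K (HD i j) (HD i (Suc j))" for i j
      by (rule lin_into_Hom_Ae[OF Dm dvc]) (simp_all add: dv_def Hom_Ae_eval lin_closed[OF Pl])
    show "dh (Suc i) j (dh i j f) = \<zero>\<^bsub>HD (Suc (Suc i)) j\<^esub>" if f: "f \<in> carrier (HD i j)" for i j f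
      by (rule HDeq[OF dhc[OF dhc[OF f]] zc]) (simp add: HDz dh_def dH_dH left_homsD(1)[OF fH(1)[OF f]] del: AWA_simps)
    show "dv i (Suc j) (dv i j f) = \<zero>\<^bsub>HD i (Suc (Suc j))\<^esub>" if f: "f \<in> carrier (HD i j)" for i j f
      by (rule HDeq[OF dvc[OF dvc[OF f]] zc])
        (simp add: HDz dv_def lin_closed[OF Pl] res_dd[OF field res] lin_zero[OF Pm Hm fB(2)[OF f]] Hom_A_zero del: AWA_simps)
    show "dh i (Suc j) (dv i j f) = dv (Suc i) j (dh i j f)" if f: "f \<in> carrier (HD i j)" for i j f
      by (rule HDeq[OF dhc[OF dvc[OF f]] dvc[OF dhc[OF f]]]) (simp add: dv_def dh_def lin_closed[OF Pl] del: AWA_simps)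
    have dEc: "dH i g \<in> carrier (HE (Suc i))" if "g \<in> carrier (HE i)" for i g
      using that dH_left dH_right dH_ext by (auto simp: Hom_Ae_carrier bimod_homs_iff simp del: AWA_simps)
    have dE: "dH i \<in> lin_maps K (HE i) (HE (Suc i))" for i
      by (rule lin_into_Hom_Ae[OF Hom_Ae_module[OF Cbi Mbi] dEc])
        (simp_all add: dH_eq lin_sgn[OF Mm Hom_Ae_eval] lin_closed[OF dl] del: AWA_simps)
    have HEz: "\<zero>\<^bsub>HE i\<^esub> x = \<zero>\<^bsub>M\<^esub>" if "x \<in> carrier (AWA (W i))" for i x
      using that by (simp add: Hom_Ae_def fun_module_simps)
    have gl: "g \<in> lin_maps K (AWA (W i)) M" if "g \<in> carrier (HE i)" for g i
      using that bimod_homsD(2) by (auto simp: Hom_Ae_carrier simp del: AWA_simps)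
    have "dH (Suc p) (dH p g) = \<zero>\<^bsub>HE (Suc (Suc p))\<^esub>" if g: "g \<in> carrier (HE p)" for p g
      by (rule Hom_Ae_eqI[OF dEc[OF dEc[OF g]] module_zero_closed[OF Hom_Ae_module[OF Cbi Mbi]]])
        (simp add: dH_dH gl[OF g] HEz del: AWA_simps)
    then show "cochain_complex K HE dH" using dE Hom_Ae_module[OF Cbi Mbi] by (simp add: cochain_complex_def)
    show "e i \<in> lin_maps K (HE i) (HD i 0)" for i
    proof (rule lin_into_Hom_Ae[OF Hom_Ae_module[OF Cbi Mbi] ec])
      fix p assume p: "p \<in> carrier (P 0)"
      have c: "e i g p \<in> carrier (HH i)" if "g \<in> carrier (HE i)" for g using fH(2)[OF ec[OF that] p] .
      show "(\<lambda>g. e i g p) \<in> lin_maps K (HE i) (HH i)"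
        by (rule lin_into_Hom_A[OF Hom_Ae_module[OF Cbi Mbi] c])
          (simp_all add: e_def p Hom_Ae_eval bimodule.ract_closed[OF Cb] lin_closed[OF el] del: AWA_simps)
    qed
    \<comment> \<open>Evaluation at a preimage of the unit undoes the embedding
      \<open>e\<close>.\<close>
    obtain p1 where p1: "p1 \<in> carrier (P 0)" "\<epsilon> p1 = \<one>\<^bsub>A\<^esub>"
      using res_eps_surj[OF field res] A.one_closed by (metis imageE)
    show "g = \<zero>\<^bsub>HE i\<^esub>" if g: "g \<in> carrier (HE i)" and z: "e i g = \<zero>\<^bsub>HD i 0\<^esub>" for g i
    proof (rule Hom_Ae_eqI[OF g module_zero_closed[OF Hom_Ae_module[OF Cbi Mbi]]])
      fix x assume x: "x \<in> carrier (AWA (W i))"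
      have "e i g p1 x = \<zero>\<^bsub>M\<^esub>" using z HDz[OF p1(1) x] by simp
      then show "g x = \<zero>\<^bsub>HE i\<^esub> x" using x p1 HEz[OF x] by (simp add: e_def bimodule.ract_one[OF Cb] del: AWA_simps)
    qed
    show "dv i 0 (e i g) = \<zero>\<^bsub>HD i (Suc 0)\<^esub>" if g: "g \<in> carrier (HE i)" for g i
      by (rule HDeq[OF dvc[OF ec[OF g]] zc])
        (use lin_closed[OF Pl] in \<open>simp add: HDz dv_def e_def eps_d[OF field res] lin_zero[OF A Cm bimodule_ract'[OF Cb]]
          lin_zero[OF Cm Mm gl[OF g]] del: AWA_simps\<close>)
    show "dh i 0 (e i g) = e (Suc i) (dH i g)" if g: "g \<in> carrier (HE i)" for g i
      by (rule HDeq[OF dhc[OF ec[OF g]] ec[OF dEc[OF g]]])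
        (simp add: dh_def e_def dH_eq lin_closed[OF dl] bimodule.ract_closed[OF Cb] lin_closed[OF el] bimod_homsD(4)[OF d] del: AWA_simps)
    show "\<exists>g\<in>carrier (HE i). e i g = f" if f: "f \<in> carrier (HD i 0)" and z: "dv i 0 f = \<zero>\<^bsub>HD i (Suc 0)\<^esub>" for f i
    proof
      note fl = fB(2)[OF f] and P0c = bimodule.lact_closed[OF Pb] bimodule.ract_closed[OF Pb]
      \<comment> \<open>A vertical cocycle vanishes on boundaries of \<open>P\<close>, so
        \<open>f p\<close> depends only on \<open>\<epsilon> p\<close>.\<close>
      have feq: "f p x = f q x" if pq: "p \<in> carrier (P 0)" "q \<in> carrier (P 0)" "\<epsilon> p = \<epsilon> q" and x: "x \<in> carrier (AWA (W i))" for p q x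
      proof -
        have "\<epsilon> (p \<ominus>\<^bsub>P 0\<^esub> q) = \<zero>\<^bsub>A\<^esub>"
          using lin_diff[OF Pm A el pq(1,2)] pq(3) module_diff_self[OF A lin_closed[OF el pq(2)]] by simp
        then obtain r where r: "r \<in> carrier (P (Suc 0))" "p \<ominus>\<^bsub>P 0\<^esub> q = dP (Suc 0) r"
          using res_exact0[OF field res] module_diff_closed[OF Pm pq(1,2)] by blast
        have "dv i 0 f r x = \<zero>\<^bsub>M\<^esub>" using z HDz[OF r(1) x] by simp
        then have "f (p \<ominus>\<^bsub>P 0\<^esub> q) x = \<zero>\<^bsub>M\<^esub>" using r by (simp add: dv_def)
        then have "f p x \<ominus>\<^bsub>M\<^esub> f q x = \<zero>\<^bsub>M\<^esub>"
          using lin_diff[OF Pm Mm lin_comp[OF fl Hom_A_eval[OF x]] pq(1,2)] by simp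
        then show ?thesis
          using module_diff_eq_zero[OF Mm] lin_closed[OF lin_comp[OF fl Hom_A_eval[OF x]]] pq(1,2) by blast
      qed
      have p1H: "f p1 \<in> left_homs K A (AWA (W i)) M" "f p1 \<in> extensional (carrier (AWA (W i)))"
        using fH(2)[OF f p1(1)] by (simp_all only: Hom_A_carrier)
      \<comment> \<open>\<open>c p1\<close> and \<open>p1 c\<close> have the same image under
        \<open>\<epsilon>\<close>, which makes \<open>f p1\<close> right linear although
        \<open>p1\<close> need not commute with \<open>c\<close>.\<close>
      have r: "f p1 (ract (AWA (W i)) x c) = ract M (f p1 x) c" if c: "c \<in> carrier A" and x: "x \<in> carrier (AWA (W i))" for c x
      proof -
        have "f p1 (ract (AWA (W i)) x c) = f (lact (P 0) c p1) x"
          using x by (simp add: bimod_homsD(3)[OF fB(1)[OF f] c p1(1)] Hom_A_act del: AWA_simps)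
        also have "\<dots> = f (ract (P 0) p1 c) x" by (rule feq) (simp_all add: c p1 P0c ea x del: AWA_simps)
        also have "\<dots> = ract M (f p1 x) c"
          using x by (simp add: bimod_homsD(4)[OF fB(1)[OF f] c p1(1)] Hom_A_act del: AWA_simps)
        finally show ?thesis .
      qed
      show g: "f p1 \<in> carrier (HE i)"
        unfolding Hom_Ae_carrier bimod_homs_iff using p1H right_homsI[OF left_homsD(1)[OF p1H(1)] r] by blast
      show "e i (f p1) = f"
      proof (rule HDeq[OF ec[OF g] f])
        fix p x assume p: "p \<in> carrier (P 0)" and x: "x \<in> carrier (AWA (W i))"
        note ep = lin_closed[OF el p]
        have "f p1 (ract (AWA (W i)) x (\<epsilon> p)) = f (lact (P 0) (\<epsilon> p) p1) x"
          using x by (simp add: bimod_homsD(3)[OF fB(1)[OF f] ep p1(1)] Hom_A_act del: AWA_simps)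
        also have "\<dots> = f p x" by (rule feq) (simp_all add: ep p p1 P0c ea x del: AWA_simps)
        finally show "e i (f p1) p x = f p x" using p x by (simp add: e_def del: AWA_simps)
      qed
    qed
  next
    fix f i j assume f: "f \<in> carrier (HD i (Suc j))" and z: "dv i (Suc j) f = \<zero>\<^bsub>HD i (Suc (Suc j))\<^esub>"
    obtain s u where su: "s \<in> right_homs (P j) (P (Suc j))" "u \<in> right_homs (P (Suc j)) (P (Suc (Suc j)))"
      "\<And>x. x \<in> carrier (P (Suc j)) \<Longrightarrow> s (dP (Suc j) x) \<oplus>\<^bsub>P (Suc j)\<^esub> dP (Suc (Suc j)) (u x) = x"
      by (rule contraction_Suc[OF field res]) blast
    \<comment> \<open>Composing with the contraction gives the primitive: the relation for
      \<open>s\<close> and \<open>u\<close> together with the cocycle condition leaves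
      \<open>f\<close> itself.\<close>
    obtain g where g: "g \<in> carrier (HD i j)"
      "\<And>p a w b. \<lbrakk>p \<in> carrier (P j); a \<in> carrier A; w \<in> carrier (W i); b \<in> carrier A\<rbrakk> \<Longrightarrow>
        g p (triple K A (W i) a w b) = lact M a (f (s (lact (P j) b p)) (triple K A (W i) \<one>\<^bsub>A\<^esub> w \<one>\<^bsub>A\<^esub>))"
      by (rule Hom_right_map[OF M W Pb Pb su(1) f]) blast
    note fl = fB(2)[OF f]
    interpret C: bimodule K A "AWA (W i)" by (rule Cb)
    have fsd: "f (s (dP (Suc j) q)) x = f q x" if q: "q \<in> carrier (P (Suc j))" and x: "x \<in> carrier (AWA (W i))" for q x
    proof -
      note uq = lin_closed[OF right_homsD(1)[OF su(2)] q] and sq = lin_closed[OF right_homsD(1)[OF su(1)] lin_closed[OF Pl q]]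
      have "dv i (Suc j) f (u q) x = \<zero>\<^bsub>M\<^esub>" using z HDz[OF uq x] by simp
      then have "f (dP (Suc (Suc j)) (u q)) x = \<zero>\<^bsub>M\<^esub>" using uq by (simp add: dv_def)
      then have "f (s (dP (Suc j) q) \<oplus>\<^bsub>P (Suc j)\<^esub> dP (Suc (Suc j)) (u q)) x = f (s (dP (Suc j) q)) x"
        using lin_add[OF lin_comp[OF fl Hom_A_eval[OF x]] sq lin_closed[OF Pl uq]]
          lin_closed[OF lin_comp[OF fl Hom_A_eval[OF x]] sq] by simp
      then show ?thesis using su(3)[OF q] by simp
    qed
    have "dv i j g = f"
    proof (rule HDeq[OF dvc[OF g(1)] f])
      fix p x assume p: "p \<in> carrier (P (Suc j))" and x: "x \<in> carrier (AWA (W i))"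
      note dp = lin_closed[OF Pl p]
      have "g (dP (Suc j) p) x = f p x"
      proof (rule AWA_eqI[OF W x left_homsD(1)[OF fH(1)[OF g(1) dp]] left_homsD(1)[OF fH(1)[OF f p]]])
        fix a w b assume *: "a \<in> carrier A" "w \<in> carrier (W i)" "b \<in> carrier A"
        let ?t = "triple K A (W i) \<one>\<^bsub>A\<^esub> w \<one>\<^bsub>A\<^esub>"
        have t: "?t \<in> carrier (AWA (W i))" using tri_closed[OF W] * by simp
        have bp: "lact (P (Suc j)) b p \<in> carrier (P (Suc j))" using bimodule.lact_closed[OF Pb *(3) p] .
        have "g (dP (Suc j) p) (triple K A (W i) a w b) = lact M a (f (s (dP (Suc j) (lact (P (Suc j)) b p))) ?t)"
          using g(2)[OF dp *] bimod_homsD(3)[OF Pd *(3) p] by simp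
        also have "\<dots> = lact M a (f p (ract (AWA (W i)) ?t b))"
          using t by (simp add: fsd[OF bp] bimod_homsD(3)[OF fB(1)[OF f] *(3) p] Hom_A_act del: AWA_simps)
        also have "\<dots> = f p (lact (AWA (W i)) a (ract (AWA (W i)) ?t b))"
          using left_homsD(2)[OF fH(1)[OF f p] *(1) C.ract_closed[OF *(3) t]] by simp
        also have "lact (AWA (W i)) a (ract (AWA (W i)) ?t b) = triple K A (W i) a w b"
          using * by (simp add: AWA_ract[OF W] AWA_lact[OF W])
        finally show "g (dP (Suc j) p) (triple K A (W i) a w b) = f p (triple K A (W i) a w b)" .
      qed
      then show "dv i j g p x = f p x" using p by (simp add: dv_def)
    qed
    then show "\<exists>y\<in>carrier (HD i j). dv i j y = f" using g(1) by blast
  qed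
  then have "mod_iso K (cohomology HE dH n) (cohomology (tot HD) (cotot_d HD dh dv) n)"
    by (rule coaugmented_double_complex.cohomology_tot_iso)
  then show ?thesis unfolding hypercohomology_def Let_def dh_def[abs_def] dv_def[abs_def] .
qed

end

end

section \<open>The tensor algebra and its quadratic quotient\<close>

lemma submodule_preimage:
  assumes "module K X" "module K Y" "h \<in> lin_maps K X Y" "submodule N K Y"
  shows "submodule {x \<in> carrier X. h x \<in> N} K X"
proof -
  interpret X: module K X by fact
  interpret Y: module K Y by fact
  note E = Y.submoduleE[OF assms(4)]
  show ?thesis
    by (rule X.submoduleI)
      (auto simp: lin_zero[OF assms(1-3)] lin_neg[OF assms(1-3)] lin_add[OF assms(3)] lin_smult[OF assms(3)]
        submodule_zero[OF assms(2,4)] E(3,4,5))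
qed

lemma span_of_eqI:
  assumes "module K X" "module K Y" "g \<in> lin_maps K X Y" "h \<in> lin_maps K X Y" "S \<subseteq> carrier X"
    "\<And>s. s \<in> S \<Longrightarrow> g s = h s" "x \<in> span_of K X S"
  shows "g x = h x"
proof -
  interpret X: module K X by fact
  have c: "x \<in> carrier X" using span_of_submodule[OF assms(1,5)] assms(7) X.submoduleE(1) by blast
  have l: "(\<lambda>x. g x \<oplus>\<^bsub>Y\<^esub> signed Y 1 (h x)) \<in> lin_maps K X Y"
    by (rule lin_sum[OF assms(2,3) lin_sgn[OF assms(2,4)]])
  have "g x \<oplus>\<^bsub>Y\<^esub> signed Y 1 (h x) = \<zero>\<^bsub>Y\<^esub>"
    by (rule span_of_zero[OF assms(1,2) l assms(5) _ assms(7)])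
      (use assms(5,6) module_diff_self[OF assms(2) lin_closed[OF assms(4)]] in \<open>auto simp: signed_def a_minus_def\<close>)
  then show ?thesis
    using module_diff_eq_zero[OF assms(2)] lin_closed[OF assms(3) c] lin_closed[OF assms(4) c]
    by (simp add: signed_def a_minus_def)
qed

text \<open>Every finite set of vectors is fixed by some operator of finite rank; the operators below
  are built up by adding terms of rank one.\<close>

lemma finite_rank_induct:
  assumes field: "field K" and V: "module K V" and F: "finite F" "F \<subseteq> carrier V"
    and zero: "Q (\<lambda>x. \<zero>\<^bsub>V\<^esub>)"
    and step: "\<And>e \<phi> v. \<lbrakk>e \<in> lin_maps K V V; Q e; \<phi> \<in> lin_maps K V (self_mod K); v \<in> carrier V\<rbrakk> \<Longrightarrow>
      Q (\<lambda>x. e x \<oplus>\<^bsub>V\<^esub> \<phi> x \<odot>\<^bsub>V\<^esub> v)"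
  obtains e where "e \<in> lin_maps K V V" "Q e" "\<And>x. x \<in> F \<Longrightarrow> e x = x"
proof -
  interpret V: module K V by (rule V)
  have "\<exists>e\<in>lin_maps K V V. Q e \<and> (\<forall>x\<in>F. e x = x)" using F
  proof (induction F)
    case empty
    then show ?case using zero lin_const_zero[OF V] by blast
  next
    case (insert y F)
    then obtain e where e: "e \<in> lin_maps K V V" "Q e" "\<And>x. x \<in> F \<Longrightarrow> e x = x" by blast
    have y: "y \<in> carrier V" using insert by simp
    note ey = lin_closed[OF e(1) y]
    \<comment> \<open>The part of the new vector that \<open>e\<close> misses; a functional equal to
      one on it supplies the correction.\<close>
    let ?y = "y \<ominus>\<^bsub>V\<^esub> e y"
    have yc: "?y \<in> carrier V" using y ey by simp
    show ?case
    proof (cases "?y = \<zero>\<^bsub>V\<^esub>")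
      case True
      then show ?thesis using e module_diff_eq_zero[OF V y ey] by auto
    next
      case False
      obtain \<psi> where p: "\<psi> \<in> lin_maps K V (self_mod K)" "\<psi> ?y = \<one>\<^bsub>K\<^esub>"
        by (rule exists_functional[OF field V yc False])
      \<comment> \<open>Passing to the difference of \<open>x\<close> and \<open>e x\<close> first
        makes the functional vanish on the vectors already fixed.\<close>
      let ?\<phi> = "\<lambda>x. \<psi> (x \<ominus>\<^bsub>V\<^esub> e x)" let ?e = "\<lambda>x. e x \<oplus>\<^bsub>V\<^esub> ?\<phi> x \<odot>\<^bsub>V\<^esub> ?y"
      have neg: "(\<lambda>x. \<ominus>\<^bsub>V\<^esub> e x) \<in> lin_maps K V V" using lin_sgn[OF V e(1), of 1] by (simp add: signed_def)
      have \<phi>: "?\<phi> \<in> lin_maps K V (self_mod K)"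
        unfolding a_minus_def by (rule lin_comp[OF lin_sum[OF V lin_id neg] p(1)])
      have sc: "(\<lambda>c. c \<odot>\<^bsub>V\<^esub> ?y) \<in> lin_maps K (self_mod K) V"
        by (rule lin_mapsI) (use yc in \<open>auto simp: V.smult_l_distr V.smult_assoc1\<close>)
      have "?e \<in> lin_maps K V V" by (rule lin_sum[OF V e(1) lin_comp[OF \<phi> sc]])
      moreover have "?e x = x" if "x \<in> F" for x
      proof -
        have x: "x \<in> carrier V" using that insert by auto
        have "?\<phi> x = \<zero>\<^bsub>K\<^esub>"
          using e(3)[OF that] module_diff_self[OF V x] lin_zero[OF V self_mod_module[OF V.R.is_cring] p(1)] by simp
        then show ?thesis using e(3)[OF that] x yc by simp
      qed
      moreover have "?e y = y" using p(2) y ey yc module_sub_add[OF V y ey] by simp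
      ultimately show ?thesis using step[OF e(1,2) \<phi> yc] by auto
    qed
  qed
  then show ?thesis using that by blast
qed

text \<open>\<open>m\<close> stands for multiplication by a letter on one side. Only finitely many
  letters occur in \<open>w\<close>; an operator of finite rank fixing them writes \<open>w\<close>
  as a finite sum of terms \<open>m v (g w)\<close> with \<open>g\<close> a contraction by a
  functional, and each such term lies in \<open>N\<close>. No basis of \<open>V\<close> is
  chosen.\<close>

lemma contraction_splitting:
  assumes field: "field K" and V: "module K V" and T: "module K T" and m: "bilin K V T T m"
    and contr: "\<And>\<beta>. bilin K V T T \<beta> \<Longrightarrow> \<exists>g\<in>lin_maps K T T. \<forall>x\<in>carrier V. \<forall>t\<in>carrier T. g (m x t) = \<beta> x t"
    and N: "submodule N K T" "\<And>x t. \<lbrakk>x \<in> carrier V; t \<in> U\<rbrakk> \<Longrightarrow> m x t \<in> N"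
    and w: "w \<in> span_of K T {m x t | x t. x \<in> carrier V \<and> t \<in> carrier T}"
    and U: "\<And>\<phi> g. \<lbrakk>\<phi> \<in> lin_maps K V (self_mod K); g \<in> lin_maps K T T;
      \<And>x t. \<lbrakk>x \<in> carrier V; t \<in> carrier T\<rbrakk> \<Longrightarrow> g (m x t) = \<phi> x \<odot>\<^bsub>T\<^esub> t\<rbrakk> \<Longrightarrow> g w \<in> U"
  shows "w \<in> N"
proof -
  interpret T: module K T by (rule T)
  interpret V: module K V by (rule V)
  let ?S = "{m x t | x t. x \<in> carrier V \<and> t \<in> carrier T}"
  have S: "?S \<subseteq> carrier T" using bilin_closed[OF m] by auto
  have wT: "w \<in> carrier T" using span_of_submodule[OF T S] w T.submoduleE(1) by blast
  note EN = T.submoduleE[OF N(1)]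
  \<comment> \<open>\<open>con e g\<close> says that \<open>g\<close> applies \<open>e\<close> to
    the letter and leaves the rest alone.\<close>
  define con where "con e g \<longleftrightarrow> g \<in> lin_maps K T T \<and> (\<forall>x\<in>carrier V. \<forall>t\<in>carrier T. g (m x t) = m (e x) t)" for e g
  have bi: "bilin K V T T (\<lambda>x t. m (e x) t)" if "e \<in> lin_maps K V V" for e
    by (rule bilinI) (auto intro: lin_comp[OF that bilin_l[OF m]] bilin_r[OF m] lin_closed[OF that])
  have ex: "\<exists>g. con e g" if "e \<in> lin_maps K V V" for e
    using contr[OF bi[OF that]] by (auto simp: con_def)
  \<comment> \<open>The elements decided by finitely many letters are closed under the module
    operations, by taking unions of the letter sets.\<close>
  have fixed: "\<exists>F\<subseteq>carrier V. finite F \<and> (\<forall>e g. e \<in> lin_maps K V V \<and> (\<forall>x\<in>F. e x = x) \<and> con e g \<longrightarrow> g u = u)" (is "?P u")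
    if "u \<in> span_of K T ?S" for u
  proof -
    have "submodule {u \<in> carrier T. ?P u} K T"
    proof (rule T.submoduleI)
      show "\<zero>\<^bsub>T\<^esub> \<in> {u \<in> carrier T. ?P u}"
        using lin_zero[OF T T] by (auto simp: con_def intro!: exI[of _ "{}"])
    next
      fix u assume "u \<in> {u \<in> carrier T. ?P u}"
      then obtain F where F: "u \<in> carrier T" "F \<subseteq> carrier V" "finite F"
        "\<And>e g. \<lbrakk>e \<in> lin_maps K V V; \<forall>x\<in>F. e x = x; con e g\<rbrakk> \<Longrightarrow> g u = u" by blast
      have "g (\<ominus>\<^bsub>T\<^esub> u) = \<ominus>\<^bsub>T\<^esub> u" if "e \<in> lin_maps K V V" "\<forall>x\<in>F. e x = x" "con e g" for e g
        using F(4)[OF that] that(3) lin_neg[OF T T _ F(1), of g] by (simp add: con_def)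
      then show "\<ominus>\<^bsub>T\<^esub> u \<in> {u \<in> carrier T. ?P u}" using F(1-3) by (auto intro!: exI[of _ F])
      have "g (c \<odot>\<^bsub>T\<^esub> u) = c \<odot>\<^bsub>T\<^esub> u"
        if "c \<in> carrier K" "e \<in> lin_maps K V V" "\<forall>x\<in>F. e x = x" "con e g" for c e g
        using F(4)[OF that(2-4)] that(4) lin_smult[OF _ that(1) F(1), of g T] by (simp add: con_def)
      then show "c \<odot>\<^bsub>T\<^esub> u \<in> {u \<in> carrier T. ?P u}" if "c \<in> carrier K" for c
        using F(1-3) that by (auto intro!: exI[of _ F])
      fix u' assume "u' \<in> {u \<in> carrier T. ?P u}"
      then obtain F' where F': "u' \<in> carrier T" "F' \<subseteq> carrier V" "finite F'"
        "\<And>e g. \<lbrakk>e \<in> lin_maps K V V; \<forall>x\<in>F'. e x = x; con e g\<rbrakk> \<Longrightarrow> g u' = u'" by blast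
      have "g (u \<oplus>\<^bsub>T\<^esub> u') = u \<oplus>\<^bsub>T\<^esub> u'" if "e \<in> lin_maps K V V" "\<forall>x\<in>F \<union> F'. e x = x" "con e g" for e g
        using F(4)[OF that(1) _ that(3)] F'(4)[OF that(1) _ that(3)] that(2,3) lin_add[of g K T T u u'] F(1) F'(1)
        by (auto simp: con_def)
      then show "u \<oplus>\<^bsub>T\<^esub> u' \<in> {u \<in> carrier T. ?P u}"
        using F(1-3) F'(1-3) by (auto intro!: exI[of _ "F \<union> F'"])
    qed auto
    moreover have "?S \<subseteq> {u \<in> carrier T. ?P u}"
    proof
      fix s assume "s \<in> ?S"
      then obtain x t where s: "s = m x t" "x \<in> carrier V" "t \<in> carrier T" by blast
      have "?P s" using s by (intro exI[of _ "{x}"]) (auto simp: con_def)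
      then show "s \<in> {u \<in> carrier T. ?P u}" using s bilin_closed[OF m] by auto
    qed
    ultimately have "span_of K T ?S \<subseteq> {u \<in> carrier T. ?P u}" by (rule span_of_least)
    then have "u \<in> {u \<in> carrier T. ?P u}" using that by (rule subsetD)
    then show ?thesis by simp
  qed
  from fixed[OF w] obtain F where F: "F \<subseteq> carrier V" "finite F"
    and Fw: "\<forall>e g. e \<in> lin_maps K V V \<and> (\<forall>x\<in>F. e x = x) \<and> con e g \<longrightarrow> g w = w"
    by (elim exE conjE)
  obtain e where e: "e \<in> lin_maps K V V" "\<And>g. con e g \<Longrightarrow> g w \<in> N" "\<And>x. x \<in> F \<Longrightarrow> e x = x"
  \<comment> \<open>The induction carries membership in \<open>N\<close> for every \<open>g\<close>
    realising the operator; the zero operator sends \<open>w\<close> to zero.\<close>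
  proof (rule finite_rank_induct[OF field V F(2,1), of "\<lambda>e. \<forall>g. con e g \<longrightarrow> g w \<in> N"])
    show "\<forall>g. con (\<lambda>x. \<zero>\<^bsub>V\<^esub>) g \<longrightarrow> g w \<in> N"
    proof (intro allI impI)
      fix g assume g: "con (\<lambda>x. \<zero>\<^bsub>V\<^esub>) g"
      have "g w = \<zero>\<^bsub>T\<^esub>"
        by (rule span_of_zero[OF T T _ S _ w]) (use g lin_zero[OF V T bilin_l[OF m]] in \<open>auto simp: con_def\<close>)
      then show "g w \<in> N" using submodule_zero[OF T N(1)] by simp
    qed
  next
    fix e \<phi> v assume e: "e \<in> lin_maps K V V" "\<forall>g. con e g \<longrightarrow> g w \<in> N" and \<phi>: "\<phi> \<in> lin_maps K V (self_mod K)"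
      and v: "v \<in> carrier V"
    show "\<forall>g. con (\<lambda>x. e x \<oplus>\<^bsub>V\<^esub> \<phi> x \<odot>\<^bsub>V\<^esub> v) g \<longrightarrow> g w \<in> N"
    proof (intro allI impI)
      fix g assume g: "con (\<lambda>x. e x \<oplus>\<^bsub>V\<^esub> \<phi> x \<odot>\<^bsub>V\<^esub> v) g"
      obtain g1 where g1: "con e g1" using ex[OF e(1)] by blast
      have \<phi>c: "\<phi> x \<in> carrier K" if "x \<in> carrier V" for x using lin_closed[OF \<phi> that] by simp
      have sc: "(\<lambda>c. c \<odot>\<^bsub>T\<^esub> t) \<in> lin_maps K (self_mod K) T" if "t \<in> carrier T" for t
        by (rule lin_mapsI) (use that in \<open>auto simp: T.smult_l_distr T.smult_assoc1\<close>)
      have "bilin K V T T (\<lambda>x t. \<phi> x \<odot>\<^bsub>T\<^esub> t)"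
        by (rule bilinI) (use lin_scale[OF T \<phi>c] lin_comp[OF \<phi> sc] in auto)
      then obtain g2 where g2: "g2 \<in> lin_maps K T T"
        "\<And>x t. \<lbrakk>x \<in> carrier V; t \<in> carrier T\<rbrakk> \<Longrightarrow> g2 (m x t) = \<phi> x \<odot>\<^bsub>T\<^esub> t" using contr by blast
      have gl: "g \<in> lin_maps K T T" "g1 \<in> lin_maps K T T" using g g1 by (auto simp: con_def)
      \<comment> \<open>A rank one summand of the operator contributes \<open>v\<close> multiplied
        with the contraction of \<open>w\<close> by \<open>\<phi>\<close>.\<close>
      have "g w = g1 w \<oplus>\<^bsub>T\<^esub> m v (g2 w)"
      proof (rule span_of_eqI[OF T T gl(1) lin_sum[OF T gl(2) lin_comp[OF g2(1) bilin_r[OF m v]]] S _ w])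
        fix s assume "s \<in> ?S"
        then obtain x t where s: "s = m x t" "x \<in> carrier V" "t \<in> carrier T" by blast
        then show "g s = g1 s \<oplus>\<^bsub>T\<^esub> m v (g2 s)"
          using g g1 \<phi>c[OF s(2)] v lin_closed[OF e(1) s(2)]
          by (simp add: con_def g2(2) lin_add[OF bilin_l[OF m]] lin_smult[OF bilin_l[OF m]] lin_smult[OF bilin_r[OF m]])
      qed
      moreover have "g2 w \<in> U" using U[OF \<phi> g2] .
      ultimately show "g w \<in> N" using e(2) g1 N(2)[OF v] EN(5) by simp
    qed
  qed blast
  obtain g where g: "con e g" using ex[OF e(1)] by blast
  have "\<forall>x\<in>F. e x = x" using e(3) by simp
  then have "g w = w" using Fw[rule_format, of e g] e(1) g by simp
  then show ?thesis using e(2)[OF g] by simp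
qed

section \<open>The free algebra on words\<close>

lemma free_algebra_simps:
  "carrier (free_algebra K S) = carrier (free_module K (lists S))" "add (free_algebra K S) = add (free_module K (lists S))"
  "zero (free_algebra K S) = zero (free_module K (lists S))" "smult (free_algebra K S) = smult (free_module K (lists S))"
  "one (free_algebra K S) = single K []"
  "mult (free_algebra K S) = (\<lambda>f g w. \<Oplus>\<^bsub>K\<^esub>i\<in>{..length w}. f (take i w) \<otimes>\<^bsub>K\<^esub> g (drop i w))"
  by (simp_all add: free_algebra_def)

lemma lin_free_algebra: "lin_maps K (free_algebra K S) Z = lin_maps K (free_module K (lists S)) Z"
  "lin_maps K Z (free_algebra K S) = lin_maps K Z (free_module K (lists S))"
  by (simp_all add: lin_maps_def free_algebra_simps)

context
  fixes K :: "'k ring" and S :: "'s set"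
  assumes K: "cring K"
begin

interpretation K: cring K by (rule K)

abbreviation (input) "FA \<equiv> free_algebra K S"

lemma FA_module: "module K FA"
  by (rule module_cong[OF free_module_module[OF K]]) (simp_all add: free_algebra_simps)

lemma FA_in: "f \<in> carrier FA \<Longrightarrow> f w \<in> carrier K"
  using free_in_K[OF K] by (simp add: free_algebra_simps)

lemma FA_mult_closed:
  assumes f: "f \<in> carrier FA" and g: "g \<in> carrier FA"
  shows "f \<otimes>\<^bsub>FA\<^esub> g \<in> carrier FA"
proof -
  note fK = FA_in[OF f] and gK = FA_in[OF g]
  let ?h = "f \<otimes>\<^bsub>FA\<^esub> g"
  have nz: "\<exists>i\<le>length w. f (take i w) \<noteq> \<zero>\<^bsub>K\<^esub> \<and> g (drop i w) \<noteq> \<zero>\<^bsub>K\<^esub>" if h: "?h w \<noteq> \<zero>\<^bsub>K\<^esub>" for w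
  proof (rule ccontr)
    assume "\<not> ?thesis"
    then have "f (take i w) \<otimes>\<^bsub>K\<^esub> g (drop i w) = \<zero>\<^bsub>K\<^esub>" if "i \<le> length w" for i using that fK gK by (metis K.l_null K.r_null)
    then have "?h w = \<zero>\<^bsub>K\<^esub>" by (auto simp: free_algebra_simps intro!: K.add.finprod_one_eqI)
    then show False using h by simp
  qed
  have "{w. ?h w \<noteq> \<zero>\<^bsub>K\<^esub>} \<subseteq> (\<lambda>(u, v). u @ v) ` ({w. f w \<noteq> \<zero>\<^bsub>K\<^esub>} \<times> {w. g w \<noteq> \<zero>\<^bsub>K\<^esub>})"
  proof
    fix w assume "w \<in> {w. ?h w \<noteq> \<zero>\<^bsub>K\<^esub>}"
    then obtain i where "f (take i w) \<noteq> \<zero>\<^bsub>K\<^esub>" "g (drop i w) \<noteq> \<zero>\<^bsub>K\<^esub>" using nz by blast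
    then show "w \<in> (\<lambda>(u, v). u @ v) ` ({w. f w \<noteq> \<zero>\<^bsub>K\<^esub>} \<times> {w. g w \<noteq> \<zero>\<^bsub>K\<^esub>})"
      by (intro image_eqI[of _ _ "(take i w, drop i w)"]) auto
  qed
  moreover have "finite {w. f w \<noteq> \<zero>\<^bsub>K\<^esub>}" "finite {w. g w \<noteq> \<zero>\<^bsub>K\<^esub>}"
    using f g by (auto simp: free_algebra_simps free_carrier_iff)
  ultimately have fin: "finite {w. ?h w \<noteq> \<zero>\<^bsub>K\<^esub>}" using finite_subset by blast
  have "w \<in> lists S" if h: "?h w \<noteq> \<zero>\<^bsub>K\<^esub>" for w
  proof -
    obtain i where "f (take i w) \<noteq> \<zero>\<^bsub>K\<^esub>" "g (drop i w) \<noteq> \<zero>\<^bsub>K\<^esub>" using nz[OF h] by blast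
    then have "take i w \<in> lists S" "drop i w \<in> lists S"
      using f g by (auto simp: free_algebra_simps free_carrier_iff)
    then have "take i w @ drop i w \<in> lists S" by (simp only: append_in_lists_conv)
    then show ?thesis by simp
  qed
  moreover have "?h w \<in> carrier K" for w
    using fK gK by (auto simp: free_algebra_simps intro!: K.finsum_closed)
  ultimately show ?thesis using fin unfolding free_algebra_simps(1) free_carrier_iff by blast
qed

lemma FA_mult_bilin: "bilin K FA FA FA (mult FA)"
proof (rule bilinI; rule lin_mapsI)
  fix f g h c assume f: "f \<in> carrier FA" and g: "g \<in> carrier FA"
  note K_in = FA_in[OF f] FA_in[OF g]
  show "f \<otimes>\<^bsub>FA\<^esub> g \<in> carrier FA" "f \<otimes>\<^bsub>FA\<^esub> g \<in> carrier FA" by (rule FA_mult_closed[OF f g])+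
  {
    assume h: "h \<in> carrier FA"
    note K_in = K_in FA_in[OF h]
    show "f \<otimes>\<^bsub>FA\<^esub> (g \<oplus>\<^bsub>FA\<^esub> h) = f \<otimes>\<^bsub>FA\<^esub> g \<oplus>\<^bsub>FA\<^esub> f \<otimes>\<^bsub>FA\<^esub> h"
      using K_in by (simp add: free_algebra_simps free_module_simps K.r_distr K.finsum_addf Pi_iff)
    show "(f \<oplus>\<^bsub>FA\<^esub> h) \<otimes>\<^bsub>FA\<^esub> g = f \<otimes>\<^bsub>FA\<^esub> g \<oplus>\<^bsub>FA\<^esub> h \<otimes>\<^bsub>FA\<^esub> g"
      using K_in by (simp add: free_algebra_simps free_module_simps K.l_distr K.finsum_addf Pi_iff)
  next
    assume c: "c \<in> carrier K"
    show "f \<otimes>\<^bsub>FA\<^esub> (c \<odot>\<^bsub>FA\<^esub> g) = c \<odot>\<^bsub>FA\<^esub> (f \<otimes>\<^bsub>FA\<^esub> g)"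
      using K_in c by (simp add: free_algebra_simps free_module_simps K.m_lcomm K.finsum_rdistr Pi_iff)
    show "(c \<odot>\<^bsub>FA\<^esub> f) \<otimes>\<^bsub>FA\<^esub> g = c \<odot>\<^bsub>FA\<^esub> (f \<otimes>\<^bsub>FA\<^esub> g)"
      using K_in c by (simp add: free_algebra_simps free_module_simps K.m_assoc K.finsum_rdistr Pi_iff)
  }
qed

lemma FA_single: "w \<in> lists S \<Longrightarrow> single K w \<in> carrier FA"
  using single_closed[OF K] by (simp add: free_algebra_simps)

lemma FA_single_mult: "single K u \<otimes>\<^bsub>FA\<^esub> single K v = single K (u @ v)"
proof
  fix w
  \<comment> \<open>Only the cut after the first \<open>length u\<close> letters can match both
    words.\<close>
  have "single K u (take i w) \<otimes>\<^bsub>K\<^esub> single K v (drop i w) = (if length u = i then single K (u @ v) w else \<zero>\<^bsub>K\<^esub>)"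
    if "i \<le> length w" for i
  proof -
    have "take i w = u \<and> drop i w = v \<longleftrightarrow> length u = i \<and> w = u @ v" using that by (auto simp: append_eq_conv_conj)
    then show ?thesis by (auto simp: single_def)
  qed
  then have "(single K u \<otimes>\<^bsub>FA\<^esub> single K v) w = (\<Oplus>\<^bsub>K\<^esub>i\<in>{..length w}. if length u = i then single K (u @ v) w else \<zero>\<^bsub>K\<^esub>)"
    by (auto simp: free_algebra_simps single_def intro!: K.finsum_cong')
  also have "\<dots> = single K (u @ v) w"
  proof (cases "length u \<le> length w")
    case True
    then show ?thesis using K.finsum_singleton[of "length u" "{..length w}" "\<lambda>_. single K (u @ v) w"] by (simp add: single_def)
  next
    case False
    then have "single K (u @ v) w = \<zero>\<^bsub>K\<^esub>" by (auto simp: single_def)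
    then show ?thesis by (auto intro!: K.add.finprod_one_eqI)
  qed
  finally show "(single K u \<otimes>\<^bsub>FA\<^esub> single K v) w = single K (u @ v) w" .
qed

lemma FA_eqI: "\<lbrakk>module K Z; g \<in> lin_maps K FA Z; h \<in> lin_maps K FA Z; \<And>w. w \<in> lists S \<Longrightarrow> g (single K w) = h (single K w);
    f \<in> carrier FA\<rbrakk> \<Longrightarrow> g f = h f"
  by (rule free_module_eqI[OF K, where S = "lists S"]) (simp_all add: lin_free_algebra free_algebra_simps)

lemma FA_kalg: "kalg K FA"
proof (rule kalg.intro[OF FA_module])
  note b = FA_mult_bilin and m = FA_module
  note l = bilin_l[OF b] and r = bilin_r[OF b] and c = FA_mult_closed
  interpret m: module K FA by (rule m)
  \<comment> \<open>Both sides are linear in each argument, so associativity reduces to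
    concatenation of words and no double sum has to be reindexed.\<close>
  have assoc: "f \<otimes>\<^bsub>FA\<^esub> g \<otimes>\<^bsub>FA\<^esub> h = f \<otimes>\<^bsub>FA\<^esub> (g \<otimes>\<^bsub>FA\<^esub> h)"
    if f: "f \<in> carrier FA" and g: "g \<in> carrier FA" and h: "h \<in> carrier FA" for f g h
  proof (rule FA_eqI[OF m lin_comp[OF l[OF g] l[OF h]] l[OF c[OF g h]] _ f])
    fix u assume u: "u \<in> lists S"
    note su = FA_single[OF u]
    show "single K u \<otimes>\<^bsub>FA\<^esub> g \<otimes>\<^bsub>FA\<^esub> h = single K u \<otimes>\<^bsub>FA\<^esub> (g \<otimes>\<^bsub>FA\<^esub> h)"
    proof (rule FA_eqI[OF m lin_comp[OF r[OF su] l[OF h]] lin_comp[OF l[OF h] r[OF su]] _ g])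
      fix v assume v: "v \<in> lists S"
      note sv = FA_single[OF v]
      show "single K u \<otimes>\<^bsub>FA\<^esub> single K v \<otimes>\<^bsub>FA\<^esub> h = single K u \<otimes>\<^bsub>FA\<^esub> (single K v \<otimes>\<^bsub>FA\<^esub> h)"
        by (rule FA_eqI[OF m r[OF c[OF su sv]] lin_comp[OF r[OF sv] r[OF su]] _ h]) (simp add: FA_single_mult)
    qed
  qed
  have one: "\<one>\<^bsub>FA\<^esub> \<in> carrier FA" using FA_single[of "[]"] by (simp add: free_algebra_simps(5))
  have l1: "\<one>\<^bsub>FA\<^esub> \<otimes>\<^bsub>FA\<^esub> f = f" if "f \<in> carrier FA" for f
    by (rule FA_eqI[OF m r[OF one] lin_id _ that]) (simp add: FA_single_mult free_algebra_simps(5))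
  have r1: "f \<otimes>\<^bsub>FA\<^esub> \<one>\<^bsub>FA\<^esub> = f" if "f \<in> carrier FA" for f
    by (rule FA_eqI[OF m l[OF one] lin_id _ that]) (simp add: FA_single_mult free_algebra_simps(5))
  show "ring FA"
  proof (rule ringI)
    show "abelian_group FA" by (rule module_abelian_group[OF m])
    show "Group.monoid FA" by (rule monoidI) (simp_all add: c one assoc l1 r1)
  qed (simp_all add: lin_add[OF l] lin_add[OF r])
qed (simp_all add: lin_smult[OF bilin_l[OF FA_mult_bilin]] lin_smult[OF bilin_r[OF FA_mult_bilin]])

end

section \<open>Ideals and quotient algebras\<close>

context kalg
begin

text \<open>Scaling by \<open>c\<close> is multiplication by the ring element \<open>c\<close> times
  one, which an ideal absorbs.\<close>

lemma ideal_submodule: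
  assumes "ideal I A"
  shows "submodule I K A"
proof -
  interpret I: ideal I A by fact
  show ?thesis
  proof (rule A.submoduleI)
    show "c \<odot>\<^bsub>A\<^esub> x \<in> I" if c: "c \<in> carrier K" and x: "x \<in> I" for c x
    proof -
      have xA: "x \<in> carrier A" using x I.a_subset by auto
      have "(c \<odot>\<^bsub>A\<^esub> \<one>\<^bsub>A\<^esub>) \<otimes>\<^bsub>A\<^esub> x \<in> I" using I.I_l_closed[OF x] c by simp
      then show ?thesis using smult_l[OF c A.one_closed xA] xA by simp
    qed
  qed (use I.a_subset in auto)
qed

lemma quot_mult:
  assumes "ideal I A" "x \<in> carrier A" "y \<in> carrier A"
  shows "(I +>\<^bsub>A\<^esub> x) \<otimes>\<^bsub>quot A I\<^esub> (I +>\<^bsub>A\<^esub> y) = I +>\<^bsub>A\<^esub> (x \<otimes>\<^bsub>A\<^esub> y)"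
  using ideal.rcoset_mult_add[OF assms] by (simp add: quot_simps)

lemma quot_kalg:
  assumes I: "ideal I A"
  shows "kalg K (quot A I)"
proof (rule kalg.intro)
  note s = ideal_submodule[OF I]
  note m = quot_mult[OF I] and a = quot_add[OF A s] and sm = quot_smult[OF A s]
  show M: "module K (quot A I)" by (rule quot_module[OF A s])
  show "ring (quot A I)"
  proof (rule ringI)
    show "abelian_group (quot A I)" by (rule module_abelian_group[OF M])
    show "Group.monoid (quot A I)"
      by (rule monoidI) (auto simp: quot_simps(1,3) m A.m_assoc)
  qed (auto simp: quot_simps(1) m a A.l_distr A.r_distr)
  show "(c \<odot>\<^bsub>quot A I\<^esub> x) \<otimes>\<^bsub>quot A I\<^esub> y = c \<odot>\<^bsub>quot A I\<^esub> (x \<otimes>\<^bsub>quot A I\<^esub> y)"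
    "x \<otimes>\<^bsub>quot A I\<^esub> (c \<odot>\<^bsub>quot A I\<^esub> y) = c \<odot>\<^bsub>quot A I\<^esub> (x \<otimes>\<^bsub>quot A I\<^esub> y)"
    if "c \<in> carrier K" "x \<in> carrier (quot A I)" "y \<in> carrier (quot A I)" for c x y
    using that by (auto simp: quot_simps(1) m sm smult_l smult_r)
qed

text \<open>The kernel of \<open>g\<close> need not be an ideal. The elements \<open>x\<close> with
  \<open>g (a x b) = 0\<close> for all \<open>a\<close> and \<open>b\<close> form one inside the
  kernel, so testing on sandwiched generators is enough.\<close>

lemma genideal_zero:
  assumes S: "S \<subseteq> carrier A" and Z: "module K Z" and g: "g \<in> lin_maps K A Z"
    and z: "\<And>a b s. \<lbrakk>a \<in> carrier A; b \<in> carrier A; s \<in> S\<rbrakk> \<Longrightarrow> g (a \<otimes>\<^bsub>A\<^esub> s \<otimes>\<^bsub>A\<^esub> b) = \<zero>\<^bsub>Z\<^esub>"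
    and x: "x \<in> Idl\<^bsub>A\<^esub> S"
  shows "g x = \<zero>\<^bsub>Z\<^esub>"
proof -
  let ?J = "{x \<in> carrier A. \<forall>a\<in>carrier A. \<forall>b\<in>carrier A. g (a \<otimes>\<^bsub>A\<^esub> x \<otimes>\<^bsub>A\<^esub> b) = \<zero>\<^bsub>Z\<^esub>}"
  interpret Z: module K Z by (rule Z)
  have l: "(\<lambda>x. g (a \<otimes>\<^bsub>A\<^esub> x \<otimes>\<^bsub>A\<^esub> b)) \<in> lin_maps K A Z" if "a \<in> carrier A" "b \<in> carrier A" for a b
    by (rule lin_comp[OF lin_comp[OF mult_lin_r[OF that(1)] mult_lin_l[OF that(2)]] g])
  have "ideal ?J A"
  proof (rule idealI[OF ring])
    have "submodule ?J K A"
      by (rule A.submoduleI)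
        (use lin_zero[OF A Z l] lin_neg[OF A Z l] lin_add[OF l] lin_smult[OF l] in auto)
    then show "subgroup ?J (add_monoid A)" by (simp add: submodule_def)
    show "y \<otimes>\<^bsub>A\<^esub> x \<in> ?J" "x \<otimes>\<^bsub>A\<^esub> y \<in> ?J" if x: "x \<in> ?J" and y: "y \<in> carrier A" for x y
    proof -
      have "a \<otimes>\<^bsub>A\<^esub> (y \<otimes>\<^bsub>A\<^esub> x) \<otimes>\<^bsub>A\<^esub> b = (a \<otimes>\<^bsub>A\<^esub> y) \<otimes>\<^bsub>A\<^esub> x \<otimes>\<^bsub>A\<^esub> b"
        "a \<otimes>\<^bsub>A\<^esub> (x \<otimes>\<^bsub>A\<^esub> y) \<otimes>\<^bsub>A\<^esub> b = a \<otimes>\<^bsub>A\<^esub> x \<otimes>\<^bsub>A\<^esub> (y \<otimes>\<^bsub>A\<^esub> b)"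
        if "a \<in> carrier A" "b \<in> carrier A" for a b using that x y by (simp_all add: A.m_assoc)
      then show "y \<otimes>\<^bsub>A\<^esub> x \<in> ?J" "x \<otimes>\<^bsub>A\<^esub> y \<in> ?J" using x y by auto
    qed
  qed
  moreover have "S \<subseteq> ?J" using S z by auto
  ultimately have "x \<in> ?J" using A.genideal_minimal x by blast
  then show ?thesis using A.one_closed A.l_one A.r_one by fastforce
qed

end

section \<open>The tensor algebra and contraction of an outer letter\<close>

locale tensor_alg =
  fixes K :: "'k ring" and V :: "('k, 'v) module"
  assumes field: "field K" and V: "module K V"
begin

abbreviation "F \<equiv> free_algebra K (carrier V)"
abbreviation "I \<equiv> tensor_ideal K V"
abbreviation "T \<equiv> tensor_algebra K V"

lemma K: "cring K" using V by (simp add: module_def)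

lemma F: "kalg K F" by (rule FA_kalg[OF K])

sublocale V: module K V by (rule V)
sublocale F: kalg K F by (rule F)

definition "gens = {single K [x \<oplus>\<^bsub>V\<^esub> y] \<ominus>\<^bsub>F\<^esub> (single K [x] \<oplus>\<^bsub>F\<^esub> single K [y]) | x y. x \<in> carrier V \<and> y \<in> carrier V} \<union>
  {single K [c \<odot>\<^bsub>V\<^esub> x] \<ominus>\<^bsub>F\<^esub> c \<odot>\<^bsub>F\<^esub> single K [x] | c x. c \<in> carrier K \<and> x \<in> carrier V}"

lemma I_eq: "I = Idl\<^bsub>F\<^esub> gens" by (simp add: tensor_ideal_def Let_def gens_def)

lemma sF: "w \<in> lists (carrier V) \<Longrightarrow> single K w \<in> carrier F" by (rule FA_single[OF K])

lemma s1: "x \<in> carrier V \<Longrightarrow> single K [x] \<in> carrier F" by (rule sF) simp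

lemma gens_closed: "gens \<subseteq> carrier F"
  unfolding gens_def by (auto intro!: F.A.minus_closed F.A.a_closed F.A.smult_closed s1)

lemma I: "ideal I F" unfolding I_eq by (rule F.A.genideal_ideal[OF gens_closed])

lemma I_sub: "submodule I K F" by (rule F.ideal_submodule[OF I])

lemma T_eq: "T = quot F I" by (simp add: tensor_algebra_def)

sublocale T: kalg K T unfolding T_eq by (rule F.quot_kalg[OF I])

definition "cls f = I +>\<^bsub>F\<^esub> f"
text \<open>For \<open>w = [x1, ..., xp]\<close> this is the decomposable tensor of its
  letters.\<close>

definition "wd w = cls (single K w)"

lemma cls_lin: "cls \<in> lin_maps K F T"
  using quot_proj[OF F.A I_sub] by (simp add: T_eq cls_def[abs_def])

lemma cls_mult: "\<lbrakk>f \<in> carrier F; g \<in> carrier F\<rbrakk> \<Longrightarrow> cls f \<otimes>\<^bsub>T\<^esub> cls g = cls (f \<otimes>\<^bsub>F\<^esub> g)"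
  using F.quot_mult[OF I] by (simp add: T_eq cls_def)

lemma cls_zero: "f \<in> I \<Longrightarrow> cls f = \<zero>\<^bsub>T\<^esub>"
  using coset_zero_iff[OF F.A I_sub] ideal.Icarr[OF I] by (simp add: T_eq cls_def quot_simps)

lemma T_carrier: "carrier T = cls ` carrier F" by (simp add: T_eq quot_simps cls_def[abs_def])

lemma wd_closed: "w \<in> lists (carrier V) \<Longrightarrow> wd w \<in> carrier T"
  using lin_closed[OF cls_lin sF] by (simp add: wd_def)

lemma wd1: "x \<in> carrier V \<Longrightarrow> wd [x] \<in> carrier T" by (rule wd_closed) simp

lemma wd_append: "\<lbrakk>u \<in> lists (carrier V); v \<in> lists (carrier V)\<rbrakk> \<Longrightarrow> wd u \<otimes>\<^bsub>T\<^esub> wd v = wd (u @ v)"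
  by (simp add: wd_def cls_mult sF FA_single_mult[OF K])

lemma wd_Nil: "wd [] = \<one>\<^bsub>T\<^esub>"
  by (simp add: wd_def cls_def T_eq quot_simps free_algebra_simps)

lemma T_eqI:
  assumes "module K Z" "g \<in> lin_maps K T Z" "h \<in> lin_maps K T Z" "\<And>w. w \<in> lists (carrier V) \<Longrightarrow> g (wd w) = h (wd w)"
    "t \<in> carrier T"
  shows "g t = h t"
proof -
  obtain f where f: "f \<in> carrier F" "t = cls f" using assms(5) T_carrier by auto
  have "g (cls f) = h (cls f)"
    by (rule FA_eqI[OF K assms(1) lin_comp[OF cls_lin assms(2)] lin_comp[OF cls_lin assms(3)] _ f(1)])
      (use assms(4) in \<open>simp add: wd_def\<close>)
  then show ?thesis using f by simp
qed

lemma gen_in_I: "g \<in> gens \<Longrightarrow> g \<in> I"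
  unfolding I_eq using F.A.genideal_self[OF gens_closed] by blast

lemma cls_eqI:
  assumes "f \<ominus>\<^bsub>F\<^esub> g \<in> I" "f \<in> carrier F" "g \<in> carrier F"
  shows "cls f = cls g"
  using coset_eq_iff[OF F.A I_sub assms(2,3)] assms(1) by (simp add: cls_def)

lemma wd_lin: "(\<lambda>x. wd [x]) \<in> lin_maps K V T"
proof (rule lin_mapsI)
  fix x assume x: "x \<in> carrier V"
  show "wd [x] \<in> carrier T" by (rule wd1[OF x])
  show "wd [c \<odot>\<^bsub>V\<^esub> x] = c \<odot>\<^bsub>T\<^esub> wd [x]" if c: "c \<in> carrier K" for c
  proof -
    have "cls (single K [c \<odot>\<^bsub>V\<^esub> x]) = cls (c \<odot>\<^bsub>F\<^esub> single K [x])"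
      by (rule cls_eqI[OF gen_in_I]) (use x c s1 in \<open>auto simp: gens_def\<close>)
    then show ?thesis using lin_smult[OF cls_lin c s1[OF x]] by (simp add: wd_def)
  qed
  show "wd [x \<oplus>\<^bsub>V\<^esub> y] = wd [x] \<oplus>\<^bsub>T\<^esub> wd [y]" if y: "y \<in> carrier V" for y
  proof -
    have "cls (single K [x \<oplus>\<^bsub>V\<^esub> y]) = cls (single K [x] \<oplus>\<^bsub>F\<^esub> single K [y])"
      by (rule cls_eqI[OF gen_in_I]) (use x y s1 in \<open>auto simp: gens_def\<close>)
    then show ?thesis using lin_add[OF cls_lin s1[OF x] s1[OF y]] by (simp add: wd_def)
  qed
qed

lemma lists_snoc: "w \<in> lists S \<Longrightarrow> w \<noteq> [] \<Longrightarrow> butlast w \<in> lists S \<and> last w \<in> S"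
  by (auto simp: in_lists_conv_set dest: in_set_butlastD)

text \<open>A nonempty word has a first letter, so \<open>T(V)\<close> is spanned by the unit and by
  the multiples of letters from the left.\<close>

lemma T_eqI_l:
  assumes "module K Z" "g \<in> lin_maps K T Z" "h \<in> lin_maps K T Z" "g \<one>\<^bsub>T\<^esub> = h \<one>\<^bsub>T\<^esub>"
    "\<And>x t. \<lbrakk>x \<in> carrier V; t \<in> carrier T\<rbrakk> \<Longrightarrow> g (wd [x] \<otimes>\<^bsub>T\<^esub> t) = h (wd [x] \<otimes>\<^bsub>T\<^esub> t)" "t \<in> carrier T"
  shows "g t = h t"
proof (rule T_eqI[OF assms(1-3) _ assms(6)])
  fix w assume w: "w \<in> lists (carrier V)"
  show "g (wd w) = h (wd w)"
  proof (cases w)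
    case (Cons x u)
    then have "wd w = wd [x] \<otimes>\<^bsub>T\<^esub> wd u" using w wd_append[of "[x]" u] by simp
    then show ?thesis using assms(5) w Cons wd_closed by simp
  qed (simp add: wd_Nil assms(4))
qed

lemma T_eqI_r:
  assumes "module K Z" "g \<in> lin_maps K T Z" "h \<in> lin_maps K T Z" "g \<one>\<^bsub>T\<^esub> = h \<one>\<^bsub>T\<^esub>"
    "\<And>x t. \<lbrakk>x \<in> carrier V; t \<in> carrier T\<rbrakk> \<Longrightarrow> g (t \<otimes>\<^bsub>T\<^esub> wd [x]) = h (t \<otimes>\<^bsub>T\<^esub> wd [x])" "t \<in> carrier T"
  shows "g t = h t"
proof (rule T_eqI[OF assms(1-3) _ assms(6)])
  fix w assume w: "w \<in> lists (carrier V)"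
  show "g (wd w) = h (wd w)"
  proof (cases "w = []")
    case False
    note b = lists_snoc[OF w False]
    have "wd w = wd (butlast w) \<otimes>\<^bsub>T\<^esub> wd [last w]" using wd_append[of "butlast w" "[last w]"] b False by simp
    then show ?thesis using assms(5) b wd_closed by simp
  qed (simp add: wd_Nil assms(4))
qed

lemma gens_mult:
  assumes s: "s \<in> gens" and Z: "module K Z" and g: "g \<in> lin_maps K F Z"
    and lin: "(\<lambda>x. g (single K [x])) \<in> lin_maps K V Z"
  shows "g s = \<zero>\<^bsub>Z\<^esub>"
proof -
  have z: "g (p \<ominus>\<^bsub>F\<^esub> q) = \<zero>\<^bsub>Z\<^esub>" if "p \<in> carrier F" "q \<in> carrier F" "g p = g q" for p q
    using lin_diff[OF F.A Z g that(1,2)] module_diff_self[OF Z lin_closed[OF g that(2)]] that(3) by simp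
  note F_closed = F.A.a_closed F.A.smult_closed s1
  show ?thesis using s unfolding gens_def
    by (auto intro!: z F_closed simp: lin_add[OF g] lin_smult[OF g] lin_add[OF lin] lin_smult[OF lin] s1)
qed

text \<open>\<open>T(V)\<close> is the direct sum of the scalars and \<open>V (x) T(V)\<close>, so
  \<open>\<beta>\<close> extends by zero on the scalars. Concretely the map is prescribed on words
  and then has to kill the ideal of multilinearity relations.\<close>

lemma lcontr_ex:
  assumes Z: "module K Z" and b: "bilin K V T Z \<beta>"
  shows "\<exists>g\<in>lin_maps K T Z. g \<one>\<^bsub>T\<^esub> = \<zero>\<^bsub>Z\<^esub> \<and> (\<forall>x\<in>carrier V. \<forall>t\<in>carrier T. g (wd [x] \<otimes>\<^bsub>T\<^esub> t) = \<beta> x t)"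
proof -
  let ?\<phi> = "\<lambda>w. case w of [] \<Rightarrow> \<zero>\<^bsub>Z\<^esub> | x # u \<Rightarrow> \<beta> x (wd u)"
  have p: "?\<phi> \<in> lists (carrier V) \<rightarrow> carrier Z"
    using bilin_closed[OF b] wd_closed module_zero_closed[OF Z] by (auto split: list.splits)
  let ?h = "lin_ext K Z ?\<phi>"
  have h: "?h \<in> lin_maps K F Z" unfolding lin_free_algebra by (rule lin_ext_lin[OF K Z p])
  have hs: "?h (single K w) = ?\<phi> w" if "w \<in> lists (carrier V)" for w by (rule lin_ext_single[OF K Z p that])
  have hx: "?h (single K [x] \<otimes>\<^bsub>F\<^esub> f) = \<beta> x (cls f)" if x: "x \<in> carrier V" and f: "f \<in> carrier F" for x f
    by (rule FA_eqI[OF K Z lin_comp[OF F.mult_lin_r[OF s1[OF x]] h] lin_comp[OF cls_lin bilin_r[OF b x]] _ f])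
      (use x in \<open>simp add: FA_single_mult[OF K] hs wd_def\<close>)
  have z: "?h f = \<zero>\<^bsub>Z\<^esub>" if "f \<in> I" for f
  proof (rule F.genideal_zero[OF gens_closed Z h _ that[unfolded I_eq]])
    fix a c s assume a: "a \<in> carrier F" and c: "c \<in> carrier F" and s: "s \<in> gens"
    have sc: "s \<in> carrier F" using s gens_closed by auto
    have l: "(\<lambda>a. ?h (a \<otimes>\<^bsub>F\<^esub> s \<otimes>\<^bsub>F\<^esub> c)) \<in> lin_maps K F Z"
      by (rule lin_comp[OF lin_comp[OF F.mult_lin_l[OF sc] F.mult_lin_l[OF c]] h])
    show "?h (a \<otimes>\<^bsub>F\<^esub> s \<otimes>\<^bsub>F\<^esub> c) = \<zero>\<^bsub>Z\<^esub>"
    proof (rule FA_eqI[OF K Z l lin_const_zero[OF Z] _ a])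
      fix w assume w: "w \<in> lists (carrier V)"
      show "?h (single K w \<otimes>\<^bsub>F\<^esub> s \<otimes>\<^bsub>F\<^esub> c) = \<zero>\<^bsub>Z\<^esub>"
      \<comment> \<open>A relation at the very front dies because \<open>\<beta>\<close> is linear
        in the first letter; one further back sits behind a first letter, where its class is already
        zero.\<close>
      proof (cases w)
        case Nil
        have "?h (s \<otimes>\<^bsub>F\<^esub> c) = \<zero>\<^bsub>Z\<^esub>"
        proof (rule gens_mult[OF s Z lin_comp[OF F.mult_lin_l[OF c] h]])
          show "(\<lambda>x. ?h (single K [x] \<otimes>\<^bsub>F\<^esub> c)) \<in> lin_maps K V Z"
            by (rule lin_maps_eq[OF bilin_l[OF b lin_closed[OF cls_lin c]] V]) (rule hx[OF _ c])
        qed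
        moreover have "single K [] \<otimes>\<^bsub>F\<^esub> s = s" using F.A.l_one[OF sc] by (simp add: free_algebra_simps(5))
        ultimately show ?thesis using Nil by simp
      next
        case (Cons x u)
        have xu: "x \<in> carrier V" "single K u \<in> carrier F" using w Cons sF by auto
        let ?f = "single K u \<otimes>\<^bsub>F\<^esub> s \<otimes>\<^bsub>F\<^esub> c"
        have fI: "?f \<in> I"
          using ideal.I_r_closed[OF I ideal.I_l_closed[OF I gen_in_I[OF s] xu(2)] c] .
        have "single K w \<otimes>\<^bsub>F\<^esub> s \<otimes>\<^bsub>F\<^esub> c = single K [x] \<otimes>\<^bsub>F\<^esub> ?f"
          using xu s1 sc c FA_single_mult[OF K, where u = "[x]" and v = u] Cons by (simp add: F.A.m_assoc[symmetric])
        then show ?thesis using hx[OF xu(1) ideal.Icarr[OF I fI]] cls_zero[OF fI] lin_zero[OF T.A Z bilin_r[OF b xu(1)]] by simp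
      qed
    qed
  qed
  let ?g = "\<lambda>S. ?h (SOME y. y \<in> S)"
  have g: "?g \<in> lin_maps K T Z" unfolding T_eq by (rule quot_lift[OF F.A I_sub Z h z])
  have v: "?g (cls f) = ?h f" if "f \<in> carrier F" for f
    unfolding cls_def by (rule quot_lift_coset[OF F.A I_sub Z h z that])
  have one: "\<one>\<^bsub>T\<^esub> = cls (single K [])" by (simp add: wd_Nil[symmetric] wd_def)
  have g1: "?g \<one>\<^bsub>T\<^esub> = \<zero>\<^bsub>Z\<^esub>" unfolding one using v[OF sF[of "[]"]] hs[of "[]"] by simp
  have g2: "?g (wd [x] \<otimes>\<^bsub>T\<^esub> t) = \<beta> x t" if x: "x \<in> carrier V" and t: "t \<in> carrier T" for x t
  proof -
    obtain f where f: "f \<in> carrier F" "t = cls f" using t T_carrier by auto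
    then show ?thesis using hx[OF x f(1)] v[OF F.A.m_closed[OF s1[OF x] f(1)]] by (simp add: wd_def cls_mult s1 x)
  qed
  show ?thesis by (intro bexI[OF _ g] conjI ballI g1 g2)
qed

text \<open>Mirror image of \<open>lcontr_ex\<close>: the last letter is split off, and the case
  distinction moves to the factor on the right of the relation.\<close>

lemma rcontr_ex:
  assumes Z: "module K Z" and b: "bilin K V T Z \<beta>"
  shows "\<exists>g\<in>lin_maps K T Z. g \<one>\<^bsub>T\<^esub> = \<zero>\<^bsub>Z\<^esub> \<and> (\<forall>x\<in>carrier V. \<forall>t\<in>carrier T. g (t \<otimes>\<^bsub>T\<^esub> wd [x]) = \<beta> x t)"
proof -
  let ?\<phi> = "\<lambda>w. if w = [] then \<zero>\<^bsub>Z\<^esub> else \<beta> (last w) (wd (butlast w))"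
  have p: "?\<phi> \<in> lists (carrier V) \<rightarrow> carrier Z"
  proof
    fix w assume w: "w \<in> lists (carrier V)"
    show "?\<phi> w \<in> carrier Z"
      using bilin_closed[OF b] wd_closed module_zero_closed[OF Z] lists_snoc[OF w] by auto
  qed
  let ?h = "lin_ext K Z ?\<phi>"
  have h: "?h \<in> lin_maps K F Z" unfolding lin_free_algebra by (rule lin_ext_lin[OF K Z p])
  have hs: "?h (single K w) = ?\<phi> w" if "w \<in> lists (carrier V)" for w by (rule lin_ext_single[OF K Z p that])
  have hx: "?h (f \<otimes>\<^bsub>F\<^esub> single K [x]) = \<beta> x (cls f)" if x: "x \<in> carrier V" and f: "f \<in> carrier F" for x f
    by (rule FA_eqI[OF K Z lin_comp[OF F.mult_lin_l[OF s1[OF x]] h] lin_comp[OF cls_lin bilin_r[OF b x]] _ f])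
      (use x in \<open>simp add: FA_single_mult[OF K] hs wd_def\<close>)
  have z: "?h f = \<zero>\<^bsub>Z\<^esub>" if "f \<in> I" for f
  proof (rule F.genideal_zero[OF gens_closed Z h _ that[unfolded I_eq]])
    fix a c s assume a: "a \<in> carrier F" and c: "c \<in> carrier F" and s: "s \<in> gens"
    have sc: "s \<in> carrier F" using s gens_closed by auto
    note as = F.A.m_closed[OF a sc]
    have l: "(\<lambda>c. ?h (a \<otimes>\<^bsub>F\<^esub> s \<otimes>\<^bsub>F\<^esub> c)) \<in> lin_maps K F Z"
      by (rule lin_comp[OF F.mult_lin_r[OF as] h])
    show "?h (a \<otimes>\<^bsub>F\<^esub> s \<otimes>\<^bsub>F\<^esub> c) = \<zero>\<^bsub>Z\<^esub>"
    proof (rule FA_eqI[OF K Z l lin_const_zero[OF Z] _ c])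
      fix w assume w: "w \<in> lists (carrier V)"
      show "?h (a \<otimes>\<^bsub>F\<^esub> s \<otimes>\<^bsub>F\<^esub> single K w) = \<zero>\<^bsub>Z\<^esub>"
      proof (cases "w = []")
        case True
        have "?h (a \<otimes>\<^bsub>F\<^esub> s) = \<zero>\<^bsub>Z\<^esub>"
        proof (rule gens_mult[OF s Z lin_comp[OF F.mult_lin_r[OF a] h]])
          show "(\<lambda>x. ?h (a \<otimes>\<^bsub>F\<^esub> single K [x])) \<in> lin_maps K V Z"
            by (rule lin_maps_eq[OF bilin_l[OF b lin_closed[OF cls_lin a]] V]) (rule hx[OF _ a])
        qed
        moreover have "a \<otimes>\<^bsub>F\<^esub> s \<otimes>\<^bsub>F\<^esub> single K [] = a \<otimes>\<^bsub>F\<^esub> s" using F.A.r_one[OF as] by (simp add: free_algebra_simps(5))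
        ultimately show ?thesis using True by simp
      next
        case False
        let ?u = "butlast w" and ?x = "last w"
        have xu: "?x \<in> carrier V" "single K ?u \<in> carrier F" using lists_snoc[OF w False] sF by auto
        let ?f = "a \<otimes>\<^bsub>F\<^esub> s \<otimes>\<^bsub>F\<^esub> single K ?u"
        have fI: "?f \<in> I"
          using ideal.I_r_closed[OF I ideal.I_l_closed[OF I gen_in_I[OF s] a] xu(2)] .
        have "a \<otimes>\<^bsub>F\<^esub> s \<otimes>\<^bsub>F\<^esub> single K w = ?f \<otimes>\<^bsub>F\<^esub> single K [?x]"
          using xu s1[OF xu(1)] as FA_single_mult[OF K, where u = ?u and v = "[?x]"] False by (simp add: F.A.m_assoc)
        then show ?thesis using hx[OF xu(1) ideal.Icarr[OF I fI]] cls_zero[OF fI] lin_zero[OF T.A Z bilin_r[OF b xu(1)]] by simp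
      qed
    qed
  qed
  let ?g = "\<lambda>S. ?h (SOME y. y \<in> S)"
  have g: "?g \<in> lin_maps K T Z" unfolding T_eq by (rule quot_lift[OF F.A I_sub Z h z])
  have v: "?g (cls f) = ?h f" if "f \<in> carrier F" for f
    unfolding cls_def by (rule quot_lift_coset[OF F.A I_sub Z h z that])
  have one: "\<one>\<^bsub>T\<^esub> = cls (single K [])" by (simp add: wd_Nil[symmetric] wd_def)
  have g1: "?g \<one>\<^bsub>T\<^esub> = \<zero>\<^bsub>Z\<^esub>" unfolding one using v[OF sF[of "[]"]] hs[of "[]"] by simp
  have g2: "?g (t \<otimes>\<^bsub>T\<^esub> wd [x]) = \<beta> x t" if x: "x \<in> carrier V" and t: "t \<in> carrier T" for x t
  proof -
    obtain f where f: "f \<in> carrier F" "t = cls f" using t T_carrier by auto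
    then show ?thesis using hx[OF x f(1)] v[OF F.A.m_closed[OF f(1) s1[OF x]]] by (simp add: wd_def cls_mult s1 x)
  qed
  show ?thesis by (intro bexI[OF _ g] conjI ballI g1 g2)
qed

text \<open>By \<open>T_eqI_l\<close> the conditions determine the map on \<open>T(V)\<close>, and
  by \<open>T_eqI_r\<close> those of \<open>rcontr\<close> do, so the choice does not matter. Having
  a function of \<open>\<beta>\<close> makes linear dependence on parameters expressible.\<close>

definition "lcontr Z \<beta> = (SOME g. g \<in> lin_maps K T Z \<and> g \<one>\<^bsub>T\<^esub> = \<zero>\<^bsub>Z\<^esub> \<and>
  (\<forall>x\<in>carrier V. \<forall>t\<in>carrier T. g (wd [x] \<otimes>\<^bsub>T\<^esub> t) = \<beta> x t))"

definition "rcontr Z \<beta> = (SOME g. g \<in> lin_maps K T Z \<and> g \<one>\<^bsub>T\<^esub> = \<zero>\<^bsub>Z\<^esub> \<and>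
  (\<forall>x\<in>carrier V. \<forall>t\<in>carrier T. g (t \<otimes>\<^bsub>T\<^esub> wd [x]) = \<beta> x t))"

lemma
  assumes "module K Z" "bilin K V T Z \<beta>"
  shows lcontr_lin: "lcontr Z \<beta> \<in> lin_maps K T Z" and lcontr_one: "lcontr Z \<beta> \<one>\<^bsub>T\<^esub> = \<zero>\<^bsub>Z\<^esub>"
    and lcontr_mult: "\<lbrakk>x \<in> carrier V; t \<in> carrier T\<rbrakk> \<Longrightarrow> lcontr Z \<beta> (wd [x] \<otimes>\<^bsub>T\<^esub> t) = \<beta> x t"
    and rcontr_lin: "rcontr Z \<beta> \<in> lin_maps K T Z" and rcontr_one: "rcontr Z \<beta> \<one>\<^bsub>T\<^esub> = \<zero>\<^bsub>Z\<^esub>"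
    and rcontr_mult: "\<lbrakk>x \<in> carrier V; t \<in> carrier T\<rbrakk> \<Longrightarrow> rcontr Z \<beta> (t \<otimes>\<^bsub>T\<^esub> wd [x]) = \<beta> x t"
proof -
  note l = someI_ex[OF lcontr_ex[OF assms, unfolded Bex_def], folded lcontr_def]
  note r = someI_ex[OF rcontr_ex[OF assms, unfolded Bex_def], folded rcontr_def]
  show "lcontr Z \<beta> \<in> lin_maps K T Z" "lcontr Z \<beta> \<one>\<^bsub>T\<^esub> = \<zero>\<^bsub>Z\<^esub>"
    "\<lbrakk>x \<in> carrier V; t \<in> carrier T\<rbrakk> \<Longrightarrow> lcontr Z \<beta> (wd [x] \<otimes>\<^bsub>T\<^esub> t) = \<beta> x t"
    "rcontr Z \<beta> \<in> lin_maps K T Z" "rcontr Z \<beta> \<one>\<^bsub>T\<^esub> = \<zero>\<^bsub>Z\<^esub>"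
    "\<lbrakk>x \<in> carrier V; t \<in> carrier T\<rbrakk> \<Longrightarrow> rcontr Z \<beta> (t \<otimes>\<^bsub>T\<^esub> wd [x]) = \<beta> x t"
    using l r by blast+
qed

lemma
  assumes Z: "module K Z" and B: "module K B" and b: "\<And>b. b \<in> carrier B \<Longrightarrow> bilin K V T Z (\<phi> b)"
    and lin: "\<And>x t. \<lbrakk>x \<in> carrier V; t \<in> carrier T\<rbrakk> \<Longrightarrow> (\<lambda>b. \<phi> b x t) \<in> lin_maps K B Z" and t: "t \<in> carrier T"
  shows lcontr_param: "(\<lambda>b. lcontr Z (\<phi> b) t) \<in> lin_maps K B Z"
    and rcontr_param: "(\<lambda>b. rcontr Z (\<phi> b) t) \<in> lin_maps K B Z"
proof -
  interpret B: module K B by (rule B)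
  interpret Z: module K Z by (rule Z)
  note l = lcontr_lin[OF Z b] lcontr_one[OF Z b] lcontr_mult[OF Z b]
  note r = rcontr_lin[OF Z b] rcontr_one[OF Z b] rcontr_mult[OF Z b]
  show "(\<lambda>b. lcontr Z (\<phi> b) t) \<in> lin_maps K B Z"
  proof (rule lin_mapsI)
    show "lcontr Z (\<phi> (x \<oplus>\<^bsub>B\<^esub> y)) t = lcontr Z (\<phi> x) t \<oplus>\<^bsub>Z\<^esub> lcontr Z (\<phi> y) t"
      if "x \<in> carrier B" "y \<in> carrier B" for x y
      by (rule T_eqI_l[OF Z l(1) lin_sum[OF Z l(1) l(1)] _ _ t]) (simp_all add: that l(2,3) lin_add[OF lin])
    show "lcontr Z (\<phi> (c \<odot>\<^bsub>B\<^esub> x)) t = c \<odot>\<^bsub>Z\<^esub> lcontr Z (\<phi> x) t" if "c \<in> carrier K" "x \<in> carrier B" for c x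
      by (rule T_eqI_l[OF Z l(1) lin_comp[OF l(1) lin_scale[OF Z that(1)]] _ _ t]) (simp_all add: that l(2,3) lin_smult[OF lin])
  qed (use lin_closed[OF l(1) t] in auto)
  show "(\<lambda>b. rcontr Z (\<phi> b) t) \<in> lin_maps K B Z"
  proof (rule lin_mapsI)
    show "rcontr Z (\<phi> (x \<oplus>\<^bsub>B\<^esub> y)) t = rcontr Z (\<phi> x) t \<oplus>\<^bsub>Z\<^esub> rcontr Z (\<phi> y) t"
      if "x \<in> carrier B" "y \<in> carrier B" for x y
      by (rule T_eqI_r[OF Z r(1) lin_sum[OF Z r(1) r(1)] _ _ t]) (simp_all add: that r(2,3) lin_add[OF lin])
    show "rcontr Z (\<phi> (c \<odot>\<^bsub>B\<^esub> x)) t = c \<odot>\<^bsub>Z\<^esub> rcontr Z (\<phi> x) t" if "c \<in> carrier K" "x \<in> carrier B" for c x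
      by (rule T_eqI_r[OF Z r(1) lin_comp[OF r(1) lin_scale[OF Z that(1)]] _ _ t]) (simp_all add: that r(2,3) lin_smult[OF lin])
  qed (use lin_closed[OF r(1) t] in auto)
qed

section \<open>Graded pieces of the tensor algebra\<close>

abbreviation "TP \<equiv> tensor_power K V"

definition "words p = {w \<in> lists (carrier V). length w = p}"

text \<open>Viewing degree \<open>p\<close> as an image of the free module on words of length
  \<open>p\<close> gives access to induction and linear extension there.\<close>

lemma TP_eq: "TP p = cls ` carrier (free_module K (words p))"
proof -
  have "{f \<in> carrier F. \<forall>w. f w \<noteq> \<zero>\<^bsub>K\<^esub> \<longrightarrow> length w = p} = carrier (free_module K (words p))"
  proof (intro equalityI subsetI)
    fix f assume f: "f \<in> {f \<in> carrier F. \<forall>w. f w \<noteq> \<zero>\<^bsub>K\<^esub> \<longrightarrow> length w = p}"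
    then have fF: "f \<in> carrier (free_module K (lists (carrier V)))" by (simp add: free_algebra_simps)
    then have "w \<in> words p" if "f w \<noteq> \<zero>\<^bsub>K\<^esub>" for w
      using f that unfolding free_carrier_iff words_def by blast
    then show "f \<in> carrier (free_module K (words p))"
      using free_in_K[OF K fF] fF unfolding free_carrier_iff by blast
  next
    fix f assume f: "f \<in> carrier (free_module K (words p))"
    then have "f \<in> carrier F"
      using free_module_mono[OF K, of "words p" "lists (carrier V)"] by (auto simp: words_def free_algebra_simps)
    moreover have "w \<in> words p" if "f w \<noteq> \<zero>\<^bsub>K\<^esub>" for w using f that unfolding free_carrier_iff by blast
    ultimately show "f \<in> {f \<in> carrier F. \<forall>w. f w \<noteq> \<zero>\<^bsub>K\<^esub> \<longrightarrow> length w = p}" by (auto simp: words_def)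
  qed
  then show ?thesis by (simp add: tensor_power_def cls_def[abs_def])
qed

lemma cls_lin_words: "cls \<in> lin_maps K (free_module K (words p)) T"
proof -
  have "carrier (free_module K (words p)) \<subseteq> carrier F"
    using free_module_mono[OF K, of "words p" "lists (carrier V)"] by (auto simp: words_def free_algebra_simps)
  then show ?thesis using cls_lin by (auto simp: lin_maps_def free_algebra_simps free_module_simps subset_iff)
qed

lemma TP_submodule: "submodule (TP p) K T"
  unfolding TP_eq by (rule submodule_image[OF free_module_module[OF K] T.A cls_lin_words])

lemma TP_closed: "t \<in> TP p \<Longrightarrow> t \<in> carrier T"
  using T.A.submoduleE(1)[OF TP_submodule] by blast

lemma wd_TP: "w \<in> words p \<Longrightarrow> wd w \<in> TP p"
  unfolding TP_eq wd_def by (rule imageI, rule single_closed[OF K])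

lemma TP_eqI:
  assumes "module K Z" "g \<in> lin_maps K T Z" "h \<in> lin_maps K T Z" "\<And>w. w \<in> words p \<Longrightarrow> g (wd w) = h (wd w)" "t \<in> TP p"
  shows "g t = h t"
proof -
  obtain f where f: "f \<in> carrier (free_module K (words p))" "t = cls f" using assms(5) TP_eq by auto
  have "g (cls f) = h (cls f)"
    by (rule free_module_eqI[OF K assms(1) lin_comp[OF cls_lin_words assms(2)] lin_comp[OF cls_lin_words assms(3)] _ f(1)])
      (use assms(4) in \<open>simp add: wd_def\<close>)
  then show ?thesis using f by simp
qed

lemma TP_least:
  assumes N: "submodule N K T" and w: "\<And>w. w \<in> words p \<Longrightarrow> wd w \<in> N" and t: "t \<in> TP p"
  shows "t \<in> N"
proof -
  note E = T.A.submoduleE[OF N]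
  obtain f where f: "f \<in> carrier (free_module K (words p))" "t = cls f" using t TP_eq by auto
  have "cls f \<in> N" using K f(1)
  proof (induction rule: free_module_induct)
    case zero
    then show ?case
      using lin_zero[OF free_module_module[OF K] T.A cls_lin_words[of p]] submodule_zero[OF T.A N] by (simp add: free_module_simps)
  next
    case (step f c s)
    note ss = single_closed[OF K step(3)]
    have cs: "c \<odot>\<^bsub>free_module K (words p)\<^esub> single K s \<in> carrier (free_module K (words p))"
      by (rule module.smult_closed[OF free_module_module[OF K] step(2) ss])
    show ?case
      unfolding lin_add[OF cls_lin_words cs step(1)] lin_smult[OF cls_lin_words step(2) ss]
      using w[OF step(3)] step(2,4) E(4,5) by (simp add: wd_def)
  qed
  then show ?thesis using f by simp
qed

lemma TP_1: "t \<in> TP 1 \<Longrightarrow> \<exists>x\<in>carrier V. t = wd [x]"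
proof -
  assume t: "t \<in> TP 1"
  have "t \<in> (\<lambda>x. wd [x]) ` carrier V"
  proof (rule TP_least[OF submodule_image[OF V T.A wd_lin] _ t])
    fix w assume "w \<in> words 1"
    then obtain x where "w = [x]" "x \<in> carrier V" by (auto simp: words_def length_Suc_conv)
    then show "wd w \<in> (\<lambda>x. wd [x]) ` carrier V" by blast
  qed
  then show ?thesis by blast
qed

lemma wd_TP1: "x \<in> carrier V \<Longrightarrow> wd [x] \<in> TP 1"
  by (rule wd_TP) (simp add: words_def)

text \<open>Degree 0 is spanned by the unit, the class of the empty word.\<close>

lemma TP_0: "\<lbrakk>module K Z; g \<in> lin_maps K T Z; g \<one>\<^bsub>T\<^esub> = \<zero>\<^bsub>Z\<^esub>; t \<in> TP 0\<rbrakk> \<Longrightarrow> g t = \<zero>\<^bsub>Z\<^esub>"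
  using TP_eqI[of Z g "\<lambda>_. \<zero>\<^bsub>Z\<^esub>" 0 t] lin_const_zero[of K Z T] by (simp add: words_def wd_Nil)

lemma words_Suc: "w \<in> words (Suc p) \<Longrightarrow> \<exists>x u. w = x # u \<and> x \<in> carrier V \<and> u \<in> words p"
  by (cases w) (auto simp: words_def)

lemma words_snoc: "w \<in> words (Suc p) \<Longrightarrow> \<exists>x u. w = u @ [x] \<and> x \<in> carrier V \<and> u \<in> words p"
  by (cases w rule: rev_cases) (auto simp: words_def)

lemma wd_Cons: "\<lbrakk>x \<in> carrier V; u \<in> words p\<rbrakk> \<Longrightarrow> wd (x # u) = wd [x] \<otimes>\<^bsub>T\<^esub> wd u"
  using wd_append[of "[x]" u] by (simp add: words_def)

lemma wd_snoc: "\<lbrakk>x \<in> carrier V; u \<in> words p\<rbrakk> \<Longrightarrow> wd (u @ [x]) = wd u \<otimes>\<^bsub>T\<^esub> wd [x]"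
  using wd_append[of u "[x]"] by (simp add: words_def)

lemma wdw: "u \<in> words p \<Longrightarrow> wd u \<in> carrier T" by (rule wd_closed) (simp add: words_def)

end

section \<open>The Koszul complex\<close>

locale quadratic = tensor_alg K V for K :: "'k ring" and V :: "('k, 'v) module" +
  fixes R :: "('k, 'v) tens set"
  assumes R: "submodule R K (tensor_algebra K V)" and R2: "R \<subseteq> tensor_power K V 2"
begin

abbreviation "A \<equiv> quadratic_algebra K V R"
abbreviation "W \<equiv> koszul_W K V R"
abbreviation "Wm \<equiv> koszul_W_mod K V R"

lemma R_closed: "R \<subseteq> carrier T"
  using T.A.submoduleE(1)[OF R] .

lemma J: "ideal (rel_ideal K V R) T"
  unfolding rel_ideal_def by (rule T.A.genideal_ideal[OF R_closed])

lemma J_sub: "submodule (rel_ideal K V R) K T" by (rule T.ideal_submodule[OF J])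

sublocale A: kalg K A
  unfolding quadratic_algebra_def by (rule T.quot_kalg[OF J])

definition "cl t = rel_ideal K V R +>\<^bsub>T\<^esub> t"

lemma cl_lin: "cl \<in> lin_maps K T A"
  using quot_proj[OF T.A J_sub] by (simp add: quadratic_algebra_def cl_def[abs_def])

lemma cl_mult: "\<lbrakk>s \<in> carrier T; t \<in> carrier T\<rbrakk> \<Longrightarrow> cl (s \<otimes>\<^bsub>T\<^esub> t) = cl s \<otimes>\<^bsub>A\<^esub> cl t"
  using T.quot_mult[OF J] by (simp add: quadratic_algebra_def cl_def)

lemma cl_R: "r \<in> R \<Longrightarrow> cl r = \<zero>\<^bsub>A\<^esub>"
  using coset_zero_iff[OF T.A J_sub, of r] T.A.genideal_self[OF R_closed] R_closed
  by (auto simp: quadratic_algebra_def cl_def quot_simps rel_ideal_def)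

lemma cl_closed: "t \<in> carrier T \<Longrightarrow> cl t \<in> carrier A" by (rule lin_closed[OF cl_lin])

section \<open>The spaces \<open>W_p\<close> and their contraction by functionals\<close>

definition "TRT i j = {a \<otimes>\<^bsub>T\<^esub> r \<otimes>\<^bsub>T\<^esub> b | a r b. a \<in> TP i \<and> r \<in> R \<and> b \<in> TP j}"

lemma W_iff: "t \<in> W p \<longleftrightarrow> t \<in> TP p \<and> (\<forall>i j. i + 2 + j = p \<longrightarrow> t \<in> span_of K T (TRT i j))"
  by (simp add: koszul_W_def Let_def TRT_def)

lemma TRT_closed: "TRT i j \<subseteq> carrier T"
  using TP_closed R_closed by (auto simp: TRT_def)

lemma W_submodule: "submodule (W p) K T"
proof -
  note S = span_of_submodule[OF T.A TRT_closed]
  note E = T.A.submoduleE[OF S] and P = T.A.submoduleE[OF TP_submodule[of p]]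
  show ?thesis
    by (rule T.A.submoduleI)
      (auto simp: W_iff TP_closed submodule_zero[OF T.A S] submodule_zero[OF T.A TP_submodule] E(3,4,5) P(3,4,5))
qed

lemma W_closed: "w \<in> W p \<Longrightarrow> w \<in> carrier T"
  using T.A.submoduleE(1)[OF W_submodule] by blast

lemma Wm_simps [simp]: "carrier (Wm p) = W p" "add (Wm p) = add T" "zero (Wm p) = zero T" "smult (Wm p) = smult T"
  by (simp_all add: koszul_W_mod_def)

lemma Wm: "module K (Wm p)"
  unfolding koszul_W_mod_def by (rule submodule.submodule_is_module[OF W_submodule T.A])

lemma lin_Wm: "h \<in> lin_maps K T Z \<Longrightarrow> h \<in> lin_maps K (Wm p) Z"
  by (rule lin_mapsI) (auto simp: W_closed lin_closed lin_add lin_smult)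

lemma lin_into_Wm: "\<lbrakk>h \<in> lin_maps K X T; \<And>x. x \<in> carrier X \<Longrightarrow> h x \<in> W p\<rbrakk> \<Longrightarrow> h \<in> lin_maps K X (Wm p)"
  by (rule lin_mapsI) (auto simp: lin_add lin_smult)

text \<open>No pair \<open>i\<close>, \<open>j\<close> satisfies \<open>i + 2 + j = 1\<close>, so
  the intersection is over the empty family.\<close>

lemma W_1: "W 1 = TP 1" by (auto simp: W_iff)

lemma W1_wd: "w \<in> W 1 \<Longrightarrow> \<exists>x\<in>carrier V. w = wd [x]" using TP_1 W_1 by simp

lemma wd_W1: "x \<in> carrier V \<Longrightarrow> wd [x] \<in> W 1" using wd_TP1 W_1 by simp

text \<open>Contracting the first letter turns the condition for \<open>(i + 1, j)\<close> on
  \<open>W (Suc p)\<close> into the one for \<open>(i, j)\<close> on \<open>W p\<close>.\<close>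

lemma W_contract_l:
  assumes w: "w \<in> W (Suc p)" and \<phi>: "\<phi> \<in> lin_maps K V (self_mod K)" and g: "g \<in> lin_maps K T T"
    and gm: "\<And>x t. \<lbrakk>x \<in> carrier V; t \<in> carrier T\<rbrakk> \<Longrightarrow> g (wd [x] \<otimes>\<^bsub>T\<^esub> t) = \<phi> x \<odot>\<^bsub>T\<^esub> t"
  shows "g w \<in> W p"
proof -
  have \<phi>c: "\<phi> x \<in> carrier K" if "x \<in> carrier V" for x using lin_closed[OF \<phi> that] by simp
  have gT: "g t \<in> TP q" if t: "t \<in> TP (Suc q)" for t q
  proof -
    have "t \<in> {t \<in> carrier T. g t \<in> TP q}"
    proof (rule TP_least[OF submodule_preimage[OF T.A T.A g TP_submodule] _ t])
      fix w assume "w \<in> words (Suc q)"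
      then obtain x u where xu: "w = x # u" "x \<in> carrier V" "u \<in> words q" using words_Suc by blast
      then have "g (wd w) = \<phi> x \<odot>\<^bsub>T\<^esub> wd u" using gm wdw by (simp add: wd_Cons)
      then show "wd w \<in> {t \<in> carrier T. g t \<in> TP q}"
        using T.A.submoduleE(4)[OF TP_submodule] \<phi>c xu wd_TP[OF xu(3)] wd1 wdw by (simp add: wd_Cons)
    qed
    then show ?thesis by simp
  qed
  \<comment> \<open>\<open>g\<close> touches only the first letter, so factors on the right can be
    pulled out; a letter must be there to be touched, hence degree \<open>Suc q\<close>.\<close>
  have gTy: "g (t \<otimes>\<^bsub>T\<^esub> y) = g t \<otimes>\<^bsub>T\<^esub> y" if t: "t \<in> TP (Suc q)" and y: "y \<in> carrier T" for t q y
  proof (rule TP_eqI[OF T.A lin_comp[OF T.mult_lin_l[OF y] g] lin_comp[OF g T.mult_lin_l[OF y]] _ t])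
    fix w assume "w \<in> words (Suc q)"
    then obtain x u where xu: "w = x # u" "x \<in> carrier V" "u \<in> words q" using words_Suc by blast
    then show "g (wd w \<otimes>\<^bsub>T\<^esub> y) = g (wd w) \<otimes>\<^bsub>T\<^esub> y"
      using y wd1 wdw \<phi>c by (simp add: wd_Cons T.A.m_assoc gm T.smult_l)
  qed
  have "g w \<in> span_of K T (TRT i j)" if "i + 2 + j = p" for i j
  proof -
    have "w \<in> span_of K T (TRT (Suc i) j)" using w that by (simp add: W_iff)
    moreover have "span_of K T (TRT (Suc i) j) \<subseteq> {t \<in> carrier T. g t \<in> span_of K T (TRT i j)}"
    proof (rule span_of_least[OF submodule_preimage[OF T.A T.A g span_of_submodule[OF T.A TRT_closed]]], rule subsetI)
      fix s assume s: "s \<in> TRT (Suc i) j"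
      then obtain a r b where arb: "s = a \<otimes>\<^bsub>T\<^esub> r \<otimes>\<^bsub>T\<^esub> b" "a \<in> TP (Suc i)" "r \<in> R" "b \<in> TP j" by (auto simp: TRT_def)
      have c: "r \<in> carrier T" "a \<in> carrier T" "b \<in> carrier T" using arb R_closed TP_closed by auto
      have "g s = g a \<otimes>\<^bsub>T\<^esub> r \<otimes>\<^bsub>T\<^esub> b"
        using gTy[OF arb(2), of "r \<otimes>\<^bsub>T\<^esub> b"] c arb(1) TP_closed[OF gT[OF arb(2)]] by (simp add: T.A.m_assoc)
      then have "g s \<in> TRT i j" using gT[OF arb(2)] arb(3,4) by (auto simp: TRT_def)
      then show "s \<in> {t \<in> carrier T. g t \<in> span_of K T (TRT i j)}"
        using span_of_base[of "g s" "TRT i j" K T] s TRT_closed[of "Suc i" j] by auto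
    qed
    ultimately show ?thesis by auto
  qed
  then show ?thesis using gT w by (simp add: W_iff)
qed

text \<open>Mirror image: the last letter is contracted, and the condition for
  \<open>(i, j + 1)\<close> yields the one for \<open>(i, j)\<close>.\<close>

lemma W_contract_r:
  assumes w: "w \<in> W (Suc p)" and \<phi>: "\<phi> \<in> lin_maps K V (self_mod K)" and g: "g \<in> lin_maps K T T"
    and gm: "\<And>x t. \<lbrakk>x \<in> carrier V; t \<in> carrier T\<rbrakk> \<Longrightarrow> g (t \<otimes>\<^bsub>T\<^esub> wd [x]) = \<phi> x \<odot>\<^bsub>T\<^esub> t"
  shows "g w \<in> W p"
proof -
  have \<phi>c: "\<phi> x \<in> carrier K" if "x \<in> carrier V" for x using lin_closed[OF \<phi> that] by simp
  have gT: "g t \<in> TP q" if t: "t \<in> TP (Suc q)" for t q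
  proof -
    have "t \<in> {t \<in> carrier T. g t \<in> TP q}"
    proof (rule TP_least[OF submodule_preimage[OF T.A T.A g TP_submodule] _ t])
      fix w assume "w \<in> words (Suc q)"
      then obtain x u where xu: "w = u @ [x]" "x \<in> carrier V" "u \<in> words q" using words_snoc by blast
      then have "g (wd w) = \<phi> x \<odot>\<^bsub>T\<^esub> wd u" using gm wdw by (simp add: wd_snoc)
      then show "wd w \<in> {t \<in> carrier T. g t \<in> TP q}"
        using T.A.submoduleE(4)[OF TP_submodule] \<phi>c xu wd_TP[OF xu(3)] wd1 wdw by (simp add: wd_snoc)
    qed
    then show ?thesis by simp
  qed
  have gTy: "g (y \<otimes>\<^bsub>T\<^esub> t) = y \<otimes>\<^bsub>T\<^esub> g t" if t: "t \<in> TP (Suc q)" and y: "y \<in> carrier T" for t q y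
  proof (rule TP_eqI[OF T.A lin_comp[OF T.mult_lin_r[OF y] g] lin_comp[OF g T.mult_lin_r[OF y]] _ t])
    fix w assume "w \<in> words (Suc q)"
    then obtain x u where xu: "w = u @ [x]" "x \<in> carrier V" "u \<in> words q" using words_snoc by blast
    then show "g (y \<otimes>\<^bsub>T\<^esub> wd w) = y \<otimes>\<^bsub>T\<^esub> g (wd w)"
      using y wd1 wdw \<phi>c by (simp add: wd_snoc T.A.m_assoc[symmetric] gm T.smult_r)
  qed
  have "g w \<in> span_of K T (TRT i j)" if "i + 2 + j = p" for i j
  proof -
    have "w \<in> span_of K T (TRT i (Suc j))" using w that by (simp add: W_iff)
    moreover have "span_of K T (TRT i (Suc j)) \<subseteq> {t \<in> carrier T. g t \<in> span_of K T (TRT i j)}"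
    proof (rule span_of_least[OF submodule_preimage[OF T.A T.A g span_of_submodule[OF T.A TRT_closed]]], rule subsetI)
      fix s assume s: "s \<in> TRT i (Suc j)"
      then obtain a r b where arb: "s = a \<otimes>\<^bsub>T\<^esub> r \<otimes>\<^bsub>T\<^esub> b" "a \<in> TP i" "r \<in> R" "b \<in> TP (Suc j)" by (auto simp: TRT_def)
      have c: "r \<in> carrier T" "a \<in> carrier T" "b \<in> carrier T" using arb R_closed TP_closed by auto
      have "g s = a \<otimes>\<^bsub>T\<^esub> r \<otimes>\<^bsub>T\<^esub> g b" using gTy[OF arb(4), of "a \<otimes>\<^bsub>T\<^esub> r"] c arb(1) by simp
      then have "g s \<in> TRT i j" using gT[OF arb(4)] arb(2,3) by (auto simp: TRT_def)
      then show "s \<in> {t \<in> carrier T. g t \<in> span_of K T (TRT i j)}"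
        using span_of_base[of "g s" "TRT i j" K T] s TRT_closed[of i "Suc j"] by auto
    qed
    ultimately show ?thesis by auto
  qed
  then show ?thesis using gT w by (simp add: W_iff)
qed

lemma mult_bilin: "bilin K V T T (\<lambda>x t. wd [x] \<otimes>\<^bsub>T\<^esub> t)" "bilin K V T T (\<lambda>x t. t \<otimes>\<^bsub>T\<^esub> wd [x])"
  by (rule bilinI; auto intro!: T.mult_lin_r T.mult_lin_l wd1 lin_comp[OF wd_lin T.mult_lin_l] lin_comp[OF wd_lin T.mult_lin_r])+

text \<open>Phrased for any \<open>N\<close> containing the products, so that \<open>N\<close> can
  be the image of the multiplication map; the result then is the inclusion of
  \<open>W (Suc p)\<close> in \<open>V (x) W p\<close>.\<close>

lemma W_split_l:
  assumes w: "w \<in> W (Suc p)" and N: "submodule N K T" "\<And>x t. \<lbrakk>x \<in> carrier V; t \<in> W p\<rbrakk> \<Longrightarrow> wd [x] \<otimes>\<^bsub>T\<^esub> t \<in> N"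
  shows "w \<in> N"
proof (rule contraction_splitting[OF field V T.A mult_bilin(1) _ N(1) N(2)])
  let ?S = "{wd [x] \<otimes>\<^bsub>T\<^esub> t | x t. x \<in> carrier V \<and> t \<in> carrier T}"
  have S: "?S \<subseteq> carrier T" using wd1 by auto
  show "w \<in> span_of K T ?S"
  proof (rule TP_least[OF span_of_submodule[OF T.A S]])
    show "w \<in> TP (Suc p)" using w by (simp add: W_iff)
    fix w assume "w \<in> words (Suc p)"
    then obtain x u where xu: "w = x # u" "x \<in> carrier V" "u \<in> words p" using words_Suc by blast
    show "wd w \<in> span_of K T ?S" by (rule span_of_base) (use xu wdw[OF xu(3)] wd_Cons[OF xu(2,3)] in blast)
  qed
  show "\<exists>g\<in>lin_maps K T T. \<forall>x\<in>carrier V. \<forall>t\<in>carrier T. g (wd [x] \<otimes>\<^bsub>T\<^esub> t) = \<beta> x t" if "bilin K V T T \<beta>" for \<beta>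
    using lcontr_ex[OF T.A that] by blast
  show "g w \<in> W p" if "\<phi> \<in> lin_maps K V (self_mod K)" "g \<in> lin_maps K T T"
    "\<And>x t. \<lbrakk>x \<in> carrier V; t \<in> carrier T\<rbrakk> \<Longrightarrow> g (wd [x] \<otimes>\<^bsub>T\<^esub> t) = \<phi> x \<odot>\<^bsub>T\<^esub> t" for \<phi> g
    by (rule W_contract_l[OF w that])
qed

lemma W_split_r:
  assumes w: "w \<in> W (Suc p)" and N: "submodule N K T" "\<And>x t. \<lbrakk>x \<in> carrier V; t \<in> W p\<rbrakk> \<Longrightarrow> t \<otimes>\<^bsub>T\<^esub> wd [x] \<in> N"
  shows "w \<in> N"
proof (rule contraction_splitting[OF field V T.A mult_bilin(2) _ N(1) N(2)])
  let ?S = "{t \<otimes>\<^bsub>T\<^esub> wd [x] | x t. x \<in> carrier V \<and> t \<in> carrier T}"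
  have S: "?S \<subseteq> carrier T" using wd1 by auto
  show "w \<in> span_of K T ?S"
  proof (rule TP_least[OF span_of_submodule[OF T.A S]])
    show "w \<in> TP (Suc p)" using w by (simp add: W_iff)
    fix w assume "w \<in> words (Suc p)"
    then obtain x u where xu: "w = u @ [x]" "x \<in> carrier V" "u \<in> words p" using words_snoc by blast
    show "wd w \<in> span_of K T ?S" by (rule span_of_base) (use xu wdw[OF xu(3)] wd_snoc[OF xu(2,3)] in blast)
  qed
  show "\<exists>g\<in>lin_maps K T T. \<forall>x\<in>carrier V. \<forall>t\<in>carrier T. g (t \<otimes>\<^bsub>T\<^esub> wd [x]) = \<beta> x t" if "bilin K V T T \<beta>" for \<beta>
    using rcontr_ex[OF T.A that] by blast
  show "g w \<in> W p" if "\<phi> \<in> lin_maps K V (self_mod K)" "g \<in> lin_maps K T T"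
    "\<And>x t. \<lbrakk>x \<in> carrier V; t \<in> carrier T\<rbrakk> \<Longrightarrow> g (t \<otimes>\<^bsub>T\<^esub> wd [x]) = \<phi> x \<odot>\<^bsub>T\<^esub> t" for \<phi> g
    by (rule W_contract_r[OF w that])
qed

section \<open>Splitting an outer letter off an element of \<open>W_p\<close>\<close>

abbreviation "VW p \<equiv> tensor_K K (Wm 1) (Wm p)"
abbreviation "WV p \<equiv> tensor_K K (Wm p) (Wm 1)"
abbreviation "lmu \<equiv> tensor_lift K T (\<lambda>x w. x \<otimes>\<^bsub>T\<^esub> w)"
abbreviation "rmu \<equiv> tensor_lift K T (\<lambda>w x. w \<otimes>\<^bsub>T\<^esub> x)"

lemma W_mult_bilin: "bilin K (Wm p) (Wm q) T (\<lambda>x w. x \<otimes>\<^bsub>T\<^esub> w)"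
  by (rule bilinI) (auto intro: lin_Wm T.mult_lin_r T.mult_lin_l W_closed)

lemmas lmu_lin = tensor_K_lift_lin[OF Wm Wm T.A W_mult_bilin]
lemmas lmu_pure = tensor_K_lift_pure[OF Wm Wm T.A W_mult_bilin, unfolded Wm_simps]

lemma W_projection:
  obtains \<pi> where "\<pi> \<in> lin_maps K T (Wm p)" "\<And>w. w \<in> W p \<Longrightarrow> \<pi> w = w"
proof -
  obtain \<pi> where p: "\<pi> \<in> lin_maps K T T" "\<And>x. x \<in> carrier T \<Longrightarrow> \<pi> x \<in> W p" "\<And>x. x \<in> W p \<Longrightarrow> \<pi> x = x"
    by (rule exists_projection[OF field T.A W_submodule]) blast
  show ?thesis by (rule that[OF lin_into_Wm[OF p(1,2)] p(3)])
qed

lemma wd_lin_W1: "(\<lambda>x. wd [x]) \<in> lin_maps K V (Wm 1)"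
  by (rule lin_into_Wm[OF wd_lin wd_W1])

text \<open>\<open>left_split\<close> is an \<open>inv_into\<close>, so its linearity rests on
  injectivity of the multiplication \<open>lmu\<close>. A left inverse of \<open>lmu\<close> is the
  contraction that splits off the first letter and projects the rest to \<open>W p\<close>.\<close>

lemma left_split:
  shows "left_split K V R (Suc p) \<in> lin_maps K (Wm (Suc p)) (VW p)"
    and "w \<in> W (Suc p) \<Longrightarrow> lmu (left_split K V R (Suc p) w) = w"
proof -
  let ?C = "carrier (VW p)"
  note Tm = tensor_K_module[OF Wm[of 1] Wm[of p]] and Tb = tensor_K_bilin[OF Wm[of 1] Wm[of p]]
  have s: "left_split K V R (Suc p) = inv_into ?C lmu" by (simp add: left_split_def Let_def)
  have im: "W (Suc p) \<subseteq> lmu ` ?C"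
  proof
    fix w assume w: "w \<in> W (Suc p)"
    show "w \<in> lmu ` ?C"
    proof (rule W_split_l[OF w submodule_image[OF Tm T.A lmu_lin]])
      fix x t assume "x \<in> carrier V" "t \<in> W p"
      then show "wd [x] \<otimes>\<^bsub>T\<^esub> t \<in> lmu ` ?C"
        using lmu_pure[OF wd_W1] bilin_closed[OF Tb] wd_W1 by (metis imageI Wm_simps(1))
    qed
  qed
  obtain \<pi> where p: "\<pi> \<in> lin_maps K T (Wm p)" "\<And>w. w \<in> W p \<Longrightarrow> \<pi> w = w" by (rule W_projection) blast
  \<comment> \<open>The projection \<open>\<pi>\<close> is inserted because \<open>lcontr\<close>
    lives on all of \<open>T(V)\<close>, while the target only admits second factors from
    \<open>W p\<close>.\<close>
  let ?\<beta> = "\<lambda>x t. pure K (VW p) (wd [x]) (\<pi> t)"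
  have b: "bilin K V T (VW p) ?\<beta>"
  proof (rule bilinI)
    show "(\<lambda>t. ?\<beta> x t) \<in> lin_maps K T (VW p)" if "x \<in> carrier V" for x
      by (rule lin_comp[OF p(1) bilin_r[OF Tb]]) (simp add: wd_W1[unfolded One_nat_def] that)
    show "(\<lambda>x. ?\<beta> x t) \<in> lin_maps K V (VW p)" if "t \<in> carrier T" for t
      by (rule lin_comp[OF wd_lin_W1 bilin_l[OF Tb lin_closed[OF p(1) that]]])
  qed
  note l = lcontr_lin[OF Tm b] and lm = lcontr_mult[OF Tm b]
  have inv: "lcontr (VW p) ?\<beta> (lmu u) = u" if u: "u \<in> ?C" for u
  proof (rule tensor_K_eqI[OF Wm Wm u lin_comp[OF lmu_lin l] lin_id])
    fix y w assume yw: "y \<in> carrier (Wm 1)" "w \<in> carrier (Wm p)"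
    then obtain x where x: "x \<in> carrier V" "y = wd [x]" using W1_wd by auto
    have w: "w \<in> W p" using yw by simp
    show "lcontr (VW p) ?\<beta> (lmu (pure K (VW p) y w)) = pure K (VW p) y w"
      unfolding x(2) lmu_pure[OF wd_W1[OF x(1)] w] lm[OF x(1) W_closed[OF w]] p(2)[OF w] by (rule refl)
  qed
  have lw: "lmu (inv_into ?C lmu w) = w" "inv_into ?C lmu w \<in> ?C" if "w \<in> W (Suc p)" for w
    using f_inv_into_f[of w lmu ?C] inv_into_into[of w lmu ?C] im that by blast+
  then show "w \<in> W (Suc p) \<Longrightarrow> lmu (left_split K V R (Suc p) w) = w" by (simp add: s)
  have "left_split K V R (Suc p) w = lcontr (VW p) ?\<beta> w" if "w \<in> W (Suc p)" for w
    using inv[OF lw(2)[OF that]] lw(1)[OF that] s by simp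
  then show "left_split K V R (Suc p) \<in> lin_maps K (Wm (Suc p)) (VW p)"
    by (intro lin_maps_eq[OF lin_Wm[OF l] Wm]) simp
qed

lemma right_split:
  shows "right_split K V R (Suc p) \<in> lin_maps K (Wm (Suc p)) (WV p)"
    and "w \<in> W (Suc p) \<Longrightarrow> rmu (right_split K V R (Suc p) w) = w"
proof -
  let ?C = "carrier (WV p)"
  note Tm = tensor_K_module[OF Wm[of p] Wm[of 1]] and Tb = tensor_K_bilin[OF Wm[of p] Wm[of 1]]
  have s: "right_split K V R (Suc p) = inv_into ?C rmu" by (simp add: right_split_def Let_def)
  have im: "W (Suc p) \<subseteq> rmu ` ?C"
  proof
    fix w assume w: "w \<in> W (Suc p)"
    show "w \<in> rmu ` ?C"
    proof (rule W_split_r[OF w submodule_image[OF Tm T.A lmu_lin]])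
      fix x t assume "x \<in> carrier V" "t \<in> W p"
      then show "t \<otimes>\<^bsub>T\<^esub> wd [x] \<in> rmu ` ?C"
        using lmu_pure[OF _ wd_W1] bilin_closed[OF Tb] wd_W1 by (metis imageI Wm_simps(1))
    qed
  qed
  obtain \<pi> where p: "\<pi> \<in> lin_maps K T (Wm p)" "\<And>w. w \<in> W p \<Longrightarrow> \<pi> w = w" by (rule W_projection) blast
  let ?\<beta> = "\<lambda>x t. pure K (WV p) (\<pi> t) (wd [x])"
  have b: "bilin K V T (WV p) ?\<beta>"
  proof (rule bilinI)
    show "(\<lambda>t. ?\<beta> x t) \<in> lin_maps K T (WV p)" if "x \<in> carrier V" for x
      by (rule lin_comp[OF p(1) bilin_l[OF Tb]]) (simp add: wd_W1[unfolded One_nat_def] that)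
    show "(\<lambda>x. ?\<beta> x t) \<in> lin_maps K V (WV p)" if "t \<in> carrier T" for t
      by (rule lin_comp[OF wd_lin_W1 bilin_r[OF Tb lin_closed[OF p(1) that]]])
  qed
  note l = rcontr_lin[OF Tm b] and lm = rcontr_mult[OF Tm b]
  have inv: "rcontr (WV p) ?\<beta> (rmu u) = u" if u: "u \<in> ?C" for u
  proof (rule tensor_K_eqI[OF Wm Wm u lin_comp[OF lmu_lin l] lin_id])
    fix w y assume yw: "w \<in> carrier (Wm p)" "y \<in> carrier (Wm 1)"
    then obtain x where x: "x \<in> carrier V" "y = wd [x]" using W1_wd by auto
    have w: "w \<in> W p" using yw by simp
    show "rcontr (WV p) ?\<beta> (rmu (pure K (WV p) w y)) = pure K (WV p) w y"
      unfolding x(2) lmu_pure[OF w wd_W1[OF x(1)]] lm[OF x(1) W_closed[OF w]] p(2)[OF w] by (rule refl)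
  qed
  have lw: "rmu (inv_into ?C rmu w) = w" "inv_into ?C rmu w \<in> ?C" if "w \<in> W (Suc p)" for w
    using f_inv_into_f[of w rmu ?C] inv_into_into[of w rmu ?C] im that by blast+
  then show "w \<in> W (Suc p) \<Longrightarrow> rmu (right_split K V R (Suc p) w) = w" by (simp add: s)
  have "right_split K V R (Suc p) w = rcontr (WV p) ?\<beta> w" if "w \<in> W (Suc p)" for w
    using inv[OF lw(2)[OF that]] lw(1)[OF that] s by simp
  then show "right_split K V R (Suc p) \<in> lin_maps K (Wm (Suc p)) (WV p)"
    by (intro lin_maps_eq[OF lin_Wm[OF l] Wm]) simp
qed

section \<open>The Koszul differential and its square\<close>

abbreviation "tri U \<equiv> triple K A U"

lemma koszul_eq: "koszul K V R p = A.AWA (Wm p)" by (simp add: koszul_def)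

text \<open>\<open>dl\<close> and \<open>dr\<close> are the two halves of the Koszul differential
  with the outer factors fixed, as functions of the split tensor.\<close>

definition "dl p a b = tensor_lift K (A.AWA (Wm p)) (\<lambda>x w'. tri (Wm p) (a \<otimes>\<^bsub>A\<^esub> cl x) w' b)"
definition "dr p a b = tensor_lift K (A.AWA (Wm p)) (\<lambda>w' x. tri (Wm p) a w' (cl x \<otimes>\<^bsub>A\<^esub> b))"

context
  fixes p :: nat
begin

abbreviation (input) "Kp \<equiv> A.AWA (Wm p)"

lemmas Kpm = A.AWA_module[OF Wm[of p]]
lemmas trip = A.triple_tri[OF Wm[of p]]

lemma l_bilin: "\<lbrakk>a \<in> carrier A; b \<in> carrier A\<rbrakk> \<Longrightarrow> bilin K (Wm 1) (Wm p) Kp (\<lambda>x w'. tri (Wm p) (a \<otimes>\<^bsub>A\<^esub> cl x) w' b)"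
  using cl_closed W_closed
  by (intro bilinI trilin_2[OF trip] lin_comp[OF lin_comp[OF lin_Wm[OF cl_lin] A.mult_lin_r] trilin_1[OF trip]]) auto

lemma r_bilin: "\<lbrakk>a \<in> carrier A; b \<in> carrier A\<rbrakk> \<Longrightarrow> bilin K (Wm p) (Wm 1) Kp (\<lambda>w' x. tri (Wm p) a w' (cl x \<otimes>\<^bsub>A\<^esub> b))"
  using cl_closed W_closed
  by (intro bilinI trilin_2[OF trip] lin_comp[OF lin_comp[OF lin_Wm[OF cl_lin] A.mult_lin_l] trilin_3[OF trip]]) auto

lemma dl_lin: "\<lbrakk>a \<in> carrier A; b \<in> carrier A\<rbrakk> \<Longrightarrow> dl p a b \<in> lin_maps K (VW p) Kp"
  unfolding dl_def by (rule tensor_K_lift_lin[OF Wm Wm Kpm l_bilin])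

lemma dr_lin: "\<lbrakk>a \<in> carrier A; b \<in> carrier A\<rbrakk> \<Longrightarrow> dr p a b \<in> lin_maps K (WV p) Kp"
  unfolding dr_def by (rule tensor_K_lift_lin[OF Wm Wm Kpm r_bilin])

lemma dl_pure: "\<lbrakk>a \<in> carrier A; b \<in> carrier A; x \<in> W 1; w \<in> W p\<rbrakk> \<Longrightarrow>
    dl p a b (pure K (VW p) x w) = tri (Wm p) (a \<otimes>\<^bsub>A\<^esub> cl x) w b"
  unfolding dl_def by (rule tensor_K_lift_pure[OF Wm Wm Kpm l_bilin]) simp_all

lemma dr_pure: "\<lbrakk>a \<in> carrier A; b \<in> carrier A; x \<in> W 1; w \<in> W p\<rbrakk> \<Longrightarrow>
    dr p a b (pure K (WV p) w x) = tri (Wm p) a w (cl x \<otimes>\<^bsub>A\<^esub> b)"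
  unfolding dr_def by (rule tensor_K_lift_pure[OF Wm Wm Kpm r_bilin]) simp_all

lemma dl_param:
  assumes u: "u \<in> carrier (VW p)"
  shows "b \<in> carrier A \<Longrightarrow> (\<lambda>a. dl p a b u) \<in> lin_maps K A Kp" and "a \<in> carrier A \<Longrightarrow> (\<lambda>b. dl p a b u) \<in> lin_maps K A Kp"
  unfolding dl_def
  by (rule tensor_K_lift_param[OF Wm Wm Kpm A.A l_bilin _ u];
    auto intro!: lin_comp[OF A.mult_lin_l trilin_1[OF trip]] trilin_3[OF trip] simp: cl_closed W_closed)+

lemma dr_param:
  assumes u: "u \<in> carrier (WV p)"
  shows "b \<in> carrier A \<Longrightarrow> (\<lambda>a. dr p a b u) \<in> lin_maps K A Kp" and "a \<in> carrier A \<Longrightarrow> (\<lambda>b. dr p a b u) \<in> lin_maps K A Kp"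
  unfolding dr_def
  by (rule tensor_K_lift_param[OF Wm Wm Kpm A.A r_bilin _ u];
    auto intro!: lin_comp[OF A.mult_lin_r trilin_3[OF trip]] trilin_1[OF trip] simp: cl_closed W_closed)+

lemma dl_act:
  assumes u: "u \<in> carrier (VW p)" and abc: "a \<in> carrier A" "b \<in> carrier A" "c \<in> carrier A"
  shows "dl p (c \<otimes>\<^bsub>A\<^esub> a) b u = lact Kp c (dl p a b u)" "dl p a (b \<otimes>\<^bsub>A\<^esub> c) u = ract Kp (dl p a b u) c"
proof -
  note c = abc A.A.m_closed[OF abc(3,1)] A.A.m_closed[OF abc(2,3)]
  show "dl p (c \<otimes>\<^bsub>A\<^esub> a) b u = lact Kp c (dl p a b u)"
    by (rule tensor_K_eqI[OF Wm Wm u dl_lin[OF c(4,2)] lin_comp[OF dl_lin[OF c(1,2)] A.AWA_lact_lin[OF Wm c(3)]]])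
      (use c in \<open>simp add: dl_pure[unfolded One_nat_def] A.AWA_lact[OF Wm] cl_closed W_closed A.A.m_assoc\<close>)
  show "dl p a (b \<otimes>\<^bsub>A\<^esub> c) u = ract Kp (dl p a b u) c"
    by (rule tensor_K_eqI[OF Wm Wm u dl_lin[OF c(1,5)] lin_comp[OF dl_lin[OF c(1,2)] A.AWA_ract_lin[OF Wm c(3)]]])
      (use c in \<open>simp add: dl_pure[unfolded One_nat_def] A.AWA_ract[OF Wm] cl_closed W_closed A.A.m_assoc\<close>)
qed

lemma dr_act:
  assumes u: "u \<in> carrier (WV p)" and abc: "a \<in> carrier A" "b \<in> carrier A" "c \<in> carrier A"
  shows "dr p (c \<otimes>\<^bsub>A\<^esub> a) b u = lact Kp c (dr p a b u)" "dr p a (b \<otimes>\<^bsub>A\<^esub> c) u = ract Kp (dr p a b u) c"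
proof -
  note c = abc A.A.m_closed[OF abc(3,1)] A.A.m_closed[OF abc(2,3)]
  show "dr p (c \<otimes>\<^bsub>A\<^esub> a) b u = lact Kp c (dr p a b u)"
    by (rule tensor_K_eqI[OF Wm Wm u dr_lin[OF c(4,2)] lin_comp[OF dr_lin[OF c(1,2)] A.AWA_lact_lin[OF Wm c(3)]]])
      (use c in \<open>simp add: dr_pure[unfolded One_nat_def] A.AWA_lact[OF Wm] cl_closed W_closed A.A.m_assoc\<close>)
  show "dr p a (b \<otimes>\<^bsub>A\<^esub> c) u = ract Kp (dr p a b u) c"
    by (rule tensor_K_eqI[OF Wm Wm u dr_lin[OF c(1,5)] lin_comp[OF dr_lin[OF c(1,2)] A.AWA_ract_lin[OF Wm c(3)]]])
      (use c in \<open>simp add: dr_pure[unfolded One_nat_def] A.AWA_ract[OF Wm] cl_closed W_closed A.A.m_assoc\<close>)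
qed

abbreviation (input) "lsp \<equiv> left_split K V R (Suc p)"
abbreviation (input) "rsp \<equiv> right_split K V R (Suc p)"

lemma koszul_d_trilin:
  "trilin K A (Wm (Suc p)) Kp (\<lambda>a w b. dl p a b (lsp w) \<oplus>\<^bsub>Kp\<^esub> signed Kp (Suc p) (dr p a b (rsp w)))"
proof (rule trilinI)
  note lc = lin_closed[OF left_split(1)] and rc = lin_closed[OF right_split(1)]
  fix a w assume "a \<in> carrier A" "w \<in> carrier (Wm (Suc p))"
  then show "(\<lambda>b. dl p a b (lsp w) \<oplus>\<^bsub>Kp\<^esub> signed Kp (Suc p) (dr p a b (rsp w))) \<in> lin_maps K A Kp"
    by (intro lin_sum[OF Kpm] lin_sgn[OF Kpm] dl_param(2)[OF lc] dr_param(2)[OF rc])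
next
  fix a b assume "a \<in> carrier A" "b \<in> carrier A"
  then show "(\<lambda>w. dl p a b (lsp w) \<oplus>\<^bsub>Kp\<^esub> signed Kp (Suc p) (dr p a b (rsp w))) \<in> lin_maps K (Wm (Suc p)) Kp"
    by (intro lin_sum[OF Kpm] lin_sgn[OF Kpm] lin_comp[OF left_split(1) dl_lin] lin_comp[OF right_split(1) dr_lin])
next
  note lc = lin_closed[OF left_split(1)] and rc = lin_closed[OF right_split(1)]
  fix w b assume "w \<in> carrier (Wm (Suc p))" "b \<in> carrier A"
  then show "(\<lambda>a. dl p a b (lsp w) \<oplus>\<^bsub>Kp\<^esub> signed Kp (Suc p) (dr p a b (rsp w))) \<in> lin_maps K A Kp"
    by (intro lin_sum[OF Kpm] lin_sgn[OF Kpm] dl_param(1)[OF lc] dr_param(1)[OF rc])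
qed

lemma koszul_d_eq: "koszul_d K V R (Suc p) =
    triple_lift K Kp (\<lambda>a w b. dl p a b (lsp w) \<oplus>\<^bsub>Kp\<^esub> signed Kp (Suc p) (dr p a b (rsp w)))"
  by (simp add: koszul_d_def Let_def dl_def dr_def koszul_eq cl_def)

lemma koszul_d_lin: "koszul_d K V R (Suc p) \<in> lin_maps K (A.AWA (Wm (Suc p))) Kp"
  unfolding koszul_d_eq by (rule A.AWA_lift_lin[OF Wm Kpm koszul_d_trilin])

lemma koszul_d_tri: "\<lbrakk>a \<in> carrier A; w \<in> W (Suc p); b \<in> carrier A\<rbrakk> \<Longrightarrow>
    koszul_d K V R (Suc p) (tri (Wm (Suc p)) a w b) = dl p a b (lsp w) \<oplus>\<^bsub>Kp\<^esub> signed Kp (Suc p) (dr p a b (rsp w))"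
  unfolding koszul_d_eq by (rule A.AWA_lift_triple[OF Wm Kpm koszul_d_trilin]) simp_all

lemma koszul_d_hom: "koszul_d K V R (Suc p) \<in> bimod_homs K A (A.AWA (Wm (Suc p))) Kp"
proof (rule A.bimod_homsI[OF koszul_d_lin])
  fix c x assume c: "c \<in> carrier A" and x: "x \<in> carrier (A.AWA (Wm (Suc p)))"
  note l = A.AWA_lact_lin[OF Wm c] and r = A.AWA_ract_lin[OF Wm c]
  note lc = lin_closed[OF left_split(1), unfolded Wm_simps] and rc = lin_closed[OF right_split(1), unfolded Wm_simps]
  have *: "signed Kp n (lact Kp c y) = lact Kp c (signed Kp n y)" "signed Kp n (ract Kp y c) = ract Kp (signed Kp n y) c"
    if "y \<in> carrier Kp" for n y
    using lin_signed[OF Kpm Kpm l that] lin_signed[OF Kpm Kpm r that] by simp_all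
  show "koszul_d K V R (Suc p) (lact (A.AWA (Wm (Suc p))) c x) = lact Kp c (koszul_d K V R (Suc p) x)"
  proof (rule A.AWA_eqI[OF Wm x lin_comp[OF l koszul_d_lin] lin_comp[OF koszul_d_lin l]])
    fix a w b assume abw: "a \<in> carrier A" "w \<in> carrier (Wm (Suc p))" "b \<in> carrier A"
    then have w: "w \<in> W (Suc p)" by simp
    note L = lin_closed[OF dl_lin[OF abw(1,3)] lc[OF w]] and R = lin_closed[OF dr_lin[OF abw(1,3)] rc[OF w]]
    show "koszul_d K V R (Suc p) (lact (A.AWA (Wm (Suc p))) c (tri (Wm (Suc p)) a w b)) =
        lact Kp c (koszul_d K V R (Suc p) (tri (Wm (Suc p)) a w b))"
      unfolding A.AWA_lact[OF Wm c abw] koszul_d_tri[OF abw(1) w abw(3)] koszul_d_tri[OF A.A.m_closed[OF c abw(1)] w abw(3)]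
        lin_add[OF l L signed_closed[OF Kpm R]] dl_act(1)[OF lc[OF w] abw(1,3) c] dr_act(1)[OF rc[OF w] abw(1,3) c] *(1)[OF R]
      by (rule refl)
  qed
  show "koszul_d K V R (Suc p) (ract (A.AWA (Wm (Suc p))) x c) = ract Kp (koszul_d K V R (Suc p) x) c"
  proof (rule A.AWA_eqI[OF Wm x lin_comp[OF r koszul_d_lin] lin_comp[OF koszul_d_lin r]])
    fix a w b assume abw: "a \<in> carrier A" "w \<in> carrier (Wm (Suc p))" "b \<in> carrier A"
    then have w: "w \<in> W (Suc p)" by simp
    note L = lin_closed[OF dl_lin[OF abw(1,3)] lc[OF w]] and R = lin_closed[OF dr_lin[OF abw(1,3)] rc[OF w]]
    show "koszul_d K V R (Suc p) (ract (A.AWA (Wm (Suc p))) (tri (Wm (Suc p)) a w b) c) =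
        ract Kp (koszul_d K V R (Suc p) (tri (Wm (Suc p)) a w b)) c"
      unfolding A.AWA_ract[OF Wm c abw] koszul_d_tri[OF abw(1) w abw(3)] koszul_d_tri[OF abw(1) w A.A.m_closed[OF abw(3) c]]
        lin_add[OF r L signed_closed[OF Kpm R]] dl_act(2)[OF lc[OF w] abw(1,3) c] dr_act(2)[OF rc[OF w] abw(1,3) c] *(2)[OF R]
      by (rule refl)
  qed
qed

end

text \<open>The differential is computed in \<open>A \<otimes> T(V) \<otimes> A\<close>, into which \<open>A \<otimes> W\<^sub>p \<otimes> A\<close> embeds because
  \<open>W\<^sub>p\<close> has a complement in \<open>T(V)\<close>.\<close>

abbreviation "AT \<equiv> A.AWA T"
abbreviation "tT \<equiv> tri T"

definition "emb p = triple_lift K AT (\<lambda>a w b. tT a w b)" for p :: nat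

text \<open>The letter is split off by \<open>lcontr\<close>, which is available on all of
  \<open>T(V)\<close>; iterating \<open>DL\<close> and \<open>DR\<close> then avoids the nested
  inverse maps hidden in \<open>left_split\<close> and \<open>right_split\<close>.\<close>

definition "DL = triple_lift K AT (\<lambda>a t b. lcontr AT (\<lambda>x t'. tT (a \<otimes>\<^bsub>A\<^esub> cl (wd [x])) t' b) t)"
definition "DR = triple_lift K AT (\<lambda>a t b. rcontr AT (\<lambda>x t'. tT a t' (cl (wd [x]) \<otimes>\<^bsub>A\<^esub> b)) t)"

lemmas ATm = A.AWA_module[OF T.A]
lemmas tTt = A.triple_tri[OF T.A]

lemma clwd: "x \<in> carrier V \<Longrightarrow> cl (wd [x]) \<in> carrier A"
  by (rule cl_closed[OF wd1])

lemma DL_bilin: "\<lbrakk>a \<in> carrier A; b \<in> carrier A\<rbrakk> \<Longrightarrow> bilin K V T AT (\<lambda>x t'. tT (a \<otimes>\<^bsub>A\<^esub> cl (wd [x])) t' b)"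
  using clwd
  by (intro bilinI trilin_2[OF tTt] lin_comp[OF lin_comp[OF lin_comp[OF wd_lin cl_lin] A.mult_lin_r] trilin_1[OF tTt]]) auto

lemma DR_bilin: "\<lbrakk>a \<in> carrier A; b \<in> carrier A\<rbrakk> \<Longrightarrow> bilin K V T AT (\<lambda>x t'. tT a t' (cl (wd [x]) \<otimes>\<^bsub>A\<^esub> b))"
  using clwd
  by (intro bilinI trilin_2[OF tTt] lin_comp[OF lin_comp[OF lin_comp[OF wd_lin cl_lin] A.mult_lin_l] trilin_3[OF tTt]]) auto

lemma DL_trilin: "trilin K A T AT (\<lambda>a t b. lcontr AT (\<lambda>x t'. tT (a \<otimes>\<^bsub>A\<^esub> cl (wd [x])) t' b) t)"
  by (rule trilinI; (rule lcontr_lin[OF ATm DL_bilin] | rule lcontr_param[OF ATm A.A DL_bilin]);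
    auto intro!: lin_comp[OF A.mult_lin_l trilin_1[OF tTt]] trilin_3[OF tTt] simp: clwd)

lemma DR_trilin: "trilin K A T AT (\<lambda>a t b. rcontr AT (\<lambda>x t'. tT a t' (cl (wd [x]) \<otimes>\<^bsub>A\<^esub> b)) t)"
  by (rule trilinI; (rule rcontr_lin[OF ATm DR_bilin] | rule rcontr_param[OF ATm A.A DR_bilin]);
    auto intro!: lin_comp[OF A.mult_lin_r trilin_3[OF tTt]] trilin_1[OF tTt] simp: clwd)

lemma DL_lin: "DL \<in> lin_maps K AT AT" and DR_lin: "DR \<in> lin_maps K AT AT"
  unfolding DL_def DR_def by (rule A.AWA_lift_lin[OF T.A ATm DL_trilin] A.AWA_lift_lin[OF T.A ATm DR_trilin])+

lemma DL_one: "\<lbrakk>a \<in> carrier A; b \<in> carrier A\<rbrakk> \<Longrightarrow> DL (tT a \<one>\<^bsub>T\<^esub> b) = \<zero>\<^bsub>AT\<^esub>"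
  unfolding DL_def using A.AWA_lift_triple[OF T.A ATm DL_trilin _ T.A.one_closed] lcontr_one[OF ATm DL_bilin] by simp

lemma DR_one: "\<lbrakk>a \<in> carrier A; b \<in> carrier A\<rbrakk> \<Longrightarrow> DR (tT a \<one>\<^bsub>T\<^esub> b) = \<zero>\<^bsub>AT\<^esub>"
  unfolding DR_def using A.AWA_lift_triple[OF T.A ATm DR_trilin _ T.A.one_closed] rcontr_one[OF ATm DR_bilin] by simp

lemma DL_mult: "\<lbrakk>a \<in> carrier A; b \<in> carrier A; x \<in> carrier V; t \<in> carrier T\<rbrakk> \<Longrightarrow>
    DL (tT a (wd [x] \<otimes>\<^bsub>T\<^esub> t) b) = tT (a \<otimes>\<^bsub>A\<^esub> cl (wd [x])) t b"
  unfolding DL_def using A.AWA_lift_triple[OF T.A ATm DL_trilin, of a "wd [x] \<otimes>\<^bsub>T\<^esub> t" b] lcontr_mult[OF ATm DL_bilin] wd1 by simp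

lemma DR_mult: "\<lbrakk>a \<in> carrier A; b \<in> carrier A; x \<in> carrier V; t \<in> carrier T\<rbrakk> \<Longrightarrow>
    DR (tT a (t \<otimes>\<^bsub>T\<^esub> wd [x]) b) = tT a t (cl (wd [x]) \<otimes>\<^bsub>A\<^esub> b)"
  unfolding DR_def using A.AWA_lift_triple[OF T.A ATm DR_trilin, of a "t \<otimes>\<^bsub>T\<^esub> wd [x]" b] rcontr_mult[OF ATm DR_bilin] wd1 by simp

lemma tT_lin: "\<lbrakk>a \<in> carrier A; b \<in> carrier A\<rbrakk> \<Longrightarrow> (\<lambda>t. tT a t b) \<in> lin_maps K T AT"
  by (rule trilin_2[OF tTt])

text \<open>Removing the first letter and removing the last one commute on words with at least two
  letters. On shorter words both composites vanish, which is why the contractions are normalised to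
  zero on the unit.\<close>

lemma DL_DR_commute:
  assumes X: "X \<in> carrier AT"
  shows "DL (DR X) = DR (DL X)"
proof (rule A.AWA_eqI[OF T.A X lin_comp[OF DR_lin DL_lin] lin_comp[OF DL_lin DR_lin]])
  fix a t b assume ab: "a \<in> carrier A" "b \<in> carrier A" and t: "t \<in> carrier T"
  note l = lin_comp[OF tT_lin[OF ab] lin_comp[OF DR_lin DL_lin]] lin_comp[OF tT_lin[OF ab] lin_comp[OF DL_lin DR_lin]]
  note z = lin_zero[OF ATm ATm DL_lin] lin_zero[OF ATm ATm DR_lin]
  show "DL (DR (tT a t b)) = DR (DL (tT a t b))"
  proof (rule T_eqI_l[OF ATm l _ _ t])
    show "DL (DR (tT a \<one>\<^bsub>T\<^esub> b)) = DR (DL (tT a \<one>\<^bsub>T\<^esub> b))" using ab z by (simp add: DL_one DR_one del: A.AWA_simps)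
  next
    fix x t assume x: "x \<in> carrier V" and t: "t \<in> carrier T"
    note ax = A.A.m_closed[OF ab(1) clwd[OF x]]
    note m = T.mult_lin_r[OF wd1[OF x]]
    show "DL (DR (tT a (wd [x] \<otimes>\<^bsub>T\<^esub> t) b)) = DR (DL (tT a (wd [x] \<otimes>\<^bsub>T\<^esub> t) b))"
    proof (rule T_eqI_r[OF ATm lin_comp[OF m l(1)] lin_comp[OF m l(2)] _ _ t])
      have "DR (tT a (wd [x] \<otimes>\<^bsub>T\<^esub> \<one>\<^bsub>T\<^esub>) b) = tT a \<one>\<^bsub>T\<^esub> (cl (wd [x]) \<otimes>\<^bsub>A\<^esub> b)"
        using DR_mult[OF ab x T.A.one_closed] wd1[OF x] by simp
      moreover have "DL (tT a (wd [x] \<otimes>\<^bsub>T\<^esub> \<one>\<^bsub>T\<^esub>) b) = tT (a \<otimes>\<^bsub>A\<^esub> cl (wd [x])) \<one>\<^bsub>T\<^esub> b"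
        by (rule DL_mult[OF ab x T.A.one_closed])
      ultimately show "DL (DR (tT a (wd [x] \<otimes>\<^bsub>T\<^esub> \<one>\<^bsub>T\<^esub>) b)) = DR (DL (tT a (wd [x] \<otimes>\<^bsub>T\<^esub> \<one>\<^bsub>T\<^esub>) b))"
        using ab ax x clwd by (simp only: DL_one DR_one A.A.m_closed)
    next
      fix y s assume y: "y \<in> carrier V" and s: "s \<in> carrier T"
      note yb = A.A.m_closed[OF clwd[OF y] ab(2)]
      have e: "wd [x] \<otimes>\<^bsub>T\<^esub> (s \<otimes>\<^bsub>T\<^esub> wd [y]) = (wd [x] \<otimes>\<^bsub>T\<^esub> s) \<otimes>\<^bsub>T\<^esub> wd [y]"
        using wd1[OF x] wd1[OF y] s by (simp add: T.A.m_assoc)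
      have "DL (DR (tT a (wd [x] \<otimes>\<^bsub>T\<^esub> (s \<otimes>\<^bsub>T\<^esub> wd [y])) b)) = tT (a \<otimes>\<^bsub>A\<^esub> cl (wd [x])) s (cl (wd [y]) \<otimes>\<^bsub>A\<^esub> b)"
        unfolding e DR_mult[OF ab y T.A.m_closed[OF wd1[OF x] s]] by (rule DL_mult[OF ab(1) yb x s])
      moreover have "DR (DL (tT a (wd [x] \<otimes>\<^bsub>T\<^esub> (s \<otimes>\<^bsub>T\<^esub> wd [y])) b)) = tT (a \<otimes>\<^bsub>A\<^esub> cl (wd [x])) s (cl (wd [y]) \<otimes>\<^bsub>A\<^esub> b)"
        unfolding DL_mult[OF ab x T.A.m_closed[OF s wd1[OF y]]] by (rule DR_mult[OF ax ab(2) y s])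
      ultimately show "DL (DR (tT a (wd [x] \<otimes>\<^bsub>T\<^esub> (s \<otimes>\<^bsub>T\<^esub> wd [y])) b)) = DR (DL (tT a (wd [x] \<otimes>\<^bsub>T\<^esub> (s \<otimes>\<^bsub>T\<^esub> wd [y])) b))"
        by simp
    qed
  qed
qed

lemma words_2: "w \<in> words 2 \<Longrightarrow> \<exists>x y. w = [x, y] \<and> x \<in> carrier V \<and> y \<in> carrier V"
  by (cases w rule: remdups_adj.cases) (auto simp: words_def)

text \<open>The two removed letters multiply up in \<open>A\<close> to the class of
  \<open>r\<close>, which is zero when \<open>r\<close> is a relation.\<close>

lemma DL_DL:
  assumes ab: "a \<in> carrier A" "b \<in> carrier A" and r: "r \<in> TP 2" and t: "t \<in> carrier T"
  shows "DL (DL (tT a (r \<otimes>\<^bsub>T\<^esub> t) b)) = tT (a \<otimes>\<^bsub>A\<^esub> cl r) t b"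
proof (rule TP_eqI[OF ATm _ _ _ r])
  show "(\<lambda>r. DL (DL (tT a (r \<otimes>\<^bsub>T\<^esub> t) b))) \<in> lin_maps K T AT"
    by (rule lin_comp[OF lin_comp[OF T.mult_lin_l[OF t] tT_lin[OF ab]] lin_comp[OF DL_lin DL_lin]])
  show "(\<lambda>r. tT (a \<otimes>\<^bsub>A\<^esub> cl r) t b) \<in> lin_maps K T AT"
    by (rule lin_comp[OF lin_comp[OF cl_lin A.mult_lin_r[OF ab(1)]] trilin_1[OF tTt t ab(2)]])
  fix w assume "w \<in> words 2"
  then obtain x y where xy: "w = [x, y]" "x \<in> carrier V" "y \<in> carrier V" using words_2 by blast
  have w: "wd w = wd [x] \<otimes>\<^bsub>T\<^esub> wd [y]" using wd_append[of "[x]" "[y]"] xy by simp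
  note c = wd1[OF xy(2)] wd1[OF xy(3)] clwd[OF xy(2)] clwd[OF xy(3)]
  have "DL (DL (tT a (wd w \<otimes>\<^bsub>T\<^esub> t) b)) = DL (tT (a \<otimes>\<^bsub>A\<^esub> cl (wd [x])) (wd [y] \<otimes>\<^bsub>T\<^esub> t) b)"
    using DL_mult[OF ab xy(2) T.A.m_closed[OF c(2) t]] c t by (simp add: w T.A.m_assoc)
  also have "\<dots> = tT (a \<otimes>\<^bsub>A\<^esub> cl (wd w)) t b"
    using DL_mult[OF A.A.m_closed[OF ab(1) c(3)] ab(2) xy(3) t] c ab by (simp add: w cl_mult A.A.m_assoc)
  finally show "DL (DL (tT a (wd w \<otimes>\<^bsub>T\<^esub> t) b)) = tT (a \<otimes>\<^bsub>A\<^esub> cl (wd w)) t b" .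
qed

lemma DR_DR:
  assumes ab: "a \<in> carrier A" "b \<in> carrier A" and r: "r \<in> TP 2" and t: "t \<in> carrier T"
  shows "DR (DR (tT a (t \<otimes>\<^bsub>T\<^esub> r) b)) = tT a t (cl r \<otimes>\<^bsub>A\<^esub> b)"
proof (rule TP_eqI[OF ATm _ _ _ r])
  show "(\<lambda>r. DR (DR (tT a (t \<otimes>\<^bsub>T\<^esub> r) b))) \<in> lin_maps K T AT"
    by (rule lin_comp[OF lin_comp[OF T.mult_lin_r[OF t] tT_lin[OF ab]] lin_comp[OF DR_lin DR_lin]])
  show "(\<lambda>r. tT a t (cl r \<otimes>\<^bsub>A\<^esub> b)) \<in> lin_maps K T AT"
    by (rule lin_comp[OF lin_comp[OF cl_lin A.mult_lin_l[OF ab(2)]] trilin_3[OF tTt ab(1) t]])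
  fix w assume "w \<in> words 2"
  then obtain x y where xy: "w = [x, y]" "x \<in> carrier V" "y \<in> carrier V" using words_2 by blast
  have w: "wd w = wd [x] \<otimes>\<^bsub>T\<^esub> wd [y]" using wd_append[of "[x]" "[y]"] xy by simp
  note c = wd1[OF xy(2)] wd1[OF xy(3)] clwd[OF xy(2)] clwd[OF xy(3)]
  have "DR (DR (tT a (t \<otimes>\<^bsub>T\<^esub> wd w) b)) = DR (tT a (t \<otimes>\<^bsub>T\<^esub> wd [x]) (cl (wd [y]) \<otimes>\<^bsub>A\<^esub> b))"
    using DR_mult[OF ab xy(3) T.A.m_closed[OF t c(1)]] c t by (simp add: w T.A.m_assoc)
  also have "\<dots> = tT a t (cl (wd w) \<otimes>\<^bsub>A\<^esub> b)"
    using DR_mult[OF ab(1) A.A.m_closed[OF c(4) ab(2)] xy(2) t] c ab by (simp add: w cl_mult A.A.m_assoc)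
  finally show "DR (DR (tT a (t \<otimes>\<^bsub>T\<^esub> wd w) b)) = tT a t (cl (wd w) \<otimes>\<^bsub>A\<^esub> b)" .
qed

text \<open>The condition with \<open>i = 0\<close> in the definition of \<open>W\<close> puts a
  relation in the first two positions, and that relation vanishes in \<open>A\<close>.\<close>

lemma DL_DL_W:
  assumes ab: "a \<in> carrier A" "b \<in> carrier A" and w: "w \<in> W (Suc (Suc p))"
  shows "DL (DL (tT a w b)) = \<zero>\<^bsub>AT\<^esub>"
proof (rule span_of_zero[OF T.A ATm lin_comp[OF tT_lin[OF ab] lin_comp[OF DL_lin DL_lin]] TRT_closed])
  show "w \<in> span_of K T (TRT 0 p)" using w by (simp add: W_iff)
  fix s assume "s \<in> TRT 0 p"
  then obtain c r t where s: "s = c \<otimes>\<^bsub>T\<^esub> r \<otimes>\<^bsub>T\<^esub> t" "c \<in> TP 0" "r \<in> R" "t \<in> TP p" by (auto simp: TRT_def)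
  note cc = subsetD[OF R_closed s(3)] TP_closed[OF s(4)] and r2 = subsetD[OF R2 s(3)]
  have "DL (DL (tT a (c \<otimes>\<^bsub>T\<^esub> r \<otimes>\<^bsub>T\<^esub> t) b)) = \<zero>\<^bsub>AT\<^esub>"
  proof (rule TP_0[OF ATm _ _ s(2)])
    show "(\<lambda>c. DL (DL (tT a (c \<otimes>\<^bsub>T\<^esub> r \<otimes>\<^bsub>T\<^esub> t) b))) \<in> lin_maps K T AT"
      by (rule lin_comp[OF lin_comp[OF lin_comp[OF T.mult_lin_l[OF cc(1)] T.mult_lin_l[OF cc(2)]] tT_lin[OF ab]] lin_comp[OF DL_lin DL_lin]])
    have "tT (a \<otimes>\<^bsub>A\<^esub> \<zero>\<^bsub>A\<^esub>) t b = \<zero>\<^bsub>AT\<^esub>"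
      using lin_zero[OF A.A ATm trilin_1[OF tTt cc(2) ab(2)]] ab by simp
    then show "DL (DL (tT a (\<one>\<^bsub>T\<^esub> \<otimes>\<^bsub>T\<^esub> r \<otimes>\<^bsub>T\<^esub> t) b)) = \<zero>\<^bsub>AT\<^esub>"
      using DL_DL[OF ab r2 cc(2)] cl_R[OF s(3)] cc(1) by (simp del: A.AWA_simps)
  qed
  then show "DL (DL (tT a s b)) = \<zero>\<^bsub>AT\<^esub>" using s(1) by simp
qed

lemma DR_DR_W:
  assumes ab: "a \<in> carrier A" "b \<in> carrier A" and w: "w \<in> W (Suc (Suc p))"
  shows "DR (DR (tT a w b)) = \<zero>\<^bsub>AT\<^esub>"
proof (rule span_of_zero[OF T.A ATm lin_comp[OF tT_lin[OF ab] lin_comp[OF DR_lin DR_lin]] TRT_closed])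
  show "w \<in> span_of K T (TRT p 0)" using w by (simp add: W_iff)
  fix s assume "s \<in> TRT p 0"
  then obtain t r c where s: "s = t \<otimes>\<^bsub>T\<^esub> r \<otimes>\<^bsub>T\<^esub> c" "c \<in> TP 0" "r \<in> R" "t \<in> TP p" by (auto simp: TRT_def)
  note cc = subsetD[OF R_closed s(3)] TP_closed[OF s(4)] and r2 = subsetD[OF R2 s(3)]
  have "DR (DR (tT a (t \<otimes>\<^bsub>T\<^esub> r \<otimes>\<^bsub>T\<^esub> c) b)) = \<zero>\<^bsub>AT\<^esub>"
  proof (rule TP_0[OF ATm _ _ s(2)])
    show "(\<lambda>c. DR (DR (tT a (t \<otimes>\<^bsub>T\<^esub> r \<otimes>\<^bsub>T\<^esub> c) b))) \<in> lin_maps K T AT"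
      by (rule lin_comp[OF lin_comp[OF T.mult_lin_r[OF T.A.m_closed[OF cc(2,1)]] tT_lin[OF ab]] lin_comp[OF DR_lin DR_lin]])
    have "tT a t (\<zero>\<^bsub>A\<^esub> \<otimes>\<^bsub>A\<^esub> b) = \<zero>\<^bsub>AT\<^esub>"
      using lin_zero[OF A.A ATm trilin_3[OF tTt ab(1) cc(2)]] ab by simp
    then show "DR (DR (tT a (t \<otimes>\<^bsub>T\<^esub> r \<otimes>\<^bsub>T\<^esub> \<one>\<^bsub>T\<^esub>) b)) = \<zero>\<^bsub>AT\<^esub>"
      using DR_DR[OF ab r2 cc(2)] cl_R[OF s(3)] cc by (simp del: A.AWA_simps)
  qed
  then show "DR (DR (tT a s b)) = \<zero>\<^bsub>AT\<^esub>" using s(1) by simp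
qed

lemma emb_trilin: "trilin K A (Wm p) AT (\<lambda>a w b. tT a w b)"
  by (rule trilinI) (auto intro: trilin_1[OF tTt] trilin_3[OF tTt] lin_Wm[OF tT_lin] W_closed)

lemma emb_lin: "emb p \<in> lin_maps K (A.AWA (Wm p)) AT"
  unfolding emb_def by (rule A.AWA_lift_lin[OF Wm ATm emb_trilin])

lemma emb_tri: "\<lbrakk>a \<in> carrier A; w \<in> W p; b \<in> carrier A\<rbrakk> \<Longrightarrow> emb p (tri (Wm p) a w b) = tT a w b"
  unfolding emb_def by (rule A.AWA_lift_triple[OF Wm ATm emb_trilin]) simp_all

lemma emb_inj:
  assumes X: "X \<in> carrier (A.AWA (Wm p))" and z: "emb p X = \<zero>\<^bsub>AT\<^esub>"
  shows "X = \<zero>\<^bsub>A.AWA (Wm p)\<^esub>"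
proof -
  obtain \<pi> where p: "\<pi> \<in> lin_maps K T (Wm p)" "\<And>w. w \<in> W p \<Longrightarrow> \<pi> w = w" by (rule W_projection) blast
  note m = A.AWA_module[OF Wm[of p]] and t = A.triple_tri[OF Wm[of p]]
  have tr: "trilin K A T (A.AWA (Wm p)) (\<lambda>a s b. tri (Wm p) a (\<pi> s) b)"
    by (rule trilinI) (auto intro: trilin_1[OF t] trilin_3[OF t] lin_comp[OF p(1) trilin_2[OF t]] lin_closed[OF p(1)])
  let ?g = "triple_lift K (A.AWA (Wm p)) (\<lambda>a s b. tri (Wm p) a (\<pi> s) b)"
  note g = A.AWA_lift_lin[OF T.A m tr] and gt = A.AWA_lift_triple[OF T.A m tr]
  have "?g (emb p X) = X"
    by (rule A.AWA_eqI[OF Wm X lin_comp[OF emb_lin g] lin_id]) (simp add: emb_tri gt p(2) W_closed)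
  then show ?thesis using z lin_zero[OF ATm m g] by simp
qed

text \<open>Under the embedding, \<open>dl\<close> at a split tensor becomes \<open>DL\<close> at
  its product, and the product of \<open>left_split\<close> applied to \<open>w\<close> is
  \<open>w\<close> again; the right half is treated alike.\<close>

lemma emb_d:
  assumes X: "X \<in> carrier (A.AWA (Wm (Suc p)))"
  shows "emb p (koszul_d K V R (Suc p) X) = DL (emb (Suc p) X) \<oplus>\<^bsub>AT\<^esub> signed AT (Suc p) (DR (emb (Suc p) X))"
proof (rule A.AWA_eqI[OF Wm X lin_comp[OF koszul_d_lin emb_lin]
      lin_sum[OF ATm lin_comp[OF emb_lin DL_lin] lin_sgn[OF ATm lin_comp[OF emb_lin DR_lin]]]])
  fix a w b assume abw: "a \<in> carrier A" "w \<in> carrier (Wm (Suc p))" "b \<in> carrier A"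
  then have w: "w \<in> W (Suc p)" by simp
  note m = A.AWA_module[OF Wm[of p]] and lc = lin_closed[OF left_split(1) abw(2)] and rc = lin_closed[OF right_split(1) abw(2)]
  have l: "emb p (dl p a b u) = DL (tT a (lmu u) b)" if u: "u \<in> carrier (VW p)" for u
  proof (rule tensor_K_eqI[OF Wm Wm u lin_comp[OF dl_lin[OF abw(1,3)] emb_lin] lin_comp[OF lin_comp[OF lmu_lin tT_lin[OF abw(1,3)]] DL_lin]])
    fix y w assume yw: "y \<in> carrier (Wm 1)" "w \<in> carrier (Wm p)"
    then obtain x where x: "x \<in> carrier V" "y = wd [x]" using W1_wd by auto
    have w: "w \<in> W p" using yw by simp
    show "emb p (dl p a b (pure K (VW p) y w)) = DL (tT a (lmu (pure K (VW p) y w)) b)"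
      unfolding x(2) lmu_pure[OF wd_W1[OF x(1)] w] dl_pure[OF abw(1,3) wd_W1[OF x(1)] w]
        emb_tri[OF A.A.m_closed[OF abw(1) clwd[OF x(1)]] w abw(3)] DL_mult[OF abw(1,3) x(1) W_closed[OF w]] by (rule refl)
  qed
  have r: "emb p (dr p a b u) = DR (tT a (rmu u) b)" if u: "u \<in> carrier (WV p)" for u
  proof (rule tensor_K_eqI[OF Wm Wm u lin_comp[OF dr_lin[OF abw(1,3)] emb_lin] lin_comp[OF lin_comp[OF lmu_lin tT_lin[OF abw(1,3)]] DR_lin]])
    fix w y assume yw: "w \<in> carrier (Wm p)" "y \<in> carrier (Wm 1)"
    then obtain x where x: "x \<in> carrier V" "y = wd [x]" using W1_wd by auto
    have w: "w \<in> W p" using yw by simp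
    show "emb p (dr p a b (pure K (WV p) w y)) = DR (tT a (rmu (pure K (WV p) w y)) b)"
      unfolding x(2) lmu_pure[OF w wd_W1[OF x(1)]] dr_pure[OF abw(1,3) wd_W1[OF x(1)] w]
        emb_tri[OF abw(1) w A.A.m_closed[OF clwd[OF x(1)] abw(3)]] DR_mult[OF abw(1,3) x(1) W_closed[OF w]] by (rule refl)
  qed
  note L = lin_closed[OF dl_lin[OF abw(1,3)] lc] and R = lin_closed[OF dr_lin[OF abw(1,3)] rc]
  show "emb p (koszul_d K V R (Suc p) (tri (Wm (Suc p)) a w b)) =
      DL (emb (Suc p) (tri (Wm (Suc p)) a w b)) \<oplus>\<^bsub>AT\<^esub> signed AT (Suc p) (DR (emb (Suc p) (tri (Wm (Suc p)) a w b)))"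
    unfolding koszul_d_tri[OF abw(1) w abw(3)] emb_tri[OF abw(1) w abw(3)] lin_add[OF emb_lin L signed_closed[OF m R]]
      lin_signed[OF m ATm emb_lin R] l[OF lc] r[OF rc] left_split(2)[OF w] right_split(2)[OF w] by (rule refl)
qed

text \<open>In the square of \<open>DL\<close> plus or minus \<open>DR\<close> the pure terms vanish
  by the relations at either end. The mixed terms cancel, since \<open>DL\<close> and
  \<open>DR\<close> commute while the sign alternates with the degree.\<close>

lemma koszul_d_d:
  assumes X: "X \<in> carrier (A.AWA (Wm (Suc (Suc p))))"
  shows "koszul_d K V R (Suc p) (koszul_d K V R (Suc (Suc p)) X) = \<zero>\<^bsub>A.AWA (Wm p)\<^esub>"
proof (rule emb_inj[OF lin_closed[OF koszul_d_lin lin_closed[OF koszul_d_lin X]]])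
  let ?Y = "emb (Suc (Suc p)) X" and ?n = "Suc (Suc p)"
  interpret m: module K AT by (rule ATm)
  note Y = lin_closed[OF emb_lin X] and L = lin_closed[OF DL_lin] and R = lin_closed[OF DR_lin]
  have ll: "DL (DL ?Y) = \<zero>\<^bsub>AT\<^esub>"
    by (rule A.AWA_eqI[OF Wm X lin_comp[OF emb_lin lin_comp[OF DL_lin DL_lin]] lin_const_zero[OF ATm]])
      (simp add: emb_tri DL_DL_W del: A.AWA_simps)
  have rr: "DR (DR ?Y) = \<zero>\<^bsub>AT\<^esub>"
    by (rule A.AWA_eqI[OF Wm X lin_comp[OF emb_lin lin_comp[OF DR_lin DR_lin]] lin_const_zero[OF ATm]])
      (simp add: emb_tri DR_DR_W del: A.AWA_simps)
  have e: "emb (Suc p) (koszul_d K V R ?n X) = DL ?Y \<oplus>\<^bsub>AT\<^esub> signed AT ?n (DR ?Y)" by (rule emb_d[OF X])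
  note s = signed_closed[OF ATm]
  have 1: "DL (emb (Suc p) (koszul_d K V R ?n X)) = signed AT ?n (DR (DL ?Y))"
    unfolding e lin_add[OF DL_lin L[OF Y] s[OF R[OF Y]]] ll lin_signed[OF ATm ATm DL_lin R[OF Y]] DL_DR_commute[OF Y]
    by (rule m.l_zero[OF s[OF R[OF L[OF Y]]]])
  have 2: "DR (emb (Suc p) (koszul_d K V R ?n X)) = DR (DL ?Y)"
    unfolding e lin_add[OF DR_lin L[OF Y] s[OF R[OF Y]]] lin_signed[OF ATm ATm DR_lin R[OF Y]] rr signed_zero[OF ATm]
    by (rule m.r_zero[OF R[OF L[OF Y]]])
  show "emb p (koszul_d K V R (Suc p) (koszul_d K V R ?n X)) = \<zero>\<^bsub>AT\<^esub>"
    unfolding emb_d[OF lin_closed[OF koszul_d_lin X]] 1 2 signed_Suc[OF ATm R[OF L[OF Y]], of "Suc p"]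
    by (rule m.l_neg[OF s[OF R[OF L[OF Y]]]])
qed

end

theorem mainTheorem2:
  fixes K :: "'k ring" and V :: "('k, 'v) module" and R :: "('k, 'v) tens set"
    and M :: "('k, ('k, 'v) quad, 'm) bimodule"
    and P :: "nat \<Rightarrow> ('k, ('k, 'v) quad, 'p) bimodule"
    and dP :: "nat \<Rightarrow> 'p \<Rightarrow> 'p" and \<epsilon> :: "'p \<Rightarrow> ('k, 'v) quad"
  assumes "field K" and "module K V"
    and "submodule R K (tensor_algebra K V)" and "R \<subseteq> tensor_power K V 2"
    and "bimodule K (quadratic_algebra K V R) M"
    and "projective_resolution K (quadratic_algebra K V R) P dP \<epsilon>"
  shows "(\<forall>p. mod_iso K (koszul_homology K V R M p)
              (hyperhomology K (quadratic_algebra K V R) P dP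
                (koszul_tensor K V R M) (koszul_tensor_d K V R M) p)) \<and>
         (\<forall>p. mod_iso K (koszul_cohomology K V R M p)
              (hypercohomology K (quadratic_algebra K V R) P dP
                (koszul_Hom K V R M) (koszul_Hom_d K V R M) p))"
proof -
  interpret quadratic K V R
    by (intro quadratic.intro tensor_alg.intro quadratic_axioms.intro assms(1-4))
  \<comment> \<open>All that the comparison results require of the Koszul complex: terms of the form
    \<open>A (x) W_i (x) A\<close>, and a differential that is a bimodule map and squares to
    zero.\<close>
  note p = assms(5) Wm assms(1,6) koszul_d_hom koszul_d_d
  have k: "koszul K V R = (\<lambda>p. A.AWA (Wm p))"
    by (simp add: koszul_def[abs_def])
  show ?thesis
    using A.homology_hyperhomology_iso[where W=Wm and d="koszul_d K V R", OF p] A.cohomology_hypercohomology_iso[where W=Wm and d="koszul_d K V R", OF p]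
    unfolding koszul_homology_def koszul_cohomology_def koszul_tensor_def[abs_def] koszul_tensor_d_def
      koszul_Hom_def[abs_def] koszul_Hom_d_def k Let_def by blast
qed

end
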